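(* Let $R$ be a local ring of Krull dimension one with regular maximal ideal $M$, let $m\in M$ be a nonzerodivisor, let $J=\bigcap_{i>0}m^iR$, and let $\widetilde{R}$ be the $mR$-adic completion of $R$. The following are equivalent: (1) $R$ is a stable ring with finite integral closure. (2) $R/J$ is a Bass ring. (3) $\widetilde{R}$ is a Bass ring.
   Context: All rings are commutative with identity; a local ring is a ring with a unique maximal ideal (not necessarily Noetherian). $Q(R)$ is the total ring of quotients and $\overline{R}$ the integral closure of $R$ in $Q(R)$; $R$ has finite integral closure if $\overline R$ is a finitely generated $R$-module. An ideal is regular if it contains a nonzerodivisor. For a regular fractional ideal $I$ (an $R$-submodule of $Q(R)$ containing a nonzerodivisor with $bI\subseteq R$ for some nonzerodivisor $b\in R$), $E(I)=\{q\in Q(R):qI\subseteq I\}$, and $I$ is stable if it is projective as an $E(I)$-module; $R$ is stable if every regular ideal is stable. A Bass ring is a reduced Noetherian local ring $R$ such that $\overline{R}$ is a finitely generated $R$-module and every ideal of $R$ can be generated by two elements. ($J$ and $\widetilde R$ do not depend on the choice of $m$.) *)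

theory Defs
  imports "HOL-Algebra.QuotRing" "HOL-Algebra.Ring_Divisibility"
begin

definition nzd :: "('a,'b) ring_scheme \<Rightarrow> 'a \<Rightarrow> bool" where
  "nzd R a \<longleftrightarrow> a \<in> carrier R \<and> (\<forall>b\<in>carrier R. a \<otimes>\<^bsub>R\<^esub> b = \<zero>\<^bsub>R\<^esub> \<longrightarrow> b = \<zero>\<^bsub>R\<^esub>)"

definition local_ring :: "('a,'b) ring_scheme \<Rightarrow> bool" where
  "local_ring R \<longleftrightarrow> cring R \<and> (\<exists>!M. maximalideal M R)"

definition krull_dim_one :: "('a,'b) ring_scheme \<Rightarrow> bool" where
  "krull_dim_one R \<longleftrightarrow>
     (\<exists>P Q. primeideal P R \<and> primeideal Q R \<and> P \<subset> Q) \<and>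
     \<not> (\<exists>P Q S. primeideal P R \<and> primeideal Q R \<and> primeideal S R \<and> P \<subset> Q \<and> Q \<subset> S)"

definition regular_ideal :: "('a,'b) ring_scheme \<Rightarrow> 'a set \<Rightarrow> bool" where
  "regular_ideal R I \<longleftrightarrow> ideal I R \<and> (\<exists>x\<in>I. nzd R x)"

definition reduced :: "('a,'b) ring_scheme \<Rightarrow> bool" where
  "reduced R \<longleftrightarrow> (\<forall>a\<in>carrier R. \<forall>n::nat. a [^]\<^bsub>R\<^esub> n = \<zero>\<^bsub>R\<^esub> \<longrightarrow> a = \<zero>\<^bsub>R\<^esub>)"

definition frac_class :: "('a,'b) ring_scheme \<Rightarrow> 'a \<Rightarrow> 'a \<Rightarrow> ('a \<times> 'a) set" where
  "frac_class R a s = {(b,t). b \<in> carrier R \<and> nzd R t \<and> a \<otimes>\<^bsub>R\<^esub> t = b \<otimes>\<^bsub>R\<^esub> s}"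

definition frac_mult :: "('a,'b) ring_scheme \<Rightarrow> ('a \<times> 'a) set \<Rightarrow> ('a \<times> 'a) set \<Rightarrow> ('a \<times> 'a) set" where
  "frac_mult R A B = {(c,u). c \<in> carrier R \<and> nzd R u \<and>
     (\<exists>a s b t. (a,s)\<in>A \<and> (b,t)\<in>B \<and> c \<otimes>\<^bsub>R\<^esub> (s \<otimes>\<^bsub>R\<^esub> t) = (a \<otimes>\<^bsub>R\<^esub> b) \<otimes>\<^bsub>R\<^esub> u)}"

definition frac_add :: "('a,'b) ring_scheme \<Rightarrow> ('a \<times> 'a) set \<Rightarrow> ('a \<times> 'a) set \<Rightarrow> ('a \<times> 'a) set" where
  "frac_add R A B = {(c,u). c \<in> carrier R \<and> nzd R u \<and>
     (\<exists>a s b t. (a,s)\<in>A \<and> (b,t)\<in>B \<and>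
        c \<otimes>\<^bsub>R\<^esub> (s \<otimes>\<^bsub>R\<^esub> t) = ((a \<otimes>\<^bsub>R\<^esub> t) \<oplus>\<^bsub>R\<^esub> (b \<otimes>\<^bsub>R\<^esub> s)) \<otimes>\<^bsub>R\<^esub> u)}"

definition total_quot :: "('a,'b) ring_scheme \<Rightarrow> ('a \<times> 'a) set ring" where
  "total_quot R = \<lparr>
     carrier = {frac_class R a s | a s. a \<in> carrier R \<and> nzd R s},
     mult = frac_mult R,
     one = frac_class R \<one>\<^bsub>R\<^esub> \<one>\<^bsub>R\<^esub>,
     zero = frac_class R \<zero>\<^bsub>R\<^esub> \<one>\<^bsub>R\<^esub>,
     add = frac_add R \<rparr>"

definition frac_emb :: "('a,'b) ring_scheme \<Rightarrow> 'a \<Rightarrow> ('a \<times> 'a) set" where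
  "frac_emb R a = frac_class R a \<one>\<^bsub>R\<^esub>"

definition int_closure :: "('a,'b) ring_scheme \<Rightarrow> ('a \<times> 'a) set set" where
  "int_closure R = {q \<in> carrier (total_quot R). \<exists>(n::nat) c. n > 0 \<and> (\<forall>i. c i \<in> carrier R) \<and>
      q [^]\<^bsub>total_quot R\<^esub> n \<oplus>\<^bsub>total_quot R\<^esub>
        (\<Oplus>\<^bsub>total_quot R\<^esub>i\<in>{..<n}. frac_emb R (c i) \<otimes>\<^bsub>total_quot R\<^esub> q [^]\<^bsub>total_quot R\<^esub> i)
      = \<zero>\<^bsub>total_quot R\<^esub>}"

definition finite_int_closure :: "('a,'b) ring_scheme \<Rightarrow> bool" where
  "finite_int_closure R \<longleftrightarrow>
     (\<exists>S. finite S \<and> S \<subseteq> int_closure R \<and>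
        (\<forall>q\<in>int_closure R. \<exists>r. (\<forall>s\<in>S. r s \<in> carrier R) \<and>
            q = (\<Oplus>\<^bsub>total_quot R\<^esub>s\<in>S. frac_emb R (r s) \<otimes>\<^bsub>total_quot R\<^esub> s)))"

definition endo_ring :: "('a,'b) ring_scheme \<Rightarrow> ('a \<times> 'a) set set \<Rightarrow> ('a \<times> 'a) set set" where
  "endo_ring R I = {q \<in> carrier (total_quot R). \<forall>x\<in>I. q \<otimes>\<^bsub>total_quot R\<^esub> x \<in> I}"

text \<open>Projectivity of an E-module N, where E and N are subsets of a common commutative
  ring Q (the E-action being multiplication in Q): N is a direct summand of the free
  E-module E^(N) on the elements of N, i.e. the canonical surjection
  E^(N) \<rightarrow> N, \<phi> \<mapsto> \<Sum>_y \<phi>(y) y, has an E-linear section s.\<close>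
definition projective_in :: "('q,'c) ring_scheme \<Rightarrow> 'q set \<Rightarrow> 'q set \<Rightarrow> bool" where
  "projective_in Q E N \<longleftrightarrow>
     (\<exists>s :: 'q \<Rightarrow> 'q \<Rightarrow> 'q.
        (\<forall>x\<in>N. \<forall>y\<in>N. s x y \<in> E) \<and>
        (\<forall>x\<in>N. finite {y\<in>N. s x y \<noteq> \<zero>\<^bsub>Q\<^esub>}) \<and>
        (\<forall>x\<in>N. \<forall>x'\<in>N. \<forall>y\<in>N. s (x \<oplus>\<^bsub>Q\<^esub> x') y = s x y \<oplus>\<^bsub>Q\<^esub> s x' y) \<and>
        (\<forall>e\<in>E. \<forall>x\<in>N. \<forall>y\<in>N. s (e \<otimes>\<^bsub>Q\<^esub> x) y = e \<otimes>\<^bsub>Q\<^esub> s x y) \<and>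
        (\<forall>x\<in>N. x = (\<Oplus>\<^bsub>Q\<^esub>y\<in>{y\<in>N. s x y \<noteq> \<zero>\<^bsub>Q\<^esub>}. s x y \<otimes>\<^bsub>Q\<^esub> y)))"

definition stable_ideal :: "('a,'b) ring_scheme \<Rightarrow> 'a set \<Rightarrow> bool" where
  "stable_ideal R I \<longleftrightarrow>
     projective_in (total_quot R) (endo_ring R (frac_emb R ` I)) (frac_emb R ` I)"

definition stable_ring :: "('a,'b) ring_scheme \<Rightarrow> bool" where
  "stable_ring R \<longleftrightarrow> (\<forall>I. regular_ideal R I \<longrightarrow> stable_ideal R I)"

definition bass_ring :: "('a,'b) ring_scheme \<Rightarrow> bool" where
  "bass_ring R \<longleftrightarrow> local_ring R \<and> noetherian_ring R \<and> reduced R \<and> finite_int_closure R \<and>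
     (\<forall>I. ideal I R \<longrightarrow> (\<exists>a\<in>carrier R. \<exists>b\<in>carrier R. I = Idl\<^bsub>R\<^esub> {a, b}))"

text \<open>The inverse limit of the rings R / m^n R (n \<ge> 0): compatible sequences of cosets.\<close>
definition adic_completion :: "('a,'b) ring_scheme \<Rightarrow> 'a \<Rightarrow> (nat \<Rightarrow> 'a set) ring" where
  "adic_completion R m = \<lparr>
     carrier = {f. (\<forall>n. f n \<in> carrier (R Quot (PIdl\<^bsub>R\<^esub> (m [^]\<^bsub>R\<^esub> n)))) \<and> (\<forall>n. f (Suc n) \<subseteq> f n)},
     mult = (\<lambda>f g n. f n \<otimes>\<^bsub>R Quot (PIdl\<^bsub>R\<^esub> (m [^]\<^bsub>R\<^esub> n))\<^esub> g n),
     one = (\<lambda>n. \<one>\<^bsub>R Quot (PIdl\<^bsub>R\<^esub> (m [^]\<^bsub>R\<^esub> n))\<^esub>),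
     zero = (\<lambda>n. \<zero>\<^bsub>R Quot (PIdl\<^bsub>R\<^esub> (m [^]\<^bsub>R\<^esub> n))\<^esub>),
     add = (\<lambda>f g n. f n \<oplus>\<^bsub>R Quot (PIdl\<^bsub>R\<^esub> (m [^]\<^bsub>R\<^esub> n))\<^esub> g n) \<rparr>"

end

theory Submission
  imports Defs
begin

text \<open>
  Each of the three conditions amounts to the conjunction of two conditions on its ring:
  every ideal containing a power of \<open>m\<close> is generated by two elements, and the almost integral
  elements of \<open>R[1/m]\<close> have a common denominator \<open>m^c\<close>. Both can be read off from the quotients
  \<open>R / m^n R\<close>, so they pass between \<open>R\<close>, \<open>R / J\<close> and the completion.

  If \<open>R\<close> is stable, a regular fractional ideal \<open>F\<close> is principal over \<open>E(F)\<close>: it is invertible, and \<open>E(F)\<close> is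
  integral over the local ring \<open>R\<close>, hence has finitely many maximal ideals modulo the radical of \<open>mE(F)\<close>.
  Then the ring \<open>T\<close> of almost integral elements is integral and of the form \<open>T = R + Rx + MT\<close>, and
  comparing leading forms along the filtration \<open>z^l T\<close>, where \<open>MT = zT\<close>, gives two generators for \<open>F\<close>.
  Conversely, if \<open>F = (a, b)\<close> and \<open>F^2\<close> is two-generated too, a quadratic relation between \<open>a\<close> and \<open>b\<close> with
  a unit coefficient yields \<open>F^2 = xF\<close> for some \<open>x \<in> F\<close>, so that \<open>F = xE(F)\<close>.
  Ideals without a power of \<open>m\<close> are reached from their saturation by a Nakayama argument, which holds in
  \<open>R / J\<close> because that ring is \<open>m\<close>-adically separated of dimension one, and in the completion by completeness.
\<close>

section \<open>Rings with a parameter, as subsets of a commutative ring\<close>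

text \<open>No length or finiteness argument is available: \<open>R\<close> need not be Noetherian,
  and the completion is not known in advance to have dimension one or \<open>A[1/m]\<close> as its
  total ring of quotients. Hence all work is done in \<open>A[1/m]\<close>, and dimension one enters
  as the statement that every nonunit has a power in \<open>mA\<close>, which passes along analytic
  isomorphisms. The closure condition concerns almost integral elements, because a denominator
  \<open>m^d\<close> common to all powers of \<open>a / m^k\<close> is a family of divisibilities by
  powers of \<open>m\<close>, visible in the quotients, while an integral equation is not.
  Integrality is recovered afterwards: endomorphisms of \<open>A + Aq\<close> are integral by
  Cayley-Hamilton, and modulo the radical of \<open>mE\<close> an integral element \<open>p\<close>
  of \<open>E\<close> satisfies \<open>p = p^2 t\<close>; the idempotents \<open>p t\<close> do the
  work of finitely many maximal ideals. That nonzerodivisors divide powers of \<open>m\<close> is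
  obtained from chains of primes for \<open>R\<close> and \<open>R / J\<close>, but from
  two-generation for the completion.\<close>

text \<open>\<open>A\<close> is a local ring with unit \<open>e\<close>, and \<open>Q = A[1/m]\<close>. The assumption \<open>rad\<close> is the form in which dimension one enters.\<close>

locale local_subring =
  fixes Q A :: "'u::comm_ring_1 set" and e m mi :: 'u
  assumes Qadd: "x \<in> Q \<Longrightarrow> y \<in> Q \<Longrightarrow> x + y \<in> Q"
    and Qneg: "x \<in> Q \<Longrightarrow> - x \<in> Q"
    and Qmul: "x \<in> Q \<Longrightarrow> y \<in> Q \<Longrightarrow> x * y \<in> Q"
    and Qunit: "x \<in> Q \<Longrightarrow> e * x = x"
    and AQ: "x \<in> A \<Longrightarrow> x \<in> Q"
    and Aadd: "x \<in> A \<Longrightarrow> y \<in> A \<Longrightarrow> x + y \<in> A"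
    and Aneg: "x \<in> A \<Longrightarrow> - x \<in> A"
    and Amul: "x \<in> A \<Longrightarrow> y \<in> A \<Longrightarrow> x * y \<in> A"
    and Ae: "e \<in> A"
    and mA: "m \<in> A" and miQ: "mi \<in> Q" and mmi: "m * mi = e"
    and Qfrac: "q \<in> Q \<Longrightarrow> \<exists>k. m ^ k * q \<in> A"
    and loc: "a \<in> A \<Longrightarrow> (\<exists>b\<in>A. a * b = e) \<or> (\<exists>b\<in>A. (e - a) * b = e)"
    and mnu: "b \<in> A \<Longrightarrow> m * b \<noteq> e"
    and rad: "a \<in> A \<Longrightarrow> (\<exists>b\<in>A. a * b = e) \<or> (\<exists>k. \<exists>x\<in>A. a ^ k * e = m * x)"
begin

definition "unitA a \<longleftrightarrow> a \<in> A \<and> (\<exists>b\<in>A. a * b = e)"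
definition "nonunitA a \<longleftrightarrow> a \<in> A \<and> \<not> unitA a"
definition "submod F \<longleftrightarrow> F \<subseteq> Q \<and> 0 \<in> F \<and> (\<forall>x\<in>F. \<forall>y\<in>F. x + y \<in> F) \<and> (\<forall>a\<in>A. \<forall>x\<in>F. a * x \<in> F)"
definition "bdd F \<longleftrightarrow> (\<exists>k. \<forall>x\<in>F. m ^ k * x \<in> A)"
definition "reg F \<longleftrightarrow> (\<exists>k. m ^ k * e \<in> F)"
definition "fractional F \<longleftrightarrow> submod F \<and> bdd F \<and> reg F"
definition "endo F = {q \<in> Q. \<forall>x\<in>F. q * x \<in> F}"
definition "subr E \<longleftrightarrow> A \<subseteq> E \<and> E \<subseteq> Q \<and> (\<forall>x\<in>E. \<forall>y\<in>E. x + y \<in> E) \<and> (\<forall>x\<in>E. \<forall>y\<in>E. x * y \<in> E)"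
text \<open>\<open>T\<close> consists of the almost integral elements. Below, \<open>inv_frac\<close> is the dual basis form of projectivity over \<open>endo F\<close>.\<close>

definition "T = {q \<in> Q. \<exists>d. \<forall>n. m ^ d * (q ^ n * e) \<in> A}"
text \<open>The leading power is multiplied by \<open>e\<close> because the ambient
  \<open>q ^ 0 = 1\<close> need not lie in \<open>Q\<close>; in the sum the coefficients play that
  role. A relation with \<open>n = 0\<close> would read \<open>e = 0\<close> and so cannot
  occur.\<close>

definition "integral q \<longleftrightarrow> (\<exists>n c. (\<forall>i. c i \<in> A) \<and> q ^ n * e + (\<Sum>i<n. c i * q ^ i) = 0)"
definition "span2 a b = {u * a + v * b | u v. u \<in> A \<and> v \<in> A}"
definition "two_gen_reg \<longleftrightarrow> (\<forall>F. submod F \<and> reg F \<and> F \<subseteq> A \<longrightarrow> (\<exists>a\<in>F. \<exists>b\<in>F. F = span2 a b))"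
definition "endo_principal \<longleftrightarrow> (\<forall>F. fractional F \<longrightarrow> (\<exists>z\<in>F. F = (\<lambda>q. z * q) ` endo F))"
definition "idl E K \<longleftrightarrow> K \<subseteq> E \<and> 0 \<in> K \<and> (\<forall>x\<in>K. \<forall>y\<in>K. x + y \<in> K) \<and> (\<forall>a\<in>E. \<forall>x\<in>K. a * x \<in> K)"
definition "radE E K = {w \<in> E. \<exists>n. w ^ n * e \<in> K}"
definition "inv_frac F \<longleftrightarrow> (\<exists>Y b. finite Y \<and> Y \<subseteq> F \<and> (\<forall>y\<in>Y. b y \<in> Q \<and> (\<forall>x\<in>F. b y * x \<in> endo F)) \<and> (\<Sum>y\<in>Y. b y * y) = e)"

declare Qadd[simp,intro] Qneg[simp,intro] Qmul[simp,intro] AQ[simp,intro] Aadd[simp,intro] Aneg[simp,intro]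
  Amul[simp,intro] Ae[simp,intro] mA[simp,intro] miQ[simp,intro]

section \<open>Arithmetic with the local unit; units and nonunits of \<open>A\<close>\<close>

lemma Qdiff[simp,intro]: "x \<in> Q \<Longrightarrow> y \<in> Q \<Longrightarrow> x - y \<in> Q"
  using Qadd[of x "-y"] by simp
lemma Adiff[simp,intro]: "x \<in> A \<Longrightarrow> y \<in> A \<Longrightarrow> x - y \<in> A"
  using Aadd[of x "-y"] by simp
lemma Qe[simp]: "e \<in> Q" and Qm[simp]: "m \<in> Q" by auto
lemma A0[simp]: "0 \<in> A" using Adiff[OF Ae Ae] by simp
lemma Q0[simp]: "0 \<in> Q" by auto
lemma e1[simp]: "x \<in> Q \<Longrightarrow> e * x = x" by (rule Qunit)
lemma e2[simp]: "x \<in> Q \<Longrightarrow> x * e = x" using Qunit[of x] by (simp add: mult.commute)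
lemma e3[simp]: "x \<in> Q \<Longrightarrow> e * (x * y) = x * y"
  using Qunit[of x] by (simp add: mult.assoc[symmetric])
lemma e4[simp]: "x \<in> Q \<Longrightarrow> x * (e * y) = x * y"
  using e2[of x] by (simp add: mult.assoc[symmetric])
lemma ee[simp]: "e * e = e" by simp

lemma Apow[simp,intro]: "a \<in> A \<Longrightarrow> x \<in> A \<Longrightarrow> a ^ n * x \<in> A"
  by (induction n) (auto simp: mult.assoc)
lemma Qpow[simp,intro]: "a \<in> Q \<Longrightarrow> x \<in> Q \<Longrightarrow> a ^ n * x \<in> Q"
  by (induction n) (auto simp: mult.assoc)
lemma Apow'[simp,intro]: "a \<in> A \<Longrightarrow> x \<in> A \<Longrightarrow> x * a ^ n \<in> A"
  using Apow[of a x n] by (simp add: mult.commute)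
lemma Qpow'[simp,intro]: "a \<in> Q \<Longrightarrow> x \<in> Q \<Longrightarrow> x * a ^ n \<in> Q"
  using Qpow[of a x n] by (simp add: mult.commute)
lemma e_pow[simp]: "e ^ n * e = e" by (induction n) (auto simp: mult.assoc)
lemma e_pow'[simp]: "x \<in> Q \<Longrightarrow> e ^ n * x = x" by (induction n) (auto simp: mult.assoc)
lemma minv: "mi ^ k * (m ^ k * x) = x" if "x \<in> Q"
proof -
  have "mi ^ k * (m ^ k * x) = (m * mi) ^ k * x" by (simp add: power_mult_distrib algebra_simps)
  then show ?thesis using that mmi by simp
qed
lemma minv': "m ^ k * (mi ^ k * x) = x" if "x \<in> Q"
  using minv[OF that, of k] by (simp add: mult.left_commute)
lemma m_cancel: "m ^ k * x = m ^ k * y \<Longrightarrow> x \<in> Q \<Longrightarrow> y \<in> Q \<Longrightarrow> x = y"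
  by (metis minv)

lemma unitA_A: "unitA a \<Longrightarrow> a \<in> A" and nonunitA_A: "nonunitA a \<Longrightarrow> a \<in> A" by (auto simp: unitA_def nonunitA_def)
lemma unitA_e: "unitA e" by (auto simp: unitA_def)
lemma e_ne_0: "e \<noteq> 0"
  using mnu[of 0] by auto
lemma nonunitA_m: "nonunitA m" using mnu by (auto simp: nonunitA_def unitA_def)
lemma nonunitA_0: "nonunitA 0" using e_ne_0 by (auto simp: nonunitA_def unitA_def)
lemma unitA_not_nonunitA: "unitA a \<Longrightarrow> \<not> nonunitA a" by (auto simp: nonunitA_def)
lemma nonunitA_mult: "nonunitA a \<Longrightarrow> b \<in> A \<Longrightarrow> nonunitA (a * b)"
  unfolding nonunitA_def unitA_def by (auto simp: mult.assoc)
lemma nonunitA_mult': "nonunitA a \<Longrightarrow> b \<in> A \<Longrightarrow> nonunitA (b * a)"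
  using nonunitA_mult[of a b] by (simp add: mult.commute)
lemma unitA_mult: assumes "unitA a" "unitA b" shows "unitA (a * b)"
proof -
  obtain c d where h: "a \<in> A" "b \<in> A" "c \<in> A" "a * c = e" "d \<in> A" "b * d = e" using assms by (auto simp: unitA_def)
  have "a * b * (c * d) = (a * c) * (b * d)" by (simp only: mult_ac)
  then show ?thesis unfolding unitA_def using h by (intro conjI bexI[of _ "c * d"]) auto
qed
text \<open>If \<open>(a + b) * v = e\<close>, then \<open>a * v\<close> and
  \<open>e - a * v = b * v\<close> are both nonunits, which contradicts \<open>loc\<close>. So the
  nonunits form the maximal ideal of \<open>A\<close>.\<close>

lemma nonunitA_add: assumes "nonunitA a" "nonunitA b" shows "nonunitA (a + b)"
proof (rule ccontr)
  assume "\<not> nonunitA (a + b)"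
  then obtain v where v: "v \<in> A" "(a + b) * v = e" using assms by (auto simp: nonunitA_def unitA_def)
  have "nonunitA (a * v)" "nonunitA (b * v)" using assms v nonunitA_mult by auto
  moreover have "e - a * v = b * v" using v by (simp add: algebra_simps)
  ultimately show False using loc[of "a * v"] by (auto simp: nonunitA_def unitA_def)
qed
lemma nonunitA_neg: "nonunitA a \<Longrightarrow> nonunitA (- a)"
  using nonunitA_mult[of a "-e"] by (auto simp: nonunitA_A)
lemma nonunitA_diff: "nonunitA a \<Longrightarrow> nonunitA b \<Longrightarrow> nonunitA (a - b)"
  using nonunitA_add[OF _ nonunitA_neg, of a b] by simp
lemma unitA_nonunitA: assumes "unitA a" "nonunitA b" shows "unitA (a + b)"
proof (rule ccontr)
  assume "\<not> unitA (a + b)"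
  then have "nonunitA (a + b)" using assms by (auto simp: nonunitA_def unitA_A)
  then have "nonunitA (a + b - b)" using assms(2) by (rule nonunitA_diff)
  then show False using assms(1) by (simp add: nonunitA_def)
qed
lemma unitA_e_minus: "nonunitA a \<Longrightarrow> unitA (e - a)" using unitA_nonunitA[OF unitA_e nonunitA_neg] by simp
lemma unitA_e_m: "a \<in> A \<Longrightarrow> \<exists>b\<in>A. (e - m * a) * b = e"
  using unitA_e_minus[OF nonunitA_mult[OF nonunitA_m]] by (auto simp: unitA_def)
lemma nonunitA_rad: "nonunitA a \<Longrightarrow> \<exists>k. \<exists>x\<in>A. a ^ k * e = m * x"
  using rad[of a] by (auto simp: nonunitA_def unitA_def)

section \<open>Submodules, intermediate rings and almost integral elements\<close>

lemma submodD:
  assumes "submod F"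
  shows "x \<in> F \<Longrightarrow> x \<in> Q" "0 \<in> F" "x \<in> F \<Longrightarrow> y \<in> F \<Longrightarrow> x + y \<in> F" "a \<in> A \<Longrightarrow> x \<in> F \<Longrightarrow> a * x \<in> F"
    "x \<in> F \<Longrightarrow> - x \<in> F" "x \<in> F \<Longrightarrow> y \<in> F \<Longrightarrow> x - y \<in> F"
proof -
  show 1: "x \<in> F \<Longrightarrow> x \<in> Q" "0 \<in> F" "x \<in> F \<Longrightarrow> y \<in> F \<Longrightarrow> x + y \<in> F" "a \<in> A \<Longrightarrow> x \<in> F \<Longrightarrow> a * x \<in> F" for x y a
    using assms by (auto simp: submod_def)
  show 2: "x \<in> F \<Longrightarrow> - x \<in> F" for x using 1(4)[of "-e" x] 1(1) by simp
  show "x \<in> F \<Longrightarrow> y \<in> F \<Longrightarrow> x - y \<in> F" using 1(3)[of x "-y"] 2 by simp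
qed

lemma idlD:
  assumes "idl E K" "subr E"
  shows "x \<in> K \<Longrightarrow> x \<in> E" "0 \<in> K" "x \<in> K \<Longrightarrow> y \<in> K \<Longrightarrow> x + y \<in> K" "a \<in> E \<Longrightarrow> x \<in> K \<Longrightarrow> a * x \<in> K"
    "x \<in> K \<Longrightarrow> - x \<in> K" "x \<in> K \<Longrightarrow> y \<in> K \<Longrightarrow> x - y \<in> K"
proof -
  show 1: "x \<in> K \<Longrightarrow> x \<in> E" "0 \<in> K" "x \<in> K \<Longrightarrow> y \<in> K \<Longrightarrow> x + y \<in> K" "a \<in> E \<Longrightarrow> x \<in> K \<Longrightarrow> a * x \<in> K" for x y a
    using assms by (auto simp: idl_def)
  have "- e \<in> E" using assms(2) by (auto simp: subr_def)
  then show 2: "x \<in> K \<Longrightarrow> - x \<in> K" for x using 1(4)[of "-e" x] 1(1)[of x] assms(2) by (auto simp: subr_def)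
  show "x \<in> K \<Longrightarrow> y \<in> K \<Longrightarrow> x - y \<in> K" using 1(3)[of x "-y"] 2 by simp
qed

lemma subrD:
  assumes "subr E"
  shows "x \<in> E \<Longrightarrow> x \<in> Q" "x \<in> A \<Longrightarrow> x \<in> E" "x \<in> E \<Longrightarrow> y \<in> E \<Longrightarrow> x + y \<in> E" "x \<in> E \<Longrightarrow> y \<in> E \<Longrightarrow> x * y \<in> E"
    "x \<in> E \<Longrightarrow> - x \<in> E" "x \<in> E \<Longrightarrow> y \<in> E \<Longrightarrow> x - y \<in> E" "x \<in> E \<Longrightarrow> y \<in> E \<Longrightarrow> x ^ n * y \<in> E"
proof -
  show 1: "x \<in> E \<Longrightarrow> x \<in> Q" "x \<in> A \<Longrightarrow> x \<in> E" "x \<in> E \<Longrightarrow> y \<in> E \<Longrightarrow> x + y \<in> E" "x \<in> E \<Longrightarrow> y \<in> E \<Longrightarrow> x * y \<in> E" for x y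
    using assms by (auto simp: subr_def)
  show 2: "x \<in> E \<Longrightarrow> - x \<in> E" for x using 1(4)[of "-e" x] 1(1)[of x] 1(2)[of "-e"] by simp
  show "x \<in> E \<Longrightarrow> y \<in> E \<Longrightarrow> x - y \<in> E" using 1(3)[of x "-y"] 2 by simp
  show "x \<in> E \<Longrightarrow> y \<in> E \<Longrightarrow> x ^ n * y \<in> E" by (induction n) (auto simp: mult.assoc 1)
qed

lemma subr_endo: assumes "submod F" shows "subr (endo F)"
proof -
  note F = submodD[OF assms]
  show ?thesis unfolding subr_def endo_def
    by (auto simp: F distrib_right mult.assoc)
qed

text \<open>If \<open>m^c\<close> clears the powers of \<open>x\<close> and \<open>m^d\<close> those
  of \<open>y\<close>, then \<open>m^(c+d)\<close> clears all monomials \<open>x^i y^j\<close>. For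
  the sum, the induction on \<open>n\<close> carries an arbitrary monomial along with
  \<open>(x + y)^n\<close>, which avoids binomial coefficients.\<close>

lemma T_subr: "subr T"
proof -
  have add: "x + y \<in> T" if xy: "x \<in> T" "y \<in> T" for x y
  proof -
    obtain c d where c: "\<And>n. m ^ c * (x ^ n * e) \<in> A" and d: "\<And>n. m ^ d * (y ^ n * e) \<in> A" and Q: "x \<in> Q" "y \<in> Q"
      using xy by (auto simp: T_def)
    have 1: "m ^ (c + d) * (x ^ i * (y ^ j * e)) \<in> A" for i j
    proof -
      have "m ^ (c + d) * (x ^ i * (y ^ j * e)) = (m ^ c * (x ^ i * e)) * (m ^ d * (y ^ j * e))"
        using Q by (simp add: power_add mult_ac)
      then show ?thesis using c d by simp
    qed
    have "\<forall>i j. m ^ (c + d) * (x ^ i * (y ^ j * ((x + y) ^ n * e))) \<in> A" for n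
    proof (induction n)
      case 0 show ?case using 1 by simp
    next
      case (Suc n)
      have "m ^ (c + d) * (x ^ i * (y ^ j * ((x + y) ^ Suc n * e))) =
        m ^ (c + d) * (x ^ Suc i * (y ^ j * ((x + y) ^ n * e))) + m ^ (c + d) * (x ^ i * (y ^ Suc j * ((x + y) ^ n * e)))" for i j
        by (simp add: algebra_simps)
      then show ?case using Suc Aadd by metis
    qed
    from this[rule_format, of 0 0] show ?thesis using Q by (auto simp: T_def)
  qed
  have mul: "x * y \<in> T" if xy: "x \<in> T" "y \<in> T" for x y
  proof -
    obtain c d where c: "\<And>n. m ^ c * (x ^ n * e) \<in> A" and d: "\<And>n. m ^ d * (y ^ n * e) \<in> A" and Q: "x \<in> Q" "y \<in> Q"
      using xy by (auto simp: T_def)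
    have "m ^ (c + d) * ((x * y) ^ n * e) = (m ^ c * (x ^ n * e)) * (m ^ d * (y ^ n * e))" for n
      using Q by (simp add: power_add power_mult_distrib mult_ac)
    then have "\<forall>n. m ^ (c + d) * ((x * y) ^ n * e) \<in> A" using c d by simp
    then show ?thesis using Q unfolding T_def by blast
  qed
  have "x \<in> T" if "x \<in> A" for x
  proof -
    have "\<forall>n. m ^ 0 * (x ^ n * e) \<in> A" using that by simp
    then show ?thesis unfolding T_def using that by blast
  qed
  then show ?thesis unfolding subr_def using add mul by (auto simp: T_def)
qed

text \<open>The powers of an element of \<open>E\<close> stay in \<open>E\<close>, so one
  denominator of \<open>E\<close> serves them all. Applied to \<open>endo F\<close>, this places all
  endomorphism rings of fractional ideals inside the single ring \<open>T\<close>.\<close>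

lemma bounded_subr_T: assumes "subr E" "bdd E" shows "E \<subseteq> T"
proof
  fix q assume q: "q \<in> E"
  obtain k where "\<forall>x\<in>E. m ^ k * x \<in> A" using assms by (auto simp: bdd_def)
  then have "\<forall>n. m ^ k * (q ^ n * e) \<in> A" using subrD[OF assms(1)] q by simp
  then show "q \<in> T" using subrD(1)[OF assms(1) q] unfolding T_def by blast
qed

lemma endo_bdd: assumes "fractional F" shows "bdd (endo F)"
proof -
  obtain k l where k: "\<And>x. x \<in> F \<Longrightarrow> m ^ k * x \<in> A" and l: "m ^ l * e \<in> F"
    using assms by (auto simp: fractional_def bdd_def reg_def)
  have "m ^ (k + l) * q \<in> A" if "q \<in> endo F" for q
  proof -
    have "q * (m ^ l * e) \<in> F" "q \<in> Q" using that l by (auto simp: endo_def)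
    moreover have "m ^ (k + l) * q = m ^ k * (q * (m ^ l * e))" using \<open>q \<in> Q\<close> by (simp add: power_add mult_ac)
    ultimately show ?thesis using k by simp
  qed
  then show ?thesis unfolding bdd_def by blast
qed

lemma endo_T: "fractional F \<Longrightarrow> endo F \<subseteq> T"
  using bounded_subr_T subr_endo endo_bdd by (auto simp: fractional_def)

section \<open>Units near \<open>e\<close>, radicals, and intermediate rings modulo the radical of
  \<open>mE\<close>\<close>

lemma geometric_sum: "subr E \<Longrightarrow> x \<in> E \<Longrightarrow> \<exists>w\<in>E. (e - x) * w = e - x ^ n * e"
proof (induction n)
  case 0
  then show ?case using subrD(2)[OF 0(1), of 0] by (auto intro!: bexI[of _ 0])
next
  case (Suc n)
  then obtain w where w: "w \<in> E" "(e - x) * w = e - x ^ n * e" by auto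
  note E = subrD[OF Suc.prems(1)]
  have "(e - x) * (w + x ^ n * e) = e - x ^ Suc n * e"
    using w E(1)[OF Suc.prems(2)] by (simp add: algebra_simps)
  then show ?case using w E Suc.prems by (intro bexI[of _ "w + x ^ n * e"]) auto
qed

text \<open>So \<open>m\<close> lies in the Jacobson radical of \<open>E\<close>. With
  \<open>m^k E\<close> inside \<open>A\<close>, the element
  \<open>(m * s)^(k+1) = m * (m^k s^(k+1))\<close> lies in \<open>mA\<close>; hence
  \<open>e - (m * s)^(k+1)\<close> is a unit of \<open>A\<close>, and \<open>e - m * s\<close>
  divides it by the geometric sum.\<close>

lemma unit_near_one: assumes "subr E" "bdd E" "s \<in> E" shows "\<exists>v\<in>E. (e - m * s) * v = e"
proof -
  note E = subrD[OF assms(1)]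
  obtain k where k: "\<forall>x\<in>E. m ^ k * x \<in> A" using assms by (auto simp: bdd_def)
  obtain w where w: "w \<in> E" "(e - m * s) * w = e - (m * s) ^ (Suc k) * e"
    using geometric_sum[OF assms(1), of "m * s" "Suc k"] E assms by auto
  let ?a = "m ^ k * (s ^ Suc k * e)"
  have "(m * s) ^ (Suc k) * e = m * ?a" by (simp add: power_mult_distrib mult_ac)
  moreover have "?a \<in> A" using k E(7)[of s e "Suc k"] E(2)[of e] assms by simp
  then obtain b where "b \<in> A" "(e - m * ?a) * b = e" using unitA_e_m by blast
  ultimately have "(e - m * s) * (w * b) = e" using w by (simp add: mult.assoc[symmetric])
  then show ?thesis using w \<open>b \<in> A\<close> E by (intro bexI[of _ "w * b"]) auto
qed

text \<open>Closure under addition is proved with a cofactor \<open>r\<close> in place of the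
  binomial theorem: one factor \<open>x + y\<close> is expanded and its summand is moved into
  \<open>r\<close>, which lowers \<open>a\<close> or \<open>b\<close> by one.\<close>

lemma radE_idl: assumes "subr E" "idl E K" shows "idl E (radE E K)"
proof -
  note E = subrD[OF assms(1)] note K = idlD[OF assms(2,1)]
  have key: "\<forall>x\<in>E. \<forall>y\<in>E. \<forall>r\<in>E. x ^ a * r \<in> K \<longrightarrow> y ^ b * r \<in> K \<longrightarrow> a + b = n \<longrightarrow> (x + y) ^ n * r \<in> K" for n a b
  proof (induction n arbitrary: a b)
    case 0 then show ?case by auto
  next
    case (Suc n)
    show ?case
    proof (intro ballI impI)
      fix x y r assume h: "x \<in> E" "y \<in> E" "r \<in> E" "x ^ a * r \<in> K" "y ^ b * r \<in> K" "a + b = Suc n"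
      have 1: "(x + y) ^ n * (x * r) \<in> K"
      proof (cases a)
        case 0
        then have "r \<in> K" using h by simp
        then have "(x + y) ^ n * x * r \<in> K" using K(4)[of "(x + y) ^ n * x" r] E h by simp
        then show ?thesis by (simp add: mult.assoc)
      next
        case (Suc a')
        then have "x ^ a' * (x * r) \<in> K" "y ^ b * (x * r) \<in> K" using h K(4)[of x "y ^ b * r"] by (auto simp: mult_ac)
        then show ?thesis using Suc.IH[of a' b] Suc h E by auto
      qed
      have 2: "(x + y) ^ n * (y * r) \<in> K"
      proof (cases b)
        case 0
        then have "r \<in> K" using h by simp
        then have "(x + y) ^ n * y * r \<in> K" using K(4)[of "(x + y) ^ n * y" r] E h by simp
        then show ?thesis by (simp add: mult.assoc)
      next
        case (Suc b')
        then have "y ^ b' * (y * r) \<in> K" "x ^ a * (y * r) \<in> K" using h K(4)[of y "x ^ a * r"] by (auto simp: mult_ac)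
        then show ?thesis using Suc.IH[of a b'] Suc h E by auto
      qed
      have "(x + y) ^ Suc n * r = (x + y) ^ n * (x * r) + (x + y) ^ n * (y * r)" by (simp add: algebra_simps)
      then show "(x + y) ^ Suc n * r \<in> K" using 1 2 K by simp
    qed
  qed
  have "x + y \<in> radE E K" if xy: "x \<in> radE E K" "y \<in> radE E K" for x y
  proof -
    obtain a b where "x \<in> E" "y \<in> E" "x ^ a * e \<in> K" "y ^ b * e \<in> K" using xy unfolding radE_def by blast
    then have "(x + y) ^ (a + b) * e \<in> K" "x + y \<in> E" using key[of a b "a + b"] E by auto
    then show ?thesis by (auto simp: radE_def)
  qed
  moreover have "a * x \<in> radE E K" if ax: "a \<in> E" "x \<in> radE E K" for a x
  proof -
    obtain n where "x \<in> E" "x ^ n * e \<in> K" using ax unfolding radE_def by blast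
    moreover have "(a * x) ^ n * e = (a ^ n * e) * (x ^ n * e)"
      using E(1)[OF \<open>x \<in> E\<close>] E(1)[OF \<open>a \<in> E\<close>] by (simp add: power_mult_distrib mult_ac)
    ultimately have "(a * x) ^ n * e \<in> K" using K(4)[of "a ^ n * e" "x ^ n * e"] E ax(1) by simp
    then show ?thesis using E ax \<open>x \<in> E\<close> by (auto simp: radE_def)
  qed
  moreover have "0 \<in> radE E K" using E(2)[of 0] K(2) by (auto simp: radE_def intro!: exI[of _ "Suc 0"])
  ultimately show ?thesis unfolding idl_def by (auto simp: radE_def)
qed

lemma radE_radical: assumes "subr E" "w \<in> E" "w ^ n * e \<in> radE E K" shows "w \<in> radE E K"
proof -
  have wQ: "w \<in> Q" using subrD(1)[OF assms(1,2)] .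
  obtain k where "(w ^ n * e) ^ k * e \<in> K" using assms by (auto simp: radE_def)
  moreover have "(w ^ n * e) ^ k * e = w ^ (n * k) * e"
    by (simp add: power_mult_distrib power_mult mult.assoc)
  ultimately show ?thesis using assms by (auto simp: radE_def)
qed

lemma radE_sub: "subr E \<Longrightarrow> idl E K \<Longrightarrow> K \<subseteq> radE E K"
proof
  fix x assume "subr E" "idl E K" "x \<in> K"
  then have "x ^ 1 * e \<in> K" "x \<in> E" using idlD(1) subrD(1) by auto
  then show "x \<in> radE E K" unfolding radE_def by blast
qed

text \<open>The ideal \<open>pE + mE\<close>; in particular \<open>gen E 0\<close> stands for
  \<open>mE\<close>. Including \<open>m\<close> allows statements about \<open>E / mE\<close> to be
  made with ideals of \<open>E\<close>.\<close>

definition "gen E p = {p * u + m * s | u s. u \<in> E \<and> s \<in> E}"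

lemma gen_idl: assumes "subr E" "p \<in> E" shows "idl E (gen E p)"
proof -
  note E = subrD[OF assms(1)]
  have mE: "m \<in> E" "0 \<in> E" using E by auto
  have "x + y \<in> gen E p" if xy: "x \<in> gen E p" "y \<in> gen E p" for x y
  proof -
    obtain u s u' s' where "x = p * u + m * s" "y = p * u' + m * s'" "u \<in> E" "s \<in> E" "u' \<in> E" "s' \<in> E" using xy unfolding gen_def by blast
    then show ?thesis unfolding gen_def by (intro CollectI exI[of _ "u + u'"] exI[of _ "s + s'"]) (auto simp: algebra_simps E)
  qed
  moreover have "a * x \<in> gen E p" if ax: "a \<in> E" "x \<in> gen E p" for a x
  proof -
    obtain u s where "x = p * u + m * s" "u \<in> E" "s \<in> E" using ax unfolding gen_def by blast
    then show ?thesis unfolding gen_def using ax by (intro CollectI exI[of _ "a * u"] exI[of _ "a * s"]) (auto simp: algebra_simps E)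
  qed
  moreover have "0 \<in> gen E p" unfolding gen_def using mE by (intro CollectI exI[of _ 0]) auto
  moreover have "gen E p \<subseteq> E" using mE assms by (auto simp: gen_def E)
  ultimately show ?thesis by (auto simp: idl_def)
qed

text \<open>This is where dimension one acts on \<open>E\<close>: the maximal ideal of
  \<open>A\<close> falls into the radical of \<open>mE\<close>, so modulo that radical coefficients
  from \<open>A\<close> become elements of the residue field.\<close>

lemma nonunitA_gen: assumes "subr E" "p \<in> E" "nonunitA a" shows "a \<in> radE E (gen E p)"
proof -
  note E = subrD[OF assms(1)]
  obtain k x where "x \<in> A" "a ^ k * e = m * x" using nonunitA_rad[OF assms(3)] by blast
  then have "a ^ k * e = p * 0 + m * x" "x \<in> E" "0 \<in> E" "a \<in> E" using E nonunitA_A[OF assms(3)] by auto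
  then show ?thesis unfolding radE_def gen_def by blast
qed

text \<open>Modulo the radical of \<open>mE\<close> an integral equation of \<open>p\<close> has
  coefficients in the residue field. Splitting off a power of \<open>p\<close> leaves
  \<open>p^j (c0 + p X) = 0\<close> with a unit \<open>c0\<close>, so
  \<open>p^j (e - p t) = 0\<close>; then \<open>p (e - p t)\<close> is nilpotent, hence zero in the
  reduced quotient. Thus \<open>p t\<close> is idempotent there and generates the same ideal as
  \<open>p\<close>.\<close>

lemma integral_pi_regular:
  assumes E: "subr E" and p: "p \<in> E" and int: "integral p"
  shows "\<exists>t\<in>E. p * (e - p * t) \<in> radE E (gen E 0)"
proof -
  note E' = subrD[OF E]
  have z: "0 \<in> E" "e \<in> E" using E' by auto
  let ?K = "radE E (gen E 0)"
  have K: "idl E ?K" by (rule radE_idl[OF E gen_idl[OF E z(1)]])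
  note K' = idlD[OF K E]
  have Kpow: "w \<in> ?K" if "w ^ n * e \<in> ?K" "w \<in> E" for w n using radE_radical[OF E] that by blast
  have key: "\<forall>c j. (\<forall>i. c i \<in> A) \<longrightarrow> p ^ j * (p ^ n * e + (\<Sum>i<n. c i * p ^ i)) \<in> ?K \<longrightarrow> (\<exists>t\<in>E. p * (e - p * t) \<in> ?K)" for n
  proof (induction n)
    case 0
    show ?case
    proof (intro allI impI)
      fix c :: "nat \<Rightarrow> 'u" and j assume "p ^ j * (p ^ 0 * e + (\<Sum>i<0. c i * p ^ i)) \<in> ?K"
      then have "p ^ j * e \<in> ?K" by simp
      then have "p \<in> ?K" by (rule Kpow[OF _ p])
      then show "\<exists>t\<in>E. p * (e - p * t) \<in> ?K" using z E'(1)[OF p] by (intro bexI[of _ 0]) auto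
    qed
  next
    case (Suc n)
    show ?case
    proof (intro allI impI)
      fix c :: "nat \<Rightarrow> 'u" and j assume c: "\<forall>i. c i \<in> A" and h: "p ^ j * (p ^ Suc n * e + (\<Sum>i<Suc n. c i * p ^ i)) \<in> ?K"
      let ?X = "p ^ n * e + (\<Sum>i<n. c (Suc i) * p ^ i)"
      have sumE: "(\<Sum>i<k. c (Suc i) * p ^ i) \<in> E" for k
      proof (induction k)
        case (Suc k)
        have "p ^ k * c (Suc k) \<in> E" by (rule E'(7)[OF p E'(2)]) (simp add: c)
        then show ?case using Suc E' by (simp add: mult.commute)
      qed (use z in simp)
      have X: "?X \<in> E" by (rule E'(3)[OF E'(7)[OF p z(2)] sumE])
      have eq: "p ^ Suc n * e + (\<Sum>i<Suc n. c i * p ^ i) = c 0 + p * ?X"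
        unfolding sum.lessThan_Suc_shift by (simp add: algebra_simps sum_distrib_left)
      show "\<exists>t\<in>E. p * (e - p * t) \<in> ?K"
      proof (cases "nonunitA (c 0)")
        case True
        \<comment> \<open>A nonunit constant term disappears modulo \<open>?K\<close>, which leaves
          a relation of lower degree with \<open>j\<close> raised by one.\<close>
        then have "c 0 \<in> ?K" using nonunitA_gen[OF E z(1)] by blast
        then have "(p ^ j * e) * c 0 \<in> ?K" using K'(4)[OF E'(7)[OF p z(2)]] by blast
        then have "p ^ j * c 0 \<in> ?K" using c by (simp add: mult.assoc)
        then have "p ^ j * (c 0 + p * ?X) - p ^ j * c 0 \<in> ?K" using h eq K' by simp
        then have "p ^ Suc j * ?X \<in> ?K" by (simp add: algebra_simps)
        then show ?thesis using Suc.IH[rule_format, of "\<lambda>i. c (Suc i)" "Suc j"] c by blast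
      next
        case False
        then obtain b where b: "b \<in> A" "c 0 * b = e" using c by (auto simp: nonunitA_def unitA_def)
        \<comment> \<open>Dividing \<open>p^j (c 0 + p X)\<close> by the unit \<open>c 0\<close>,
          whose inverse is \<open>b\<close>, leaves \<open>p^j (e - p t)\<close>.\<close>
        let ?t = "- (?X * b)"
        have t: "?t \<in> E" by (rule E'(5)[OF E'(4)[OF X E'(2)[OF b(1)]]])
        have pQ: "p \<in> Q" "?X \<in> Q" "b \<in> Q" using E'(1)[OF p] E'(1)[OF X] b by auto
        have "p ^ j * (c 0 * b - p * (- (X * b))) = b * (p ^ j * (c 0 + p * X))" for X
          by (simp add: algebra_simps)
        then have "p ^ j * (e - p * ?t) = b * (p ^ j * (c 0 + p * ?X))" using b(2) by metis
        then have 1: "p ^ j * (e - p * ?t) \<in> ?K" using h eq K'(4)[of b] E'(2)[OF b(1)] by simp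
        let ?u = "e - p * ?t"
        have u: "?u \<in> E" by (rule E'(6)[OF z(2) E'(4)[OF p t]])
        have "(p * (?u ^ j * e)) * (p ^ j * ?u) \<in> ?K" by (rule K'(4)[OF E'(4)[OF p E'(7)[OF u z(2)]] 1])
        moreover have "(p * (?u ^ j * e)) * (p ^ j * ?u) = (p * ?u) ^ Suc j * e" by (simp add: power_mult_distrib mult_ac)
        ultimately have "p * ?u \<in> ?K" by (intro Kpow[of "p * ?u" "Suc j", OF _ E'(4)[OF p u]]) (simp only:)
        then show ?thesis using t by blast
      qed
    qed
  qed
  obtain n c where "\<forall>i. c i \<in> A" "p ^ n * e + (\<Sum>i<n. c i * p ^ i) = 0" using int by (auto simp: integral_def)
  then show ?thesis using key[of n, rule_format, of c 0] K'(2) by auto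
qed

end

section \<open>From invertible to principal over the endomorphism ring\<close>

context local_subring begin

text \<open>Modulo \<open>K\<close> the element \<open>a * b * t\<close> is an idempotent generating the ideal of \<open>a * b\<close>; gluing \<open>a\<close> to \<open>a'\<close> and \<open>b\<close> to \<open>b'\<close>
  along it merges two products into one, which reduces the length of a relation \<open>\<Sum> b y * y = e\<close>.\<close>

lemma merge_step:
  assumes E: "subr E" and K: "idl E K" and Krad: "\<And>w. w \<in> E \<Longrightarrow> w * w \<in> K \<Longrightarrow> w \<in> K"
    and p: "a * b \<in> E" "a' * b' \<in> E" "a * b' + a' * b \<in> E" and t: "t \<in> E"
    and pt: "a * b * (e - a * b * t) \<in> K"
    and xy: "(a * b * t * a + (e - a * b * t) * a') * (a * b * t * b + (e - a * b * t) * b') \<in> K"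
    and Q: "a \<in> Q" "b \<in> Q" "a' \<in> Q" "b' \<in> Q"
  shows "a * b \<in> K \<and> a' * b' \<in> K"
proof -
  note E' = subrD[OF E] note K' = idlD[OF K E]
  define p where "p = a * b"
  define p' where "p' = a' * b'"
  define r where "r = a * b' + a' * b"
  define d where "d = e - p * t"
  define z where "z = (p * t * a + d * a') * (p * t * b + d * b')"
  have pE: "p \<in> E" "p' \<in> E" "r \<in> E" "e \<in> E" using p E'(2)[OF Ae] unfolding p_def p'_def r_def by auto
  have dE: "d \<in> E" "p * t \<in> E" unfolding d_def by (intro E'(4,6) pE t)+
  have pd: "p * d \<in> K" using pt unfolding p_def d_def .
  have zK: "z \<in> K" using xy unfolding z_def p_def d_def .
  have QQ: "p \<in> Q" "p' \<in> Q" "r \<in> Q" "d \<in> Q" "t \<in> Q" "z \<in> Q" using E'(1)[OF pE(1)] E'(1)[OF pE(2)] E'(1)[OF pE(3)] E'(1)[OF dE(1)] E'(1)[OF t] E'(1)[OF K'(1)[OF zK]] by auto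
  \<comment> \<open>Since \<open>p d\<close> lies in \<open>K\<close> and
    \<open>p t = e - d\<close>, multiplying this expansion by \<open>p\<close> leaves
    \<open>p^2\<close> modulo \<open>K\<close>, so \<open>p\<close> lies in \<open>K\<close>. Then
    \<open>d\<close> is \<open>e\<close> modulo \<open>K\<close>, and the same expansion leaves
    \<open>p'\<close>.\<close>
  have z: "z = (p * t) * (p * t) * p + (t * r) * (p * d) + d * d * p'"
    unfolding z_def p_def p'_def r_def by (simp add: algebra_simps)
  have pt': "p * t = e - d" unfolding d_def by simp
  have z1: "p * z = p * p + (p * d) * (p * d) - p * (p * d) - p * (p * d) + (p * (t * r)) * (p * d) + (p * d) * (d * p')"
    unfolding z pt' using QQ by (simp add: algebra_simps)
  have "p * z \<in> K" by (rule K'(4)[OF pE(1) zK])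
  moreover have "(p * d) * (p * d) \<in> K" "p * (p * d) \<in> K" "(p * (t * r)) * (p * d) \<in> K" "(d * p') * (p * d) \<in> K"
    by (auto intro!: K'(4)[OF _ pd] E'(4) pE dE t)
  moreover have eq: "p * p = p * z - (p * d) * (p * d) + p * (p * d) + p * (p * d) - (p * (t * r)) * (p * d) - (d * p') * (p * d)"
    unfolding z1 by (simp add: algebra_simps)
  ultimately have "p * p \<in> K" by (subst eq) (intro K'(3,6))
  then have pK: "p \<in> K" using Krad pE by blast
  have eq2: "p' = z - (p * t) * (p * t) * p - (t * r) * (p * d) + (t * p' + d * t * p') * p"
    unfolding z d_def using QQ(1-3,5) by (simp add: algebra_simps)
  moreover have "(p * t) * (p * t) * p \<in> K" "(t * p' + d * t * p') * p \<in> K"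
    by (intro K'(4)[OF _ pK] E'(3,4) pE dE t)+
  moreover have "(t * r) * (p * d) \<in> K"
    by (intro K'(4)[OF _ pd] E'(4) pE dE t)
  ultimately have "p' \<in> K" using zK by (subst eq2) (intro K'(3,6))
  then show ?thesis using pK unfolding p_def p'_def by simp
qed

text \<open>Invertibility is the relation \<open>e = \<Sum> b y * y\<close>; wanted is one product
  \<open>x * y\<close>, with \<open>x\<close> in \<open>F\<close> and \<open>y F\<close> inside
  \<open>endo F\<close>, that is a unit of \<open>endo F\<close>. The terms are merged one at a
  time, so that every radical ideal containing \<open>m\<close> and the merged product contains all
  products used so far. In the end the radical of the ideal generated by \<open>x * y\<close> and
  \<open>m\<close> contains \<open>e\<close>, so \<open>e = x y u + m s\<close>; as
  \<open>e - m s\<close> is a unit, \<open>F = x * endo F\<close>.\<close>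

lemma inv_frac_principal:
  assumes F: "fractional F" and inv: "inv_frac F" and int: "\<And>p. p \<in> endo F \<Longrightarrow> integral p"
  shows "\<exists>z\<in>F. F = (\<lambda>q. z * q) ` endo F"
proof -
  let ?E = "endo F"
  have sF: "submod F" using F by (simp add: fractional_def)
  note F' = submodD[OF sF]
  have E: "subr ?E" using subr_endo[OF sF] .
  note E' = subrD[OF E]
  have EF: "q * x \<in> F" if "q \<in> ?E" "x \<in> F" for q x using that by (auto simp: endo_def)
  obtain Y b where Y: "finite Y" "Y \<subseteq> F" "\<And>y. y \<in> Y \<Longrightarrow> b y \<in> Q" "\<And>y x. y \<in> Y \<Longrightarrow> x \<in> F \<Longrightarrow> b y * x \<in> ?E"
      "(\<Sum>y\<in>Y. b y * y) = e"
    using inv unfolding inv_frac_def by blast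
  \<comment> \<open>All radical ideals above the radical of \<open>mE\<close> are considered at
    once, because the ideal to which the claim is applied at the end is built from the merged pair
    and is not known while merging.\<close>
  let ?ok = "\<lambda>K. idl ?E K \<and> (\<forall>w\<in>?E. w * w \<in> K \<longrightarrow> w \<in> K) \<and> radE ?E (gen ?E 0) \<subseteq> K"
  have claim: "finite Z \<Longrightarrow> Z \<subseteq> Y \<Longrightarrow> \<exists>x\<in>F. \<exists>y\<in>Q. (\<forall>f\<in>F. y * f \<in> ?E) \<and> (\<forall>K. ?ok K \<longrightarrow> x * y \<in> K \<longrightarrow> (\<forall>z\<in>Z. b z * z \<in> K))" for Z
  proof (induction Z rule: finite_induct)
    case empty
    have "0 \<in> F" "0 \<in> ?E" using F'(2) E'(2)[OF A0] by blast+
    then show ?case by (intro bexI[of _ 0]) auto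
  next
    case (insert z Z)
    then obtain a' b' where h: "a' \<in> F" "b' \<in> Q" "\<forall>f\<in>F. b' * f \<in> ?E"
      "\<And>K. ?ok K \<Longrightarrow> a' * b' \<in> K \<Longrightarrow> \<forall>z\<in>Z. b z * z \<in> K" by auto
    have z: "z \<in> F" "b z \<in> Q" "\<And>f. f \<in> F \<Longrightarrow> b z * f \<in> ?E" using insert.prems Y(2-4) by auto
    have zb: "z * b z \<in> ?E" using z(3)[OF z(1)] by (simp add: mult.commute)
    obtain t where t: "t \<in> ?E" "z * b z * (e - z * b z * t) \<in> radE ?E (gen ?E 0)"
      using integral_pi_regular[OF E zb int[OF zb]] by blast
    let ?d = "e - z * b z * t"
    let ?x = "z * b z * t * z + ?d * a'" and ?y = "z * b z * t * b z + ?d * b'"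
    have pt: "z * b z * t \<in> ?E" "?d \<in> ?E" by (intro E'(4,6) zb t(1) E'(2)[OF Ae])+
    have x: "?x \<in> F" using EF[OF pt(1) z(1)] EF[OF pt(2) h(1)] by (rule F'(3))
    have yf: "?y * f \<in> ?E" if "f \<in> F" for f
    proof -
      have "?y * f = (z * b z * t) * (b z * f) + ?d * (b' * f)" by (simp add: algebra_simps)
      moreover have "b' * f \<in> ?E" using h(3) that by blast
      ultimately show ?thesis using E'(3)[OF E'(4)[OF pt(1) z(3)[OF that]] E'(4)[OF pt(2)]] by simp
    qed
    have yQ: "?y \<in> Q" using E'(1)[OF pt(1)] E'(1)[OF pt(2)] z h by blast
    have "\<forall>w\<in>insert z Z. b w * w \<in> K" if K: "?ok K" "?x * ?y \<in> K" for K
    proof -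
      have p: "a' * b' \<in> ?E" "z * b' + a' * b z \<in> ?E"
        using h(3) h(1) z(1) E'(3)[of "b' * z" "b z * a'"] z(3)[OF h(1)] by (auto simp: mult.commute)
      have "z * b z \<in> K \<and> a' * b' \<in> K"
        by (rule merge_step[OF E _ _ zb p(1) p(2) t(1) _ K(2)]) (use K(1) t(2) F'(1)[OF z(1)] F'(1)[OF h(1)] z(2) h(2) in blast)+
      then have "b z * z \<in> K" "\<forall>z\<in>Z. b z * z \<in> K" using h(4)[OF K(1)] by (simp_all add: mult.commute)
      then show ?thesis by blast
    qed
    then show ?case using x yQ yf by (intro bexI[of _ ?x] bexI[of _ ?y] conjI) blast+
  qed
  from claim[OF Y(1) subset_refl] obtain x y where xy: "x \<in> F" "y \<in> Q" "\<forall>f\<in>F. y * f \<in> ?E"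
      and xyK: "\<forall>K. ?ok K \<longrightarrow> x * y \<in> K \<longrightarrow> (\<forall>z\<in>Y. b z * z \<in> K)" by (elim bexE conjE) (rule that)
  have xyE: "x * y \<in> ?E" using xy(3) xy(1) by (simp add: mult.commute)
  let ?G = "gen ?E (x * y)"
  let ?K = "radE ?E ?G"
  have eE: "e \<in> ?E" "0 \<in> ?E" using E'(2)[OF Ae] E'(2)[OF A0] by blast+
  have G: "idl ?E ?G" by (rule gen_idl[OF E xyE])
  have K: "idl ?E ?K" by (rule radE_idl[OF E G])
  have "radE ?E (gen ?E 0) \<subseteq> ?K"
  proof -
    have "gen ?E 0 \<subseteq> ?G"
    proof
      fix w assume "w \<in> gen ?E 0"
      then obtain u s where us: "s \<in> ?E" "w = 0 * u + m * s" unfolding gen_def by blast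
      then have "w = x * y * 0 + m * s" by simp
      then show "w \<in> ?G" unfolding gen_def using us eE by blast
    qed
    then show ?thesis unfolding radE_def by blast
  qed
  moreover have "\<forall>w\<in>?E. w * w \<in> ?K \<longrightarrow> w \<in> ?K"
  proof (intro ballI impI)
    fix w assume w: "w \<in> ?E" "w * w \<in> ?K"
    then have "w ^ 2 * e \<in> ?K" using E'(1)[OF w(1)] by (simp add: power2_eq_square mult.assoc)
    then show "w \<in> ?K" using radE_radical[OF E w(1)] by blast
  qed
  ultimately have ok: "?ok ?K" using K by blast
  have "x * y * e + m * 0 \<in> ?G" unfolding gen_def using eE by blast
  then have "x * y \<in> ?K" using radE_sub[OF E G] E'(1)[OF xyE] by auto
  then have bK: "b z * z \<in> ?K" if "z \<in> Y" for z using xyK[rule_format, OF ok] that by blast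
  have "(\<Sum>z\<in>Z. b z * z) \<in> ?K" if "finite Z" "Z \<subseteq> Y" for Z
    using that by (induction Z rule: finite_induct) (auto intro: idlD[OF K E] bK)
  from this[OF Y(1)] have "e \<in> ?K" using Y(5) by simp
  then obtain n where "e ^ n * e \<in> ?G" unfolding radE_def by blast
  then have "e \<in> ?G" by simp
  then obtain u s where us: "u \<in> ?E" "s \<in> ?E" "e = x * y * u + m * s" unfolding gen_def by blast
  obtain v where v: "v \<in> ?E" "(e - m * s) * v = e" using unit_near_one[OF E endo_bdd[OF F] us(2)] by blast
  have "e - m * s = x * y * u" by (subst us(3)) simp
  then have xyv: "x * y * u * v = e" using v by simp
  have "F = (\<lambda>q. x * q) ` ?E"
  proof
    show "F \<subseteq> (\<lambda>q. x * q) ` ?E"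
    proof
      fix f assume f: "f \<in> F"
      have "x * (y * f * (u * v)) = (x * y * u * v) * f" by (simp add: algebra_simps)
      then have "f = x * (y * f * (u * v))" using xyv F'(1)[OF f] by simp
      moreover have "y * f * (u * v) \<in> ?E" by (intro E'(4) xy(3)[rule_format, OF f] us(1) v(1))
      ultimately show "f \<in> (\<lambda>q. x * q) ` ?E" by blast
    qed
    show "(\<lambda>q. x * q) ` ?E \<subseteq> F" using EF xy(1) by (auto simp: mult.commute)
  qed
  then show ?thesis using xy(1) by blast
qed

text \<open>Cayley-Hamilton for multiplication by \<open>r\<close> on the generators
  \<open>e, q\<close>: with \<open>r = a + b q\<close> and \<open>r q = c + d q\<close> the relation
  is \<open>r^2 - (a + d) r + (a d - b c) = 0\<close>.\<close>

lemma quadratic_integral: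
  assumes "q \<in> Q" "r \<in> endo (span2 e q)"
  shows "integral r"
proof -
  have rQ: "r \<in> Q" using assms by (simp add: endo_def)
  have "e * e + 0 * q \<in> span2 e q" "0 * e + e * q \<in> span2 e q" unfolding span2_def using A0 Ae by blast+
  then have "e \<in> span2 e q" "q \<in> span2 e q" using assms by auto
  then have m: "r * e \<in> span2 e q" "r * q \<in> span2 e q" using assms(2) unfolding endo_def by blast+
  obtain a b where 1: "a \<in> A" "b \<in> A" "r * e = a * e + b * q" using m(1) unfolding span2_def by blast
  obtain c d where 2: "c \<in> A" "d \<in> A" "r * q = c * e + d * q" using m(2) unfolding span2_def by blast
  note A = 1(1,2) 2(1,2) and h = 1(3) 2(3)
  have r: "r = a + b * q" using h(1) A rQ by simp
  have rq: "r * q = c + d * q" using h(2) A by simp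
  have "(r - a) * (r - d) = b * (r * q - d * q)" unfolding r by (simp add: algebra_simps)
  also have "r * q - d * q = c" unfolding rq by simp
  finally have "(r - a) * (r - d) = b * c" .
  moreover have "r * r + (a * d - b * c - (a + d) * r) = (r - a) * (r - d) - b * c" by (simp add: algebra_simps)
  ultimately have eq: "r * r + (a * d - b * c - (a + d) * r) = 0" by (simp only: diff_self)
  let ?c = "\<lambda>i::nat. if i = 0 then a * d - b * c else - (a + d)"
  have "r ^ 2 * e = r * r" using rQ by (simp add: power2_eq_square mult.assoc)
  moreover have "(\<Sum>i<2. ?c i * r ^ i) = (a * d - b * c) - (a + d) * r"
    by (simp add: numeral_2_eq_2 algebra_simps)
  ultimately have "r ^ 2 * e + (\<Sum>i<2. ?c i * r ^ i) = 0" using eq by (simp only:)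
  moreover have "\<forall>i. ?c i \<in> A" using A by auto
  ultimately show ?thesis unfolding integral_def by (intro exI[of _ 2] exI[of _ ?c] conjI)
qed

text \<open>Put \<open>g = e - f t\<close>, with \<open>f g\<close> nilpotent modulo
  \<open>mE\<close>. Multiplying a power of \<open>f g\<close> by the same power of \<open>z\<close>
  removes \<open>f\<close>, so a power of \<open>g\<close> becomes \<open>m\<close> times an element
  of \<open>A\<close> once enough factors \<open>m\<close> are present to absorb the denominators of
  \<open>E\<close> and of the powers of \<open>z\<close>. On the other hand every power of
  \<open>g\<close> is \<open>e\<close> minus a multiple of \<open>f t\<close>, so \<open>f\<close>
  has an inverse in \<open>E\<close>, which is \<open>z\<close>.\<close>

lemma unit_integral:
  assumes E: "subr E" "bdd E" and f: "f \<in> E" "integral f" and z: "z \<in> T" "z * f = e"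
  shows "z \<in> E"
proof -
  note E' = subrD[OF E(1)]
  have zQ: "z \<in> Q" using z by (simp add: T_def)
  have fQ: "f \<in> Q" using E' f by auto
  obtain t where t: "t \<in> E" "f * (e - f * t) \<in> radE E (gen E 0)" using integral_pi_regular[OF E(1) f] by blast
  obtain k where k: "\<And>x. x \<in> E \<Longrightarrow> m ^ k * x \<in> A" using E by (auto simp: bdd_def)
  obtain d where d: "\<And>n. m ^ d * (z ^ n * e) \<in> A" using z by (auto simp: T_def)
  obtain n u s where us: "u \<in> E" "s \<in> E" "(f * (e - f * t)) ^ n * e = 0 * u + m * s"
    using t(2) unfolding radE_def gen_def by blast
  \<comment> \<open>Of these factors \<open>m\<close>, \<open>k\<close> bring the power of
    \<open>s\<close> into \<open>A\<close>, \<open>d\<close> do the same for the power of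
    \<open>z\<close>, and one remains.\<close>
  let ?N = "Suc (k + d)"
  define g where "g = e - f * t"
  have gQ: "g \<in> Q" using t E' fQ unfolding g_def by auto
  have pe: "x ^ i * e = (x * e) ^ i * e" for x i by (simp add: power_mult_distrib mult.assoc)
  have 1: "(f * g) ^ n * e = m * s" using us unfolding g_def by simp
  have "((f * g) ^ n * e) ^ ?N * e = (f * g) ^ (n * ?N) * e"
    by (simp only: power_mult power_mult_distrib mult.assoc e_pow)
  then have "(f * g) ^ (n * ?N) * e = m ^ ?N * s ^ ?N * e" unfolding 1 by (simp only: power_mult_distrib)
  moreover have "(z * (f * g)) ^ (n * ?N) * e = z ^ (n * ?N) * ((f * g) ^ (n * ?N) * e)" by (simp add: power_mult_distrib mult.assoc)
  moreover have "z * (f * g) = e * g" using z by (simp add: mult.assoc[symmetric])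
  ultimately have 2: "g ^ (n * ?N) * e = z ^ (n * ?N) * (m ^ ?N * s ^ ?N * e)" using gQ by simp
  have 3: "z ^ (n * ?N) * (m ^ ?N * s ^ ?N * e) = m * ((m ^ k * (s ^ ?N * e)) * (m ^ d * (z ^ (n * ?N) * e)))"
    (is "_ = m * ?a")
  proof -
    have "m * ((m ^ k * (s ^ ?N * e)) * (m ^ d * (z ^ (n * ?N) * e))) = z ^ (n * ?N) * (m ^ ?N * s ^ ?N * (e * e))"
      by (simp only: power_Suc power_add mult_ac)
    then show ?thesis by simp
  qed
  have a: "?a \<in> A" using k[OF E'(7)[OF us(2) E'(2)[OF Ae]], of ?N] d[of "n * ?N"] by blast
  have ft: "f * t \<in> E" by (intro E'(4) t(1) f(1))
  have "\<exists>w\<in>E. g * w = g * w \<and> e - f * t * w = g ^ j * e" for j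
  proof (induction j)
    case 0 show ?case using E'(2)[of 0] by (intro bexI[of _ 0]) auto
  next
    case (Suc j)
    then obtain w where w: "w \<in> E" "e - f * t * w = g ^ j * e" by blast
    have wQ: "w \<in> Q" "t \<in> Q" using w t E' by auto
    have "e - f * t * (w + e - f * t * w) = (e - f * t) * (e - f * t * w)"
      using wQ fQ by (simp add: algebra_simps)
    also have "\<dots> = g ^ Suc j * e" using w by (simp add: g_def mult.assoc)
    finally show ?case by (intro bexI[of _ "w + e - f * t * w"] conjI refl E'(3) E'(4) E'(6) w(1) ft E'(2)[OF Ae])
  qed
  then obtain w where w: "w \<in> E" "e - f * t * w = g ^ (n * ?N) * e" by blast
  then have "e - f * t * w = m * ?a" using 2 3 by simp
  then have "f * t * w = e - m * ?a" by (metis add_diff_cancel_left' diff_add_cancel)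
  moreover obtain b where b: "b \<in> A" "(e - m * ?a) * b = e" using unitA_e_m[OF a] by blast
  ultimately have "f * t * w * b = e" by simp
  then have "z * (f * t * w * b) = z" using zQ by simp
  moreover have "z * (f * t * w * b) = (z * f) * (t * w * b)" by (simp add: mult_ac)
  moreover have "t * w * b \<in> E" by (intro E'(4) t(1) w(1) E'(2)[OF b(1)])
  ultimately show ?thesis using z(2) E'(1) by simp
qed

lemma span2_submod: "a \<in> Q \<Longrightarrow> b \<in> Q \<Longrightarrow> submod (span2 a b)"
proof -
  assume Q: "a \<in> Q" "b \<in> Q"
  have "x + y \<in> span2 a b" if xy: "x \<in> span2 a b" "y \<in> span2 a b" for x y
  proof -
    obtain u v u' v' where "x = u * a + v * b" "y = u' * a + v' * b" "u \<in> A" "v \<in> A" "u' \<in> A" "v' \<in> A"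
      using xy unfolding span2_def by blast
    then show ?thesis unfolding span2_def by (intro CollectI exI[of _ "u + u'"] exI[of _ "v + v'"]) (auto simp: algebra_simps)
  qed
  moreover have "c * x \<in> span2 a b" if cx: "c \<in> A" "x \<in> span2 a b" for c x
  proof -
    obtain u v where "x = u * a + v * b" "u \<in> A" "v \<in> A" using cx unfolding span2_def by blast
    then show ?thesis unfolding span2_def using cx by (intro CollectI exI[of _ "c * u"] exI[of _ "c * v"]) (auto simp: algebra_simps)
  qed
  moreover have "0 \<in> span2 a b" unfolding span2_def by (intro CollectI exI[of _ 0]) auto
  ultimately show ?thesis unfolding submod_def using Q by (auto simp: span2_def)
qed

lemma span2_mem: "a \<in> Q \<Longrightarrow> b \<in> Q \<Longrightarrow> a \<in> span2 a b" "a \<in> Q \<Longrightarrow> b \<in> Q \<Longrightarrow> b \<in> span2 a b"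
proof -
  assume Q: "a \<in> Q" "b \<in> Q"
  have "e * a + 0 * b \<in> span2 a b" "0 * a + e * b \<in> span2 a b" unfolding span2_def using A0 Ae by blast+
  then show "a \<in> span2 a b" "b \<in> span2 a b" using Q by auto
qed

lemma span2_least: "submod F \<Longrightarrow> a \<in> F \<Longrightarrow> b \<in> F \<Longrightarrow> span2 a b \<subseteq> F"
  unfolding span2_def by (auto intro!: submodD)

text \<open>With degree \<open>n\<close> and \<open>m^k q\<close> in \<open>A\<close>, the exponent
  \<open>k n\<close> clears \<open>q^j\<close> for \<open>j < n\<close>; higher powers reduce to
  lower ones by the equation and keep the same denominator.\<close>

lemma integral_T: assumes "q \<in> Q" "integral q" shows "q \<in> T"
proof -
  obtain n c where c: "\<forall>i. c i \<in> A" and eq: "q ^ n * e + (\<Sum>i<n. c i * q ^ i) = 0" using assms by (auto simp: integral_def)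
  obtain k where k: "m ^ k * q \<in> A" using Qfrac assms by blast
  have "m ^ (k * n) * (q ^ j * e) \<in> A" for j
  proof (induction j rule: less_induct)
    case (less j)
    show ?case
    proof (cases "j < n")
      case True
      then have n: "n = j + (n - j)" by simp
      have "m ^ (k * n) = m ^ (k * (n - j)) * (m ^ k) ^ j"
        by (metis n add.commute distrib_left power_add power_mult)
      then have "m ^ (k * n) * (q ^ j * e) = m ^ (k * (n - j)) * ((m ^ k * q) ^ j * e)"
        by (simp only: power_mult_distrib mult_ac)
      then show ?thesis using k by simp
    next
      case False
      have "q ^ j * e = q ^ (j - n) * (q ^ n * e)" using False by (simp add: power_add[symmetric] mult.assoc[symmetric])
      also have "q ^ n * e = - (\<Sum>i<n. c i * q ^ i)" using eq by (simp add: eq_neg_iff_add_eq_0)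
      also have "q ^ (j - n) * - (\<Sum>i<n. c i * q ^ i) = - (\<Sum>i<n. c i * (q ^ (i + (j - n)) * e))"
        using c by (simp add: sum_distrib_left power_add mult_ac)
      finally have "m ^ (k * n) * (q ^ j * e) = - (\<Sum>i<n. c i * (m ^ (k * n) * (q ^ (i + (j - n)) * e)))"
        by (simp add: sum_distrib_left mult_ac)
      moreover have "(\<Sum>i<l. c i * (m ^ (k * n) * (q ^ (i + (j - n)) * e))) \<in> A" if "l \<le> n" for l
        using that by (induction l) (use False c less in \<open>auto intro!: Aadd Amul\<close>)
      ultimately show ?thesis by simp
    qed
  qed
  then show ?thesis using assms unfolding T_def by blast
qed

lemma fractional_span2: assumes "q \<in> Q" shows "fractional (span2 e q)"
proof -
  obtain k where k: "m ^ k * q \<in> A" using Qfrac assms by blast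
  have "m ^ k * x \<in> A" if x: "x \<in> span2 e q" for x
  proof -
    obtain u v where uv: "x = u * e + v * q" "u \<in> A" "v \<in> A" using x unfolding span2_def by blast
    have "m ^ k * x = m ^ k * u + v * (m ^ k * q)" unfolding uv(1) using uv by (simp add: algebra_simps)
    then show ?thesis using uv k by simp
  qed
  moreover have "m ^ 0 * e \<in> span2 e q" using span2_mem(1)[of e q] assms by simp
  ultimately show ?thesis unfolding fractional_def bdd_def reg_def using span2_submod[of e q] assms by blast
qed

lemma span2_T: assumes "q \<in> T" shows "span2 e q \<subseteq> T"
  unfolding span2_def using assms subrD(2)[OF T_subr] by (auto intro!: subrD(3,4)[OF T_subr])

text \<open>Let \<open>F = A + Aq = zE\<close>. Since \<open>e\<close> lies in \<open>F\<close>,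
  there is \<open>f\<close> in \<open>E\<close> with \<open>e = z f\<close>; it is integral by
  Cayley-Hamilton, and \<open>z\<close> is almost integral, so \<open>z\<close> lies in
  \<open>E\<close>. Hence \<open>F = zE\<close> is contained in \<open>E\<close>, and
  \<open>q\<close> is itself an endomorphism of \<open>F\<close>.\<close>

lemma T_integral:
  assumes "q \<in> T" and "\<exists>z\<in>span2 e q. span2 e q = (\<lambda>x. z * x) ` endo (span2 e q)"
  shows "integral q"
proof -
  have q: "q \<in> Q" using assms by (simp add: T_def)
  let ?E = "endo (span2 e q)"
  have fr: "fractional (span2 e q)" by (rule fractional_span2[OF q])
  have E: "subr ?E" using subr_endo fr by (simp add: fractional_def)
  obtain z where z: "z \<in> span2 e q" "span2 e q = (\<lambda>x. z * x) ` ?E" using assms by blast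
  have "e \<in> span2 e q" using span2_mem q by simp
  then obtain f where f: "f \<in> ?E" "e = z * f" by (subst (asm) z(2)) (erule imageE)
  have "z \<in> T" using z(1) span2_T[OF assms(1)] by (rule subsetD[rotated])
  then have "z \<in> ?E" by (rule unit_integral[OF E endo_bdd[OF fr] f(1) quadratic_integral[OF q f(1)] _ f(2)[symmetric]])
  moreover have "q \<in> span2 e q" using span2_mem q by simp
  then obtain g where "g \<in> ?E" "q = z * g" by (subst (asm) z(2)) (erule imageE)
  ultimately have "q \<in> ?E" using subrD(4)[OF E, of z g] by simp
  then show ?thesis by (rule quadratic_integral[OF q])
qed

lemma endo_principal_T_integral: assumes "endo_principal" "q \<in> T" shows "integral q"
proof (rule T_integral[OF assms(2)])
  have "fractional (span2 e q)" using fractional_span2 assms(2) by (simp add: T_def)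
  then show "\<exists>z\<in>span2 e q. span2 e q = (\<lambda>x. z * x) ` endo (span2 e q)" by (rule assms(1)[unfolded endo_principal_def, rule_format])
qed

text \<open>Principality was derived from integrality of the endomorphism ring. For
  \<open>F = A + Aq\<close> this is supplied by Cayley-Hamilton; it follows that all of
  \<open>T\<close> is integral, and \<open>T\<close> contains every endomorphism ring.\<close>

lemma inv_frac_endo_principal: assumes "\<And>F. fractional F \<Longrightarrow> inv_frac F" shows "endo_principal"
proof -
  have T: "integral q" if "q \<in> T" for q
  proof (rule T_integral[OF that])
    have q: "q \<in> Q" using that by (simp add: T_def)
    show "\<exists>z\<in>span2 e q. span2 e q = (\<lambda>x. z * x) ` endo (span2 e q)"
      by (rule inv_frac_principal[OF fractional_span2[OF q] assms[OF fractional_span2[OF q]]]) (rule quadratic_integral[OF q])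
  qed
  show ?thesis unfolding endo_principal_def
  proof (intro allI impI)
    fix F assume F: "fractional F"
    show "\<exists>z\<in>F. F = (\<lambda>q. z * q) ` endo F"
      by (rule inv_frac_principal[OF F assms[OF F]]) (use T endo_T[OF F] in auto)
  qed
qed

end

section \<open>Stability implies two-generation\<close>

context local_subring begin

text \<open>\<open>D\<close> is the submodule to be factored out. Two generators are obtained with
  \<open>w = 0\<close>, and \<open>D = {0}\<close> gives modules with three generators.\<close>

definition "span3 D x y w = {a * x + b * y + g * w + d | a b g d. a \<in> A \<and> b \<in> A \<and> g \<in> A \<and> d \<in> D}"

lemma span3I: "a \<in> A \<Longrightarrow> b \<in> A \<Longrightarrow> g \<in> A \<Longrightarrow> d \<in> D \<Longrightarrow> a * x + b * y + g * w + d \<in> span3 D x y w"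
  unfolding span3_def by blast

lemma span3_submod:
  assumes D: "submod D" and Q: "x \<in> Q" "y \<in> Q" "w \<in> Q"
  shows "submod (span3 D x y w)" "D \<subseteq> span3 D x y w" "x \<in> span3 D x y w" "y \<in> span3 D x y w" "w \<in> span3 D x y w"
proof -
  note D' = submodD[OF D]
  have "s + t \<in> span3 D x y w" if st: "s \<in> span3 D x y w" "t \<in> span3 D x y w" for s t
  proof -
    obtain a b g d where 1: "s = a * x + b * y + g * w + d" "a \<in> A" "b \<in> A" "g \<in> A" "d \<in> D"
      using st(1) unfolding span3_def by blast
    obtain a' b' g' d' where 2: "t = a' * x + b' * y + g' * w + d'" "a' \<in> A" "b' \<in> A" "g' \<in> A" "d' \<in> D"
      using st(2) unfolding span3_def by blast
    have "s + t = (a + a') * x + (b + b') * y + (g + g') * w + (d + d')" unfolding 1(1) 2(1) by (simp add: algebra_simps)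
    also have "\<dots> \<in> span3 D x y w" using 1(2-5) 2(2-5) by (intro span3I D'(3) Aadd)
    finally show ?thesis .
  qed
  moreover have "c * s \<in> span3 D x y w" if cs: "c \<in> A" "s \<in> span3 D x y w" for c s
  proof -
    obtain a b g d where 1: "s = a * x + b * y + g * w + d" "a \<in> A" "b \<in> A" "g \<in> A" "d \<in> D"
      using cs(2) unfolding span3_def by blast
    have "c * s = (c * a) * x + (c * b) * y + (c * g) * w + (c * d)" unfolding 1(1) by (simp add: algebra_simps)
    also have "\<dots> \<in> span3 D x y w" using 1(2-5) cs(1) by (intro span3I D'(4) Amul)
    finally show ?thesis .
  qed
  moreover have "0 * x + 0 * y + 0 * w + 0 \<in> span3 D x y w" using D'(2) by (intro span3I) auto
  moreover have "span3 D x y w \<subseteq> Q" unfolding span3_def using D'(1) Q by auto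
  ultimately show "submod (span3 D x y w)" unfolding submod_def by simp
  show "D \<subseteq> span3 D x y w"
  proof
    fix d assume "d \<in> D"
    then have "0 * x + 0 * y + 0 * w + d \<in> span3 D x y w" by (intro span3I) auto
    then show "d \<in> span3 D x y w" by simp
  qed
  have "e * x + 0 * y + 0 * w + 0 \<in> span3 D x y w" "0 * x + e * y + 0 * w + 0 \<in> span3 D x y w" "0 * x + 0 * y + e * w + 0 \<in> span3 D x y w"
    using D'(2) by (intro span3I; simp)+
  then show "x \<in> span3 D x y w" "y \<in> span3 D x y w" "w \<in> span3 D x y w" using Q by simp_all
qed

text \<open>Three elements of a space spanned by \<open>p\<close> and \<open>q\<close> over the
  residue field are dependent. The coefficients are the 2x2 minors if one of these is a unit;
  otherwise the coefficient matrix has rank at most one modulo nonunits, and a unit entry yields a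
  relation between two rows. If all entries are nonunits, \<open>w1\<close> already lies in
  \<open>D\<close>.\<close>

lemma dim3:
  assumes D: "submod D" and nD: "\<And>a. nonunitA a \<Longrightarrow> a * p \<in> D" "\<And>a. nonunitA a \<Longrightarrow> a * q \<in> D"
    and A: "a1 \<in> A" "b1 \<in> A" "a2 \<in> A" "b2 \<in> A" "a3 \<in> A" "b3 \<in> A"
    and w: "w1 - (a1 * p + b1 * q) \<in> D" "w2 - (a2 * p + b2 * q) \<in> D" "w3 - (a3 * p + b3 * q) \<in> D"
    and Q: "w1 \<in> Q" "w2 \<in> Q" "w3 \<in> Q"
  shows "\<exists>\<alpha>\<in>A. \<exists>\<beta>\<in>A. \<exists>\<gamma>\<in>A. (unitA \<alpha> \<or> unitA \<beta> \<or> unitA \<gamma>) \<and> \<alpha> * w1 + \<beta> * w2 + \<gamma> * w3 \<in> D"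
proof -
  note D' = submodD[OF D]
  have main: "\<alpha> * w1 + \<beta> * w2 + \<gamma> * w3 \<in> D"
    if "\<alpha> \<in> A" "\<beta> \<in> A" "\<gamma> \<in> A" "(\<alpha> * a1 + \<beta> * a2 + \<gamma> * a3) * p \<in> D" "(\<alpha> * b1 + \<beta> * b2 + \<gamma> * b3) * q \<in> D" for \<alpha> \<beta> \<gamma>
  proof -
    have eq: "\<alpha> * w1 + \<beta> * w2 + \<gamma> * w3 = \<alpha> * (w1 - (a1 * p + b1 * q)) + \<beta> * (w2 - (a2 * p + b2 * q)) + \<gamma> * (w3 - (a3 * p + b3 * q))
      + (\<alpha> * a1 + \<beta> * a2 + \<gamma> * a3) * p + (\<alpha> * b1 + \<beta> * b2 + \<gamma> * b3) * q" by (simp add: algebra_simps)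
    have "\<alpha> * (w1 - (a1 * p + b1 * q)) \<in> D" "\<beta> * (w2 - (a2 * p + b2 * q)) \<in> D" "\<gamma> * (w3 - (a3 * p + b3 * q)) \<in> D"
      using that(1-3) w D'(4) by blast+
    then show ?thesis unfolding eq using that(4,5) by (intro D'(3))
  qed
  let ?m23 = "a2 * b3 - a3 * b2" and ?m31 = "a3 * b1 - a1 * b3" and ?m12 = "a1 * b2 - a2 * b1"
  have mA': "?m23 \<in> A" "?m31 \<in> A" "?m12 \<in> A" using A by auto
  show ?thesis
  proof (cases "unitA ?m23 \<or> unitA ?m31 \<or> unitA ?m12")
    case True
    have "(?m23 * a1 + ?m31 * a2 + ?m12 * a3) = 0" "(?m23 * b1 + ?m31 * b2 + ?m12 * b3) = 0" by (simp_all add: algebra_simps)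
    then have "?m23 * w1 + ?m31 * w2 + ?m12 * w3 \<in> D" using main[of ?m23 ?m31 ?m12] mA' D'(2) by simp
    then show ?thesis using True mA' by blast
  next
    case False
    then have nm: "nonunitA ?m23" "nonunitA ?m31" "nonunitA ?m12" using mA' by (auto simp: nonunitA_def)
    have nm': "nonunitA (a2 * b1 - a1 * b2)" "nonunitA (a1 * b3 - a3 * b1)" using nonunitA_neg[OF nm(3)] nonunitA_neg[OF nm(2)] by simp_all
    consider "unitA a1" | "unitA a2" | "unitA a3" | "unitA b1" | "unitA b2" | "unitA b3" | "nonunitA a1" "nonunitA a2" "nonunitA a3" "nonunitA b1" "nonunitA b2" "nonunitA b3"
      using A by (auto simp: nonunitA_def)
    then show ?thesis
    proof cases
      case 1
      have "- a2 * w1 + a1 * w2 + 0 * w3 \<in> D" by (rule main) (use A D'(2) nD(2)[OF nm(3)] in \<open>auto simp: algebra_simps\<close>)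
      then show ?thesis using 1 A by (intro bexI[of _ "- a2"] bexI[of _ a1] bexI[of _ 0]) auto
    next
      case 2
      have "a2 * w1 + (- a1) * w2 + 0 * w3 \<in> D" by (rule main) (use A D'(2) nD(2)[OF nm'(1)] in \<open>auto simp: algebra_simps\<close>)
      then show ?thesis using 2 A by (intro bexI[of _ a2] bexI[of _ "- a1"] bexI[of _ 0]) auto
    next
      case 3
      have "a3 * w1 + 0 * w2 + (- a1) * w3 \<in> D" by (rule main) (use A D'(2) nD(2)[OF nm(2)] in \<open>auto simp: algebra_simps\<close>)
      then show ?thesis using 3 A by (intro bexI[of _ a3] bexI[of _ 0] bexI[of _ "- a1"]) auto
    next
      case 4
      have "- b2 * w1 + b1 * w2 + 0 * w3 \<in> D" by (rule main) (use A D'(2) nD(1)[OF nm'(1)] in \<open>auto simp: algebra_simps\<close>)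
      then show ?thesis using 4 A by (intro bexI[of _ "- b2"] bexI[of _ b1] bexI[of _ 0]) auto
    next
      case 5
      have "b2 * w1 + (- b1) * w2 + 0 * w3 \<in> D" by (rule main) (use A D'(2) nD(1)[OF nm(3)] in \<open>auto simp: algebra_simps\<close>)
      then show ?thesis using 5 A by (intro bexI[of _ b2] bexI[of _ "- b1"] bexI[of _ 0]) auto
    next
      case 6
      have "b3 * w1 + 0 * w2 + (- b1) * w3 \<in> D" by (rule main) (use A D'(2) nD(1)[OF nm'(2)] in \<open>auto simp: algebra_simps\<close>)
      then show ?thesis using 6 A by (intro bexI[of _ b3] bexI[of _ 0] bexI[of _ "- b1"]) auto
    next
      case 7
      have "e * w1 + 0 * w2 + 0 * w3 \<in> D"
        by (rule main) (use A nD(1)[OF 7(1)] nD(2)[OF 7(4)] in auto)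
      then show ?thesis using unitA_e by (intro bexI[of _ e] bexI[of _ 0]) auto
    qed
  qed
qed

lemma fractional_max: "fractional {a. nonunitA a}"
proof -
  have "submod {a. nonunitA a}" unfolding submod_def using nonunitA_A nonunitA_0 nonunitA_add nonunitA_mult' by auto
  moreover have "\<forall>x\<in>{a. nonunitA a}. m ^ 0 * x \<in> A" using nonunitA_A by simp
  moreover have "m ^ 1 * e \<in> {a. nonunitA a}" using nonunitA_m by simp
  ultimately show ?thesis unfolding fractional_def bdd_def reg_def by blast
qed

text \<open>The maximal ideal \<open>M\<close> of \<open>A\<close> is fractional, hence
  \<open>M = z * endo M\<close>, and \<open>endo M\<close> is contained in \<open>T\<close>. So
  \<open>z\<close> generates \<open>MT\<close> over \<open>T\<close>.\<close>

lemma obtain_param: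
  assumes endo_principal
  obtains z where "nonunitA z" "\<And>a. nonunitA a \<Longrightarrow> \<exists>t\<in>T. a = z * t"
proof -
  obtain z where z: "z \<in> {a. nonunitA a}" "{a. nonunitA a} = (\<lambda>q. z * q) ` endo {a. nonunitA a}"
    using assms[unfolded endo_principal_def, rule_format, OF fractional_max] by blast
  have "\<exists>t\<in>T. a = z * t" if "nonunitA a" for a
  proof -
    have "a \<in> (\<lambda>q. z * q) ` endo {a. nonunitA a}" using that z(2) by simp
    then show ?thesis using endo_T[OF fractional_max] by blast
  qed
  then show ?thesis using that z(1) by simp
qed

end

section \<open>The algebra \<open>T / MT\<close> over the residue field\<close>

locale local_subring_param = local_subring +
  fixes c z
  assumes P: "endo_principal" and c: "\<And>q. q \<in> T \<Longrightarrow> m ^ c * q \<in> A"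
    and z: "nonunitA z" and zT: "\<And>a. nonunitA a \<Longrightarrow> \<exists>t\<in>T. a = z * t"
begin

text \<open>This is \<open>MT = zT\<close>. The quotient \<open>T / D\<close> is an algebra over the
  residue field of \<open>A\<close>, and the aim is that its dimension is at most two.\<close>

definition "D = (\<lambda>t. z * t) ` T"
lemmas T' = subrD[OF T_subr]

lemma TQ: "t \<in> T \<Longrightarrow> t \<in> Q" by (rule T'(1))
lemma zA: "z \<in> A" "z \<in> T" "z \<in> Q" using z nonunitA_A T'(2) by auto
lemma D_submod: "submod D"
proof -
  have "x + y \<in> D" if xy: "x \<in> D" "y \<in> D" for x y
  proof -
    obtain s t where "s \<in> T" "t \<in> T" "x = z * s" "y = z * t" using xy unfolding D_def by blast
    then have "x + y = z * (s + t)" "s + t \<in> T" by (simp_all add: algebra_simps T'(3))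
    then show ?thesis unfolding D_def by blast
  qed
  moreover have "a * x \<in> D" if ax: "a \<in> A" "x \<in> D" for a x
  proof -
    obtain s where "s \<in> T" "x = z * s" using ax unfolding D_def by blast
    then have "a * x = z * (a * s)" "a * s \<in> T" using ax(1) by (simp_all add: mult.left_commute T'(4) T'(2))
    then show ?thesis unfolding D_def by blast
  qed
  moreover have "z * 0 \<in> D" unfolding D_def using T'(2)[OF A0] by blast
  ultimately show ?thesis unfolding submod_def using TQ zA by (auto simp: D_def)
qed
lemmas D' = submodD[OF D_submod]
lemma DT: "d \<in> D \<Longrightarrow> t \<in> T \<Longrightarrow> t * d \<in> D"
proof -
  assume "d \<in> D" "t \<in> T"
  then obtain s where "s \<in> T" "d = z * s" unfolding D_def by blast
  then have "t * d = z * (t * s)" "t * s \<in> T" using \<open>t \<in> T\<close> by (simp_all add: mult.left_commute T'(4))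
  then show ?thesis unfolding D_def by blast
qed
lemma D_T: "d \<in> D \<Longrightarrow> d \<in> T" unfolding D_def using zA(2) T'(4) by blast
lemma nuD: "nonunitA a \<Longrightarrow> a \<in> D" using zT unfolding D_def by blast
lemma nuDT: "nonunitA a \<Longrightarrow> t \<in> T \<Longrightarrow> a * t \<in> D" using DT[OF nuD] by (simp add: mult.commute)

text \<open>If \<open>z^j\<close> lies in \<open>mA\<close>, then \<open>z^(j(k+c))\<close> contains
  \<open>k + c\<close> factors \<open>m\<close>, of which \<open>c\<close> bring \<open>T\<close>
  into \<open>A\<close>. So the filtration \<open>z^l T\<close> eventually enters every
  \<open>m^k A\<close>.\<close>

lemma zpow: "\<exists>N. \<forall>t\<in>T. \<exists>a\<in>A. z ^ N * t = m ^ k * a"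
proof -
  obtain j x where x: "x \<in> A" "z ^ j * e = m * x" using nonunitA_rad[OF z] by blast
  have pe: "(z ^ j * e) ^ i * e = z ^ (j * i) * e" for i by (simp only: power_mult power_mult_distrib mult.assoc e_pow)
  have "\<exists>a\<in>A. z ^ (j * (k + c)) * t = m ^ k * a" if t: "t \<in> T" for t
  proof -
    have "z ^ (j * (k + c)) * t = (z ^ (j * (k + c)) * e) * t" using TQ[OF t] by (simp add: mult.assoc)
    also have "\<dots> = (m * x) ^ (k + c) * e * t" by (simp only: pe[symmetric] x)
    also have "\<dots> = m ^ k * ((x ^ (k + c) * e) * (m ^ c * t))" by (simp add: power_mult_distrib power_add mult_ac)
    finally show ?thesis using c[OF t] x by blast
  qed
  then show ?thesis by blast
qed

text \<open>If \<open>e = z t\<close>, then \<open>e = z^N t^N\<close> lies in \<open>mA\<close> for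
  a suitable \<open>N\<close>, although \<open>m\<close> is a nonunit.\<close>

lemma e_notin_D: "e \<notin> D"
proof
  assume "e \<in> D"
  then obtain t where t: "t \<in> T" "e = z * t" unfolding D_def by blast
  obtain N where N: "\<forall>t\<in>T. \<exists>a\<in>A. z ^ N * t = m ^ 1 * a" using zpow by blast
  have "t ^ N * e \<in> T" by (rule T'(7)[OF t(1) T'(2)[OF Ae]])
  then obtain a where a: "a \<in> A" "z ^ N * (t ^ N * e) = m ^ 1 * a" using N by blast
  have "z ^ N * (t ^ N * e) = (z * t) ^ N * e" by (simp only: power_mult_distrib mult.assoc)
  then have "m * a = e" using a t(2)[symmetric] by simp
  then show False using mnu a by blast
qed

lemma z_inv: "\<exists>zi\<in>Q. z * zi = e"
proof -
  obtain t where t: "t \<in> T" "m = z * t" using zT[OF nonunitA_m] by blast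
  then have "z * (t * mi) = e" using mmi by (simp add: mult.assoc[symmetric])
  then show ?thesis using TQ[OF t(1)] by (intro bexI[of _ "t * mi"]) auto
qed

lemma z_cancel: assumes "z ^ i * x = z ^ i * y" "x \<in> Q" "y \<in> Q" shows "x = y"
proof -
  obtain zi where zi: "zi \<in> Q" "z * zi = e" using z_inv by blast
  have "x = zi ^ i * (z ^ i * x)" if "x \<in> Q" for x
  proof -
    have "zi ^ i * (z ^ i * x) = (z * zi) ^ i * x" by (simp add: power_mult_distrib mult_ac)
    then show ?thesis using that zi by simp
  qed
  then show ?thesis using assms by metis
qed

lemma fractional_between: assumes "submod F" "D \<subseteq> F" "F \<subseteq> T" shows "fractional F"
proof -
  have "m ^ 1 * e \<in> F" using nuD[OF nonunitA_m] assms(2) by auto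
  moreover have "\<forall>x\<in>F. m ^ c * x \<in> A" using c assms(3) by blast
  ultimately show ?thesis using assms(1) unfolding fractional_def bdd_def reg_def by blast
qed

lemma principal_between: assumes "submod F" "D \<subseteq> F" "F \<subseteq> T"
  shows "\<exists>w\<in>F. F = (\<lambda>q. w * q) ` endo F"
  by (rule P[unfolded endo_principal_def, rule_format, OF fractional_between[OF assms]])

text \<open>Write \<open>F = w * endo F\<close> and \<open>e = w f\<close>. As \<open>f\<close> is
  integral and \<open>w\<close> almost integral, \<open>w\<close> lies in \<open>endo F\<close>; so
  \<open>F\<close> is contained in \<open>endo F\<close>, which is closure under
  multiplication.\<close>

lemma ring_between:
  assumes F: "submod F" "D \<subseteq> F" "F \<subseteq> T" and eF: "e \<in> F" and xy: "x \<in> F" "y \<in> F"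
  shows "x * y \<in> F"
proof -
  have fr: "fractional F" by (rule fractional_between[OF F])
  note E = subr_endo[OF F(1)]
  obtain w where w: "w \<in> F" "F = (\<lambda>q. w * q) ` endo F" using principal_between[OF F] by blast
  obtain f where f: "f \<in> endo F" "e = w * f" using eF by (subst (asm) w(2)) (erule imageE)
  have "f \<in> T" using f endo_T[OF fr] by blast
  then have "integral f" by (rule endo_principal_T_integral[OF P])
  moreover have "w \<in> T" using w(1) F(3) by blast
  ultimately have wE: "w \<in> endo F" using unit_integral[OF E endo_bdd[OF fr] f(1)] f(2) by simp
  obtain g where g: "g \<in> endo F" "x = w * g" using xy(1) by (subst (asm) w(2)) (erule imageE)
  have "x \<in> endo F" using subrD(4)[OF E wE g(1)] g(2) by simp
  then show ?thesis using xy(2) by (simp add: endo_def)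
qed

text \<open>\<open>A + Ax + Ay + D\<close> contains \<open>e\<close> and lies between
  \<open>D\<close> and \<open>T\<close>, hence is a ring.\<close>

lemma mult_in_span: assumes "x \<in> T" "y \<in> T"
  shows "\<exists>a\<in>A. \<exists>b\<in>A. \<exists>g\<in>A. x * y - (a + b * x + g * y) \<in> D"
proof -
  have Q: "e \<in> Q" "x \<in> Q" "y \<in> Q" using assms TQ by auto
  note s = span3_submod[OF D_submod Q]
  have "span3 D e x y \<subseteq> T"
    unfolding span3_def using assms T'(2) D_T by (auto intro!: T'(3) T'(4))
  then have "x * y \<in> span3 D e x y" by (intro ring_between[OF s(1) s(2)] s(3) s(4) s(5))
  then obtain a b g d where h: "x * y = a * e + b * x + g * y + d" "a \<in> A" "b \<in> A" "g \<in> A" "d \<in> D"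
    unfolding span3_def by blast
  then have "x * y - (a + b * x + g * y) \<in> D" by simp
  then show ?thesis using h by blast
qed

text \<open>Linear independence of \<open>e, x, y\<close> in \<open>T / D\<close> over the residue
  field; it is introduced in order to be refuted.\<close>

definition "ind x y \<longleftrightarrow> x \<in> T \<and> y \<in> T \<and> (\<forall>a\<in>A. \<forall>b\<in>A. \<forall>g\<in>A. a + b * x + g * y \<in> D \<longrightarrow> nonunitA a \<and> nonunitA b \<and> nonunitA g)"

lemma indD: "ind x y \<Longrightarrow> a + b * x + g * y \<in> D \<Longrightarrow> a \<in> A \<Longrightarrow> b \<in> A \<Longrightarrow> g \<in> A \<Longrightarrow> nonunitA a \<and> nonunitA b \<and> nonunitA g"
  unfolding ind_def by blast

lemma ind_sym: "ind x y \<Longrightarrow> ind y x"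
proof -
  assume h: "ind x y"
  have "a + g * x + b * y \<in> D" if "a + b * y + g * x \<in> D" for a b g using that by (simp add: ac_simps)
  then show ?thesis using h unfolding ind_def by blast
qed

lemma ind_shift: assumes h: "ind x y" and A: "g \<in> A" "b \<in> A" shows "ind (x - g) (y - b)"
proof -
  have T1: "x - g \<in> T" "y - b \<in> T" using h A T'(2) by (auto simp: ind_def intro!: T'(6))
  have "nonunitA \<alpha> \<and> nonunitA \<beta> \<and> nonunitA \<gamma>" if k: "\<alpha> \<in> A" "\<beta> \<in> A" "\<gamma> \<in> A" "\<alpha> + \<beta> * (x - g) + \<gamma> * (y - b) \<in> D" for \<alpha> \<beta> \<gamma>
  proof -
    have "(\<alpha> - \<beta> * g - \<gamma> * b) + \<beta> * x + \<gamma> * y \<in> D" using k(4) by (simp add: algebra_simps)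
    from indD[OF h this] have n: "nonunitA (\<alpha> - \<beta> * g - \<gamma> * b)" "nonunitA \<beta>" "nonunitA \<gamma>" using k(1-3) A by auto
    have "nonunitA ((\<alpha> - \<beta> * g - \<gamma> * b) + \<beta> * g + \<gamma> * b)" by (intro nonunitA_add n nonunitA_mult A)
    then show ?thesis using n by (simp add: algebra_simps)
  qed
  then show ?thesis unfolding ind_def using T1 by blast
qed

lemma square_in_span: assumes "x \<in> T" shows "\<exists>a\<in>A. \<exists>b\<in>A. x * x - (a + b * x) \<in> D"
proof -
  obtain a b g where h: "a \<in> A" "b \<in> A" "g \<in> A" "x * x - (a + b * x + g * x) \<in> D" using mult_in_span[OF assms assms] by blast
  then have "x * x - (a + (b + g) * x) \<in> D" by (simp add: algebra_simps)
  then show ?thesis using h Aadd by blast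
qed

text \<open>Computing \<open>x^2 y\<close> modulo \<open>D\<close> in two ways, as
  \<open>(a + b x) y\<close> and as \<open>d0 x\<close>, gives a relation in which \<open>x\<close>
  has the coefficient \<open>d0\<close>.\<close>

lemma ind_prod: assumes h: "ind x y" and d: "d0 \<in> A" "x * y - d0 \<in> D" shows "x * y \<in> D"
proof -
  have T1: "x \<in> T" "y \<in> T" using h by (auto simp: ind_def)
  obtain a b where ab: "a \<in> A" "b \<in> A" "x * x - (a + b * x) \<in> D" using square_in_span[OF T1(1)] by blast
  have "y * (x * x - (a + b * x)) - x * (x * y - d0) + b * (x * y - d0) \<in> D"
    by (intro D'(3) D'(6) DT ab d T1 T'(2))
  then have k: "- (b * d0) + d0 * x + (- a) * y \<in> D" by (simp add: algebra_simps)
  then have "nonunitA d0" using indD[OF h k] ab d by auto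
  then have "(x * y - d0) + d0 \<in> D" by (intro D'(3) d nuD)
  then show ?thesis by simp
qed

text \<open>Now \<open>x^2 y\<close> lies in \<open>D\<close>, so the constant term of
  \<open>x^2 = a + b x\<close> becomes the coefficient of \<open>y\<close> in a relation and is a
  nonunit.\<close>

lemma ind_sq: assumes h: "ind x y" and d: "x * y \<in> D" shows "\<exists>b\<in>A. x * x - b * x \<in> D"
proof -
  have T1: "x \<in> T" "y \<in> T" using h by (auto simp: ind_def)
  obtain a b where ab: "a \<in> A" "b \<in> A" "x * x - (a + b * x) \<in> D" using square_in_span[OF T1(1)] by blast
  have "y * (x * x - (a + b * x)) - x * (x * y) + b * (x * y) \<in> D"
    by (intro D'(3) D'(6) DT ab d T1 T'(2))
  then have k: "0 + 0 * x + (- a) * y \<in> D" by (simp add: algebra_simps)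
  then have "nonunitA (- a)" using indD[OF h k] ab by auto
  then have "nonunitA a" using nonunitA_neg by fastforce
  then have "(x * x - (a + b * x)) + a \<in> D" by (intro D'(3) ab nuD)
  then show ?thesis using ab by (intro bexI[of _ b]) (simp_all add: algebra_simps)
qed

lemma nonunitA_cancel: "nonunitA (a * b) \<Longrightarrow> unitA a \<Longrightarrow> b \<in> A \<Longrightarrow> nonunitA b"
  using unitA_mult[of a b] by (auto simp: nonunitA_def)

text \<open>Up to the unit \<open>b\<close>, the elements \<open>x\<close> and \<open>y\<close> are
  orthogonal idempotents. For \<open>u = b - x\<close> and \<open>v = b - y\<close>, the module
  \<open>F = Au + Av + D\<close> equals \<open>w * endo F\<close>, so products of elements of
  \<open>F\<close> lie in \<open>wF\<close> and, modulo \<open>D\<close>, in the span of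
  \<open>w u\<close> and \<open>w v\<close>. But \<open>u^2, v^2, u v\<close> are, modulo
  \<open>D\<close>, \<open>b (b - x)\<close>, \<open>b (b - y)\<close>,
  \<open>b (b - x - y)\<close>, and these are independent.\<close>

lemma ind_not_split:
  assumes h: "ind x y" and d: "x * y \<in> D" "x * x - b * x \<in> D" "y * y - b * y \<in> D" and b: "unitA b"
  shows False
proof -
  have T1: "x \<in> T" "y \<in> T" using h by (auto simp: ind_def)
  have bA: "b \<in> A" "b \<in> T" using b unitA_A T'(2) by auto
  let ?u = "b - x" and ?v = "b - y"
  have uT: "?u \<in> T" "?v \<in> T" using T1 bA T'(6) by auto
  have Q: "?u \<in> Q" "?v \<in> Q" "(0::'a) \<in> Q" using uT TQ by auto
  let ?F = "span3 D ?u ?v 0"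
  note s = span3_submod[OF D_submod Q]
  have FT: "?F \<subseteq> T" unfolding span3_def using uT T'(2) D_T by (auto intro!: T'(3) T'(4))
  obtain w where w: "w \<in> ?F" "?F = (\<lambda>q. w * q) ` endo ?F" using principal_between[OF s(1,2) FT] by blast
  have wT: "w \<in> T" using w(1) FT by blast
  have prod: "\<exists>p\<in>A. \<exists>q\<in>A. g * k - (p * (w * ?u) + q * (w * ?v)) \<in> D" if gk: "g \<in> ?F" "k \<in> ?F" for g k
  proof -
    obtain s where s: "s \<in> endo ?F" "g = w * s" using gk(1) by (subst (asm) w(2)) (erule imageE)
    have "s * k \<in> ?F" using s gk(2) by (simp add: endo_def)
    then obtain p q g' d where h: "s * k = p * ?u + q * ?v + g' * 0 + d" "p \<in> A" "q \<in> A" "d \<in> D" unfolding span3_def by blast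
    have "g * k = w * (s * k)" unfolding s by (simp add: mult.assoc)
    then have "g * k - (p * (w * ?u) + q * (w * ?v)) = w * d" unfolding h by (simp add: algebra_simps)
    then show ?thesis using DT[OF h(4) wT] h by metis
  qed
  obtain a1 b1 where 1: "a1 \<in> A" "b1 \<in> A" "?u * ?u - (a1 * (w * ?u) + b1 * (w * ?v)) \<in> D" using prod s by blast
  obtain a2 b2 where 2: "a2 \<in> A" "b2 \<in> A" "?v * ?v - (a2 * (w * ?u) + b2 * (w * ?v)) \<in> D" using prod s by blast
  obtain a3 b3 where 3: "a3 \<in> A" "b3 \<in> A" "?u * ?v - (a3 * (w * ?u) + b3 * (w * ?v)) \<in> D" using prod s by blast
  obtain p q r where pqr: "p \<in> A" "q \<in> A" "r \<in> A" "unitA p \<or> unitA q \<or> unitA r" "p * (?u * ?u) + q * (?v * ?v) + r * (?u * ?v) \<in> D"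
    using dim3[OF D_submod _ _ 1(1,2) 2(1,2) 3(1,2) 1(3) 2(3) 3(3)] nuDT T'(4)[OF wT] uT Q Qmul by blast
  have "p * (?u * ?u) + q * (?v * ?v) + r * (?u * ?v) - p * (x * x - b * x) - q * (y * y - b * y) - r * (x * y) \<in> D"
    by (intro D'(6) D'(4) pqr d)
  then have k: "b * (b * (p + q + r)) + (- (b * (p + r))) * x + (- (b * (q + r))) * y \<in> D"
    by (simp add: algebra_simps)
  then have n: "nonunitA (b * (b * (p + q + r)))" "nonunitA (- (b * (p + r)))" "nonunitA (- (b * (q + r)))"
    using indD[OF h k] bA(1) pqr(1-3) by auto
  have n1: "nonunitA (p + q + r)" using nonunitA_cancel[OF nonunitA_cancel[OF n(1) b]] b bA pqr by auto
  have n2: "nonunitA (p + r)" using nonunitA_cancel[of b "p + r"] nonunitA_neg[OF n(2)] b pqr by auto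
  have n3: "nonunitA (q + r)" using nonunitA_cancel[of b "q + r"] nonunitA_neg[OF n(3)] b pqr by auto
  have "nonunitA q" "nonunitA p" using nonunitA_diff[OF n1 n2] nonunitA_diff[OF n1 n3] by (simp_all add: algebra_simps)
  moreover have "nonunitA r" using nonunitA_diff[OF n2 \<open>nonunitA p\<close>] by simp
  ultimately show False using pqr(4) unitA_not_nonunitA by blast
qed

text \<open>All products of \<open>x\<close> and \<open>y\<close> lie in \<open>D\<close> and
  \<open>p\<close> is a unit, so \<open>w\<close> can replace \<open>x\<close> in the independent
  family. Writing \<open>w s = a + b w + g s\<close> modulo \<open>D\<close> and multiplying by
  \<open>w\<close> kills \<open>w y\<close> and \<open>w^2\<close>, so \<open>a\<close> and
  \<open>g\<close> are nonunits; then \<open>y = w s\<close> equals \<open>b w\<close> modulo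
  \<open>D\<close>, against independence.\<close>

lemma ind_not_square_zero_aux:
  assumes h: "ind x y" and d: "x * y \<in> D" "x * x \<in> D" "y * y \<in> D"
    and w: "w = p * x + q * y + d0" "unitA p" "q \<in> A" "d0 \<in> D" and s: "s \<in> T" "y = w * s"
  shows False
proof -
  have T1: "x \<in> T" "y \<in> T" "p \<in> A" "p \<in> T" "q \<in> T" "d0 \<in> T" using h w unitA_A T'(2) D_T by (auto simp: ind_def)
  have wT: "w \<in> T" unfolding w(1) by (intro T'(3) T'(4) T1)
  have wy: "w * y \<in> D"
  proof -
    have "p * (x * y) + q * (y * y) + y * d0 \<in> D" by (intro D'(3) DT d w T1)
    then show ?thesis unfolding w by (simp add: algebra_simps)
  qed
  have wx: "w * x \<in> D"
  proof -
    have "p * (x * x) + q * (x * y) + x * d0 \<in> D" by (intro D'(3) DT d w T1)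
    then show ?thesis unfolding w by (simp add: algebra_simps)
  qed
  have ww: "w * w \<in> D"
  proof -
    have "p * (w * x) + q * (w * y) + w * d0 \<in> D" by (intro D'(3) DT wx wy w T1 wT)
    moreover have "p * (w * x) + q * (w * y) + w * d0 = w * (p * x + q * y + d0)" by (simp add: algebra_simps)
    ultimately show ?thesis using w(1) by simp
  qed
  have iw: "nonunitA a \<and> nonunitA b \<and> nonunitA g" if k: "a + b * w + g * y \<in> D" "a \<in> A" "b \<in> A" "g \<in> A" for a b g
  proof -
    have "a + b * w + g * y - b * d0 \<in> D" by (intro D'(6) D'(4) k w)
    then have l: "a + (p * b) * x + (b * q + g) * y \<in> D" unfolding w(1) by (simp add: algebra_simps)
    then have n: "nonunitA a" "nonunitA (p * b)" "nonunitA (b * q + g)" using indD[OF h l] k(2-4) T1(3) w(3) by auto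
    have nb: "nonunitA b" using nonunitA_cancel[OF n(2) w(2) k(3)] .
    have "nonunitA g" using nonunitA_diff[OF n(3) nonunitA_mult[OF nb w(3)]] by simp
    then show ?thesis using n nb by blast
  qed
  obtain a b g where abg: "a \<in> A" "b \<in> A" "g \<in> A" "w * s - (a + b * w + g * s) \<in> D" using mult_in_span[OF wT s(1)] by blast
  have "w * y - b * (w * w) - w * (w * s - (a + b * w + g * s)) \<in> D"
    by (intro D'(6) DT wy ww abg wT T'(2))
  moreover have eq: "w * (w * s - (a + b * w + g * s)) = w * y - w * a - b * (w * w) - g * y"
    unfolding s(2) by (simp add: algebra_simps)
  ultimately have k: "0 + a * w + g * y \<in> D" unfolding eq by (simp add: algebra_simps)
  then have n: "nonunitA a" "nonunitA g" using iw[OF k] abg(1-3) by auto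
  have "(w * s - (a + b * w + g * s)) + a + g * s \<in> D" by (intro D'(3) abg nuD nuDT n s)
  then have k: "0 + (- b) * w + e * y \<in> D" using s(2) TQ[OF T1(2)] by (simp add: algebra_simps)
  then have "nonunitA e" using iw[OF k] abg(1-3) by auto
  then show False using unitA_e unitA_not_nonunitA by blast
qed

text \<open>\<open>F = Ax + Ay + D\<close> equals \<open>w * endo F\<close>, so \<open>x\<close> and
  \<open>y\<close> are \<open>w\<close> times elements of \<open>T\<close>. A unit coefficient of
  \<open>w\<close> at \<open>x\<close> or at \<open>y\<close> is excluded by the preceding
  computation; without one, \<open>w\<close> lies in \<open>D\<close>, and then so does
  \<open>x\<close>.\<close>

lemma ind_not_square_zero:
  assumes h: "ind x y" and d: "x * y \<in> D" "x * x \<in> D" "y * y \<in> D"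
  shows False
proof -
  have T1: "x \<in> T" "y \<in> T" using h by (auto simp: ind_def)
  have Q: "x \<in> Q" "y \<in> Q" "(0::'a) \<in> Q" using T1 TQ by auto
  let ?F = "span3 D x y 0"
  note s = span3_submod[OF D_submod Q]
  have FT: "?F \<subseteq> T" unfolding span3_def using T1 T'(2) D_T by (auto intro!: T'(3) T'(4))
  obtain w where w: "w \<in> ?F" "?F = (\<lambda>q. w * q) ` endo ?F" using principal_between[OF s(1,2) FT] by blast
  have ET: "endo ?F \<subseteq> T" by (rule endo_T[OF fractional_between[OF s(1,2) FT]])
  have fac: "\<exists>t\<in>T. f = w * t" if f: "f \<in> ?F" for f
  proof -
    obtain t where "t \<in> endo ?F" "f = w * t" using f by (subst (asm) w(2)) (erule imageE)
    then show ?thesis using ET by blast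
  qed
  obtain s1 where s1: "s1 \<in> T" "x = w * s1" using fac s(3) by blast
  obtain s2 where s2: "s2 \<in> T" "y = w * s2" using fac s(4) by blast
  obtain p q g d0 where w': "w = p * x + q * y + g * 0 + d0" "p \<in> A" "q \<in> A" "d0 \<in> D" using w(1) unfolding span3_def by blast
  have w1: "w = p * x + q * y + d0" using w' by simp
  have w2: "w = q * y + p * x + d0" using w1 by (simp add: ac_simps)
  have "\<not> unitA p" using ind_not_square_zero_aux[OF h d w1 _ w'(3,4) s2] by blast
  moreover have "\<not> unitA q" using ind_not_square_zero_aux[OF ind_sym[OF h] _ d(3,2) w2 _ w'(2,4) s1] d(1) by (auto simp: mult.commute)
  ultimately have "nonunitA p" "nonunitA q" using w' by (auto simp: nonunitA_def)
  then have "w \<in> D" unfolding w1 by (intro D'(3) nuDT T1 w')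
  then have "x \<in> D" using s1 DT[of w s1] by (simp add: mult.commute)
  then have "0 + e * x + 0 * y \<in> D" using Q by simp
  then have "nonunitA e" using indD[OF h, of 0 e 0] by simp
  then show False using unitA_e unitA_not_nonunitA by blast
qed

text \<open>If \<open>e, x, y\<close> were independent in \<open>T / D\<close>, a translation gives \<open>x * y\<close>, \<open>x\<^sup>2 - \<beta> * x\<close>, \<open>y\<^sup>2 - \<beta> * y \<in> D\<close>. Comparing dimensions, a
  fractional ideal between \<open>D\<close> and \<open>T\<close> fails to be principal over its endomorphism ring, whether \<open>\<beta>\<close> is a unit or not.\<close>

lemma not_ind: "\<not> ind x y"
proof
  assume h0: "ind x y"
  have T0: "x \<in> T" "y \<in> T" using h0 by (auto simp: ind_def)
  obtain a b g where abg: "a \<in> A" "b \<in> A" "g \<in> A" "x * y - (a + b * x + g * y) \<in> D" using mult_in_span[OF T0] by blast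
  let ?x = "x - g" and ?y = "y - b"
  have h: "ind ?x ?y" by (rule ind_shift[OF h0 abg(3,2)])
  have "?x * ?y - (a + b * g) \<in> D" using abg(4) by (simp add: algebra_simps)
  then have xy: "?x * ?y \<in> D" using ind_prod[OF h, of "a + b * g"] abg by auto
  have T1: "?x \<in> T" "?y \<in> T" using h by (auto simp: ind_def)
  obtain \<beta> where b: "\<beta> \<in> A" "?x * ?x - \<beta> * ?x \<in> D" using ind_sq[OF h xy] by blast
  obtain \<delta> where dl: "\<delta> \<in> A" "?y * ?y - \<delta> * ?y \<in> D" using ind_sq[OF ind_sym[OF h]] xy by (auto simp: mult.commute)
  \<comment> \<open>The square of the sum forces both \<open>\<beta>\<close> and
    \<open>\<delta>\<close> to agree with \<open>q\<close> up to nonunits, so that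
    \<open>\<beta>\<close> can serve for both elements.\<close>
  obtain p q where pq: "p \<in> A" "q \<in> A" "(?x + ?y) * (?x + ?y) - (p + q * (?x + ?y)) \<in> D" using square_in_span[OF T'(3)[OF T1]] by blast
  define X where "X = ?x"
  define Y where "Y = ?y"
  note f = h[folded X_def Y_def] xy[folded X_def Y_def] b(2)[folded X_def] dl(2)[folded Y_def] pq(3)[folded X_def Y_def]
  have TX: "X \<in> T" "Y \<in> T" using f(1) by (auto simp: ind_def)
  have "(X + Y) * (X + Y) - (p + q * (X + Y)) - (X * X - \<beta> * X) - (Y * Y - \<delta> * Y) - X * Y - X * Y \<in> D"
    by (intro D'(6) f)
  then have k: "(- p) + (\<beta> - q) * X + (\<delta> - q) * Y \<in> D" by (simp add: algebra_simps)
  then have "nonunitA (\<beta> - q)" "nonunitA (\<delta> - q)" using indD[OF f(1) k] pq(1,2) b(1) dl(1) by auto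
  then have "nonunitA (\<delta> - \<beta>)" using nonunitA_diff[of "\<delta> - q" "\<beta> - q"] by simp
  then have "(Y * Y - \<delta> * Y) + (\<delta> - \<beta>) * Y \<in> D" by (intro D'(3) f nuDT TX)
  then have yy: "Y * Y - \<beta> * Y \<in> D" by (simp add: algebra_simps)
  show False
  proof (cases "unitA \<beta>")
    case True then show False using ind_not_split[OF f(1,2,3) yy] by blast
  next
    case False
    then have nb: "nonunitA \<beta>" using b by (auto simp: nonunitA_def)
    have "(X * X - \<beta> * X) + \<beta> * X \<in> D" "(Y * Y - \<beta> * Y) + \<beta> * Y \<in> D" by (intro D'(3) f yy nuDT nb TX)+
    then show False using ind_not_square_zero[OF f(1,2)] by simp
  qed
qed

text \<open>Greedy choice: an \<open>x\<close> outside the span of \<open>e\<close> and then a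
  \<open>y\<close> outside the span of \<open>e\<close> and \<open>x\<close> would form an
  independent family. So \<open>T = A + Ax + MT\<close>.\<close>

lemma two_gen_T: "\<exists>x\<in>T. \<forall>t\<in>T. \<exists>a\<in>A. \<exists>b\<in>A. t - (a * e + b * x) \<in> D"
proof (rule ccontr)
  assume neg: "\<not> ?thesis"
  have "0 \<in> T" using T'(2)[OF A0] .
  then obtain x where x: "x \<in> T" "\<And>a b. a \<in> A \<Longrightarrow> b \<in> A \<Longrightarrow> x - (a * e + b * 0) \<notin> D" using neg by blast
  obtain y where y: "y \<in> T" "\<And>a b. a \<in> A \<Longrightarrow> b \<in> A \<Longrightarrow> y - (a * e + b * x) \<notin> D" using neg x(1) by blast
  have "nonunitA a \<and> nonunitA b \<and> nonunitA g" if k: "a \<in> A" "b \<in> A" "g \<in> A" "a + b * x + g * y \<in> D" for a b g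
  proof -
    have ng: "nonunitA g"
    proof (rule ccontr)
      assume "\<not> nonunitA g"
      then obtain i where i: "i \<in> A" "g * i = e" using k by (auto simp: nonunitA_def unitA_def)
      have "i * (a + b * x + g * y) \<in> D" using D'(4)[OF i(1) k(4)] .
      moreover have "i * (a + b * x + g * y) = (g * i) * y - ((- (i * a)) * e + (- (i * b)) * x)" using k(1-3) i(1) by (simp add: algebra_simps)
      ultimately have "y - ((- (i * a)) * e + (- (i * b)) * x) \<in> D" using i TQ[OF y(1)] by simp
      then show False using y(2)[of "- (i * a)" "- (i * b)"] i k by simp
    qed
    then have 1: "a + b * x \<in> D" using D'(6)[OF k(4) nuDT[OF ng y(1)]] by simp
    have nb: "nonunitA b"
    proof (rule ccontr)
      assume "\<not> nonunitA b"
      then obtain i where i: "i \<in> A" "b * i = e" using k by (auto simp: nonunitA_def unitA_def)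
      have "i * (a + b * x) \<in> D" using D'(4)[OF i(1) 1] .
      moreover have "i * (a + b * x) = (b * i) * x - ((- (i * a)) * e + 0 * 0)" using k(1-3) i(1) by (simp add: algebra_simps)
      ultimately have "x - ((- (i * a)) * e + 0 * 0) \<in> D" using i TQ[OF x(1)] by simp
      then show False using x(2)[of "- (i * a)" 0] i k by simp
    qed
    then have 2: "a \<in> D" using D'(6)[OF 1 nuDT[OF nb x(1)]] by simp
    have "nonunitA a"
    proof (rule ccontr)
      assume "\<not> nonunitA a"
      then obtain i where i: "i \<in> A" "a * i = e" using k by (auto simp: nonunitA_def unitA_def)
      have "i * a \<in> D" using D'(4)[OF i(1) 2] .
      then show False using i e_notin_D by (simp add: mult.commute)
    qed
    then show ?thesis using ng nb by blast
  qed
  then have "ind x y" unfolding ind_def using x y by blast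
  then show False using not_ind by blast
qed

end

section \<open>Two generators from leading forms\<close>

context local_subring_param begin

text \<open>An element \<open>z^l h0\<close> of \<open>F\<close> has the leading form
  \<open>h0\<close> modulo \<open>D\<close>. The generator \<open>f\<close> has least order
  \<open>i\<close>; \<open>g\<close> has the least order \<open>j\<close> at which a leading form
  outside the line of \<open>f0\<close> occurs. Below \<open>j\<close> leading forms are multiples
  of \<open>f0\<close>; from \<open>j\<close> on they are combinations of \<open>f0\<close> and
  \<open>g0\<close>, as \<open>T / D\<close> has dimension at most two. Subtraction raises the
  order, with coefficients \<open>z^(l-i)\<close> and \<open>z^(l-j)\<close> that lie in
  \<open>A\<close>.\<close>

lemma param_two_gen_reg: "two_gen_reg"
  unfolding two_gen_reg_def
proof (intro allI impI, elim conjE)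
  fix F assume F: "submod F" and rF: "reg F" and FA: "F \<subseteq> A"
  note F' = submodD[OF F]
  have FT: "f \<in> T" if "f \<in> F" for f using FA that T'(2) by blast
  have eT: "e \<in> T" "0 \<in> T" using T'(2)[OF Ae] T'(2)[OF A0] by blast+
  have zT': "z ^ n * t \<in> T" if "t \<in> T" for n t using T'(7)[OF zA(2) that] .
  obtain x where x: "x \<in> T" "\<And>t. t \<in> T \<Longrightarrow> \<exists>a\<in>A. \<exists>b\<in>A. t - (a * e + b * x) \<in> D" using two_gen_T by blast
  obtain k where k: "m ^ k * e \<in> F" using rF by (auto simp: reg_def)
  obtain N where N: "\<forall>t\<in>T. \<exists>a\<in>A. z ^ N * t = m ^ k * a" using zpow by blast
  obtain N1 where N1: "\<forall>t\<in>T. \<exists>a\<in>A. z ^ N1 * t = m ^ 1 * a" using zpow by blast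
  have zN: "z ^ N * t \<in> F" if t: "t \<in> T" for t
  proof -
    obtain a where a: "a \<in> A" "z ^ N * t = m ^ k * a" using N t by blast
    have "z ^ N * t = a * (m ^ k * e)" using a by (simp add: mult.commute mult.left_commute)
    then show ?thesis using F'(4)[OF a(1) k] by simp
  qed
  \<comment> \<open>The least \<open>i\<close> with \<open>P i\<close> is the order of
    \<open>F\<close>: all of \<open>F\<close> lies in \<open>z^i T\<close>, and some element has its
    leading form outside \<open>D\<close>.\<close>
  define P where "P i \<longleftrightarrow> (\<exists>f\<in>F. f \<notin> (\<lambda>t. z ^ Suc i * t) ` T)" for i
  have PN: "P N"
  proof -
    have "z ^ N * e \<notin> (\<lambda>t. z ^ Suc N * t) ` T"
    proof
      assume "z ^ N * e \<in> (\<lambda>t. z ^ Suc N * t) ` T"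
      then obtain t where t: "t \<in> T" "z ^ N * e = z ^ Suc N * t" by blast
      then have "z ^ N * e = z ^ N * (z * t)" by (simp add: mult.left_commute mult.assoc)
      then have "e = z * t" by (rule z_cancel) (use TQ[OF t(1)] zA in auto)
      then show False using e_notin_D t unfolding D_def by blast
    qed
    then show ?thesis unfolding P_def using zN[OF eT(1)] by blast
  qed
  define i where "i = (LEAST i. P i)"
  have Pi: "P i" unfolding i_def by (rule LeastI[of P, OF PN])
  have iN: "i \<le> N" unfolding i_def by (rule Least_le[of P, OF PN])
  have Fi: "\<exists>t\<in>T. h = z ^ i * t" if h: "h \<in> F" for h
  proof (cases i)
    case 0 then show ?thesis using FT[OF h] by (intro bexI[of _ h]) auto
  next
    case (Suc j)
    then have "\<not> P j" unfolding i_def using not_less_Least[of j P] by simp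
    then show ?thesis using h Suc unfolding P_def by blast
  qed
  obtain f where f: "f \<in> F" "f \<notin> (\<lambda>t. z ^ Suc i * t) ` T" using Pi unfolding P_def by blast
  obtain f0 where f0: "f0 \<in> T" "f = z ^ i * f0" using Fi f by blast
  have f0D: "f0 \<notin> D"
  proof
    assume "f0 \<in> D"
    then obtain t where "t \<in> T" "f0 = z * t" unfolding D_def by blast
    then have "f = z ^ Suc i * t" using f0 by (simp add: mult.left_commute mult.assoc)
    then show False using f(2) \<open>t \<in> T\<close> by blast
  qed
  \<comment> \<open>The least \<open>j\<close> with \<open>R j\<close> provides the second
    generator. If there is none, \<open>f\<close> alone reduces every element, and
    \<open>g = 0\<close> is taken.\<close>
  define R where "R j \<longleftrightarrow> (\<exists>g0\<in>T. z ^ j * g0 \<in> F \<and> (\<forall>a\<in>A. g0 - a * f0 \<notin> D))" for j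
  have lift_f: "\<exists>u\<in>A. \<exists>v\<in>A. \<exists>h1\<in>T. z ^ l * h0 = u * f + v * g + z ^ Suc l * h1"
    if l: "l \<ge> i" and a: "a \<in> A" "h0 - a * f0 \<in> D" for l h0 a g
  proof -
    obtain h1 where h1: "h1 \<in> T" "h0 - a * f0 = z * h1" using a(2) unfolding D_def by blast
    have "z ^ l = z ^ (l - i) * z ^ i" using l by (simp add: power_add[symmetric])
    then have "(a * z ^ (l - i)) * f + 0 * g + z ^ Suc l * h1 = a * z ^ l * f0 + z ^ l * (z * h1)"
      unfolding f0(2) by (simp add: mult_ac)
    also have "\<dots> = z ^ l * h0" unfolding h1(2)[symmetric] by (simp add: algebra_simps)
    finally show ?thesis using h1(1) a(1) zA(1) by (intro bexI[of _ "a * z ^ (l - i)"] bexI[of _ 0] bexI[of _ h1]) auto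
  qed
  have "\<exists>g\<in>F. \<forall>l h0. l \<ge> i \<longrightarrow> h0 \<in> T \<longrightarrow> z ^ l * h0 \<in> F \<longrightarrow>
      (\<exists>u\<in>A. \<exists>v\<in>A. \<exists>h1\<in>T. z ^ l * h0 = u * f + v * g + z ^ Suc l * h1)"
  proof (cases "\<exists>j. R j")
    case False
    show ?thesis
    proof (rule bexI[of _ 0], intro allI impI)
      fix l h0 assume h: "i \<le> l" "h0 \<in> T" "z ^ l * h0 \<in> F"
      then obtain a where "a \<in> A" "h0 - a * f0 \<in> D" using False unfolding R_def by blast
      then show "\<exists>u\<in>A. \<exists>v\<in>A. \<exists>h1\<in>T. z ^ l * h0 = u * f + v * 0 + z ^ Suc l * h1" by (rule lift_f[OF h(1)])
    qed (rule F'(2))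
  next
    case True
    define j where "j = (LEAST j. R j)"
    have Rj: "R j" unfolding j_def using True by (rule LeastI_ex)
    have lj: "\<not> R l" if "l < j" for l using that not_less_Least[of l R] unfolding j_def by blast
    obtain g0 where g0: "g0 \<in> T" "z ^ j * g0 \<in> F" "\<And>a. a \<in> A \<Longrightarrow> g0 - a * f0 \<notin> D" using Rj unfolding R_def by blast
    have ij: "i \<le> j"
    proof (rule ccontr)
      assume "\<not> i \<le> j"
      then have ii: "i = j + Suc (i - j - 1)" by simp
      obtain t where t: "t \<in> T" "z ^ j * g0 = z ^ i * t" using Fi[OF g0(2)] by blast
      have "z ^ i * t = z ^ j * (z * (z ^ (i - j - 1) * t))"
        by (subst ii, simp only: power_add power_Suc mult.assoc)
      then have "z ^ j * g0 = z ^ j * (z * (z ^ (i - j - 1) * t))" using t(2) by simp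
      then have "g0 = z * (z ^ (i - j - 1) * t)" by (rule z_cancel) (use TQ[OF g0(1)] TQ[OF t(1)] zA in auto)
      then have "g0 \<in> D" unfolding D_def using zT'[OF t(1)] by blast
      then show False using g0(3)[of 0] by simp
    qed
    let ?g = "z ^ j * g0"
    show ?thesis
    proof (rule bexI[of _ ?g], intro allI impI)
      fix l h0 assume h: "i \<le> l" "h0 \<in> T" "z ^ l * h0 \<in> F"
      show "\<exists>u\<in>A. \<exists>v\<in>A. \<exists>h1\<in>T. z ^ l * h0 = u * f + v * ?g + z ^ Suc l * h1"
      proof (cases "l < j")
        case True
        then obtain a where "a \<in> A" "h0 - a * f0 \<in> D" using lj[OF True] h unfolding R_def by blast
        then show ?thesis by (rule lift_f[OF h(1)])
      next
        case False
        obtain a1 b1 where 1: "a1 \<in> A" "b1 \<in> A" "f0 - (a1 * e + b1 * x) \<in> D" using x(2)[OF f0(1)] by blast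
        obtain a2 b2 where 2: "a2 \<in> A" "b2 \<in> A" "g0 - (a2 * e + b2 * x) \<in> D" using x(2)[OF g0(1)] by blast
        obtain a3 b3 where 3: "a3 \<in> A" "b3 \<in> A" "h0 - (a3 * e + b3 * x) \<in> D" using x(2)[OF h(2)] by blast
        obtain p q r where pqr: "p \<in> A" "q \<in> A" "r \<in> A" "unitA p \<or> unitA q \<or> unitA r" "p * f0 + q * g0 + r * h0 \<in> D"
          using dim3[OF D_submod nuDT[OF _ eT(1)] nuDT[OF _ x(1)] 1(1,2) 2(1,2) 3(1,2) 1(3) 2(3) 3(3) TQ[OF f0(1)] TQ[OF g0(1)] TQ[OF h(2)]] by blast
        \<comment> \<open>If \<open>r\<close> were a nonunit, the relation would make
          \<open>g0\<close> a multiple of \<open>f0\<close> modulo \<open>D\<close> or put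
          \<open>f0\<close> into \<open>D\<close>.\<close>
        have "unitA r"
        proof (rule ccontr)
          assume "\<not> unitA r"
          then have nr: "nonunitA r" using pqr by (auto simp: nonunitA_def)
          have 4: "p * f0 + q * g0 \<in> D" using D'(6)[OF pqr(5) nuDT[OF nr h(2)]] by simp
          have "\<not> unitA q"
          proof
            assume "unitA q"
            then obtain y where y: "y \<in> A" "q * y = e" by (auto simp: unitA_def)
            have "y * (p * f0 + q * g0) = (q * y) * g0 - (- (y * p)) * f0" by (simp add: algebra_simps)
            then have "g0 - (- (y * p)) * f0 \<in> D" using D'(4)[OF y(1) 4] y TQ[OF g0(1)] by simp
            then show False using g0(3)[of "- (y * p)"] y pqr by blast
          qed
          then have nq: "nonunitA q" using pqr by (auto simp: nonunitA_def)
          have 5: "p * f0 \<in> D" using D'(6)[OF 4 nuDT[OF nq g0(1)]] by simp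
          have "unitA p" using pqr(4) \<open>\<not> unitA q\<close> \<open>\<not> unitA r\<close> by blast
          then obtain y where y: "y \<in> A" "p * y = e" by (auto simp: unitA_def)
          have "y * (p * f0) = (p * y) * f0" by (simp add: mult_ac)
          then show False using D'(4)[OF y(1) 5] f0D y TQ[OF f0(1)] by simp
        qed
        then obtain y where y: "y \<in> A" "r * y = e" by (auto simp: unitA_def)
        have "y * (p * f0 + q * g0 + r * h0) \<in> D" using D'(4)[OF y(1) pqr(5)] .
        then obtain h1 where h1: "h1 \<in> T" "y * (p * f0 + q * g0 + r * h0) = z * h1" unfolding D_def by blast
        have l1: "z ^ l = z ^ (l - i) * z ^ i" using h by (simp add: power_add[symmetric])
        have l2: "z ^ l = z ^ (l - j) * z ^ j" using False by (simp add: power_add[symmetric])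
        have "z ^ l * h0 = z ^ l * ((r * y) * h0)" using y(2) TQ[OF h(2)] by simp
        also have "(r * y) * h0 = z * h1 - y * p * f0 - y * q * g0" unfolding h1(2)[symmetric] by (simp add: algebra_simps)
        also have "z ^ l * (z * h1 - y * p * f0 - y * q * g0) = - (y * p) * (z ^ l * f0) + - (y * q) * (z ^ l * g0) + z ^ Suc l * h1"
          by (simp add: algebra_simps)
        also have "z ^ l * f0 = z ^ (l - i) * f" unfolding f0(2) l1 by (simp add: mult.assoc)
        also have "z ^ l * g0 = z ^ (l - j) * ?g" unfolding l2 by (simp add: mult.assoc)
        finally have "z ^ l * h0 = (- (y * p) * z ^ (l - i)) * f + (- (y * q) * z ^ (l - j)) * ?g + z ^ Suc l * h1"
          by (simp add: mult.assoc)
        moreover have "- (y * p) * z ^ (l - i) \<in> A" "- (y * q) * z ^ (l - j) \<in> A" using y pqr zA by auto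
        ultimately show ?thesis using h1(1) by blast
      qed
    qed (rule g0(2))
  qed
  then obtain g where g: "g \<in> F" "\<And>l h0. l \<ge> i \<Longrightarrow> h0 \<in> T \<Longrightarrow> z ^ l * h0 \<in> F \<Longrightarrow>
      \<exists>u\<in>A. \<exists>v\<in>A. \<exists>h1\<in>T. z ^ l * h0 = u * f + v * g + z ^ Suc l * h1" by blast
  have iter: "\<exists>u\<in>A. \<exists>v\<in>A. \<exists>h1\<in>T. z ^ l * h0 = u * f + v * g + z ^ (l + n) * h1 \<and> z ^ (l + n) * h1 \<in> F"
    if h: "l \<ge> i" "h0 \<in> T" "z ^ l * h0 \<in> F" for l h0 n
  proof (induction n)
    case 0
    then show ?case using h by (intro bexI[of _ 0] bexI[of _ h0]) auto
  next
    case (Suc n)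
    then obtain u v h1 where 1: "u \<in> A" "v \<in> A" "h1 \<in> T" "z ^ l * h0 = u * f + v * g + z ^ (l + n) * h1" "z ^ (l + n) * h1 \<in> F" by blast
    obtain u' v' h2 where 2: "u' \<in> A" "v' \<in> A" "h2 \<in> T" "z ^ (l + n) * h1 = u' * f + v' * g + z ^ Suc (l + n) * h2"
      using g(2)[OF _ 1(3,5)] h(1) by (meson trans_le_add1)
    have 3: "z ^ (l + Suc n) * h2 = z ^ (l + n) * h1 - (u' * f + v' * g)" using 2(4) by simp
    have "z ^ (l + Suc n) * h2 \<in> F" unfolding 3 by (intro F'(6) F'(3) F'(4) 1 2 f(1) g(1))
    moreover have "z ^ l * h0 = (u + u') * f + (v + v') * g + z ^ (l + Suc n) * h2" unfolding 1(4) 2(4) by (simp add: algebra_simps)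
    ultimately show ?case using 1 2 Aadd by blast
  qed
  have fQ: "f \<in> Q" "g \<in> Q" using F'(1) f(1) g(1) by auto
  note spD = submodD[OF span2_submod[OF fQ]]
  have comb: "u * f + v * g \<in> span2 f g" if "u \<in> A" "v \<in> A" for u v using that unfolding span2_def by blast
  \<comment> \<open>All of \<open>z^N T\<close> lies in \<open>F\<close>, and \<open>z^N1 T\<close>
    lies in \<open>mA\<close>. After \<open>N1\<close> reductions of \<open>z^N e\<close> the
    remainder is \<open>m a\<close> times \<open>z^N e\<close> itself, and \<open>e - m a\<close> is
    a unit; this is the Nakayama step that makes the reduction finite.\<close>
  have zNsp: "z ^ N * e \<in> span2 f g"
  proof -
    obtain u v h1 where 1: "u \<in> A" "v \<in> A" "h1 \<in> T" "z ^ N * e = u * f + v * g + z ^ (N + N1) * h1"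
      using iter[OF iN eT(1) zN[OF eT(1)]] by blast
    obtain a where a: "a \<in> A" "z ^ N1 * h1 = m ^ 1 * a" using N1 1(3) by blast
    obtain b where b: "b \<in> A" "(e - m * a) * b = e" using unitA_e_m[OF a(1)] by blast
    have "z ^ (N + N1) * h1 = z ^ N * (m * a)" using a(2) by (simp add: power_add mult.assoc)
    then have "z ^ N * (e - m * a) = u * f + v * g" using 1(4) by (simp add: algebra_simps)
    then have "b * (z ^ N * (e - m * a)) \<in> span2 f g" using spD(4)[OF b(1) comb[OF 1(1,2)]] by simp
    moreover have "b * (z ^ N * (e - m * a)) = z ^ N * ((e - m * a) * b)" by (simp add: mult_ac)
    ultimately show ?thesis using b by simp
  qed
  have "F \<subseteq> span2 f g"
  proof
    fix h assume h: "h \<in> F"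
    obtain t where t: "t \<in> T" "h = z ^ i * t" using Fi h by blast
    \<comment> \<open>Here \<open>N + N1\<close> reductions are made, so that the remainder is a
      multiple of \<open>z^N e\<close>, already known to lie in the span.\<close>
    obtain u v h1 where 1: "u \<in> A" "v \<in> A" "h1 \<in> T" "h = u * f + v * g + z ^ (i + (N + N1)) * h1"
      using iter[of i t "N + N1"] t h by blast
    obtain a where a: "a \<in> A" "z ^ N1 * (z ^ i * h1) = m ^ 1 * a" using N1 zT'[OF 1(3)] by blast
    have "z ^ (i + (N + N1)) * h1 = z ^ N * (z ^ N1 * (z ^ i * h1))" by (simp add: power_add mult_ac)
    also have "\<dots> = (m * a) * (z ^ N * e)" unfolding a(2) using a(1) by (simp add: mult_ac)
    also have "\<dots> \<in> span2 f g" using spD(4)[OF _ zNsp] a(1) by blast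
    finally show "h \<in> span2 f g" unfolding 1(4) by (intro spD(3) comb 1)
  qed
  then have "F = span2 f g" using span2_least[OF F f(1) g(1)] by blast
  then show "\<exists>a\<in>F. \<exists>b\<in>F. F = span2 a b" using f(1) g(1) by blast
qed

end

section \<open>Principality over the endomorphism ring versus two generators\<close>

context local_subring begin

lemma endo_principal_two_gen_reg: assumes "endo_principal" "\<And>q. q \<in> T \<Longrightarrow> m ^ c * q \<in> A" shows "two_gen_reg"
proof -
  obtain z where z: "nonunitA z" "\<And>a. nonunitA a \<Longrightarrow> \<exists>t\<in>T. a = z * t" by (rule obtain_param[OF assms(1)]) blast
  interpret local_subring_param Q A e m mi c z by unfold_locales (use assms z in auto)
  show ?thesis by (rule param_two_gen_reg)
qed

lemma two_gen_reg_frac: assumes two_gen_reg "fractional F" shows "\<exists>a\<in>F. \<exists>b\<in>F. F = span2 a b"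
proof -
  have F: "submod F" using assms(2) by (simp add: fractional_def)
  note F' = submodD[OF F]
  obtain k l where k: "\<And>x. x \<in> F \<Longrightarrow> m ^ k * x \<in> A" and l: "m ^ l * e \<in> F"
    using assms(2) by (auto simp: fractional_def bdd_def reg_def)
  let ?G = "(\<lambda>x. m ^ k * x) ` F"
  have "submod ?G" unfolding submod_def
  proof (intro conjI ballI)
    show "?G \<subseteq> Q" using k by auto
    show "0 \<in> ?G" using F'(2) by (intro image_eqI[of _ _ 0]) auto
    fix x y assume "x \<in> ?G" "y \<in> ?G"
    then obtain x' y' where "x' \<in> F" "y' \<in> F" "x = m ^ k * x'" "y = m ^ k * y'" by blast
    then show "x + y \<in> ?G" using F'(3) by (intro image_eqI[of _ _ "x' + y'"]) (auto simp: distrib_left)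
  next
    fix a x assume "a \<in> A" "x \<in> ?G"
    then obtain x' where "x' \<in> F" "x = m ^ k * x'" by blast
    then show "a * x \<in> ?G" using F'(4) \<open>a \<in> A\<close> by (intro image_eqI[of _ _ "a * x'"]) (auto simp: mult_ac)
  qed
  moreover have "m ^ (k + l) * e \<in> ?G" using l by (intro image_eqI[of _ _ "m ^ l * e"]) (auto simp: power_add mult_ac)
  then have "reg ?G" unfolding reg_def by blast
  moreover have "?G \<subseteq> A" using k by auto
  ultimately obtain a' b' where G: "a' \<in> ?G" "b' \<in> ?G" "?G = span2 a' b'" using assms(1) unfolding two_gen_reg_def by meson
  obtain a b where ab: "a \<in> F" "b \<in> F" "a' = m ^ k * a" "b' = m ^ k * b" using G(1,2) by blast
  have "x \<in> span2 a b" if x: "x \<in> F" for x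
  proof -
    have "m ^ k * x \<in> span2 a' b'" using x G(3) by blast
    then obtain u v where uv: "u \<in> A" "v \<in> A" "m ^ k * x = u * a' + v * b'" unfolding span2_def by blast
    then have "m ^ k * x = m ^ k * (u * a + v * b)" unfolding ab by (simp add: algebra_simps)
    then have "x = u * a + v * b" by (rule m_cancel) (use x uv F'(1) ab in auto)
    then show ?thesis unfolding span2_def using uv by blast
  qed
  then have "F = span2 a b" using span2_least[OF F ab(1,2)] by blast
  then show ?thesis using ab by blast
qed

text \<open>The products \<open>a^2, a b, b^2\<close> span \<open>F^2\<close>, which has two
  generators, so they satisfy a relation with a unit coefficient. It allows \<open>F^2 = xF\<close>
  to be solved with \<open>x\<close> one of \<open>a, b, a + b\<close>. As \<open>F^2\<close>
  contains a power of \<open>m\<close>, \<open>x\<close> is invertible in \<open>Q\<close>, and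
  \<open>x^(-1) F\<close> multiplies \<open>F\<close> into itself; hence
  \<open>F = x * endo F\<close>.\<close>

lemma two_gen_reg_endo_principal: assumes two_gen_reg shows endo_principal
  unfolding endo_principal_def
proof (intro allI impI)
  fix F assume fr: "fractional F"
  have F: "submod F" using fr by (simp add: fractional_def)
  note F' = submodD[OF F]
  obtain a b where ab: "a \<in> F" "b \<in> F" "F = span2 a b" using two_gen_reg_frac[OF assms fr] by blast
  have Q: "a \<in> Q" "b \<in> Q" using F'(1) ab by auto
  obtain k l where k: "\<And>x. x \<in> F \<Longrightarrow> m ^ k * x \<in> A" and l: "m ^ l * e \<in> F"
    using fr by (auto simp: fractional_def bdd_def reg_def)
  let ?aa = "a * a" and ?ab = "a * b" and ?bb = "b * b"
  have Q2: "?aa \<in> Q" "?ab \<in> Q" "?bb \<in> Q" using Q by auto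
  have s0: "submod {0}" unfolding submod_def by auto
  let ?FF = "span3 {0} ?aa ?ab ?bb"
  note S = span3_submod[OF s0 Q2]
  have prod: "x * y \<in> ?FF" if xy: "x \<in> F" "y \<in> F" for x y
  proof -
    obtain u v where 1: "u \<in> A" "v \<in> A" "x = u * a + v * b" using xy(1) unfolding ab(3) span2_def by blast
    obtain u' v' where 2: "u' \<in> A" "v' \<in> A" "y = u' * a + v' * b" using xy(2) unfolding ab(3) span2_def by blast
    have "x * y = (u * u') * ?aa + (u * v' + v * u') * ?ab + (v * v') * ?bb + 0" unfolding 1 2 by (simp add: algebra_simps)
    also have "\<dots> \<in> ?FF" using 1 2 by (intro span3I) auto
    finally show ?thesis .
  qed
  have "fractional ?FF"
  proof -
    have "m ^ (k + k) * x \<in> A" if x: "x \<in> ?FF" for x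
    proof -
      obtain p q r where h: "p \<in> A" "q \<in> A" "r \<in> A" "x = p * ?aa + q * ?ab + r * ?bb + 0" using x unfolding span3_def by blast
      have "m ^ (k + k) * x = p * ((m ^ k * a) * (m ^ k * a)) + q * ((m ^ k * a) * (m ^ k * b)) + r * ((m ^ k * b) * (m ^ k * b))"
        unfolding h by (simp add: power_add algebra_simps)
      also have "\<dots> \<in> A" using h k[OF ab(1)] k[OF ab(2)] by auto
      finally show ?thesis .
    qed
    moreover have "(m ^ l * e) * (m ^ l * e) = m ^ (l + l) * e" by (simp add: power_add mult_ac)
    then have "m ^ (l + l) * e \<in> ?FF" using prod[OF l l] by simp
    ultimately show ?thesis using S(1) unfolding fractional_def bdd_def reg_def by blast
  qed
  then obtain p q where pq: "p \<in> ?FF" "q \<in> ?FF" "?FF = span2 p q" using two_gen_reg_frac[OF assms] by blast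
  \<comment> \<open>This is \<open>F^2\<close> times the maximal ideal. With its elements written
    out, a relation modulo \<open>D\<close> becomes an exact one by correcting the coefficients by
    nonunits, which keeps a unit coefficient a unit.\<close>
  define D where "D = {u * ?aa + v * ?ab + w * ?bb | u v w. nonunitA u \<and> nonunitA v \<and> nonunitA w}"
  let ?D = "{u * ?aa + v * ?ab + w * ?bb | u v w. nonunitA u \<and> nonunitA v \<and> nonunitA w}"
  have D: "submod D" unfolding submod_def D_def
  proof (intro conjI ballI)
    show "?D \<subseteq> Q" using nonunitA_A Q2 by auto
    show "0 \<in> ?D" using nonunitA_0 by (intro CollectI exI[of _ 0]) auto
    fix x y assume "x \<in> ?D" "y \<in> ?D"
    then obtain u v w u' v' w' where "x = u * ?aa + v * ?ab + w * ?bb" "nonunitA u" "nonunitA v" "nonunitA w" "y = u' * ?aa + v' * ?ab + w' * ?bb" "nonunitA u'" "nonunitA v'" "nonunitA w'" by blast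
    then show "x + y \<in> ?D" by (intro CollectI exI[of _ "u + u'"] exI[of _ "v + v'"] exI[of _ "w + w'"]) (auto simp: algebra_simps nonunitA_add)
  next
    fix s x assume "s \<in> A" "x \<in> ?D"
    then obtain u v w where "x = u * ?aa + v * ?ab + w * ?bb" "nonunitA u" "nonunitA v" "nonunitA w" by blast
    then show "s * x \<in> ?D" using \<open>s \<in> A\<close> by (intro CollectI exI[of _ "s * u"] exI[of _ "s * v"] exI[of _ "s * w"]) (auto simp: algebra_simps nonunitA_mult')
  qed
  have nD: "n * y \<in> D" if n: "nonunitA n" "y \<in> ?FF" for n y
  proof -
    obtain u v w where h: "u \<in> A" "v \<in> A" "w \<in> A" "y = u * ?aa + v * ?ab + w * ?bb + 0" using n(2) unfolding span3_def by blast
    then show ?thesis using n(1) unfolding D_def by (intro CollectI exI[of _ "n * u"] exI[of _ "n * v"] exI[of _ "n * w"]) (auto simp: algebra_simps nonunitA_mult)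
  qed
  have D0: "0 \<in> D" using submodD(2)[OF D] .
  have spm: "\<exists>r\<in>A. \<exists>s\<in>A. x - (r * p + s * q) \<in> D" if x: "x \<in> ?FF" for x
  proof -
    have "x \<in> span2 p q" using x pq(3) by simp
    then obtain r s where "r \<in> A" "s \<in> A" "x = r * p + s * q" unfolding span2_def by blast
    then show ?thesis using D0 by (intro bexI[of _ r] bexI[of _ s]) simp_all
  qed
  obtain a1 b1 where 1: "a1 \<in> A" "b1 \<in> A" "?aa - (a1 * p + b1 * q) \<in> D" using spm[OF S(3)] by blast
  obtain a2 b2 where 2: "a2 \<in> A" "b2 \<in> A" "?ab - (a2 * p + b2 * q) \<in> D" using spm[OF S(4)] by blast
  obtain a3 b3 where 3: "a3 \<in> A" "b3 \<in> A" "?bb - (a3 * p + b3 * q) \<in> D" using spm[OF S(5)] by blast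
  obtain \<alpha>0 \<beta>0 \<gamma>0 where r0: "\<alpha>0 \<in> A" "\<beta>0 \<in> A" "\<gamma>0 \<in> A" "unitA \<alpha>0 \<or> unitA \<beta>0 \<or> unitA \<gamma>0" "\<alpha>0 * ?aa + \<beta>0 * ?ab + \<gamma>0 * ?bb \<in> D"
    using dim3[OF D nD[OF _ pq(1)] nD[OF _ pq(2)] 1(1,2) 2(1,2) 3(1,2) 1(3) 2(3) 3(3) Q2] by blast
  obtain u v w where uvw: "\<alpha>0 * ?aa + \<beta>0 * ?ab + \<gamma>0 * ?bb = u * ?aa + v * ?ab + w * ?bb" "nonunitA u" "nonunitA v" "nonunitA w" using r0(5) unfolding D_def by blast
  define \<alpha> where "\<alpha> = \<alpha>0 + - u"
  define \<beta> where "\<beta> = \<beta>0 + - v"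
  define \<gamma> where "\<gamma> = \<gamma>0 + - w"
  have rel: "\<alpha> * ?aa + \<beta> * ?ab + \<gamma> * ?bb = 0" using uvw(1) unfolding \<alpha>_def \<beta>_def \<gamma>_def by (simp add: algebra_simps)
  have rA: "\<alpha> \<in> A" "\<beta> \<in> A" "\<gamma> \<in> A" using r0 uvw(2-4) nonunitA_A unfolding \<alpha>_def \<beta>_def \<gamma>_def by auto
  have unitA: "unitA \<alpha> \<or> unitA \<beta> \<or> unitA \<gamma>" using r0(4) unitA_nonunitA[OF _ nonunitA_neg[OF uvw(2)]] unitA_nonunitA[OF _ nonunitA_neg[OF uvw(3)]] unitA_nonunitA[OF _ nonunitA_neg[OF uvw(4)]]
    unfolding \<alpha>_def \<beta>_def \<gamma>_def by blast
  have spI: "r * x + s * y \<in> span2 x y" if "r \<in> A" "s \<in> A" for r s x y using that unfolding span2_def by blast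
  have "\<exists>x\<in>F. ?aa \<in> span2 (x * a) (x * b) \<and> ?ab \<in> span2 (x * a) (x * b) \<and> ?bb \<in> span2 (x * a) (x * b)"
  proof -
    \<comment> \<open>A unit \<open>\<alpha>\<close> puts \<open>a^2\<close> into \<open>bF\<close>,
      a unit \<open>\<gamma>\<close> puts \<open>b^2\<close> into \<open>aF\<close>. If only
      \<open>\<beta>\<close> is a unit, \<open>a b\<close> is a combination of \<open>a^2\<close>
      and \<open>b^2\<close> with nonunit coefficients, and \<open>x = a + b\<close> works.\<close>
    consider "unitA \<alpha>" | "unitA \<gamma>" | "nonunitA \<alpha>" "nonunitA \<gamma>" "unitA \<beta>" using unitA rA by (auto simp: nonunitA_def)
    then show ?thesis
    proof cases
      case 1
      then obtain y where y: "y \<in> A" "\<alpha> * y = e" by (auto simp: unitA_def)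
      have "(- (y * \<beta>)) * (b * a) + (- (y * \<gamma>)) * (b * b) = (\<alpha> * y) * ?aa - y * (\<alpha> * ?aa + \<beta> * ?ab + \<gamma> * ?bb)" by (simp add: algebra_simps)
      then have "?aa = (- (y * \<beta>)) * (b * a) + (- (y * \<gamma>)) * (b * b)" using rel y Q2 by simp
      then have "?aa \<in> span2 (b * a) (b * b)" using spI[of "- (y * \<beta>)" "- (y * \<gamma>)" "b * a" "b * b"] y rA by simp
      then show ?thesis using span2_mem[of "b * a" "b * b"] Q ab(2) by (intro bexI[of _ b]) (auto simp: mult.commute)
    next
      case 2
      then obtain y where y: "y \<in> A" "\<gamma> * y = e" by (auto simp: unitA_def)
      have "(- (y * \<alpha>)) * (a * a) + (- (y * \<beta>)) * (a * b) = (\<gamma> * y) * ?bb - y * (\<alpha> * ?aa + \<beta> * ?ab + \<gamma> * ?bb)" by (simp add: algebra_simps)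
      then have "?bb = (- (y * \<alpha>)) * (a * a) + (- (y * \<beta>)) * (a * b)" using rel y Q2 by simp
      then have "?bb \<in> span2 (a * a) (a * b)" using spI[of "- (y * \<alpha>)" "- (y * \<beta>)" "a * a" "a * b"] y rA by simp
      then show ?thesis using span2_mem[of "a * a" "a * b"] Q ab(1) by (intro bexI[of _ a]) auto
    next
      case 3
      then obtain y where y: "y \<in> A" "\<beta> * y = e" by (auto simp: unitA_def)
      define \<mu> where "\<mu> = - (y * \<alpha>)"
      define \<nu> where "\<nu> = - (y * \<gamma>)"
      have n: "nonunitA \<mu>" "nonunitA \<nu>" unfolding \<mu>_def \<nu>_def by (intro nonunitA_neg nonunitA_mult' 3 y)+
      have nA: "\<mu> \<in> A" "\<nu> \<in> A" using n nonunitA_A by auto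
      have "\<mu> * ?aa + \<nu> * ?bb = (\<beta> * y) * ?ab - y * (\<alpha> * ?aa + \<beta> * ?ab + \<gamma> * ?bb)" unfolding \<mu>_def \<nu>_def by (simp add: algebra_simps)
      then have ab': "?ab = \<mu> * ?aa + \<nu> * ?bb" using rel y Q2 by simp
      \<comment> \<open>This is the determinant of the matrix that expresses \<open>x a\<close> and
        \<open>x b\<close> by \<open>a^2\<close> and \<open>b^2\<close>.\<close>
      have "unitA (e + (\<mu> + \<nu>))" by (intro unitA_nonunitA unitA_e nonunitA_add n)
      then obtain j where j: "j \<in> A" "(e + (\<mu> + \<nu>)) * j = e" by (auto simp: unitA_def)
      let ?x = "a + b"
      have xa: "?x * a = (e + \<mu>) * ?aa + \<nu> * ?bb"
      proof -
        have "?x * a = ?aa + ?ab" by (simp add: algebra_simps)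
        then show ?thesis unfolding ab' using Q by (simp add: algebra_simps)
      qed
      have xb: "?x * b = \<mu> * ?aa + (e + \<nu>) * ?bb"
      proof -
        have "?x * b = ?ab + ?bb" by (simp add: algebra_simps)
        then show ?thesis unfolding ab' using Q by (simp add: algebra_simps)
      qed
      have QQ: "?x * a \<in> Q" "?x * b \<in> Q" using Q by auto
      note spD = submodD[OF span2_submod[OF QQ]]
      have "(e + \<nu>) * (?x * a) + (- \<nu>) * (?x * b) = (e + (\<mu> + \<nu>)) * ?aa" unfolding xa xb using Q nA by (simp add: algebra_simps)
      then have "j * ((e + \<nu>) * (?x * a) + (- \<nu>) * (?x * b)) = ((e + (\<mu> + \<nu>)) * j) * ?aa" by (simp add: mult_ac)
      then have "?aa = j * ((e + \<nu>) * (?x * a) + (- \<nu>) * (?x * b))" using j Q2 by simp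
      then have 1: "?aa \<in> span2 (?x * a) (?x * b)" using spD(4)[OF j(1) spI[of "e + \<nu>" "- \<nu>" "?x * a" "?x * b"]] nA by simp
      have "(- \<mu>) * (?x * a) + (e + \<mu>) * (?x * b) = (e + (\<mu> + \<nu>)) * ?bb" unfolding xa xb using Q nA by (simp add: algebra_simps)
      then have "j * ((- \<mu>) * (?x * a) + (e + \<mu>) * (?x * b)) = ((e + (\<mu> + \<nu>)) * j) * ?bb" by (simp add: mult_ac)
      then have "?bb = j * ((- \<mu>) * (?x * a) + (e + \<mu>) * (?x * b))" using j Q2 by simp
      then have 2: "?bb \<in> span2 (?x * a) (?x * b)" using spD(4)[OF j(1) spI[of "- \<mu>" "e + \<mu>" "?x * a" "?x * b"]] nA by simp
      have "?ab \<in> span2 (?x * a) (?x * b)" unfolding ab' by (intro spD(3) spD(4) 1 2 nA)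
      then show ?thesis using 1 2 F'(3)[OF ab(1,2)] by blast
    qed
  qed
  then obtain x where x: "x \<in> F" "?aa \<in> span2 (x * a) (x * b)" "?ab \<in> span2 (x * a) (x * b)" "?bb \<in> span2 (x * a) (x * b)" by blast
  have xQ: "x \<in> Q" using F'(1) x(1) .
  have div: "\<exists>f\<in>F. g * h = x * f" if gh: "g \<in> F" "h \<in> F" for g h
  proof -
    have xx: "x * a \<in> Q" "x * b \<in> Q" using xQ Q by auto
    note spD = submodD[OF span2_submod[OF xx]]
    obtain r s t where h: "r \<in> A" "s \<in> A" "t \<in> A" "g * h = r * ?aa + s * ?ab + t * ?bb + 0" using prod[OF gh] unfolding span3_def by blast
    have "r * ?aa + s * ?ab + t * ?bb \<in> span2 (x * a) (x * b)" by (intro spD(3) spD(4) h x)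
    then obtain r' s' where rs: "r' \<in> A" "s' \<in> A" "g * h = r' * (x * a) + s' * (x * b)" unfolding h(4) span2_def by auto
    then have "g * h = x * (r' * a + s' * b)" by (simp add: algebra_simps)
    moreover have "r' * a + s' * b \<in> F" by (intro F'(3) F'(4) rs ab(1,2))
    ultimately show ?thesis by blast
  qed
  \<comment> \<open>A power of \<open>m\<close> lies in \<open>F^2 = xF\<close>, which makes
    \<open>x\<close> invertible in \<open>Q\<close>.\<close>
  obtain f where f: "f \<in> F" "(m ^ l * e) * (m ^ l * e) = x * f" using div[OF l l] by blast
  let ?xi = "mi ^ (l + l) * f"
  have "x * ?xi = mi ^ (l + l) * ((m ^ l * e) * (m ^ l * e))" unfolding f(2) by (simp add: mult_ac)
  also have "\<dots> = mi ^ (l + l) * (m ^ (l + l) * e)" by (simp add: power_add mult_ac)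
  finally have xi: "x * ?xi = e" by (simp only: minv[OF Qe])
  have xiQ: "?xi \<in> Q" using F'(1)[OF f(1)] by simp
  have "F = (\<lambda>q. x * q) ` endo F"
  proof
    show "F \<subseteq> (\<lambda>q. x * q) ` endo F"
    proof
      fix h assume h: "h \<in> F"
      have hQ: "h \<in> Q" using F'(1) h .
      have "?xi * h \<in> endo F" unfolding endo_def
      proof (intro CollectI conjI ballI)
        show "?xi * h \<in> Q" by (rule Qmul[OF xiQ hQ])
        fix g assume g: "g \<in> F"
        obtain f' where f': "f' \<in> F" "h * g = x * f'" using div[OF h g] by blast
        have "?xi * h * g = (x * ?xi) * f'" unfolding mult.assoc[of ?xi h g] f'(2) by (simp add: mult_ac)
        then show "?xi * h * g \<in> F" using xi f'(1) F'(1)[OF f'(1)] by simp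
      qed
      moreover have "x * (?xi * h) = h" using xi hQ by (simp only: mult.assoc[symmetric] e1)
      ultimately show "h \<in> (\<lambda>q. x * q) ` endo F" by (metis image_eqI)
    qed
    show "(\<lambda>q. x * q) ` endo F \<subseteq> F" using x(1) by (auto simp: endo_def mult.commute)
  qed
  then show "\<exists>z\<in>F. F = (\<lambda>q. z * q) ` endo F" using x(1) by blast
qed

end

section \<open>Ideals without a power of the parameter\<close>

context local_subring begin

definition "m_separated \<longleftrightarrow> (\<forall>x\<in>A. (\<forall>k. \<exists>y\<in>A. x = m ^ k * y) \<longrightarrow> x = 0)"
definition "m_complete \<longleftrightarrow> (\<forall>s. (\<forall>n. s n \<in> A \<and> (\<exists>y\<in>A. s (Suc n) - s n = m ^ n * y)) \<longrightarrow>
  (\<exists>t\<in>A. \<forall>n. \<exists>y\<in>A. t - s n = m ^ n * y))"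
text \<open>Since \<open>I\<close> is not assumed finitely generated, passing from
  \<open>I = (a, b) + mI\<close> to \<open>I = (a, b)\<close> is a property of the ring and not a
  theorem. It is obtained from separatedness combined either with regularity of elements or with
  completeness.\<close>

definition "nakayama \<longleftrightarrow> (\<forall>I a b. submod I \<and> I \<subseteq> A \<and> a \<in> I \<and> b \<in> I \<and>
  (\<forall>i\<in>I. \<exists>u\<in>A. \<exists>v\<in>A. \<exists>j\<in>I. i = u * a + v * b + m * j) \<longrightarrow> I = span2 a b)"
definition "two_gen_all \<longleftrightarrow> (\<forall>I. submod I \<and> I \<subseteq> A \<longrightarrow> (\<exists>a\<in>I. \<exists>b\<in>I. I = span2 a b))"

text \<open>If \<open>a\<close> is nilpotent, so is \<open>a / m^k\<close> for every
  \<open>k\<close>, which is therefore almost integral. The common denominator \<open>m^c\<close>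
  then gives \<open>m^c a\<close> in \<open>m^k A\<close> for all \<open>k\<close>, hence
  \<open>m^c a = 0\<close>.\<close>

lemma bounded_reduced:
  assumes "m_separated" "\<And>q. q \<in> T \<Longrightarrow> m ^ c * q \<in> A" "a \<in> A" "a ^ n * e = 0"
  shows "a = 0"
proof -
  have T1: "mi ^ k * a \<in> T" for k
  proof -
    have "m ^ (k * n) * ((mi ^ k * a) ^ j * e) \<in> A" for j
    proof (cases "j < n")
      case True
      have "m ^ (k * n) * ((mi ^ k * a) ^ j * e) = m ^ (k * (n - j) + k * j) * (mi ^ (k * j) * (a ^ j * e))"
        using True by (simp add: power_mult_distrib power_mult mult.assoc distrib_left[symmetric])
      also have "\<dots> = m ^ (k * (n - j)) * (m ^ (k * j) * (mi ^ (k * j) * (a ^ j * e)))" by (simp only: power_add mult.assoc)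
      also have "\<dots> = m ^ (k * (n - j)) * (a ^ j * e)" using assms(3) by (subst minv') auto
      finally show ?thesis using assms(3) by simp
    next
      case False
      have "a ^ j * e = a ^ (j - n) * (a ^ n * e)" using False by (simp add: power_add[symmetric] mult.assoc[symmetric])
      then have "a ^ j * e = 0" using assms(4) by simp
      then have "(mi ^ k * a) ^ j * e = 0" by (simp add: power_mult_distrib mult.assoc)
      then show ?thesis by simp
    qed
    then show ?thesis unfolding T_def using assms(3) by blast
  qed
  have "\<exists>y\<in>A. m ^ c * a = m ^ k * y" for k
  proof (intro bexI)
    show "m ^ c * (mi ^ k * a) \<in> A" by (rule assms(2)[OF T1])
    have "m ^ k * (m ^ c * (mi ^ k * a)) = m ^ c * (m ^ k * (mi ^ k * a))" by (simp add: mult_ac)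
    also have "\<dots> = m ^ c * a" using assms(3) by (subst minv') auto
    finally show "m ^ c * a = m ^ k * (m ^ c * (mi ^ k * a))" by simp
  qed
  then have "m ^ c * a = 0" using assms(1,3) unfolding m_separated_def by simp
  then have "m ^ c * a = m ^ c * 0" by simp
  then show ?thesis by (rule m_cancel) (use assms(3) in auto)
qed

text \<open>The element \<open>f = (m^j - a x) (m^j' - b y)\<close> annihilates \<open>a\<close> and
  \<open>b\<close>. From \<open>I = (a, b) + mI\<close> it follows that \<open>f I = m f I\<close>,
  so \<open>f I\<close> lies in all \<open>m^n A\<close> and vanishes by separatedness. This shows
  that \<open>m^(j+j') I\<close> lies in \<open>(a, b)\<close>, and iterating
  \<open>I = (a, b) + mI\<close> that often finishes.\<close>

lemma m_separated_vN_nakayama: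
  assumes "m_separated" and vN: "\<And>a. a \<in> A \<Longrightarrow> \<exists>j. \<exists>x\<in>A. m ^ j * a = a * a * x"
  shows "nakayama"
  unfolding nakayama_def
proof (intro allI impI, elim conjE)
  fix I a b assume I: "submod I" "I \<subseteq> A" and ab: "a \<in> I" "b \<in> I"
    and h: "\<forall>i\<in>I. \<exists>u\<in>A. \<exists>v\<in>A. \<exists>j\<in>I. i = u * a + v * b + m * j"
  note I' = submodD[OF I(1)]
  have abA: "a \<in> A" "b \<in> A" using ab I by auto
  obtain j x where x: "x \<in> A" "m ^ j * a = a * a * x" using vN[OF abA(1)] by blast
  obtain j' y where y: "y \<in> A" "m ^ j' * b = b * b * y" using vN[OF abA(2)] by blast
  define f where "f = (m ^ j * e - a * x) * (m ^ j' * e - b * y)"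
  have "(m ^ j * e - a * x) * a = m ^ j * a - a * a * x" using abA by (simp add: algebra_simps)
  then have za: "(m ^ j * e - a * x) * a = 0" using x by simp
  have "(m ^ j' * e - b * y) * b = m ^ j' * b - b * b * y" using abA by (simp add: algebra_simps)
  then have zb: "(m ^ j' * e - b * y) * b = 0" using y by simp
  have "f * a = (m ^ j' * e - b * y) * ((m ^ j * e - a * x) * a)" unfolding f_def by (simp only: mult_ac)
  then have fa: "f * a = 0" using za by simp
  have "f * b = (m ^ j * e - a * x) * ((m ^ j' * e - b * y) * b)" unfolding f_def by (simp only: mult_ac)
  then have fb: "f * b = 0" using zb by simp
  have fA: "f \<in> A" unfolding f_def using abA x y by simp
  have fI: "f * i = 0" if i: "i \<in> I" for i
  proof -
    have "\<exists>i'\<in>I. f * i = m ^ n * (f * i')" for n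
    proof (induction n)
      case 0 then show ?case using i by auto
    next
      case (Suc n)
      then obtain i' where i': "i' \<in> I" "f * i = m ^ n * (f * i')" by blast
      obtain u v k where k: "k \<in> I" "i' = u * a + v * b + m * k" using h i' by blast
      have "f * i' = u * (f * a) + v * (f * b) + m * (f * k)" unfolding k(2) by (simp add: algebra_simps)
      then have "f * i' = m * (f * k)" using fa fb by simp
      then show ?case using i'(2) k(1) by (intro bexI[of _ k]) (simp_all add: mult_ac)
    qed
    then have "\<forall>n. \<exists>y\<in>A. f * i = m ^ n * y" using fA I(2) by (meson Amul subsetD)
    then show ?thesis using assms(1) fA I(2) i unfolding m_separated_def by (meson Amul subsetD)
  qed
  have spI: "u * a + v * b \<in> span2 a b" if "u \<in> A" "v \<in> A" for u v using that unfolding span2_def by blast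
  have abQ: "a \<in> Q" "b \<in> Q" using abA by auto
  note spD = submodD[OF span2_submod[OF abQ]]
  \<comment> \<open>Expanding \<open>f i = 0\<close> isolates \<open>m^(j+j') i\<close>; all other
    terms are multiples of \<open>a\<close> or \<open>b\<close>.\<close>
  have big: "m ^ (j + j') * i \<in> span2 a b" if i: "i \<in> I" for i
  proof -
    have iA: "i \<in> A" using i I(2) by auto
    have "f * i = m ^ (j + j') * i - ((m ^ j' * (x * i)) * a + (m ^ j * (y * i) - a * x * y * i) * b)"
      unfolding f_def using iA abA x(1) y(1) by (simp add: algebra_simps power_add)
    then have "m ^ (j + j') * i = (m ^ j' * (x * i)) * a + (m ^ j * (y * i) - a * x * y * i) * b" using fI[OF i] by simp
    also have "\<dots> \<in> span2 a b" by (rule spI) (use iA abA x(1) y(1) in auto)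
    finally show ?thesis .
  qed
  have "\<exists>s\<in>span2 a b. \<exists>i'\<in>I. i = s + m ^ n * i'" if i: "i \<in> I" for i n
  proof (induction n)
    case 0 then show ?case using spD(2) i by (intro bexI[of _ 0] bexI[of _ i]) auto
  next
    case (Suc n)
    then obtain s i' where s: "s \<in> span2 a b" "i' \<in> I" "i = s + m ^ n * i'" by blast
    obtain u v k where k: "u \<in> A" "v \<in> A" "k \<in> I" "i' = u * a + v * b + m * k" using h s by blast
    have "i = (s + (m ^ n * e) * (u * a + v * b)) + m ^ Suc n * k" unfolding s(3) k(4) using abA k by (simp add: algebra_simps)
    moreover have "s + (m ^ n * e) * (u * a + v * b) \<in> span2 a b" by (intro spD(3) spD(4) s spI k) simp
    ultimately show ?case using k(3) by blast
  qed
  then have "I \<subseteq> span2 a b" using big spD(3) by (metis subsetI)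
  then show "I = span2 a b" using span2_least[OF I(1) ab] by blast
qed

text \<open>Iterating \<open>i = U i * a + V i * b + m * G i\<close> produces coefficient series in
  powers of \<open>m\<close>; completeness provides their sums and separatedness the equality in the
  limit.\<close>

lemma m_complete_nakayama:
  assumes "m_separated" "m_complete" shows "nakayama"
  unfolding nakayama_def
proof (intro allI impI, elim conjE)
  fix I a b assume I: "submod I" "I \<subseteq> A" and ab: "a \<in> I" "b \<in> I"
    and h: "\<forall>i\<in>I. \<exists>u\<in>A. \<exists>v\<in>A. \<exists>j\<in>I. i = u * a + v * b + m * j"
  have abA: "a \<in> A" "b \<in> A" using ab I by auto
  obtain U V G where UVG: "\<And>i. i \<in> I \<Longrightarrow> U i \<in> A \<and> V i \<in> A \<and> G i \<in> I \<and> i = U i * a + V i * b + m * G i"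
    using h by metis
  have U: "\<And>i. i \<in> I \<Longrightarrow> U i \<in> A" and V: "\<And>i. i \<in> I \<Longrightarrow> V i \<in> A"
    and G: "\<forall>i\<in>I. G i \<in> I \<and> i = U i * a + V i * b + m * G i" using UVG by blast+
  have key: "I \<subseteq> span2 a b"
  proof
    fix i assume i: "i \<in> I"
    define g where "g n = (G ^^ n) i" for n
    have gI: "g n \<in> I" for n by (induction n) (use i G in \<open>auto simp: g_def\<close>)
    have gS: "g n = U (g n) * a + V (g n) * b + m * g (Suc n)" for n
      using G gI[of n] unfolding g_def by simp
    define s where "s n = (\<Sum>k<n. m ^ k * U (g k))" for n
    define s' where "s' n = (\<Sum>k<n. m ^ k * V (g k))" for n
    have sA: "s n \<in> A" "s' n \<in> A" for n unfolding s_def s'_def by (induction n) (use U V gI in auto)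
    have "s n \<in> A \<and> (\<exists>y\<in>A. s (Suc n) - s n = m ^ n * y)" for n using sA U[OF gI] by (auto simp: s_def)
    then obtain t where t: "t \<in> A" "\<And>n. \<exists>y\<in>A. t - s n = m ^ n * y" using assms(2) unfolding m_complete_def by meson
    have "s' n \<in> A \<and> (\<exists>y\<in>A. s' (Suc n) - s' n = m ^ n * y)" for n using sA V[OF gI] by (auto simp: s'_def)
    then obtain t' where t': "t' \<in> A" "\<And>n. \<exists>y\<in>A. t' - s' n = m ^ n * y" using assms(2) unfolding m_complete_def by meson
    have i_eq: "i = s n * a + s' n * b + m ^ n * g n" for n
    proof (induction n)
      case 0 then show ?case by (simp add: s_def s'_def g_def)
    next
      case (Suc n)
      have "m ^ n * g n = m ^ n * (U (g n) * a + V (g n) * b + m * g (Suc n))" using gS[of n] by simp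
      then show ?case unfolding Suc s_def s'_def by (simp add: algebra_simps)
    qed
    have "\<exists>y\<in>A. i - (t * a + t' * b) = m ^ n * y" for n
    proof -
      obtain y where y: "y \<in> A" "t - s n = m ^ n * y" using t(2) by blast
      obtain y' where y': "y' \<in> A" "t' - s' n = m ^ n * y'" using t'(2) by blast
      have "i - (t * a + t' * b) = m ^ n * g n - (t - s n) * a - (t' - s' n) * b" by (subst i_eq[of n]) (simp add: algebra_simps)
      also have "\<dots> = m ^ n * (g n - y * a - y' * b)" unfolding y(2) y'(2) by (simp add: algebra_simps)
      finally show ?thesis using y y' abA gI[of n] I(2) by (intro bexI[of _ "g n - y * a - y' * b"]) auto
    qed
    then have "i - (t * a + t' * b) = 0" using assms(1) i I(2) t t' abA unfolding m_separated_def
      by (metis Aadd Adiff Amul subsetD)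
    then have "i = t * a + t' * b" by simp
    then show "i \<in> span2 a b" unfolding span2_def using t t' by blast
  qed
  then show "I = span2 a b" using span2_least[OF I(1) ab] by blast
qed

text \<open>Every ideal \<open>I\<close> is compared with the regular ideals \<open>I + m^k A\<close>; passing through the saturation \<open>L\<close> of \<open>I\<close>
  first makes the error term \<open>I \<inter> m^(k+1) A\<close> land in \<open>m I\<close>.\<close>
lemma two_gen_reg_nakayama_two_gen_all: assumes two_gen_reg nakayama shows two_gen_all
  unfolding two_gen_all_def
proof (intro allI impI, elim conjE)
  fix I assume I: "submod I" "I \<subseteq> A"
  note I' = submodD[OF I(1)]
  \<comment> \<open>\<open>L + m^k A\<close> contains a power of \<open>m\<close>, so it has two
    generators; their components in \<open>L\<close> generate \<open>L\<close> up to
    \<open>m^k A\<close>.\<close>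
  have plus: "\<exists>g\<in>L. \<exists>h\<in>L. \<forall>x\<in>L. \<exists>u\<in>A. \<exists>v\<in>A. \<exists>r\<in>A. x = u * g + v * h + m ^ k * r" if L: "submod L" "L \<subseteq> A" for L k
  proof -
    note L' = submodD[OF L(1)]
    let ?G = "{l + m ^ k * r | l r. l \<in> L \<and> r \<in> A}"
    have "submod ?G" unfolding submod_def
    proof (intro conjI ballI)
      show "?G \<subseteq> Q" using L' by auto
      show "0 \<in> ?G" using L'(2) by (intro CollectI exI[of _ 0]) auto
      fix x y assume "x \<in> ?G" "y \<in> ?G"
      then obtain l r l' r' where "x = l + m ^ k * r" "y = l' + m ^ k * r'" "l \<in> L" "r \<in> A" "l' \<in> L" "r' \<in> A" by blast
      then show "x + y \<in> ?G" using L'(3) by (intro CollectI exI[of _ "l + l'"] exI[of _ "r + r'"]) (auto simp: algebra_simps)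
    next
      fix a x assume "a \<in> A" "x \<in> ?G"
      then obtain l r where "x = l + m ^ k * r" "l \<in> L" "r \<in> A" by blast
      then show "a * x \<in> ?G" using L'(4) \<open>a \<in> A\<close> by (intro CollectI exI[of _ "a * l"] exI[of _ "a * r"]) (auto simp: algebra_simps)
    qed
    moreover have "0 + m ^ k * e \<in> ?G" using L'(2) Ae by blast
    then have "reg ?G" unfolding reg_def by auto
    moreover have "?G \<subseteq> A" using L(2) by auto
    ultimately obtain p q where pq: "p \<in> ?G" "q \<in> ?G" "?G = span2 p q" using assms(1) unfolding two_gen_reg_def by meson
    obtain g r where g: "p = g + m ^ k * r" "g \<in> L" "r \<in> A" using pq(1) by blast
    obtain h s where h: "q = h + m ^ k * s" "h \<in> L" "s \<in> A" using pq(2) by blast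
    have "\<exists>u\<in>A. \<exists>v\<in>A. \<exists>r\<in>A. x = u * g + v * h + m ^ k * r" if x: "x \<in> L" for x
    proof -
      have "x + m ^ k * 0 \<in> ?G" using x A0 by blast
      then have "x \<in> span2 p q" using pq(3) by simp
      then obtain u v where uv: "u \<in> A" "v \<in> A" "x = u * p + v * q" unfolding span2_def by blast
      then have "x = u * g + v * h + m ^ k * (u * r + v * s)" unfolding g(1) h(1) by (simp add: algebra_simps)
      moreover have "u * r + v * s \<in> A" using uv g h by auto
      ultimately show ?thesis using uv by blast
    qed
    then show ?thesis using g h by blast
  qed
  define L where "L = {x \<in> A. \<exists>k. m ^ k * x \<in> I}"
  have mI: "m ^ k * x \<in> I" if "x \<in> I" for k x using I'(4)[of "m ^ k * e" x] I'(1)[OF that] that by (simp add: mult.assoc)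
  have L: "submod L" unfolding submod_def
  proof (intro conjI ballI)
    show "L \<subseteq> Q" unfolding L_def by auto
    show "0 \<in> L" unfolding L_def using I'(2) by auto
    fix x y assume "x \<in> L" "y \<in> L"
    then obtain k l where kl: "x \<in> A" "y \<in> A" "m ^ k * x \<in> I" "m ^ l * y \<in> I" unfolding L_def by blast
    have "m ^ (k + l) * (x + y) = m ^ l * (m ^ k * x) + m ^ k * (m ^ l * y)" by (simp add: power_add algebra_simps)
    also have "\<dots> \<in> I" by (intro I'(3) mI kl)
    finally show "x + y \<in> L" unfolding L_def using kl by blast
  next
    fix a x assume "a \<in> A" "x \<in> L"
    then obtain k where "x \<in> A" "m ^ k * x \<in> I" unfolding L_def by blast
    then have "m ^ k * (a * x) \<in> I" "a * x \<in> A" using I'(4)[OF \<open>a \<in> A\<close>] \<open>a \<in> A\<close> by (auto simp: mult.left_commute)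
    then show "a * x \<in> L" unfolding L_def by blast
  qed
  have LA: "L \<subseteq> A" unfolding L_def by blast
  note L' = submodD[OF L]
  have sat: "r \<in> L" if rk: "r \<in> A" "m ^ k * r \<in> L" for r k
  proof -
    obtain l where "m ^ l * (m ^ k * r) \<in> I" using rk unfolding L_def by blast
    then have "m ^ (l + k) * r \<in> I" by (simp add: power_add mult.assoc)
    then show ?thesis unfolding L_def using rk by blast
  qed
  \<comment> \<open>The exponent one is enough for \<open>L\<close>: by saturation
    \<open>m r\<close> in \<open>L\<close> implies \<open>r\<close> in \<open>L\<close>, so the
    error lies in \<open>mL\<close>.\<close>
  obtain g h where gh: "g \<in> L" "h \<in> L" "\<forall>x\<in>L. \<exists>u\<in>A. \<exists>v\<in>A. \<exists>r\<in>A. x = u * g + v * h + m ^ 1 * r" using plus[OF L LA] by blast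
  have "L = span2 g h"
  proof (rule assms(2)[unfolded nakayama_def, rule_format], intro conjI L LA gh(1,2) ballI)
    fix x assume x: "x \<in> L"
    then obtain u v r where uv: "u \<in> A" "v \<in> A" "r \<in> A" "x = u * g + v * h + m ^ 1 * r" using gh(3) by blast
    have eq: "m ^ 1 * r = x - (u * g + v * h)" using uv(4) by simp
    have "m ^ 1 * r \<in> L" unfolding eq by (intro L'(6) L'(3) L'(4) x gh uv)
    then have "r \<in> L" using sat uv by blast
    then show "\<exists>u\<in>A. \<exists>v\<in>A. \<exists>j\<in>L. x = u * g + v * h + m * j" using uv by auto
  qed
  obtain k where k: "m ^ k * g \<in> I" using gh(1) unfolding L_def by blast
  obtain l where l: "m ^ l * h \<in> I" using gh(2) unfolding L_def by blast
  have big: "m ^ (k + l) * x \<in> I" if x: "x \<in> L" for x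
  proof -
    obtain u v where uv: "u \<in> A" "v \<in> A" "x = u * g + v * h" using x \<open>L = span2 g h\<close> unfolding span2_def by blast
    have "m ^ (k + l) * x = u * (m ^ l * (m ^ k * g)) + v * (m ^ k * (m ^ l * h))" unfolding uv(3) by (simp add: power_add algebra_simps)
    also have "\<dots> \<in> I" by (intro I'(3) I'(4) mI k l uv)
    finally show ?thesis .
  qed
  \<comment> \<open>\<open>m^(k+l)\<close> maps \<open>L\<close> into \<open>I\<close>. One further
    factor \<open>m\<close> makes the error \<open>m\<close> times an element of
    \<open>m^(k+l) L\<close>, so it lies in \<open>mI\<close>.\<close>
  obtain a b where ab: "a \<in> I" "b \<in> I" "\<forall>x\<in>I. \<exists>u\<in>A. \<exists>v\<in>A. \<exists>r\<in>A. x = u * a + v * b + m ^ Suc (k + l) * r" using plus[OF I] by blast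
  have "I = span2 a b"
  proof (rule assms(2)[unfolded nakayama_def, rule_format], intro conjI I ab(1,2) ballI)
    fix x assume x: "x \<in> I"
    then obtain u v r where uv: "u \<in> A" "v \<in> A" "r \<in> A" "x = u * a + v * b + m ^ Suc (k + l) * r" using ab(3) by blast
    have eq: "m ^ Suc (k + l) * r = x - (u * a + v * b)" using uv(4) by simp
    have "m ^ Suc (k + l) * r \<in> I" unfolding eq by (intro I'(6) I'(3) I'(4) x ab uv)
    then have "r \<in> L" unfolding L_def using uv by blast
    then have "m ^ (k + l) * r \<in> I" by (rule big)
    moreover have "x = u * a + v * b + m * (m ^ (k + l) * r)" using uv(4) by (simp add: mult.assoc)
    ultimately show "\<exists>u\<in>A. \<exists>v\<in>A. \<exists>j\<in>I. x = u * a + v * b + m * j" using uv by blast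
  qed
  then show "\<exists>a\<in>I. \<exists>b\<in>I. I = span2 a b" using ab by blast
qed

text \<open>A \<open>T\<close>-submodule of \<open>T\<close> containing \<open>m\<close> is
  fractional with endomorphism ring \<open>T\<close>, so it is a principal ideal of
  \<open>T\<close>.\<close>

lemma endo_principal_T_principal:
  assumes "endo_principal" and bnd: "\<And>q. q \<in> T \<Longrightarrow> m ^ c * q \<in> A"
    and F: "submod F" "F \<subseteq> T" "m \<in> F" "\<And>t x. t \<in> T \<Longrightarrow> x \<in> F \<Longrightarrow> t * x \<in> F"
  shows "\<exists>w\<in>F. F = (\<lambda>t. w * t) ` T"
proof -
  have "m ^ 1 * e \<in> F" using F(3) by simp
  then have fr: "fractional F" unfolding fractional_def bdd_def reg_def using F bnd by blast
  have "endo F = T" using endo_T[OF fr] F(4) unfolding endo_def T_def by blast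
  then show ?thesis using assms(1)[unfolded endo_principal_def, rule_format, OF fr] by simp
qed

text \<open>Meant for the completion, where no chains of primes are at hand. The descending chain
  \<open>L n = r^n Q \<inter> T\<close> is controlled by dualizing the ideals
  \<open>L n + mT\<close> into an ascending chain, which stops because its union is principal. A
  Nakayama argument then gives \<open>L n = L (n+1)\<close> for some \<open>n\<close>, so
  \<open>r^n = r^(n+1) q\<close> and \<open>r q = e\<close>.\<close>

lemma nakayama_nzd_unit:
  assumes "two_gen_reg" "two_gen_all" and bnd: "\<And>q. q \<in> T \<Longrightarrow> m ^ c * q \<in> A"
    and r: "r \<in> A" "\<And>x. x \<in> A \<Longrightarrow> r * x = 0 \<Longrightarrow> x = 0"
  shows "\<exists>y\<in>Q. r * y = e"
proof -
  have P: endo_principal by (rule two_gen_reg_endo_principal[OF assms(1)])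
  note T' = subrD[OF T_subr]
  have eT: "e \<in> T" "m \<in> T" "0 \<in> T" "r \<in> T" using T'(2) r by auto
  have rQ: "x = 0" if x: "x \<in> Q" "r ^ n * x = 0" for x n
    using x(2)
  proof (induction n)
    case 0 then show ?case by simp
  next
    case (Suc n)
    obtain k where k: "m ^ k * (r ^ n * x) \<in> A" using Qfrac x(1) r(1) by blast
    have "r * (m ^ k * (r ^ n * x)) = m ^ k * (r ^ Suc n * x)" by (simp add: mult_ac)
    then have "r * (m ^ k * (r ^ n * x)) = 0" unfolding Suc.prems by simp
    then have "m ^ k * (r ^ n * x) = m ^ k * 0" using r(2)[OF k] by simp
    then have "r ^ n * x = 0" by (rule m_cancel) (use x(1) r(1) in auto)
    then show ?case by (rule Suc.IH)
  qed
  define L where "L n = {x \<in> T. \<exists>q\<in>Q. x = r ^ n * q}" for n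
  have LT: "t * x \<in> L n" if tx: "t \<in> T" "x \<in> L n" for t x n
  proof -
    obtain q where q: "q \<in> Q" "x = r ^ n * q" "x \<in> T" using tx unfolding L_def by blast
    then have "t * x = r ^ n * (t * q)" "t * q \<in> Q" "t * x \<in> T" using T'(1)[OF tx(1)] T'(4)[OF tx(1)] by (auto simp: mult.left_commute)
    then show ?thesis unfolding L_def by blast
  qed
  have Ladd: "x + y \<in> L n" if xy: "x \<in> L n" "y \<in> L n" for x y n
  proof -
    obtain p q where "p \<in> Q" "q \<in> Q" "x = r ^ n * p" "y = r ^ n * q" "x \<in> T" "y \<in> T" using xy unfolding L_def by blast
    then have "x + y = r ^ n * (p + q)" "p + q \<in> Q" "x + y \<in> T" using T'(3) by (auto simp: distrib_left)
    then show ?thesis unfolding L_def by blast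
  qed
  have L0: "0 \<in> L n" for n unfolding L_def using eT(3) by (auto intro!: bexI[of _ 0])
  have Lsub: "submod (L n)" for n
    unfolding submod_def
  proof (intro conjI ballI)
    show "L n \<subseteq> Q" unfolding L_def using T'(1) by blast
    show "0 \<in> L n" by (rule L0)
    fix x y assume "x \<in> L n" "y \<in> L n" then show "x + y \<in> L n" by (rule Ladd)
  next
    fix a x assume "a \<in> A" "x \<in> L n" then show "a * x \<in> L n" by (intro LT T'(2))
  qed
  have Ldec: "L (Suc n) \<subseteq> L n" for n
  proof
    fix x assume "x \<in> L (Suc n)"
    then obtain q where q: "q \<in> Q" "x = r ^ Suc n * q" "x \<in> T" unfolding L_def by blast
    have "x = r ^ n * (r * q)" unfolding q(2) by (simp add: mult_ac)
    moreover have "r * q \<in> Q" using r(1) q(1) by simp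
    ultimately show "x \<in> L n" unfolding L_def using q(3) by blast
  qed
  \<comment> \<open>The summand \<open>mT\<close> brings \<open>m\<close> into the ideal, which
    makes it principal over \<open>T\<close>.\<close>
  define K where "K n = {x + m * t | x t. x \<in> L n \<and> t \<in> T}" for n
  have KT: "t * k \<in> K n" if tk: "t \<in> T" "k \<in> K n" for t k n
  proof -
    obtain x s where "x \<in> L n" "s \<in> T" "k = x + m * s" using tk unfolding K_def by blast
    moreover from this have "t * k = t * x + m * (t * s)" by (simp add: algebra_simps)
    ultimately show ?thesis unfolding K_def using LT[OF tk(1)] T'(4)[OF tk(1)] by blast
  qed
  have Ksub: "submod (K n)" for n unfolding submod_def
  proof (intro conjI ballI)
    show "K n \<subseteq> Q" unfolding K_def using submodD(1)[OF Lsub] T'(1) by auto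
    have "0 + m * 0 \<in> K n" unfolding K_def using L0 eT(3) by blast
    then show "0 \<in> K n" by simp
    fix x y assume "x \<in> K n" "y \<in> K n"
    then obtain a s b t where ab: "x = a + m * s" "y = b + m * t" "a \<in> L n" "b \<in> L n" "s \<in> T" "t \<in> T" unfolding K_def by blast
    then have "x + y = (a + b) + m * (s + t)" by (simp add: algebra_simps)
    then show "x + y \<in> K n" unfolding K_def using Ladd[OF ab(3,4)] T'(3)[OF ab(5,6)] by blast
  next
    fix a x assume "a \<in> A" "x \<in> K n"
    then show "a * x \<in> K n" using KT T'(2) by blast
  qed
  have KsubT: "K n \<subseteq> T" for n unfolding K_def L_def using T'(3) T'(4)[OF eT(2)] by blast
  have "0 + m * e \<in> K n" for n unfolding K_def using L0 eT(1) by blast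
  then have mK: "m \<in> K n" for n by simp
  have "\<exists>w\<in>K n. K n = (\<lambda>t. w * t) ` T" for n
    by (rule endo_principal_T_principal[OF P bnd Ksub KsubT mK KT])
  then obtain w where w: "\<And>n. w n \<in> K n" "\<And>n. K n = (\<lambda>t. w n * t) ` T" by metis
  \<comment> \<open>With \<open>K n = w n T\<close>, the quotient \<open>y n = m / w n\<close>
    generates the dual ideal; as \<open>K n\<close> shrinks, \<open>y n T\<close> grows.\<close>
  have "\<exists>y\<in>T. m = w n * y" for n using mK[of n] w(2)[of n] by auto
  then obtain y where y: "\<And>n. y n \<in> T" "\<And>n. m = w n * y n" by metis
  have wy_cancel: "x = x'" if "w n * x = w n * x'" "x \<in> Q" "x' \<in> Q" for n x x'
  proof -
    have "m * x = y n * (w n * x)" "m * x' = y n * (w n * x')" using y(2)[of n] by (simp_all add: mult_ac)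
    then have "m ^ 1 * x = m ^ 1 * x'" using that by simp
    then show ?thesis using m_cancel that by blast
  qed
  have yw_cancel: "x = x'" if "y n * x = y n * x'" "x \<in> Q" "x' \<in> Q" for n x x'
  proof -
    have "m * x = w n * (y n * x)" "m * x' = w n * (y n * x')" using y(2)[of n] by (simp_all add: mult_ac)
    then have "m ^ 1 * x = m ^ 1 * x'" using that by simp
    then show ?thesis using m_cancel that by blast
  qed
  have Kdec: "K (Suc n) \<subseteq> K n" for n unfolding K_def using Ldec by blast
  have ystep: "\<exists>t\<in>T. y n = t * y (Suc n) \<and> w (Suc n) = w n * t" for n
  proof -
    have "w (Suc n) \<in> (\<lambda>t. w n * t) ` T" using w Kdec by blast
    then obtain t where t: "t \<in> T" "w (Suc n) = w n * t" by blast
    have "w n * y n = w n * (t * y (Suc n))" using y(2)[of n] y(2)[of "Suc n"] t(2) by (simp add: mult.assoc)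
    then have "y n = t * y (Suc n)" by (rule wy_cancel) (use T'(1)[OF y(1)] T'(1)[OF t(1)] in auto)
    then show ?thesis using t by blast
  qed
  define Y where "Y n = (\<lambda>t. y n * t) ` T" for n
  have Yinc: "Y n \<subseteq> Y (Suc n)" for n
  proof
    fix x assume "x \<in> Y n"
    then obtain s where s: "s \<in> T" "x = y n * s" unfolding Y_def by blast
    obtain t where t: "t \<in> T" "y n = t * y (Suc n)" using ystep by blast
    have "x = y (Suc n) * (t * s)" using s t by (simp add: mult_ac)
    then show "x \<in> Y (Suc n)" unfolding Y_def using T'(4)[OF t(1) s(1)] by blast
  qed
  have Ymono: "Y n \<subseteq> Y k" if "n \<le> k" for n k using that lift_Suc_mono_le[of Y] Yinc by blast
  let ?Y = "\<Union>n. Y n"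
  have YTn: "t * x \<in> Y n" if tx: "t \<in> T" "x \<in> Y n" for t x n
  proof -
    obtain s where "s \<in> T" "x = y n * s" using tx unfolding Y_def by blast
    then show ?thesis unfolding Y_def using T'(4)[OF tx(1)] by (intro image_eqI[of _ _ "t * s"]) (auto simp: mult_ac)
  qed
  have Yaddn: "x + x' \<in> Y n" if xx: "x \<in> Y n" "x' \<in> Y n" for x x' n
  proof -
    obtain s s' where "s \<in> T" "x = y n * s" "s' \<in> T" "x' = y n * s'" using xx unfolding Y_def by blast
    then show ?thesis unfolding Y_def using T'(3) by (intro image_eqI[of _ _ "s + s'"]) (auto simp: distrib_left)
  qed
  have YsT: "?Y \<subseteq> T" unfolding Y_def using T'(4)[OF y(1)] by blast
  have Ysub: "submod ?Y" unfolding submod_def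
  proof (intro conjI ballI)
    show "?Y \<subseteq> Q" using YsT T'(1) by blast
    have "y 0 * 0 \<in> Y 0" unfolding Y_def using eT by blast
    then show "0 \<in> ?Y" by auto
    fix x x' assume "x \<in> ?Y" "x' \<in> ?Y"
    then obtain n n' where "x \<in> Y n" "x' \<in> Y n'" by blast
    then have "x \<in> Y (max n n')" "x' \<in> Y (max n n')" using Ymono[of n "max n n'"] Ymono[of n' "max n n'"] by auto
    then show "x + x' \<in> ?Y" using Yaddn by blast
  next
    fix a x assume "a \<in> A" "x \<in> ?Y"
    then show "a * x \<in> ?Y" using YTn[OF T'(2)] by blast
  qed
  have mY: "m \<in> ?Y"
  proof -
    have "w 0 \<in> T" using w(1) KsubT by blast
    then have "m \<in> Y 0" unfolding Y_def using y(2)[of 0] by (intro image_eqI[of _ _ "w 0"]) (auto simp: mult.commute)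
    then show ?thesis by blast
  qed
  have YTu: "t * x \<in> ?Y" if "t \<in> T" "x \<in> ?Y" for t x using that YTn by blast
  have "\<exists>v\<in>?Y. ?Y = (\<lambda>t. v * t) ` T" by (rule endo_principal_T_principal[OF P bnd Ysub YsT mY YTu])
  then obtain v where v: "v \<in> ?Y" "?Y = (\<lambda>t. v * t) ` T" by (elim bexE) (rule that)
  \<comment> \<open>The generator of the union lies in some \<open>Y n\<close>, where the ascending
    chain stops; dually \<open>K n = K (n+1)\<close>.\<close>
  obtain n where n: "v \<in> Y n" using v(1) by blast
  have "y (Suc n) * e \<in> Y (Suc n)" unfolding Y_def using eT(1) by blast
  then have "y (Suc n) \<in> ?Y" using T'(1)[OF y(1)] by auto
  then obtain s0 where s0: "s0 \<in> T" "y (Suc n) = v * s0" by (subst (asm) v(2)) (erule imageE)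
  obtain s1 where s1: "s1 \<in> T" "v = y n * s1" using n unfolding Y_def by blast
  define s where "s = s1 * s0"
  have s: "s \<in> T" "y (Suc n) = y n * s" unfolding s_def using s0 s1 T'(4) by (auto simp: mult.assoc)
  have wQ: "w k \<in> Q" for k using w(1) KsubT T'(1) by blast
  have "y n * w n = y n * (w (Suc n) * s)" using y(2)[of n] y(2)[of "Suc n"] s(2) by (simp add: mult_ac)
  then have wn: "w n = w (Suc n) * s" by (rule yw_cancel) (use wQ T'(1)[OF s(1)] in auto)
  have Keq: "K n \<subseteq> K (Suc n)"
  proof
    fix x assume "x \<in> K n"
    then obtain t where "t \<in> T" "x = w n * t" using w(2)[of n] by blast
    then have "x = w (Suc n) * (s * t)" "s * t \<in> T" using wn T'(4)[OF s(1)] by (auto simp: mult.assoc)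
    then show "x \<in> K (Suc n)" using w(2)[of "Suc n"] by blast
  qed
  \<comment> \<open>Since \<open>m\<close> is invertible in \<open>Q\<close>, \<open>m t\<close> in
    \<open>L n\<close> with \<open>t\<close> in \<open>T\<close> implies \<open>t\<close> in
    \<open>L n\<close>. Together with \<open>K n = K (n+1)\<close> this gives
    \<open>L n = L (n+1) + m L n\<close>.\<close>
  have dec: "\<exists>l\<in>L (Suc n). \<exists>x'\<in>L n. x = l + m * x'" if x: "x \<in> L n" for x
  proof -
    have "x + m * 0 \<in> K n" unfolding K_def using x eT by blast
    then have "x \<in> K (Suc n)" using Keq by auto
    then obtain l t where l: "l \<in> L (Suc n)" "t \<in> T" "x = l + m * t" unfolding K_def by blast
    have tQ: "t \<in> Q" using T'(1) l by blast
    have "m * t = x - l" using l by simp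
    then have "m * t \<in> L n" using submodD(6)[OF Lsub x] l(1) Ldec by auto
    then obtain q where q: "q \<in> Q" "m * t = r ^ n * q" unfolding L_def by blast
    have "m ^ 1 * t = m ^ 1 * (r ^ n * (mi * q))"
    proof -
      have "m ^ 1 * (r ^ n * (mi * q)) = (m * mi) * (r ^ n * q)" by (simp add: mult_ac)
      then show ?thesis using q mmi r(1) by simp
    qed
    then have "t = r ^ n * (mi * q)" by (rule m_cancel) (use tQ q r(1) in auto)
    then have "t \<in> L n" unfolding L_def using l(2) q(1) by blast
    then show ?thesis using l by blast
  qed
  let ?I = "(\<lambda>x. m ^ c * x) ` L n"
  have IA: "?I \<subseteq> A" using bnd unfolding L_def by blast
  have "submod ?I" unfolding submod_def
  proof (intro conjI ballI)
    show "?I \<subseteq> Q" using IA by auto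
    show "0 \<in> ?I" using L0 by (intro image_eqI[of _ _ 0]) auto
    fix x x' assume "x \<in> ?I" "x' \<in> ?I"
    then obtain p p' where "p \<in> L n" "p' \<in> L n" "x = m ^ c * p" "x' = m ^ c * p'" by blast
    then show "x + x' \<in> ?I" using Ladd by (intro image_eqI[of _ _ "p + p'"]) (auto simp: distrib_left)
  next
    fix a x assume a: "a \<in> A" and "x \<in> ?I"
    then obtain p where p: "p \<in> L n" "x = m ^ c * p" by blast
    have "a * x = m ^ c * (a * p)" unfolding p(2) by (simp add: mult_ac)
    then show "a * x \<in> ?I" using LT[OF T'(2)[OF a] p(1)] by blast
  qed
  then obtain g1 g2 where g: "g1 \<in> ?I" "g2 \<in> ?I" "?I = span2 g1 g2" using assms(2) IA unfolding two_gen_all_def by meson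
  obtain h1 h2 where hh: "h1 \<in> L n" "h2 \<in> L n" "g1 = m ^ c * h1" "g2 = m ^ c * h2" using g(1,2) by blast
  have LQ: "x \<in> Q" if "x \<in> L k" for x k using submodD(1)[OF Lsub that] .
  have gen: "\<exists>u\<in>A. \<exists>v\<in>A. x = u * h1 + v * h2" if x: "x \<in> L n" for x
  proof -
    have "m ^ c * x \<in> span2 g1 g2" using x g(3) by blast
    then obtain u v where uv: "u \<in> A" "v \<in> A" "m ^ c * x = u * g1 + v * g2" unfolding span2_def by blast
    have "m ^ c * x = m ^ c * (u * h1 + v * h2)" unfolding uv(3) hh(3,4) by (simp add: algebra_simps)
    then have "x = u * h1 + v * h2" by (rule m_cancel) (use LQ x uv hh in auto)
    then show ?thesis using uv by blast
  qed
  obtain l1 x1 where l1: "l1 \<in> L (Suc n)" "x1 \<in> L n" "h1 = l1 + m * x1" using dec[OF hh(1)] by blast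
  obtain l2 x2 where l2: "l2 \<in> L (Suc n)" "x2 \<in> L n" "h2 = l2 + m * x2" using dec[OF hh(2)] by blast
  obtain \<alpha> \<beta> where ab: "\<alpha> \<in> A" "\<beta> \<in> A" "x1 = \<alpha> * h1 + \<beta> * h2" using gen[OF l1(2)] by blast
  obtain \<gamma> \<delta> where cd: "\<gamma> \<in> A" "\<delta> \<in> A" "x2 = \<gamma> * h1 + \<delta> * h2" using gen[OF l2(2)] by blast
  have hQ: "h1 \<in> Q" "h2 \<in> Q" using LQ hh by auto
  have e1: "l1 = h1 - m * \<alpha> * h1 - m * \<beta> * h2" using l1(3) ab(3) by (simp add: algebra_simps)
  have e2: "l2 = h2 - m * \<gamma> * h1 - m * \<delta> * h2" using l2(3) cd(3) by (simp add: algebra_simps)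
  \<comment> \<open>The 2x2 system for \<open>h1, h2\<close> is solved by Cramer's rule; its
    determinant is \<open>e - m * ?a\<close>, a unit.\<close>
  let ?a = "\<alpha> + \<delta> - m * \<alpha> * \<delta> + m * \<beta> * \<gamma>"
  have aA: "?a \<in> A" using ab cd by auto
  have d1: "(e - m * \<delta>) * l1 + (m * \<beta>) * l2 = (e - m * ?a) * h1" unfolding e1 e2 using hQ ab cd by (simp add: algebra_simps)
  have d2: "(m * \<gamma>) * l1 + (e - m * \<alpha>) * l2 = (e - m * ?a) * h2" unfolding e1 e2 using hQ ab cd by (simp add: algebra_simps)
  obtain b where b: "b \<in> A" "(e - m * ?a) * b = e" using unitA_e_m[OF aA] by blast
  note LD = submodD[OF Lsub[of "Suc n"]]
  have "b * ((e - m * \<delta>) * l1 + (m * \<beta>) * l2) \<in> L (Suc n)" "b * ((m * \<gamma>) * l1 + (e - m * \<alpha>) * l2) \<in> L (Suc n)"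
    by (intro LD(4) LD(3) b l1 l2 Amul Adiff Ae mA ab cd)+
  then have "b * ((e - m * ?a) * h1) \<in> L (Suc n)" "b * ((e - m * ?a) * h2) \<in> L (Suc n)" unfolding d1 d2 .
  moreover have "b * ((e - m * ?a) * h) = ((e - m * ?a) * b) * h" for h by (simp only: mult_ac)
  ultimately have h12: "h1 \<in> L (Suc n)" "h2 \<in> L (Suc n)" using b(2) hQ by simp_all
  have "r ^ n * e \<in> L n" unfolding L_def using T'(7)[OF eT(4,1)] by auto
  then obtain u v where "u \<in> A" "v \<in> A" "r ^ n * e = u * h1 + v * h2" using gen by blast
  then have "r ^ n * e \<in> L (Suc n)" using LD(3,4) h12 by simp
  then obtain q where q: "q \<in> Q" "r ^ n * e = r ^ Suc n * q" unfolding L_def by blast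
  have "r ^ n * (r * q - e) = 0" using q(2) by (simp add: algebra_simps)
  then have "r * q - e = 0" by (rule rQ[rotated]) (use r(1) q(1) in auto)
  then show ?thesis using q(1) by auto
qed

end

section \<open>An ambient commutative ring\<close>

text \<open>The product of \<open>\<int>\<close> and of all commutative rings on subsets of \<open>'q\<close>. It is an instance of \<open>comm_ring_1\<close> (the factor \<open>\<int>\<close>
  ensures \<open>0 \<noteq> 1\<close>) and contains every such ring as an ideal, with a local unit \<open>e\<close>, so that arguments about a ring and
  its quotient ring can be carried out with type-class algebra.\<close>

typedef 'q ambient = "{p :: ('q ring \<Rightarrow> 'q) \<times> int. \<forall>S. if cring S then fst p S \<in> carrier S else fst p S = undefined}"
proof
  show "(\<lambda>S. if cring S then \<zero>\<^bsub>S\<^esub> else undefined, 0) \<in> {p :: ('q ring \<Rightarrow> 'q) \<times> int. \<forall>S. if cring S then fst p S \<in> carrier S else fst p S = undefined}"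
    by (auto simp: cring.cring_simprules)
qed

setup_lifting type_definition_ambient

instantiation ambient :: (type) comm_ring_1
begin

lift_definition zero_ambient :: "'a ambient" is "(\<lambda>S. if cring S then \<zero>\<^bsub>S\<^esub> else undefined, 0)"
  by (auto simp: cring.cring_simprules)
lift_definition one_ambient :: "'a ambient" is "(\<lambda>S. if cring S then \<one>\<^bsub>S\<^esub> else undefined, 1)"
  by (auto simp: cring.cring_simprules)
lift_definition plus_ambient :: "'a ambient \<Rightarrow> 'a ambient \<Rightarrow> 'a ambient" is
  "\<lambda>p q. (\<lambda>S. if cring S then fst p S \<oplus>\<^bsub>S\<^esub> fst q S else undefined, snd p + snd q)"
  by (auto simp: cring.cring_simprules split: if_splits)
lift_definition times_ambient :: "'a ambient \<Rightarrow> 'a ambient \<Rightarrow> 'a ambient" is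
  "\<lambda>p q. (\<lambda>S. if cring S then fst p S \<otimes>\<^bsub>S\<^esub> fst q S else undefined, snd p * snd q)"
  by (auto simp: cring.cring_simprules split: if_splits)
lift_definition uminus_ambient :: "'a ambient \<Rightarrow> 'a ambient" is
  "\<lambda>p. (\<lambda>S. if cring S then \<ominus>\<^bsub>S\<^esub> fst p S else undefined, - snd p)"
  by (auto simp: cring.cring_simprules split: if_splits)
lift_definition minus_ambient :: "'a ambient \<Rightarrow> 'a ambient \<Rightarrow> 'a ambient" is
  "\<lambda>p q. (\<lambda>S. if cring S then fst p S \<oplus>\<^bsub>S\<^esub> (\<ominus>\<^bsub>S\<^esub> fst q S) else undefined, snd p - snd q)"
  by (auto simp: cring.cring_simprules split: if_splits)

instance
proof
  fix a b c :: "'a ambient"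
  show "a * b * c = a * (b * c)" by transfer (auto simp: fun_eq_iff cring.cring_simprules split: if_splits)
  show "a * b = b * a" by transfer (auto simp: fun_eq_iff cring.cring_simprules split: if_splits)
  show "1 * a = a" by transfer (auto simp: fun_eq_iff prod_eq_iff cring.cring_simprules split: if_splits)
  show "a + b + c = a + (b + c)" by transfer (auto simp: fun_eq_iff cring.cring_simprules split: if_splits)
  show "a + b = b + a" by transfer (auto simp: fun_eq_iff cring.cring_simprules split: if_splits)
  show "0 + a = a" by transfer (auto simp: fun_eq_iff prod_eq_iff cring.cring_simprules split: if_splits)
  show "- a + a = 0" by transfer (auto simp: fun_eq_iff cring.cring_simprules split: if_splits)
  show "a - b = a + - b" by transfer (auto simp: fun_eq_iff cring.cring_simprules split: if_splits)
  show "(a + b) * c = a * c + b * c" by transfer (auto simp: fun_eq_iff cring.cring_simprules algebra_simps split: if_splits)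
  show "(0::'a ambient) \<noteq> 1" by transfer auto
qed

end

text \<open>All coordinates other than \<open>R\<close> vanish, the integer one included. So the
  image of the carrier is an ideal, and the image of the unit is an idempotent that acts on it as
  identity.\<close>

definition emb :: "'q ring \<Rightarrow> 'q \<Rightarrow> 'q ambient" where
  "emb R x = Abs_ambient (\<lambda>S. if cring S then (if S = R then x else \<zero>\<^bsub>S\<^esub>) else undefined, 0)"

lemma Rep_emb:
  assumes "cring R" "x \<in> carrier R"
  shows "Rep_ambient (emb R x) = (\<lambda>S. if cring S then (if S = R then x else \<zero>\<^bsub>S\<^esub>) else undefined, 0)"
  unfolding emb_def using assms by (intro Abs_ambient_inverse) (auto simp: cring.cring_simprules)

lemma emb_inj: assumes "cring R" "x \<in> carrier R" "y \<in> carrier R" "emb R x = emb R y" shows "x = y"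
proof -
  have "fst (Rep_ambient (emb R z)) R = z" if "z \<in> carrier R" for z
    using Rep_emb[OF assms(1) that] assms(1) by simp
  then show ?thesis using assms(2-4) by metis
qed

lemma emb_add: assumes "cring R" "x \<in> carrier R" "y \<in> carrier R" shows "emb R (x \<oplus>\<^bsub>R\<^esub> y) = emb R x + emb R y"
proof -
  interpret cring R by fact
  have "Rep_ambient (emb R (x \<oplus>\<^bsub>R\<^esub> y)) = Rep_ambient (emb R x + emb R y)"
    unfolding plus_ambient.rep_eq using assms by (simp add: Rep_emb fun_eq_iff cring.cring_simprules)
  then show ?thesis by (simp add: Rep_ambient_inject)
qed

lemma emb_mult: assumes "cring R" "x \<in> carrier R" "y \<in> carrier R" shows "emb R (x \<otimes>\<^bsub>R\<^esub> y) = emb R x * emb R y"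
proof -
  interpret cring R by fact
  have "Rep_ambient (emb R (x \<otimes>\<^bsub>R\<^esub> y)) = Rep_ambient (emb R x * emb R y)"
    unfolding times_ambient.rep_eq using assms by (simp add: Rep_emb fun_eq_iff cring.cring_simprules)
  then show ?thesis by (simp add: Rep_ambient_inject)
qed

lemma emb_zero: assumes "cring R" shows "emb R \<zero>\<^bsub>R\<^esub> = 0"
proof -
  interpret cring R by fact
  have "Rep_ambient (emb R \<zero>\<^bsub>R\<^esub>) = Rep_ambient 0"
    unfolding zero_ambient.rep_eq using assms by (simp add: Rep_emb fun_eq_iff cring.cring_simprules)
  then show ?thesis by (simp add: Rep_ambient_inject)
qed

lemma emb_minus: assumes "cring R" "x \<in> carrier R" shows "emb R (\<ominus>\<^bsub>R\<^esub> x) = - emb R x"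
proof -
  interpret cring R by fact
  have "emb R (\<ominus>\<^bsub>R\<^esub> x) + emb R x = 0" using emb_add[OF assms(1), of "\<ominus>\<^bsub>R\<^esub> x" x] assms emb_zero[OF assms(1)] by (simp add: l_neg)
  then show ?thesis by (simp add: eq_neg_iff_add_eq_0)
qed

section \<open>The total ring of quotients\<close>

context cring begin

lemma nzd_closed[simp]: "nzd R s \<Longrightarrow> s \<in> carrier R" by (simp add: nzd_def)

lemma nzd_cancel: assumes "nzd R s" "x \<in> carrier R" "y \<in> carrier R" "s \<otimes> x = s \<otimes> y" shows "x = y"
proof -
  have s: "s \<in> carrier R" using assms by simp
  have "s \<otimes> (x \<ominus> y) = s \<otimes> x \<ominus> s \<otimes> y" using s assms by algebra
  then have "s \<otimes> (x \<ominus> y) = \<zero>" using assms s by (simp add: a_minus_def r_neg)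
  moreover have "x \<ominus> y \<in> carrier R" using assms by simp
  ultimately have "x \<ominus> y = \<zero>" using assms(1) unfolding nzd_def by blast
  then show ?thesis using assms(2,3) by simp
qed

lemma nzd_one: "nzd R \<one>" unfolding nzd_def by simp
lemma nzd_mult: assumes "nzd R s" "nzd R t" shows "nzd R (s \<otimes> t)"
  unfolding nzd_def
proof (intro conjI ballI impI)
  show "s \<otimes> t \<in> carrier R" using assms by simp
  fix b assume b: "b \<in> carrier R" "s \<otimes> t \<otimes> b = \<zero>"
  then have "s \<otimes> (t \<otimes> b) = \<zero>" "t \<otimes> b \<in> carrier R" using assms by (simp_all add: m_assoc)
  then have "t \<otimes> b = \<zero>" using assms(1) unfolding nzd_def by blast
  then show "b = \<zero>" using assms(2) b(1) unfolding nzd_def by blast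
qed
lemma nzd_pow: "nzd R s \<Longrightarrow> nzd R (s [^] (n::nat))"
  by (induction n) (auto simp: nzd_one nzd_mult)

lemma frac_class_mem: "a \<in> carrier R \<Longrightarrow> nzd R s \<Longrightarrow> (a, s) \<in> frac_class R a s"
  by (simp add: frac_class_def)

lemma frac_class_eq:
  assumes "a \<in> carrier R" "b \<in> carrier R" "nzd R s" "nzd R t"
  shows "frac_class R a s = frac_class R b t \<longleftrightarrow> a \<otimes> t = b \<otimes> s"
proof
  assume "frac_class R a s = frac_class R b t"
  then have "(a, s) \<in> frac_class R b t" using frac_class_mem assms by blast
  then show "a \<otimes> t = b \<otimes> s" by (simp add: frac_class_def)
next
  have key: "b \<otimes> u = c \<otimes> t" if h: "a \<in> carrier R" "b \<in> carrier R" "nzd R s" "nzd R t" "a \<otimes> t = b \<otimes> s" "c \<in> carrier R" "nzd R u" "a \<otimes> u = c \<otimes> s" for a b s t c u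
  proof (rule nzd_cancel[OF h(3)])
    have "s \<otimes> (b \<otimes> u) = (b \<otimes> s) \<otimes> u" using h by (simp add: m_ac)
    also have "\<dots> = (a \<otimes> u) \<otimes> t" unfolding h(5)[symmetric] using h(1-4,6,7) by (simp add: m_ac)
    also have "\<dots> = s \<otimes> (c \<otimes> t)" unfolding h(8) using h(1-4,6,7) by (simp add: m_ac)
    finally show "s \<otimes> (b \<otimes> u) = s \<otimes> (c \<otimes> t)" .
  qed (use h in auto)
  assume eq: "a \<otimes> t = b \<otimes> s"
  have "a \<otimes> u = c \<otimes> s \<longleftrightarrow> b \<otimes> u = c \<otimes> t" if "c \<in> carrier R" "nzd R u" for c u
    using key[OF assms eq that] key[OF assms(2,1,4,3) eq[symmetric] that] by blast
  then show "frac_class R a s = frac_class R b t"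
    unfolding frac_class_def by blast
qed

text \<open>The set-level product asks for some pair of representatives; cancelling the
  nonzerodivisor \<open>s' t'\<close> shows that every pair leads to the same class.\<close>

lemma frac_mult_class:
  assumes "a \<in> carrier R" "b \<in> carrier R" "nzd R s" "nzd R t"
  shows "frac_mult R (frac_class R a s) (frac_class R b t) = frac_class R (a \<otimes> b) (s \<otimes> t)"
proof -
  have key: "(a \<otimes> b) \<otimes> u = c \<otimes> (s \<otimes> t)"
    if h: "c \<in> carrier R" "nzd R u" "a' \<in> carrier R" "nzd R s'" "a \<otimes> s' = a' \<otimes> s" "b' \<in> carrier R" "nzd R t'" "b \<otimes> t' = b' \<otimes> t"
      "c \<otimes> (s' \<otimes> t') = (a' \<otimes> b') \<otimes> u" for c u a' s' b' t'
  proof (rule nzd_cancel[OF nzd_mult[OF h(4,7)]])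
    note cl = h(1,3,6) nzd_closed[OF h(2)] nzd_closed[OF h(4)] nzd_closed[OF h(7)] assms(1,2) nzd_closed[OF assms(3)] nzd_closed[OF assms(4)]
    have "(s' \<otimes> t') \<otimes> ((a \<otimes> b) \<otimes> u) = (a \<otimes> s') \<otimes> (b \<otimes> t') \<otimes> u" using cl by (simp add: m_ac)
    also have "\<dots> = ((a' \<otimes> b') \<otimes> u) \<otimes> (s \<otimes> t)" unfolding h(5) h(8) using cl by (simp add: m_ac)
    also have "\<dots> = (s' \<otimes> t') \<otimes> (c \<otimes> (s \<otimes> t))" unfolding h(9)[symmetric] using cl by (simp add: m_ac)
    finally show "(s' \<otimes> t') \<otimes> ((a \<otimes> b) \<otimes> u) = (s' \<otimes> t') \<otimes> (c \<otimes> (s \<otimes> t))" .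
  qed (use h assms in auto)
  have mem: "(a, s) \<in> frac_class R a s" "(b, t) \<in> frac_class R b t" using frac_class_mem assms by auto
  have "(\<exists>a' s' b' t'. (a', s') \<in> frac_class R a s \<and> (b', t') \<in> frac_class R b t \<and> c \<otimes> (s' \<otimes> t') = (a' \<otimes> b') \<otimes> u)
      \<longleftrightarrow> (a \<otimes> b) \<otimes> u = c \<otimes> (s \<otimes> t)" (is "?l \<longleftrightarrow> ?r") if cu: "c \<in> carrier R" "nzd R u" for c u
  proof
    assume ?l
    then obtain a' s' b' t' where h: "(a', s') \<in> frac_class R a s" "(b', t') \<in> frac_class R b t" "c \<otimes> (s' \<otimes> t') = (a' \<otimes> b') \<otimes> u" by blast
    then show ?r using key[OF cu, of a' s' b' t'] unfolding frac_class_def by blast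
  next
    assume ?r
    then have "c \<otimes> (s \<otimes> t) = (a \<otimes> b) \<otimes> u" by (rule sym)
    then show ?l using mem by blast
  qed
  then show ?thesis unfolding frac_mult_def frac_class_def[of R "(a \<otimes> b)"] by blast
qed

lemma frac_add_class:
  assumes "a \<in> carrier R" "b \<in> carrier R" "nzd R s" "nzd R t"
  shows "frac_add R (frac_class R a s) (frac_class R b t) = frac_class R ((a \<otimes> t) \<oplus> (b \<otimes> s)) (s \<otimes> t)"
proof -
  have key: "((a \<otimes> t) \<oplus> (b \<otimes> s)) \<otimes> u = c \<otimes> (s \<otimes> t)"
    if h: "c \<in> carrier R" "nzd R u" "a' \<in> carrier R" "nzd R s'" "a \<otimes> s' = a' \<otimes> s" "b' \<in> carrier R" "nzd R t'" "b \<otimes> t' = b' \<otimes> t"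
      "c \<otimes> (s' \<otimes> t') = ((a' \<otimes> t') \<oplus> (b' \<otimes> s')) \<otimes> u" for c u a' s' b' t'
  proof (rule nzd_cancel[OF nzd_mult[OF h(4,7)]])
    note cl = h(1,3,6) nzd_closed[OF h(2)] nzd_closed[OF h(4)] nzd_closed[OF h(7)] assms(1,2) nzd_closed[OF assms(3)] nzd_closed[OF assms(4)]
    have "(s' \<otimes> t') \<otimes> (((a \<otimes> t) \<oplus> (b \<otimes> s)) \<otimes> u) = ((a \<otimes> s') \<otimes> (t \<otimes> t') \<oplus> (b \<otimes> t') \<otimes> (s \<otimes> s')) \<otimes> u"
      using cl by (simp add: m_ac r_distr l_distr)
    also have "\<dots> = (((a' \<otimes> t') \<oplus> (b' \<otimes> s')) \<otimes> u) \<otimes> (s \<otimes> t)" unfolding h(5) h(8) using cl by (simp add: m_ac r_distr l_distr)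
    also have "\<dots> = (s' \<otimes> t') \<otimes> (c \<otimes> (s \<otimes> t))" unfolding h(9)[symmetric] using cl by (simp add: m_ac)
    finally show "(s' \<otimes> t') \<otimes> (((a \<otimes> t) \<oplus> (b \<otimes> s)) \<otimes> u) = (s' \<otimes> t') \<otimes> (c \<otimes> (s \<otimes> t))" .
  qed (use h assms in auto)
  have mem: "(a, s) \<in> frac_class R a s" "(b, t) \<in> frac_class R b t" using frac_class_mem assms by auto
  have "(\<exists>a' s' b' t'. (a', s') \<in> frac_class R a s \<and> (b', t') \<in> frac_class R b t \<and> c \<otimes> (s' \<otimes> t') = ((a' \<otimes> t') \<oplus> (b' \<otimes> s')) \<otimes> u)
      \<longleftrightarrow> ((a \<otimes> t) \<oplus> (b \<otimes> s)) \<otimes> u = c \<otimes> (s \<otimes> t)" (is "?l \<longleftrightarrow> ?r") if cu: "c \<in> carrier R" "nzd R u" for c u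
  proof
    assume ?l
    then obtain a' s' b' t' where h: "(a', s') \<in> frac_class R a s" "(b', t') \<in> frac_class R b t" "c \<otimes> (s' \<otimes> t') = ((a' \<otimes> t') \<oplus> (b' \<otimes> s')) \<otimes> u" by blast
    then show ?r using key[OF cu, of a' s' b' t'] unfolding frac_class_def by blast
  next
    assume ?r
    then have "c \<otimes> (s \<otimes> t) = ((a \<otimes> t) \<oplus> (b \<otimes> s)) \<otimes> u" by (rule sym)
    then show ?l using mem by blast
  qed
  then show ?thesis unfolding frac_add_def frac_class_def[of R "((a \<otimes> t) \<oplus> (b \<otimes> s))"] by blast
qed

abbreviation "QR \<equiv> total_quot R"

lemma TQ_mult: "a \<in> carrier R \<Longrightarrow> b \<in> carrier R \<Longrightarrow> nzd R s \<Longrightarrow> nzd R t \<Longrightarrow>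
    frac_class R a s \<otimes>\<^bsub>QR\<^esub> frac_class R b t = frac_class R (a \<otimes> b) (s \<otimes> t)"
  by (simp add: total_quot_def frac_mult_class)
lemma TQ_add: "a \<in> carrier R \<Longrightarrow> b \<in> carrier R \<Longrightarrow> nzd R s \<Longrightarrow> nzd R t \<Longrightarrow>
    frac_class R a s \<oplus>\<^bsub>QR\<^esub> frac_class R b t = frac_class R ((a \<otimes> t) \<oplus> (b \<otimes> s)) (s \<otimes> t)"
  by (simp add: total_quot_def frac_add_class)
lemma TQ_carrier: "carrier QR = {frac_class R a s | a s. a \<in> carrier R \<and> nzd R s}"
  by (simp add: total_quot_def)
lemma TQ_one: "\<one>\<^bsub>QR\<^esub> = frac_class R \<one> \<one>" by (simp add: total_quot_def)
lemma TQ_zero: "\<zero>\<^bsub>QR\<^esub> = frac_class R \<zero> \<one>" by (simp add: total_quot_def)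
lemma TQ_closed: "a \<in> carrier R \<Longrightarrow> nzd R s \<Longrightarrow> frac_class R a s \<in> carrier QR" by (auto simp: TQ_carrier)
lemma TQ_cases: assumes "x \<in> carrier QR" obtains a s where "a \<in> carrier R" "nzd R s" "x = frac_class R a s"
  using assms by (auto simp: TQ_carrier)

lemma total_quot_cring: "cring QR"
proof (rule cringI)
  show "abelian_group QR"
  proof (rule abelian_groupI)
    fix x y assume "x \<in> carrier QR" "y \<in> carrier QR"
    then obtain a s b t where x: "a \<in> carrier R" "nzd R s" "x = frac_class R a s" and y: "b \<in> carrier R" "nzd R t" "y = frac_class R b t"
      by (meson TQ_cases)
    show "x \<oplus>\<^bsub>QR\<^esub> y \<in> carrier QR" using x y by (simp add: TQ_add TQ_closed nzd_mult)
    show "x \<oplus>\<^bsub>QR\<^esub> y = y \<oplus>\<^bsub>QR\<^esub> x" using x y by (simp add: TQ_add m_comm a_comm)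
    fix z assume "z \<in> carrier QR"
    then obtain c u where z: "c \<in> carrier R" "nzd R u" "z = frac_class R c u" by (meson TQ_cases)
    show "(x \<oplus>\<^bsub>QR\<^esub> y) \<oplus>\<^bsub>QR\<^esub> z = x \<oplus>\<^bsub>QR\<^esub> (y \<oplus>\<^bsub>QR\<^esub> z)"
      using x y z by (simp add: TQ_add nzd_mult l_distr r_distr m_ac a_ac)
  next
    show "\<zero>\<^bsub>QR\<^esub> \<in> carrier QR" by (simp add: TQ_zero TQ_closed nzd_one)
    fix x assume "x \<in> carrier QR"
    then obtain a s where x: "a \<in> carrier R" "nzd R s" "x = frac_class R a s" by (meson TQ_cases)
    show "\<zero>\<^bsub>QR\<^esub> \<oplus>\<^bsub>QR\<^esub> x = x" using x by (simp add: TQ_add TQ_zero nzd_one)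
    have "frac_class R (\<ominus> a) s \<oplus>\<^bsub>QR\<^esub> x = frac_class R \<zero> \<one>"
      using x nzd_one by (simp add: TQ_add frac_class_eq nzd_mult l_minus l_neg)
    then show "\<exists>y\<in>carrier QR. y \<oplus>\<^bsub>QR\<^esub> x = \<zero>\<^bsub>QR\<^esub>" using x TQ_closed[of "\<ominus> a" s] by (auto simp: TQ_zero)
  qed
  show "comm_monoid QR"
  proof (rule comm_monoidI)
    fix x y assume "x \<in> carrier QR" "y \<in> carrier QR"
    then obtain a s b t where x: "a \<in> carrier R" "nzd R s" "x = frac_class R a s" and y: "b \<in> carrier R" "nzd R t" "y = frac_class R b t"
      by (meson TQ_cases)
    show "x \<otimes>\<^bsub>QR\<^esub> y \<in> carrier QR" using x y by (simp add: TQ_mult TQ_closed nzd_mult)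
    show "x \<otimes>\<^bsub>QR\<^esub> y = y \<otimes>\<^bsub>QR\<^esub> x" using x y by (simp add: TQ_mult m_comm)
    fix z assume "z \<in> carrier QR"
    then obtain c u where z: "c \<in> carrier R" "nzd R u" "z = frac_class R c u" by (meson TQ_cases)
    show "(x \<otimes>\<^bsub>QR\<^esub> y) \<otimes>\<^bsub>QR\<^esub> z = x \<otimes>\<^bsub>QR\<^esub> (y \<otimes>\<^bsub>QR\<^esub> z)"
      using x y z by (simp add: TQ_mult nzd_mult m_ac)
  next
    show "\<one>\<^bsub>QR\<^esub> \<in> carrier QR" by (simp add: TQ_one TQ_closed nzd_one)
    fix x assume "x \<in> carrier QR"
    then obtain a s where x: "a \<in> carrier R" "nzd R s" "x = frac_class R a s" by (meson TQ_cases)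
    show "\<one>\<^bsub>QR\<^esub> \<otimes>\<^bsub>QR\<^esub> x = x" using x by (simp add: TQ_mult TQ_one nzd_one)
  qed
  fix x y z assume "x \<in> carrier QR" "y \<in> carrier QR" "z \<in> carrier QR"
  then obtain a s b t c u where x: "a \<in> carrier R" "nzd R s" "x = frac_class R a s" and y: "b \<in> carrier R" "nzd R t" "y = frac_class R b t"
    and z: "c \<in> carrier R" "nzd R u" "z = frac_class R c u" by (meson TQ_cases)
  show "(x \<oplus>\<^bsub>QR\<^esub> y) \<otimes>\<^bsub>QR\<^esub> z = x \<otimes>\<^bsub>QR\<^esub> z \<oplus>\<^bsub>QR\<^esub> y \<otimes>\<^bsub>QR\<^esub> z"
    using x y z by (simp add: TQ_add TQ_mult nzd_mult frac_class_eq l_distr r_distr m_ac)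
qed

lemma frac_emb_closed: "a \<in> carrier R \<Longrightarrow> frac_emb R a \<in> carrier QR"
  by (simp add: frac_emb_def TQ_closed nzd_one)
lemma frac_emb_inj: "a \<in> carrier R \<Longrightarrow> b \<in> carrier R \<Longrightarrow> frac_emb R a = frac_emb R b \<longleftrightarrow> a = b"
  by (simp add: frac_emb_def frac_class_eq nzd_one)
lemma frac_emb_add: "a \<in> carrier R \<Longrightarrow> b \<in> carrier R \<Longrightarrow> frac_emb R (a \<oplus> b) = frac_emb R a \<oplus>\<^bsub>QR\<^esub> frac_emb R b"
  by (simp add: frac_emb_def TQ_add nzd_one)
lemma frac_emb_mult: "a \<in> carrier R \<Longrightarrow> b \<in> carrier R \<Longrightarrow> frac_emb R (a \<otimes> b) = frac_emb R a \<otimes>\<^bsub>QR\<^esub> frac_emb R b"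
  by (simp add: frac_emb_def TQ_mult nzd_one)

end

section \<open>Passage between a ring and its copy\<close>

text \<open>Restricted to ideals containing a power of \<open>m\<close>, which are the ones that can
  be compared through the quotients modulo \<open>m^k\<close>.\<close>

definition "two_gen R m \<longleftrightarrow> (\<forall>I. ideal I R \<and> (\<exists>k::nat. m [^]\<^bsub>R\<^esub> k \<in> I) \<longrightarrow>
  (\<exists>a\<in>carrier R. \<exists>b\<in>carrier R. I = Idl\<^bsub>R\<^esub> {a, b}))"

definition "all_two_gen R \<longleftrightarrow> (\<forall>I. ideal I R \<longrightarrow> (\<exists>a\<in>carrier R. \<exists>b\<in>carrier R. I = Idl\<^bsub>R\<^esub> {a, b}))"

text \<open>Without denominators: every almost integral element \<open>a / m^k\<close> of \<open>R[1/m]\<close> lies in \<open>m^(-c) R\<close>.\<close>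
definition "bounded_closure R m \<longleftrightarrow> (\<exists>c::nat. \<forall>a\<in>carrier R. \<forall>k::nat.
  (\<exists>d::nat. \<forall>n::nat. \<exists>y\<in>carrier R. m [^]\<^bsub>R\<^esub> d \<otimes>\<^bsub>R\<^esub> a [^]\<^bsub>R\<^esub> n = m [^]\<^bsub>R\<^esub> (k * n) \<otimes>\<^bsub>R\<^esub> y) \<longrightarrow>
  (\<exists>y\<in>carrier R. m [^]\<^bsub>R\<^esub> c \<otimes>\<^bsub>R\<^esub> a = m [^]\<^bsub>R\<^esub> k \<otimes>\<^bsub>R\<^esub> y))"

definition "adic_separated R m \<longleftrightarrow> (\<forall>x\<in>carrier R. (\<forall>k::nat. \<exists>y\<in>carrier R. x = m [^]\<^bsub>R\<^esub> k \<otimes>\<^bsub>R\<^esub> y) \<longrightarrow> x = \<zero>\<^bsub>R\<^esub>)"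

definition "adic_complete R m \<longleftrightarrow> (\<forall>s. (\<forall>n::nat. s n \<in> carrier R \<and> (\<exists>y\<in>carrier R. s (Suc n) = s n \<oplus>\<^bsub>R\<^esub> m [^]\<^bsub>R\<^esub> n \<otimes>\<^bsub>R\<^esub> y)) \<longrightarrow>
  (\<exists>t\<in>carrier R. \<forall>n. \<exists>y\<in>carrier R. t = s n \<oplus>\<^bsub>R\<^esub> m [^]\<^bsub>R\<^esub> n \<otimes>\<^bsub>R\<^esub> y))"

text \<open>Equivalent, for a nonzerodivisor \<open>m\<close>, to \<open>R[1/m]\<close> being the
  whole total ring of quotients.\<close>

definition "nzd_divides R m \<longleftrightarrow> (\<forall>r. nzd R r \<longrightarrow> (\<exists>k::nat. \<exists>y\<in>carrier R. m [^]\<^bsub>R\<^esub> k = r \<otimes>\<^bsub>R\<^esub> y))"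

text \<open>The common properties of \<open>R\<close>, \<open>R / J\<close> and the completion.
  Krull dimension is replaced by \<open>radical\<close>, which for the last two rings can be checked
  by approximation modulo \<open>m\<close>.\<close>

locale param_ring = cring R for R (structure) +
  fixes m
  assumes nzd_m: "nzd R m"
    and local: "a \<in> carrier R \<Longrightarrow> a \<in> Units R \<or> \<one> \<ominus> a \<in> Units R"
    and m_nonunit: "m \<notin> Units R"
    and radical: "a \<in> carrier R \<Longrightarrow> a \<in> Units R \<or> (\<exists>k::nat. \<exists>x\<in>carrier R. a [^] k = m \<otimes> x)"
begin

lemma m_closed': "m \<in> carrier R" using nzd_m by (rule nzd_closed)
declare m_closed'[simp]

definition "E q = emb QR q"
definition "\<phi> x = E (frac_emb R x)"
definition "AA = \<phi> ` carrier R"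
text \<open>The copy of \<open>R[1/m]\<close> inside the total ring of quotients; the two coincide
  once every nonzerodivisor divides a power of \<open>m\<close>.\<close>

definition "QQ = {u \<in> E ` carrier QR. \<exists>k. \<phi> m ^ k * u \<in> AA}"
definition "mi = E (frac_class R \<one> m)"

interpretation TQ: cring QR by (rule total_quot_cring)

lemma E_add: "x \<in> carrier QR \<Longrightarrow> y \<in> carrier QR \<Longrightarrow> E (x \<oplus>\<^bsub>QR\<^esub> y) = E x + E y"
  unfolding E_def by (rule emb_add[OF total_quot_cring])
lemma E_mult: "x \<in> carrier QR \<Longrightarrow> y \<in> carrier QR \<Longrightarrow> E (x \<otimes>\<^bsub>QR\<^esub> y) = E x * E y"
  unfolding E_def by (rule emb_mult[OF total_quot_cring])
lemma E_zero: "E \<zero>\<^bsub>QR\<^esub> = 0" unfolding E_def by (rule emb_zero[OF total_quot_cring])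
lemma E_minus: "x \<in> carrier QR \<Longrightarrow> E (\<ominus>\<^bsub>QR\<^esub> x) = - E x" unfolding E_def by (rule emb_minus[OF total_quot_cring])
lemma E_inj: "x \<in> carrier QR \<Longrightarrow> y \<in> carrier QR \<Longrightarrow> E x = E y \<longleftrightarrow> x = y"
  unfolding E_def using emb_inj[OF total_quot_cring] by blast
lemma E_one: "E \<one>\<^bsub>QR\<^esub> = \<phi> \<one>" unfolding \<phi>_def frac_emb_def TQ_one ..
lemma E_unit: "x \<in> carrier QR \<Longrightarrow> \<phi> \<one> * E x = E x"
  using E_mult[of "\<one>\<^bsub>QR\<^esub>" x] by (simp add: E_one)

lemma phi_add: "x \<in> carrier R \<Longrightarrow> y \<in> carrier R \<Longrightarrow> \<phi> (x \<oplus> y) = \<phi> x + \<phi> y"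
  unfolding \<phi>_def by (simp add: frac_emb_add E_add frac_emb_closed)
lemma phi_mult: "x \<in> carrier R \<Longrightarrow> y \<in> carrier R \<Longrightarrow> \<phi> (x \<otimes> y) = \<phi> x * \<phi> y"
  unfolding \<phi>_def by (simp add: frac_emb_mult E_mult frac_emb_closed)
lemma phi_inj: "x \<in> carrier R \<Longrightarrow> y \<in> carrier R \<Longrightarrow> \<phi> x = \<phi> y \<longleftrightarrow> x = y"
  unfolding \<phi>_def by (simp add: E_inj frac_emb_inj frac_emb_closed)
lemma phi_zero: "\<phi> \<zero> = 0"
  using phi_add[of \<zero> \<zero>] by simp
lemma phi_neg: "x \<in> carrier R \<Longrightarrow> \<phi> (\<ominus> x) = - \<phi> x"
  using phi_add[of "\<ominus> x" x] by (simp add: l_neg phi_zero eq_neg_iff_add_eq_0)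
lemma phi_minus: "x \<in> carrier R \<Longrightarrow> y \<in> carrier R \<Longrightarrow> \<phi> (x \<ominus> y) = \<phi> x - \<phi> y"
  by (simp add: a_minus_def phi_add phi_neg)
lemma phi_pow_mult: "x \<in> carrier R \<Longrightarrow> y \<in> carrier R \<Longrightarrow> \<phi> (x [^] (n::nat) \<otimes> y) = \<phi> x ^ n * \<phi> y"
proof (induction n)
  case (Suc n)
  have "\<phi> (x [^] Suc n \<otimes> y) = \<phi> (x \<otimes> (x [^] n \<otimes> y))" using Suc by (simp add: m_ac)
  also have "\<dots> = \<phi> x * (\<phi> x ^ n * \<phi> y)" using Suc by (subst phi_mult) auto
  finally show ?case by (simp add: mult.assoc)
qed simp
lemma phi_pow: "x \<in> carrier R \<Longrightarrow> \<phi> (x [^] (n::nat)) = \<phi> x ^ n * \<phi> \<one>"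
  using phi_pow_mult[of x \<one> n] by simp

lemma phi_EQ: "x \<in> carrier R \<Longrightarrow> \<phi> x \<in> E ` carrier QR" unfolding \<phi>_def using frac_emb_closed by blast
lemma phi_A: "x \<in> carrier R \<Longrightarrow> \<phi> x \<in> AA" unfolding AA_def by blast
lemma AA_cases: assumes "u \<in> AA" obtains x where "x \<in> carrier R" "u = \<phi> x" using assms unfolding AA_def by blast

lemma mmi: "\<phi> m * mi = \<phi> \<one>"
proof -
  have "frac_emb R m \<otimes>\<^bsub>QR\<^esub> frac_class R \<one> m = frac_emb R \<one>"
    unfolding frac_emb_def using nzd_m nzd_one by (simp add: TQ_mult frac_class_eq)
  then show ?thesis unfolding \<phi>_def mi_def by (metis E_mult frac_emb_closed m_closed' TQ_closed one_closed nzd_m)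
qed

lemma AA_closed:
  "x \<in> AA \<Longrightarrow> y \<in> AA \<Longrightarrow> x + y \<in> AA" "x \<in> AA \<Longrightarrow> - x \<in> AA" "x \<in> AA \<Longrightarrow> y \<in> AA \<Longrightarrow> x * y \<in> AA"
  "x \<in> AA \<Longrightarrow> \<phi> m ^ n * x \<in> AA"
proof -
  show "x + y \<in> AA" "x * y \<in> AA" if xy: "x \<in> AA" "y \<in> AA" for x y
  proof -
    obtain a where a: "a \<in> carrier R" "x = \<phi> a" using xy(1) by (rule AA_cases)
    obtain b where b: "b \<in> carrier R" "y = \<phi> b" using xy(2) by (rule AA_cases)
    show "x + y \<in> AA" using phi_A[OF add.m_closed[OF a(1) b(1)]] a b by (simp add: phi_add)
    show "x * y \<in> AA" using phi_A[OF m_closed[OF a(1) b(1)]] a b by (simp add: phi_mult)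
  qed
  show "- x \<in> AA" if x: "x \<in> AA" for x
  proof -
    obtain a where a: "a \<in> carrier R" "x = \<phi> a" using x by (rule AA_cases)
    then show ?thesis using phi_A[OF a_inv_closed[OF a(1)]] by (simp add: phi_neg)
  qed
  show "\<phi> m ^ n * x \<in> AA" if "x \<in> AA" for x
  proof -
    obtain a where "a \<in> carrier R" "x = \<phi> a" using \<open>x \<in> AA\<close> by (rule AA_cases)
    then show ?thesis using phi_pow_mult[of m a n] phi_A[of "m [^] n \<otimes> a"] by simp
  qed
qed

lemma unit_phi: assumes "a \<in> Units R" shows "\<exists>b\<in>AA. \<phi> a * b = \<phi> \<one>"
proof -
  have "a \<otimes> inv a = \<one>" "inv a \<in> carrier R" "a \<in> carrier R" using assms by auto
  then have "\<phi> a * \<phi> (inv a) = \<phi> \<one>" by (metis phi_mult)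
  then show ?thesis using phi_A \<open>inv a \<in> carrier R\<close> by blast
qed

sublocale C: local_subring QQ AA "\<phi> \<one>" "\<phi> m" mi
proof
  show "x + y \<in> QQ" if xy: "x \<in> QQ" "y \<in> QQ" for x y
  proof -
    obtain k l where kl: "\<phi> m ^ k * x \<in> AA" "\<phi> m ^ l * y \<in> AA" "x \<in> E ` carrier QR" "y \<in> E ` carrier QR" using xy unfolding QQ_def by blast
    have "\<phi> m ^ (k + l) * (x + y) = \<phi> m ^ l * (\<phi> m ^ k * x) + \<phi> m ^ k * (\<phi> m ^ l * y)" by (simp add: power_add algebra_simps)
    then have "\<phi> m ^ (k + l) * (x + y) \<in> AA" using AA_closed(1)[OF AA_closed(4)[OF kl(1)] AA_closed(4)[OF kl(2)]] by simp
    moreover have "x + y \<in> E ` carrier QR" using kl(3,4) by (auto simp: E_add[symmetric])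
    ultimately show ?thesis unfolding QQ_def by blast
  qed
  show "- x \<in> QQ" if x: "x \<in> QQ" for x
  proof -
    obtain k where k: "\<phi> m ^ k * x \<in> AA" "x \<in> E ` carrier QR" using x unfolding QQ_def by blast
    then have "\<phi> m ^ k * (- x) \<in> AA" using AA_closed(2)[OF k(1)] by simp
    moreover have "- x \<in> E ` carrier QR" using k(2) by (auto simp: E_minus[symmetric])
    ultimately show ?thesis unfolding QQ_def by blast
  qed
  show "x * y \<in> QQ" if xy: "x \<in> QQ" "y \<in> QQ" for x y
  proof -
    obtain k l where kl: "\<phi> m ^ k * x \<in> AA" "\<phi> m ^ l * y \<in> AA" "x \<in> E ` carrier QR" "y \<in> E ` carrier QR" using xy unfolding QQ_def by blast
    have "\<phi> m ^ (k + l) * (x * y) = (\<phi> m ^ k * x) * (\<phi> m ^ l * y)" by (simp add: power_add mult_ac)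
    then have "\<phi> m ^ (k + l) * (x * y) \<in> AA" using AA_closed(3)[OF kl(1,2)] by simp
    moreover have "x * y \<in> E ` carrier QR" using kl(3,4) by (auto simp: E_mult[symmetric])
    ultimately show ?thesis unfolding QQ_def by blast
  qed
  show "\<phi> \<one> * x = x" if "x \<in> QQ" for x using that E_unit unfolding QQ_def by blast
  show "x \<in> QQ" if "x \<in> AA" for x
  proof -
    have "\<phi> m ^ 0 * x \<in> AA" using that by simp
    moreover have "x \<in> E ` carrier QR" using that phi_EQ unfolding AA_def by blast
    ultimately show ?thesis unfolding QQ_def by blast
  qed
  show "x + y \<in> AA" "x * y \<in> AA" if "x \<in> AA" "y \<in> AA" for x y using AA_closed(1,3) that by blast+
  show "- x \<in> AA" if "x \<in> AA" for x using AA_closed(2) that by blast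
  show "\<phi> \<one> \<in> AA" "\<phi> m \<in> AA" using phi_A by auto
  show "mi \<in> QQ"
  proof -
    have "\<phi> m ^ 1 * mi \<in> AA" using mmi phi_A by simp
    moreover have "mi \<in> E ` carrier QR" unfolding mi_def using TQ_closed[OF one_closed nzd_m] by blast
    ultimately show ?thesis unfolding QQ_def by blast
  qed
  show "\<phi> m * mi = \<phi> \<one>" by (rule mmi)
  show "\<exists>k. \<phi> m ^ k * q \<in> AA" if "q \<in> QQ" for q using that unfolding QQ_def by blast
  show "(\<exists>b\<in>AA. a * b = \<phi> \<one>) \<or> (\<exists>b\<in>AA. (\<phi> \<one> - a) * b = \<phi> \<one>)" if a: "a \<in> AA" for a
  proof -
    obtain x where x: "x \<in> carrier R" "a = \<phi> x" using a by (rule AA_cases)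
    have "\<phi> (\<one> \<ominus> x) = \<phi> \<one> - a" using x by (simp add: phi_minus)
    then show ?thesis using local[OF x(1)] unit_phi[of x] unit_phi[of "\<one> \<ominus> x"] x(2) by metis
  qed
  show "\<phi> m * b \<noteq> \<phi> \<one>" if b: "b \<in> AA" for b
  proof
    assume h: "\<phi> m * b = \<phi> \<one>"
    obtain x where x: "x \<in> carrier R" "b = \<phi> x" using b by (rule AA_cases)
    have "m \<otimes> x = \<one>" using h x by (metis phi_mult phi_inj m_closed' m_closed one_closed)
    moreover from this have "x \<otimes> m = \<one>" using x(1) by (simp add: m_comm)
    ultimately have "m \<in> Units R" using x(1) m_closed' unfolding Units_def by blast
    then show False using m_nonunit by blast
  qed
  show "(\<exists>b\<in>AA. a * b = \<phi> \<one>) \<or> (\<exists>k. \<exists>x\<in>AA. a ^ k * \<phi> \<one> = \<phi> m * x)" if a: "a \<in> AA" for a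
  proof -
    obtain x where x: "x \<in> carrier R" "a = \<phi> x" using a by (rule AA_cases)
    show ?thesis
    proof (cases "x \<in> Units R")
      case True then show ?thesis using unit_phi x(2) by blast
    next
      case False
      then obtain k :: nat and y where "y \<in> carrier R" "x [^] k = m \<otimes> y" using radical[OF x(1)] by blast
      then have "a ^ k * \<phi> \<one> = \<phi> m * \<phi> y" using phi_pow[OF x(1), of k] x(2) by (simp add: phi_mult)
      then show ?thesis using phi_A \<open>y \<in> carrier R\<close> by blast
    qed
  qed
qed

end

section \<open>Ideals, denominators and almost integral elements under the embedding\<close>

context param_ring begin

interpretation TQ: cring QR by (rule total_quot_cring)

lemma Idl_two:
  assumes "a \<in> carrier R" "b \<in> carrier R"
  shows "Idl\<^bsub>R\<^esub> {a, b} = {u \<otimes> a \<oplus> v \<otimes> b | u v. u \<in> carrier R \<and> v \<in> carrier R}" (is "_ = ?S")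
proof
  have "ideal ?S R"
  proof (rule idealI[OF ring_axioms])
    show "subgroup ?S (add_monoid R)"
    proof (rule add.subgroupI)
      show "?S \<subseteq> carrier R" using assms by auto
      have "\<zero> \<otimes> a \<oplus> \<zero> \<otimes> b \<in> ?S" by blast
      then show "?S \<noteq> {}" by blast
      fix x assume "x \<in> ?S"
      then obtain u v where uv: "u \<in> carrier R" "v \<in> carrier R" "x = u \<otimes> a \<oplus> v \<otimes> b" by blast
      then have "\<ominus> x = (\<ominus> u) \<otimes> a \<oplus> (\<ominus> v) \<otimes> b" using assms by (simp add: l_minus minus_add)
      then show "\<ominus> x \<in> ?S" using uv by blast
      fix y assume "y \<in> ?S"
      then obtain u' v' where uv': "u' \<in> carrier R" "v' \<in> carrier R" "y = u' \<otimes> a \<oplus> v' \<otimes> b" by blast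
      then have "x \<oplus> y = (u \<oplus> u') \<otimes> a \<oplus> (v \<oplus> v') \<otimes> b" using assms uv by (simp add: l_distr a_ac)
      then show "x \<oplus> y \<in> ?S" using uv uv' by blast
    qed
    fix x y assume xy: "x \<in> ?S" "y \<in> carrier R"
    then obtain u v where uv: "u \<in> carrier R" "v \<in> carrier R" "x = u \<otimes> a \<oplus> v \<otimes> b" by blast
    then have eq: "y \<otimes> x = (y \<otimes> u) \<otimes> a \<oplus> (y \<otimes> v) \<otimes> b" using assms xy by (simp add: r_distr m_assoc)
    then show "y \<otimes> x \<in> ?S" using uv xy by blast
    then show "x \<otimes> y \<in> ?S" using uv xy assms by (simp add: m_comm)
  qed
  moreover have "a = \<one> \<otimes> a \<oplus> \<zero> \<otimes> b" "b = \<zero> \<otimes> a \<oplus> \<one> \<otimes> b" using assms by simp_all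
  then have "a \<in> ?S" "b \<in> ?S" by blast+
  ultimately show "Idl\<^bsub>R\<^esub> {a, b} \<subseteq> ?S" by (intro genideal_minimal) auto
  have "ideal (Idl\<^bsub>R\<^esub> {a, b}) R" using assms by (intro genideal_ideal) auto
  then interpret I: ideal "Idl\<^bsub>R\<^esub> {a, b}" R .
  have "a \<in> Idl\<^bsub>R\<^esub> {a, b}" "b \<in> Idl\<^bsub>R\<^esub> {a, b}" using genideal_self[of "{a, b}"] assms by auto
  then show "?S \<subseteq> Idl\<^bsub>R\<^esub> {a, b}" using I.I_l_closed I.a_closed by blast
qed

lemma phi_Idl: assumes "a \<in> carrier R" "b \<in> carrier R" shows "\<phi> ` (Idl\<^bsub>R\<^esub> {a, b}) = C.span2 (\<phi> a) (\<phi> b)"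
proof -
  have "\<phi> ` (Idl\<^bsub>R\<^esub> {a, b}) = {\<phi> u * \<phi> a + \<phi> v * \<phi> b | u v. u \<in> carrier R \<and> v \<in> carrier R}"
  proof -
    have "\<phi> (u \<otimes> a \<oplus> v \<otimes> b) = \<phi> u * \<phi> a + \<phi> v * \<phi> b" if "u \<in> carrier R" "v \<in> carrier R" for u v
      using assms that by (simp add: phi_add phi_mult)
    then show ?thesis unfolding Idl_two[OF assms] by (force simp: image_iff)
  qed
  also have "\<dots> = C.span2 (\<phi> a) (\<phi> b)" unfolding C.span2_def unfolding AA_def by (rule Collect_cong) blast
  finally show ?thesis .
qed

lemma ideal_submod: assumes "ideal I R" shows "C.submod (\<phi> ` I)" "\<phi> ` I \<subseteq> AA"
proof -
  interpret I: ideal I R by fact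
  show A: "\<phi> ` I \<subseteq> AA" unfolding AA_def using I.a_subset by blast
  show "C.submod (\<phi> ` I)" unfolding C.submod_def
  proof (intro conjI ballI)
    show "\<phi> ` I \<subseteq> QQ" using A by auto
    show "0 \<in> \<phi> ` I" using I.zero_closed phi_zero by (metis image_eqI)
    fix x y assume "x \<in> \<phi> ` I" "y \<in> \<phi> ` I"
    then obtain a b where ab: "a \<in> I" "b \<in> I" "x = \<phi> a" "y = \<phi> b" by blast
    then have "x + y = \<phi> (a \<oplus> b)" using I.Icarr by (simp add: phi_add)
    then show "x + y \<in> \<phi> ` I" using I.a_closed ab by blast
  next
    fix u x assume "u \<in> AA" "x \<in> \<phi> ` I"
    then obtain a b where ab: "a \<in> carrier R" "b \<in> I" "u = \<phi> a" "x = \<phi> b" unfolding AA_def by blast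
    then have "u * x = \<phi> (a \<otimes> b)" using I.Icarr by (simp add: phi_mult)
    then show "u * x \<in> \<phi> ` I" using I.I_l_closed ab by blast
  qed
qed

lemma submod_ideal: assumes "C.submod F" "F \<subseteq> AA" shows "\<exists>I. ideal I R \<and> F = \<phi> ` I"
proof (intro exI conjI)
  let ?I = "{x \<in> carrier R. \<phi> x \<in> F}"
  note F' = C.submodD[OF assms(1)]
  show "ideal ?I R"
  proof (rule idealI[OF ring_axioms])
    show "subgroup ?I (add_monoid R)"
    proof (rule add.subgroupI)
      show "?I \<subseteq> carrier R" by blast
      show "?I \<noteq> {}" using F'(2) phi_zero by (auto intro!: exI[of _ \<zero>])
      show "\<ominus> x \<in> ?I" if "x \<in> ?I" for x using that F'(5) by (simp add: phi_neg)
      show "x \<oplus> y \<in> ?I" if "x \<in> ?I" "y \<in> ?I" for x y using that F'(3) by (simp add: phi_add)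
    qed
    fix x y assume xy: "x \<in> ?I" "y \<in> carrier R"
    show "y \<otimes> x \<in> ?I" using xy F'(4)[OF phi_A] by (simp add: phi_mult)
    then show "x \<otimes> y \<in> ?I" using xy by (simp add: m_comm)
  qed
  show "F = \<phi> ` ?I" using assms(2) unfolding AA_def by blast
qed

lemma phi_image_eq: "I \<subseteq> carrier R \<Longrightarrow> I' \<subseteq> carrier R \<Longrightarrow> \<phi> ` I = \<phi> ` I' \<Longrightarrow> I = I'"
  using phi_inj by (blast intro: inj_on_image_eq_iff[THEN iffD1] inj_onI)

lemma reg_phi: "I \<subseteq> carrier R \<Longrightarrow> C.reg (\<phi> ` I) \<longleftrightarrow> (\<exists>k::nat. m [^] k \<in> I)"
proof -
  assume I: "I \<subseteq> carrier R"
  have "\<phi> m ^ k * \<phi> \<one> \<in> \<phi> ` I \<longleftrightarrow> m [^] k \<in> I" for k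
  proof -
    have "\<phi> m ^ k * \<phi> \<one> = \<phi> (m [^] k)" by (simp add: phi_pow)
    moreover have "\<phi> (m [^] k) \<in> \<phi> ` I \<longleftrightarrow> m [^] k \<in> I" using I phi_inj by (auto simp: image_iff)
    ultimately show ?thesis by simp
  qed
  then show ?thesis unfolding C.reg_def by blast
qed

lemma two_gen_aux:
  assumes "ideal I R"
  shows "(\<exists>a\<in>\<phi> ` I. \<exists>b\<in>\<phi> ` I. \<phi> ` I = C.span2 a b) \<longleftrightarrow> (\<exists>a\<in>carrier R. \<exists>b\<in>carrier R. I = Idl\<^bsub>R\<^esub> {a, b})"
proof -
  interpret I: ideal I R by fact
  show ?thesis
  proof
    assume "\<exists>a\<in>\<phi> ` I. \<exists>b\<in>\<phi> ` I. \<phi> ` I = C.span2 a b"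
    then obtain a b where ab: "a \<in> I" "b \<in> I" "\<phi> ` I = C.span2 (\<phi> a) (\<phi> b)" by blast
    have c: "a \<in> carrier R" "b \<in> carrier R" using ab I.Icarr by auto
    have "\<phi> ` I = \<phi> ` (Idl\<^bsub>R\<^esub> {a, b})" using ab phi_Idl[OF c] by simp
    moreover have "Idl\<^bsub>R\<^esub> {a, b} \<subseteq> carrier R" using c unfolding Idl_two[OF c] by auto
    ultimately have "I = Idl\<^bsub>R\<^esub> {a, b}" using phi_image_eq I.a_subset by blast
    then show "\<exists>a\<in>carrier R. \<exists>b\<in>carrier R. I = Idl\<^bsub>R\<^esub> {a, b}" using c by blast
  next
    assume "\<exists>a\<in>carrier R. \<exists>b\<in>carrier R. I = Idl\<^bsub>R\<^esub> {a, b}"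
    then obtain a b where ab: "a \<in> carrier R" "b \<in> carrier R" "I = Idl\<^bsub>R\<^esub> {a, b}" by blast
    have "a \<in> I" "b \<in> I" unfolding ab(3) using genideal_self[of "{a, b}"] ab by auto
    moreover have "\<phi> ` I = C.span2 (\<phi> a) (\<phi> b)" unfolding ab(3) by (rule phi_Idl[OF ab(1,2)])
    ultimately show "\<exists>a\<in>\<phi> ` I. \<exists>b\<in>\<phi> ` I. \<phi> ` I = C.span2 a b" by blast
  qed
qed

lemma two_gen_iff: "two_gen R m \<longleftrightarrow> C.two_gen_reg"
proof
  assume t: "two_gen R m"
  show "C.two_gen_reg" unfolding C.two_gen_reg_def
  proof (intro allI impI, elim conjE)
    fix F assume F: "C.submod F" "C.reg F" "F \<subseteq> AA"
    obtain I where I: "ideal I R" "F = \<phi> ` I" using submod_ideal F by blast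
    have "I \<subseteq> carrier R" using I(1) by (simp add: ideal.axioms(1) additive_subgroup.a_subset)
    then have "\<exists>k::nat. m [^] k \<in> I" using reg_phi F(2) I(2) by blast
    then have "\<exists>a\<in>carrier R. \<exists>b\<in>carrier R. I = Idl\<^bsub>R\<^esub> {a, b}" using t I(1) unfolding two_gen_def by blast
    then show "\<exists>a\<in>F. \<exists>b\<in>F. F = C.span2 a b" unfolding I(2) using two_gen_aux[OF I(1)] by blast
  qed
next
  assume T: "C.two_gen_reg"
  show "two_gen R m" unfolding two_gen_def
  proof (intro allI impI, elim conjE)
    fix I assume I: "ideal I R" and k: "\<exists>k::nat. m [^] k \<in> I"
    have "I \<subseteq> carrier R" using I by (simp add: ideal.axioms(1) additive_subgroup.a_subset)
    then have "C.reg (\<phi> ` I)" using reg_phi k by blast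
    then have "\<exists>a\<in>\<phi> ` I. \<exists>b\<in>\<phi> ` I. \<phi> ` I = C.span2 a b" using T ideal_submod[OF I] unfolding C.two_gen_reg_def by blast
    then show "\<exists>a\<in>carrier R. \<exists>b\<in>carrier R. I = Idl\<^bsub>R\<^esub> {a, b}" using two_gen_aux[OF I] by blast
  qed
qed

lemma all_two_gen_iff: "all_two_gen R \<longleftrightarrow> C.two_gen_all"
proof
  assume t: "all_two_gen R"
  show "C.two_gen_all" unfolding C.two_gen_all_def
  proof (intro allI impI, elim conjE)
    fix F assume F: "C.submod F" "F \<subseteq> AA"
    obtain I where I: "ideal I R" "F = \<phi> ` I" using submod_ideal F by blast
    have "\<exists>a\<in>carrier R. \<exists>b\<in>carrier R. I = Idl\<^bsub>R\<^esub> {a, b}" using t I(1) unfolding all_two_gen_def by blast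
    then show "\<exists>a\<in>F. \<exists>b\<in>F. F = C.span2 a b" unfolding I(2) using two_gen_aux[OF I(1)] by blast
  qed
next
  assume T: "C.two_gen_all"
  show "all_two_gen R" unfolding all_two_gen_def
  proof (intro allI impI)
    fix I assume I: "ideal I R"
    have "\<exists>a\<in>\<phi> ` I. \<exists>b\<in>\<phi> ` I. \<phi> ` I = C.span2 a b" using T ideal_submod[OF I] unfolding C.two_gen_all_def by blast
    then show "\<exists>a\<in>carrier R. \<exists>b\<in>carrier R. I = Idl\<^bsub>R\<^esub> {a, b}" using two_gen_aux[OF I] by blast
  qed
qed

text \<open>Cancelling powers of \<open>m\<close> turns membership of a fraction into a divisibility
  in \<open>R\<close>; statements about \<open>T\<close> are moved to \<open>R\<close> in this
  way.\<close>

lemma A_div_iff: assumes "a \<in> carrier R"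
  shows "\<phi> m ^ d * (mi ^ j * \<phi> a) \<in> AA \<longleftrightarrow> (\<exists>y\<in>carrier R. m [^] d \<otimes> a = m [^] j \<otimes> y)"
proof -
  have aQ: "\<phi> a \<in> QQ" using assms phi_A by blast
  have 1: "\<phi> m ^ j * (\<phi> m ^ d * (mi ^ j * \<phi> a)) = \<phi> (m [^] d \<otimes> a)"
  proof -
    have "\<phi> m ^ j * (\<phi> m ^ d * (mi ^ j * \<phi> a)) = \<phi> m ^ d * (\<phi> m ^ j * (mi ^ j * \<phi> a))" by (simp only: mult_ac)
    also have "\<dots> = \<phi> m ^ d * \<phi> a" by (simp only: C.minv'[OF aQ])
    finally show ?thesis using phi_pow_mult[of m a d] assms by simp
  qed
  show ?thesis
  proof
    assume "\<phi> m ^ d * (mi ^ j * \<phi> a) \<in> AA"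
    then obtain y where y: "y \<in> carrier R" "\<phi> m ^ d * (mi ^ j * \<phi> a) = \<phi> y" by (rule AA_cases)
    then have "\<phi> (m [^] d \<otimes> a) = \<phi> (m [^] j \<otimes> y)" using 1 phi_pow_mult[of m y j] by simp
    then have "m [^] d \<otimes> a = m [^] j \<otimes> y" using phi_inj assms y by simp
    then show "\<exists>y\<in>carrier R. m [^] d \<otimes> a = m [^] j \<otimes> y" using y by blast
  next
    assume "\<exists>y\<in>carrier R. m [^] d \<otimes> a = m [^] j \<otimes> y"
    then obtain y where y: "y \<in> carrier R" "m [^] d \<otimes> a = m [^] j \<otimes> y" by blast
    then have "\<phi> m ^ j * (\<phi> m ^ d * (mi ^ j * \<phi> a)) = \<phi> m ^ j * \<phi> y" using 1 phi_pow_mult[of m y j] by simp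
    then have "\<phi> m ^ d * (mi ^ j * \<phi> a) = \<phi> y"
      by (rule C.m_cancel) (use aQ phi_A[OF y(1)] C.miQ in \<open>auto intro!: C.Qpow\<close>)
    then show "\<phi> m ^ d * (mi ^ j * \<phi> a) \<in> AA" using phi_A[OF y(1)] by simp
  qed
qed

lemma QQ_form: assumes "q \<in> QQ" shows "\<exists>k. \<exists>a\<in>carrier R. q = mi ^ k * \<phi> a"
proof -
  obtain k where k: "\<phi> m ^ k * q \<in> AA" using C.Qfrac[OF assms] by blast
  then obtain a where a: "a \<in> carrier R" "\<phi> m ^ k * q = \<phi> a" by (rule AA_cases)
  have "q = mi ^ k * (\<phi> m ^ k * q)" using C.minv[OF assms] by simp
  then show ?thesis using a by auto
qed

lemma T_iff: assumes "a \<in> carrier R"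
  shows "mi ^ k * \<phi> a \<in> C.T \<longleftrightarrow> (\<exists>d::nat. \<forall>n::nat. \<exists>y\<in>carrier R. m [^] d \<otimes> a [^] n = m [^] (k * n) \<otimes> y)"
proof -
  have "(mi ^ k * \<phi> a) ^ n * \<phi> \<one> = mi ^ (k * n) * \<phi> (a [^] n)" for n
    using phi_pow[OF assms, of n] by (simp add: power_mult_distrib power_mult mult.assoc)
  then have "\<phi> m ^ d * ((mi ^ k * \<phi> a) ^ n * \<phi> \<one>) \<in> AA \<longleftrightarrow> (\<exists>y\<in>carrier R. m [^] d \<otimes> a [^] n = m [^] (k * n) \<otimes> y)" for d n
    using A_div_iff[of "a [^] n" d "k * n"] assms by simp
  moreover have "mi ^ k * \<phi> a \<in> QQ" using C.Qpow[OF C.miQ C.AQ[OF phi_A[OF assms]]] .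
  ultimately show ?thesis unfolding C.T_def by blast
qed

lemma bounded_iff: "bounded_closure R m \<longleftrightarrow> (\<exists>c. \<forall>q\<in>C.T. \<phi> m ^ c * q \<in> AA)"
proof -
  have "(\<forall>a\<in>carrier R. \<forall>k::nat.
    (\<exists>d::nat. \<forall>n::nat. \<exists>y\<in>carrier R. m [^] d \<otimes> a [^] n = m [^] (k * n) \<otimes> y) \<longrightarrow> (\<exists>y\<in>carrier R. m [^] c \<otimes> a = m [^] k \<otimes> y))
     \<longleftrightarrow> (\<forall>q\<in>C.T. \<phi> m ^ c * q \<in> AA)" (is "?l \<longleftrightarrow> ?r") for c :: nat
  proof
    assume l: ?l
    show ?r
    proof
      fix q assume q: "q \<in> C.T"
      then obtain k a where a: "a \<in> carrier R" "q = mi ^ k * \<phi> a" using QQ_form[of q] by (auto simp: C.T_def)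
      then show "\<phi> m ^ c * q \<in> AA" using l T_iff[OF a(1), of k] A_div_iff[OF a(1), of c k] q by blast
    qed
  next
    assume r: ?r
    show ?l
    proof (intro ballI allI impI)
      fix a and k :: nat assume a: "a \<in> carrier R" "\<exists>d::nat. \<forall>n::nat. \<exists>y\<in>carrier R. m [^] d \<otimes> a [^] n = m [^] (k * n) \<otimes> y"
      then show "\<exists>y\<in>carrier R. m [^] c \<otimes> a = m [^] k \<otimes> y" using r T_iff[OF a(1), of k] A_div_iff[OF a(1), of c k] by blast
    qed
  qed
  then show ?thesis unfolding bounded_closure_def by blast
qed

lemma m_separated_I: assumes "adic_separated R m" shows "C.m_separated"
  unfolding C.m_separated_def
proof (intro ballI impI)
  fix x assume x: "x \<in> AA" "\<forall>k. \<exists>y\<in>AA. x = \<phi> m ^ k * y"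
  obtain a where a: "a \<in> carrier R" "x = \<phi> a" using x(1) by (rule AA_cases)
  have "\<exists>y\<in>carrier R. a = m [^] k \<otimes> y" for k :: nat
  proof -
    obtain y where "y \<in> AA" "x = \<phi> m ^ k * y" using x(2) by blast
    then obtain b where b: "b \<in> carrier R" "x = \<phi> m ^ k * \<phi> b" using AA_cases by metis
    then have "\<phi> a = \<phi> (m [^] k \<otimes> b)" using a phi_pow_mult[of m b k] by simp
    then show ?thesis using phi_inj a b by auto
  qed
  then have "a = \<zero>" using assms a(1) unfolding adic_separated_def by blast
  then show "x = 0" using a phi_zero by simp
qed

lemma m_complete_I: assumes "adic_complete R m" shows "C.m_complete"
  unfolding C.m_complete_def
proof (intro allI impI)
  fix s assume s: "\<forall>n. s n \<in> AA \<and> (\<exists>y\<in>AA. s (Suc n) - s n = \<phi> m ^ n * y)"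
  then have "\<forall>n. \<exists>x\<in>carrier R. s n = \<phi> x" using AA_cases by metis
  then obtain r where r: "\<And>n. r n \<in> carrier R" "\<And>n. s n = \<phi> (r n)" by metis
  have "\<exists>y\<in>carrier R. r (Suc n) = r n \<oplus> m [^] n \<otimes> y" for n :: nat
  proof -
    obtain y where "y \<in> AA" "s (Suc n) - s n = \<phi> m ^ n * y" using s by blast
    then obtain b where b: "b \<in> carrier R" "s (Suc n) - s n = \<phi> m ^ n * \<phi> b" using AA_cases by metis
    then have "s (Suc n) = s n + \<phi> m ^ n * \<phi> b" by (simp add: algebra_simps)
    then have "\<phi> (r (Suc n)) = \<phi> (r n \<oplus> m [^] n \<otimes> b)" using r b phi_pow_mult[of m b n] by (simp add: phi_add)
    then show ?thesis using phi_inj r b by auto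
  qed
  then obtain t where t: "t \<in> carrier R" "\<And>n::nat. \<exists>y\<in>carrier R. t = r n \<oplus> m [^] n \<otimes> y"
    using assms r unfolding adic_complete_def by meson
  have "\<exists>y\<in>AA. \<phi> t - s n = \<phi> m ^ n * y" for n
  proof -
    obtain y where y: "y \<in> carrier R" "t = r n \<oplus> m [^] n \<otimes> y" using t(2) by blast
    then have "\<phi> t = s n + \<phi> m ^ n * \<phi> y" using r phi_pow_mult[of m y n] by (simp add: phi_add)
    then have "\<phi> t - s n = \<phi> m ^ n * \<phi> y" by simp
    then show ?thesis using phi_A y by blast
  qed
  then show "\<exists>t\<in>AA. \<forall>n. \<exists>y\<in>AA. t - s n = \<phi> m ^ n * y" using phi_A t(1) by blast
qed

lemma reduced_I: assumes "adic_separated R m" "bounded_closure R m" shows "reduced R"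
  unfolding reduced_def
proof (intro ballI allI impI)
  fix a and n :: nat assume a: "a \<in> carrier R" "a [^] n = \<zero>"
  obtain c where c: "\<And>q. q \<in> C.T \<Longrightarrow> \<phi> m ^ c * q \<in> AA" using assms(2) bounded_iff by blast
  have "\<phi> a ^ n * \<phi> \<one> = 0" using phi_pow[OF a(1), of n] a(2) phi_zero by simp
  then have "\<phi> a = 0" using C.bounded_reduced[OF m_separated_I[OF assms(1)] c phi_A[OF a(1)]] by blast
  then show "a = \<zero>" using phi_inj[OF a(1), of \<zero>] phi_zero by simp
qed

lemma complete_all_two_gen:
  assumes "adic_separated R m" "adic_complete R m" "two_gen R m" shows "all_two_gen R"
  using C.two_gen_reg_nakayama_two_gen_all C.m_complete_nakayama m_separated_I m_complete_I two_gen_iff all_two_gen_iff assms by blast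

text \<open>Separatedness and boundedness make \<open>R\<close> reduced, so the exponent
  \<open>n\<close> in \<open>pi\<close> can be lowered to one: \<open>a (m^j - a x)\<close> is
  nilpotent, hence zero. That is the form in which the Nakayama property uses it.\<close>

lemma pi_regular_all_two_gen:
  assumes "adic_separated R m" "bounded_closure R m" "two_gen R m"
    and pi: "\<And>a. a \<in> carrier R \<Longrightarrow> \<exists>(j::nat) (n::nat). \<exists>x\<in>carrier R. m [^] j \<otimes> a [^] n = a [^] Suc n \<otimes> x"
  shows "all_two_gen R"
proof -
  have red: "reduced R" by (rule reduced_I[OF assms(1,2)])
  have "\<exists>j. \<exists>x\<in>AA. \<phi> m ^ j * u = u * u * x" if u: "u \<in> AA" for u
  proof -
    obtain a where a: "a \<in> carrier R" "u = \<phi> a" using u by (rule AA_cases)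
    obtain j n :: nat and x where x: "x \<in> carrier R" "m [^] j \<otimes> a [^] n = a [^] Suc n \<otimes> x" using pi[OF a(1)] by blast
    let ?f = "m [^] j \<ominus> a \<otimes> x"
    have "a [^] n \<otimes> ?f = a [^] n \<otimes> m [^] j \<ominus> a [^] n \<otimes> (a \<otimes> x)" using a x by (simp add: a_minus_def r_distr r_minus)
    also have "a [^] n \<otimes> (a \<otimes> x) = m [^] j \<otimes> a [^] n" using a x by (simp add: m_assoc)
    finally have 0: "a [^] n \<otimes> ?f = \<zero>" using a x by (simp add: m_comm a_minus_def r_neg)
    have "(a \<otimes> ?f) [^] Suc n = (a [^] n \<otimes> ?f) \<otimes> (a \<otimes> ?f [^] n)"
      using a x by (simp add: nat_pow_distrib m_ac)
    then have "(a \<otimes> ?f) [^] Suc n = \<zero>" using 0 a x by simp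
    moreover have "a \<otimes> ?f \<in> carrier R" using a x by simp
    ultimately have "a \<otimes> ?f = \<zero>" by (rule red[unfolded reduced_def, rule_format, rotated])
    then have "\<phi> a * (\<phi> (m [^] j) - \<phi> a * \<phi> x) = 0" using a x phi_zero phi_mult[of a ?f] by (simp add: phi_minus phi_mult)
    moreover have "\<phi> a * \<phi> (m [^] j) = \<phi> m ^ j * \<phi> a" using phi_pow_mult[of m a j] a phi_mult[of "m [^] j" a] by (simp add: mult.commute)
    ultimately have "\<phi> m ^ j * u = u * u * \<phi> x" unfolding a(2) by (simp add: algebra_simps)
    then show ?thesis using phi_A x by blast
  qed
  then have "C.nakayama" using C.m_separated_vN_nakayama[OF m_separated_I[OF assms(1)]] by blast
  then show ?thesis using C.two_gen_reg_nakayama_two_gen_all two_gen_iff all_two_gen_iff assms by blast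
qed

text \<open>An inverse of \<open>r\<close> in \<open>R[1/m]\<close>, cleared of its denominator
  \<open>m^k\<close>, exhibits \<open>m^k\<close> as a multiple of \<open>r\<close>.\<close>

lemma complete_nzd_divides:
  assumes "adic_separated R m" "adic_complete R m" "two_gen R m" "bounded_closure R m" shows "nzd_divides R m"
  unfolding nzd_divides_def
proof (intro allI impI)
  fix r assume r: "nzd R r"
  have rc: "r \<in> carrier R" using r by simp
  obtain c where c: "\<And>q. q \<in> C.T \<Longrightarrow> \<phi> m ^ c * q \<in> AA" using assms(4) bounded_iff by blast
  have "\<exists>y\<in>QQ. \<phi> r * y = \<phi> \<one>"
  proof (rule C.nakayama_nzd_unit[OF _ _ c])
    show "C.two_gen_reg" "C.two_gen_all" using complete_all_two_gen[OF assms(1-3)] assms(3) two_gen_iff all_two_gen_iff by auto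
    show "\<phi> r \<in> AA" using phi_A rc .
    fix x assume x: "x \<in> AA" "\<phi> r * x = 0"
    obtain a where a: "a \<in> carrier R" "x = \<phi> a" using x(1) by (rule AA_cases)
    then have "\<phi> (r \<otimes> a) = \<phi> \<zero>" using x rc by (simp add: phi_mult phi_zero)
    then have "r \<otimes> a = \<zero>" using phi_inj[of "r \<otimes> a" \<zero>] rc a by simp
    then have "a = \<zero>" using r a(1) unfolding nzd_def by blast
    then show "x = 0" using a(2) phi_zero by simp
  qed
  then obtain y where y: "y \<in> QQ" "\<phi> r * y = \<phi> \<one>" by blast
  obtain k where k: "\<phi> m ^ k * y \<in> AA" using C.Qfrac[OF y(1)] by blast
  then obtain b where b: "b \<in> carrier R" "\<phi> m ^ k * y = \<phi> b" by (rule AA_cases)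
  have "\<phi> r * \<phi> b = \<phi> m ^ k * (\<phi> r * y)" unfolding b(2)[symmetric] by (simp add: mult_ac)
  then have "\<phi> (r \<otimes> b) = \<phi> (m [^] k)" using y(2) rc b by (simp add: phi_mult phi_pow)
  then have "m [^] k = r \<otimes> b" using phi_inj[of "r \<otimes> b" "m [^] k"] rc b by simp
  then show "\<exists>k::nat. \<exists>y\<in>carrier R. m [^] k = r \<otimes> y" using b by blast
qed

end

context local_subring begin

text \<open>\<open>F\<close> and \<open>m^k F\<close> have the same endomorphism ring; the dual
  basis is transported by dividing the elements \<open>y\<close> by \<open>m^k\<close> and
  multiplying the \<open>b y\<close> by \<open>m^k\<close>.\<close>

lemma inv_frac_scale: assumes F: "submod F" and inv: "inv_frac ((\<lambda>x. m ^ k * x) ` F)" shows "inv_frac F"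
proof -
  note F' = submodD[OF F]
  let ?G = "(\<lambda>x. m ^ k * x) ` F"
  have endo: "endo ?G = endo F"
  proof -
    have "m ^ k * (q * x) \<in> ?G \<longleftrightarrow> q * x \<in> F" if q: "q \<in> Q" "x \<in> F" for q x
    proof
      assume "m ^ k * (q * x) \<in> ?G"
      then obtain y where y: "y \<in> F" "m ^ k * (q * x) = m ^ k * y" by blast
      then have "q * x = y" using m_cancel[OF y(2)] q F'(1) by blast
      then show "q * x \<in> F" using y by simp
    qed blast
    then show ?thesis unfolding endo_def by (auto simp: mult.left_commute)
  qed
  obtain Y b where Y: "finite Y" "Y \<subseteq> ?G" "\<And>y. y \<in> Y \<Longrightarrow> b y \<in> Q" "\<And>y x. y \<in> Y \<Longrightarrow> x \<in> ?G \<Longrightarrow> b y * x \<in> endo ?G" "(\<Sum>y\<in>Y. b y * y) = e"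
    using inv unfolding inv_frac_def by blast
  have YQ: "y \<in> Q" if "y \<in> Y" for y using that Y(2) F'(1) by auto
  let ?h = "\<lambda>y. mi ^ k * y"
  have inj: "inj_on ?h Y" by (rule inj_onI) (metis YQ minv')
  have hm: "m ^ k * ?h y = y" if "y \<in> Y" for y using minv'[OF YQ[OF that]] .
  show ?thesis unfolding inv_frac_def
  proof (intro exI[of _ "?h ` Y"] exI[of _ "\<lambda>z. m ^ k * b (m ^ k * z)"] conjI ballI)
    show "finite (?h ` Y)" using Y(1) by simp
    show "?h ` Y \<subseteq> F"
    proof
      fix z assume "z \<in> ?h ` Y"
      then obtain y where y: "y \<in> Y" "z = ?h y" by blast
      then obtain x where "x \<in> F" "y = m ^ k * x" using Y(2) by blast
      then show "z \<in> F" using y minv[of x k] F'(1) by simp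
    qed
    fix z assume "z \<in> ?h ` Y"
    then obtain y where y: "y \<in> Y" "z = ?h y" by blast
    have bz: "b (m ^ k * z) = b y" using hm[OF y(1)] y(2) by simp
    show "m ^ k * b (m ^ k * z) \<in> Q" unfolding bz using Y(3)[OF y(1)] by simp
    fix x assume x: "x \<in> F"
    have "b y * (m ^ k * x) \<in> endo F" using Y(4)[OF y(1)] x endo by blast
    then show "m ^ k * b (m ^ k * z) * x \<in> endo F" unfolding bz by (simp add: mult_ac)
  next
    have "(\<Sum>z\<in>?h ` Y. m ^ k * b (m ^ k * z) * z) = (\<Sum>y\<in>Y. m ^ k * b (m ^ k * ?h y) * ?h y)"
      by (rule sum.reindex_cong[OF inj]) auto
    also have "\<dots> = (\<Sum>y\<in>Y. b y * y)"
    proof (rule sum.cong[OF refl])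
      fix y assume y: "y \<in> Y"
      have "m ^ k * b (m ^ k * ?h y) * ?h y = b (m ^ k * ?h y) * (m ^ k * ?h y)" by (simp only: mult_ac)
      then show "m ^ k * b (m ^ k * ?h y) * ?h y = b y * y" by (simp only: hm[OF y])
    qed
    finally show "(\<Sum>z\<in>?h ` Y. m ^ k * b (m ^ k * z) * z) = e" using Y(5) by simp
  qed
qed

end

section \<open>Integral closure and stability in the total ring of quotients\<close>

context param_ring begin

interpretation TQ: cring QR by (rule total_quot_cring)

lemma E_QQ: "x \<in> QQ \<Longrightarrow> \<exists>q\<in>carrier QR. x = E q" unfolding QQ_def by blast

lemma E_pow: "q \<in> carrier QR \<Longrightarrow> E (q [^]\<^bsub>QR\<^esub> (n::nat)) = E q ^ n * \<phi> \<one>"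
proof (induction n)
  case 0 then show ?case by (simp add: E_one)
next
  case (Suc n)
  then have "E (q [^]\<^bsub>QR\<^esub> Suc n) = (E q ^ n * \<phi> \<one>) * E q" by (simp add: E_mult)
  then show ?case by (simp add: mult_ac)
qed

lemma E_sum: "finite I \<Longrightarrow> (\<And>i. i \<in> I \<Longrightarrow> f i \<in> carrier QR) \<Longrightarrow> E (\<Oplus>\<^bsub>QR\<^esub>i\<in>I. f i) = (\<Sum>i\<in>I. E (f i))"
proof (induction I rule: finite_induct)
  case empty then show ?case by (simp add: E_zero)
next
  case (insert i I)
  then have "(\<Oplus>\<^bsub>QR\<^esub>i\<in>insert i I. f i) = f i \<oplus>\<^bsub>QR\<^esub> (\<Oplus>\<^bsub>QR\<^esub>i\<in>I. f i)" by (intro TQ.finsum_insert) auto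
  moreover have "(\<Oplus>\<^bsub>QR\<^esub>i\<in>I. f i) \<in> carrier QR" using insert by (intro TQ.finsum_closed) auto
  ultimately show ?case using insert by (simp add: E_add)
qed

lemma E_integral_eq:
  assumes q: "q \<in> carrier QR" and c: "\<And>i. c i \<in> carrier R"
  shows "q [^]\<^bsub>QR\<^esub> n \<oplus>\<^bsub>QR\<^esub> (\<Oplus>\<^bsub>QR\<^esub>i\<in>{..<n::nat}. frac_emb R (c i) \<otimes>\<^bsub>QR\<^esub> q [^]\<^bsub>QR\<^esub> i) = \<zero>\<^bsub>QR\<^esub> \<longleftrightarrow>
    E q ^ n * \<phi> \<one> + (\<Sum>i<n. \<phi> (c i) * E q ^ i) = 0" (is "?x = _ \<longleftrightarrow> _")
proof -
  let ?f = "\<lambda>i. frac_emb R (c i) \<otimes>\<^bsub>QR\<^esub> q [^]\<^bsub>QR\<^esub> i"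
  have cl: "?f i \<in> carrier QR" for i using q c frac_emb_closed by simp
  have sc: "(\<Oplus>\<^bsub>QR\<^esub>i\<in>{..<n}. ?f i) \<in> carrier QR" using cl by (intro TQ.finsum_closed) auto
  have "E (?f i) = \<phi> (c i) * E q ^ i" for i
  proof -
    have "E (?f i) = \<phi> (c i) * (E q ^ i * \<phi> \<one>)" using q c frac_emb_closed by (simp add: E_mult E_pow \<phi>_def)
    then show ?thesis using c phi_A by (simp add: mult_ac)
  qed
  then have "E ?x = E q ^ n * \<phi> \<one> + (\<Sum>i<n. \<phi> (c i) * E q ^ i)"
    using q sc cl by (simp add: E_add E_pow E_sum)
  moreover have "?x \<in> carrier QR" using q sc by simp
  then have "?x = \<zero>\<^bsub>QR\<^esub> \<longleftrightarrow> E ?x = 0" using E_inj[of ?x "\<zero>\<^bsub>QR\<^esub>"] E_zero by simp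
  ultimately show ?thesis by simp
qed

lemma int_closure_iff: assumes q: "q \<in> carrier QR" shows "q \<in> int_closure R \<longleftrightarrow> C.integral (E q)"
proof
  assume "q \<in> int_closure R"
  then obtain n :: nat and c where c: "\<And>i. c i \<in> carrier R"
    and eq: "q [^]\<^bsub>QR\<^esub> n \<oplus>\<^bsub>QR\<^esub> (\<Oplus>\<^bsub>QR\<^esub>i\<in>{..<n}. frac_emb R (c i) \<otimes>\<^bsub>QR\<^esub> q [^]\<^bsub>QR\<^esub> i) = \<zero>\<^bsub>QR\<^esub>"
    unfolding int_closure_def by blast
  have "E q ^ n * \<phi> \<one> + (\<Sum>i<n. \<phi> (c i) * E q ^ i) = 0" using E_integral_eq[of q c n, OF q c] eq by blast
  then show "C.integral (E q)" unfolding C.integral_def using phi_A c by (intro exI[of _ n] exI[of _ "\<lambda>i. \<phi> (c i)"]) auto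
next
  assume "C.integral (E q)"
  then obtain n d where d: "\<forall>i. d i \<in> AA" and eq: "E q ^ n * \<phi> \<one> + (\<Sum>i<n. d i * E q ^ i) = 0" unfolding C.integral_def by blast
  have "\<forall>i. \<exists>x\<in>carrier R. d i = \<phi> x" using d AA_cases by metis
  then obtain c where c: "\<And>i. c i \<in> carrier R" "\<And>i. d i = \<phi> (c i)" by metis
  have "n > 0" using eq C.e_ne_0 by (cases n) auto
  moreover have "q [^]\<^bsub>QR\<^esub> n \<oplus>\<^bsub>QR\<^esub> (\<Oplus>\<^bsub>QR\<^esub>i\<in>{..<n}. frac_emb R (c i) \<otimes>\<^bsub>QR\<^esub> q [^]\<^bsub>QR\<^esub> i) = \<zero>\<^bsub>QR\<^esub>"
    using E_integral_eq[of q c n, OF q c(1)] eq c(2) by simp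
  ultimately show "q \<in> int_closure R" unfolding int_closure_def using q c(1) by blast
qed

lemma QQ_full: assumes "nzd_divides R m" "q \<in> carrier QR" shows "E q \<in> QQ"
proof -
  obtain a s where as: "a \<in> carrier R" "nzd R s" "q = frac_class R a s" using TQ_cases assms(2) by blast
  obtain k :: nat and y where y: "y \<in> carrier R" "m [^] k = s \<otimes> y" using assms(1) as unfolding nzd_divides_def by blast
  have "frac_emb R (m [^] k) \<otimes>\<^bsub>QR\<^esub> q = frac_emb R (a \<otimes> y)"
  proof -
    have "frac_class R (m [^] k) \<one> \<otimes>\<^bsub>QR\<^esub> frac_class R a s = frac_class R (m [^] k \<otimes> a) (\<one> \<otimes> s)"
      using as nzd_one by (intro TQ_mult) auto
    also have "\<dots> = frac_class R (a \<otimes> y) \<one>" using as y nzd_one by (subst frac_class_eq) (auto simp: m_ac)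
    finally show ?thesis unfolding frac_emb_def as(3) .
  qed
  then have "\<phi> (m [^] k) * E q = \<phi> (a \<otimes> y)" unfolding \<phi>_def using assms(2) frac_emb_closed[of "m [^] k"] by (simp add: E_mult[symmetric])
  then have "\<phi> m ^ k * E q = \<phi> (a \<otimes> y)" using E_unit[OF assms(2)] by (simp add: phi_pow mult.assoc)
  then have "\<phi> m ^ k * E q \<in> AA" using phi_A as y by simp
  then show ?thesis unfolding QQ_def using assms(2) by blast
qed

text \<open>A nonzerodivisor clears the denominators of a finite generating set of the integral closure.\<close>
lemma finite_closure_denominator:
  assumes "finite_int_closure R"
  shows "\<exists>r. nzd R r \<and> (\<forall>q\<in>int_closure R. \<phi> r * E q \<in> AA)"
proof -
  obtain S where S: "finite S" "S \<subseteq> int_closure R"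
    and gen: "\<And>q. q \<in> int_closure R \<Longrightarrow> \<exists>r. (\<forall>s\<in>S. r s \<in> carrier R) \<and> q = (\<Oplus>\<^bsub>QR\<^esub>s\<in>S. frac_emb R (r s) \<otimes>\<^bsub>QR\<^esub> s)"
    using assms unfolding finite_int_closure_def by meson
  have Sc: "S \<subseteq> carrier QR" using S unfolding int_closure_def by blast
  have claim: "finite Z \<Longrightarrow> Z \<subseteq> S \<Longrightarrow> \<exists>r. nzd R r \<and> (\<forall>s\<in>Z. \<phi> r * E s \<in> AA)" for Z
  proof (induction Z rule: finite_induct)
    case empty then show ?case using nzd_one by blast
  next
    case (insert s Z)
    then obtain r where r: "nzd R r" "\<forall>s\<in>Z. \<phi> r * E s \<in> AA" by auto
    obtain a t where at: "a \<in> carrier R" "nzd R t" "s = frac_class R a t" using TQ_cases insert.prems Sc by (metis insert_subset subsetD)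
    have "frac_emb R t \<otimes>\<^bsub>QR\<^esub> s = frac_emb R a"
    proof -
      have "frac_class R t \<one> \<otimes>\<^bsub>QR\<^esub> frac_class R a t = frac_class R (t \<otimes> a) (\<one> \<otimes> t)" using at nzd_one by (intro TQ_mult) auto
      also have "\<dots> = frac_class R a \<one>" using at nzd_one by (subst frac_class_eq) (auto simp: m_ac)
      finally show ?thesis unfolding frac_emb_def at(3) .
    qed
    then have 1: "\<phi> t * E s = \<phi> a" unfolding \<phi>_def using insert.prems Sc at frac_emb_closed[of t] by (simp add: E_mult[symmetric] subset_iff)
    have "\<phi> (r \<otimes> t) * E s' \<in> AA" if "s' \<in> insert s Z" for s'
    proof (cases "s' = s")
      case True
      have "\<phi> (r \<otimes> t) * E s = \<phi> r * \<phi> a" using r at 1 by (simp add: phi_mult mult.assoc)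
      then show ?thesis using True phi_A r at by auto
    next
      case False
      have "\<phi> (r \<otimes> t) * E s' = \<phi> t * (\<phi> r * E s')" using r at by (simp add: phi_mult mult_ac)
      then show ?thesis using False that r phi_A at by auto
    qed
    then show ?case using nzd_mult[OF r(1) at(2)] by blast
  qed
  from claim[OF S(1) subset_refl] obtain r where r: "nzd R r" "\<And>s. s \<in> S \<Longrightarrow> \<phi> r * E s \<in> AA" by blast
  have "\<phi> r * E q \<in> AA" if q: "q \<in> int_closure R" for q
  proof -
    obtain f where f: "\<And>s. s \<in> S \<Longrightarrow> f s \<in> carrier R" "q = (\<Oplus>\<^bsub>QR\<^esub>s\<in>S. frac_emb R (f s) \<otimes>\<^bsub>QR\<^esub> s)" using gen[OF q] by blast
    have "E q = (\<Sum>s\<in>S. \<phi> (f s) * E s)" unfolding f(2)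
      using S(1) Sc f(1) frac_emb_closed by (subst E_sum) (auto simp: E_mult \<phi>_def subset_iff)
    then have "\<phi> r * E q = (\<Sum>s\<in>S. \<phi> (f s) * (\<phi> r * E s))" by (simp add: sum_distrib_left mult_ac)
    moreover have "finite Z \<Longrightarrow> Z \<subseteq> S \<Longrightarrow> (\<Sum>s\<in>Z. \<phi> (f s) * (\<phi> r * E s)) \<in> AA" for Z
      by (induction Z rule: finite_induct) (use r(2) f(1) phi_A in auto)
    ultimately show ?thesis using S(1) by simp
  qed
  then show ?thesis using r by blast
qed

lemma two_gen_reg_T_int_closure: assumes "C.endo_principal" "u \<in> C.T" shows "\<exists>q\<in>int_closure R. u = E q"
proof -
  have "C.integral u" by (rule C.endo_principal_T_integral[OF assms])
  moreover obtain q where "q \<in> carrier QR" "u = E q" using E_QQ assms(2) by (auto simp: C.T_def)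
  ultimately show ?thesis using int_closure_iff by auto
qed

text \<open>The common denominator \<open>r\<close> of the integral closure is not known to divide a
  power of \<open>m\<close>, so it only serves to move \<open>T\<close> into the ring:
  \<open>rT\<close> is an ideal, generated by some \<open>r s\<close> and \<open>r t\<close>. Then
  \<open>T = As + At\<close>, and powers of \<open>m\<close> clearing \<open>s\<close> and
  \<open>t\<close> clear all of \<open>T\<close>.\<close>

lemma all_two_gen_bounded:
  assumes "all_two_gen R" "finite_int_closure R" shows "bounded_closure R m"
proof -
  have two: "C.two_gen_reg" and all: "C.two_gen_all" using assms(1) two_gen_iff all_two_gen_iff unfolding two_gen_def all_two_gen_def by blast+
  have P: "C.endo_principal" by (rule C.two_gen_reg_endo_principal[OF two])
  obtain r where r: "nzd R r" "\<And>q. q \<in> int_closure R \<Longrightarrow> \<phi> r * E q \<in> AA" using finite_closure_denominator[OF assms(2)] by blast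
  note T' = C.subrD[OF C.T_subr]
  have rQ: "x = 0" if x: "x \<in> QQ" "\<phi> r * x = 0" for x
  proof -
    obtain k where k: "\<phi> m ^ k * x \<in> AA" using C.Qfrac[OF x(1)] by blast
    then obtain y where y: "y \<in> carrier R" "\<phi> m ^ k * x = \<phi> y" by (rule AA_cases)
    have "\<phi> r * \<phi> y = \<phi> m ^ k * (\<phi> r * x)" unfolding y(2)[symmetric] by (simp add: mult_ac)
    then have "\<phi> (r \<otimes> y) = \<phi> \<zero>" using x(2) r y by (simp add: phi_mult phi_zero)
    then have "r \<otimes> y = \<zero>" using phi_inj[of "r \<otimes> y" \<zero>] r y by simp
    then have "y = \<zero>" using r(1) y(1) unfolding nzd_def by blast
    then have "\<phi> m ^ k * x = \<phi> m ^ k * 0" using y phi_zero by simp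
    then show ?thesis by (rule C.m_cancel) (use x in auto)
  qed
  let ?F = "(\<lambda>t. \<phi> r * t) ` C.T"
  have FA: "?F \<subseteq> AA" using r(2) two_gen_reg_T_int_closure[OF P] by blast
  have "C.submod ?F" unfolding C.submod_def
  proof (intro conjI ballI)
    show "?F \<subseteq> QQ" using FA by auto
    show "0 \<in> ?F" using T'(2)[OF C.A0] by (intro image_eqI[of _ _ 0]) auto
    fix x y assume "x \<in> ?F" "y \<in> ?F"
    then obtain s t where st: "s \<in> C.T" "t \<in> C.T" "x = \<phi> r * s" "y = \<phi> r * t" by blast
    then show "x + y \<in> ?F" using T'(3)[OF st(1,2)] by (intro image_eqI[of _ _ "s + t"]) (auto simp: distrib_left)
  next
    fix a x assume "a \<in> AA" "x \<in> ?F"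
    then obtain s where s: "s \<in> C.T" "x = \<phi> r * s" by blast
    show "a * x \<in> ?F" using T'(4)[OF T'(2)[OF \<open>a \<in> AA\<close>] s(1)] s(2) by (intro image_eqI[of _ _ "a * s"]) (auto simp: mult_ac)
  qed
  then obtain g h where gh: "g \<in> ?F" "h \<in> ?F" "?F = C.span2 g h" using all FA unfolding C.two_gen_all_def by meson
  obtain s t where st: "s \<in> C.T" "t \<in> C.T" "g = \<phi> r * s" "h = \<phi> r * t" using gh(1,2) by blast
  obtain k where k: "\<phi> m ^ k * s \<in> AA" using C.Qfrac T'(1)[OF st(1)] by blast
  obtain l where l: "\<phi> m ^ l * t \<in> AA" using C.Qfrac T'(1)[OF st(2)] by blast
  have "\<phi> m ^ (k + l) * q \<in> AA" if q: "q \<in> C.T" for q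
  proof -
    have "\<phi> r * q \<in> C.span2 g h" using q gh(3) by blast
    then obtain u v where uv: "u \<in> AA" "v \<in> AA" "\<phi> r * q = u * g + v * h" unfolding C.span2_def by blast
    then have "\<phi> r * (q - (u * s + v * t)) = 0" unfolding st(3,4) by (simp add: algebra_simps)
    moreover have "q - (u * s + v * t) \<in> QQ" using T'(1)[OF q] T'(1)[OF st(1)] T'(1)[OF st(2)] uv by auto
    ultimately have "q - (u * s + v * t) = 0" by (rule rQ[rotated])
    then have "q = u * s + v * t" by simp
    then have "\<phi> m ^ (k + l) * q = (\<phi> m ^ l * u) * (\<phi> m ^ k * s) + (\<phi> m ^ k * v) * (\<phi> m ^ l * t)" by (simp add: power_add algebra_simps)
    then show ?thesis using AA_closed(1,3,4) uv k l by simp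
  qed
  then show ?thesis using bounded_iff by blast
qed

text \<open>Here the common denominator \<open>r\<close> divides some \<open>m^k\<close>, and this
  exponent bounds \<open>T\<close>.\<close>

lemma nzd_divides_bounded:
  assumes "C.endo_principal" "finite_int_closure R" "nzd_divides R m" shows "bounded_closure R m"
proof -
  obtain r where r: "nzd R r" "\<And>q. q \<in> int_closure R \<Longrightarrow> \<phi> r * E q \<in> AA" using finite_closure_denominator[OF assms(2)] by blast
  obtain k :: nat and y where y: "y \<in> carrier R" "m [^] k = r \<otimes> y" using assms(3) r(1) unfolding nzd_divides_def by blast
  have "\<phi> m ^ k * u \<in> AA" if u: "u \<in> C.T" for u
  proof -
    obtain q where q: "q \<in> int_closure R" "u = E q" using two_gen_reg_T_int_closure[OF assms(1) u] by blast
    have uQ: "u \<in> QQ" using u by (simp add: C.T_def)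
    have "\<phi> m ^ k * u = (\<phi> m ^ k * \<phi> \<one>) * u" using uQ by (simp add: mult.assoc)
    also have "\<phi> m ^ k * \<phi> \<one> = \<phi> r * \<phi> y" using phi_pow[of m k] y nzd_closed[OF r(1)] by (simp add: phi_mult)
    also have "\<phi> r * \<phi> y * u = \<phi> y * (\<phi> r * u)" by (simp only: mult_ac)
    finally show ?thesis using r(2)[OF q(1)] q(2) phi_A[OF y(1)] by simp
  qed
  then show ?thesis using bounded_iff by blast
qed

text \<open>As \<open>Q(R) = R[1/m]\<close>, the integral closure is exactly \<open>T\<close>. By
  boundedness \<open>T\<close> is a fractional ideal, and its two generators as a module generate
  the closure.\<close>

lemma bounded_finite_closure:
  assumes "two_gen R m" "bounded_closure R m" "nzd_divides R m" shows "finite_int_closure R"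
proof -
  have two: "C.two_gen_reg" using assms(1) two_gen_iff by blast
  obtain c where c: "\<And>q. q \<in> C.T \<Longrightarrow> \<phi> m ^ c * q \<in> AA" using assms(2) bounded_iff by blast
  note T' = C.subrD[OF C.T_subr]
  have "C.submod C.T" unfolding C.submod_def using T'(1-4) T'(2)[OF C.A0] by blast
  moreover have "\<phi> m ^ 0 * \<phi> \<one> \<in> C.T" using T'(2)[OF C.Ae] by simp
  ultimately have "C.fractional C.T" unfolding C.fractional_def C.bdd_def C.reg_def using c by blast
  then obtain t1 t2 where t: "t1 \<in> C.T" "t2 \<in> C.T" "C.T = C.span2 t1 t2" using C.two_gen_reg_frac[OF two] by blast
  obtain s1 where s1: "s1 \<in> int_closure R" "t1 = E s1" using two_gen_reg_T_int_closure[OF C.two_gen_reg_endo_principal[OF two] t(1)] by blast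
  obtain s2 where s2: "s2 \<in> int_closure R" "t2 = E s2" using two_gen_reg_T_int_closure[OF C.two_gen_reg_endo_principal[OF two] t(2)] by blast
  have sc: "s1 \<in> carrier QR" "s2 \<in> carrier QR" using s1 s2 unfolding int_closure_def by auto
  show ?thesis unfolding finite_int_closure_def
  proof (intro exI[of _ "{s1, s2}"] conjI ballI)
    show "finite {s1, s2}" "{s1, s2} \<subseteq> int_closure R" using s1 s2 by auto
    fix q assume q: "q \<in> int_closure R"
    have qc: "q \<in> carrier QR" using q unfolding int_closure_def by blast
    have "E q \<in> C.T" using C.integral_T[OF QQ_full[OF assms(3) qc]] int_closure_iff[OF qc] q by blast
    then obtain u v where uv: "u \<in> AA" "v \<in> AA" "E q = u * t1 + v * t2" using t(3) unfolding C.span2_def by blast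
    obtain a where a: "a \<in> carrier R" "u = \<phi> a" using uv(1) by (rule AA_cases)
    obtain b where b: "b \<in> carrier R" "v = \<phi> b" using uv(2) by (rule AA_cases)
    show "\<exists>r. (\<forall>s\<in>{s1, s2}. r s \<in> carrier R) \<and> q = (\<Oplus>\<^bsub>QR\<^esub>s\<in>{s1, s2}. frac_emb R (r s) \<otimes>\<^bsub>QR\<^esub> s)"
    \<comment> \<open>If the two generators coincide, the sum over the set has a single term, and
      the two coefficients have to be added.\<close>
    proof (cases "s1 = s2")
      case True
      have "E q = E (frac_emb R (a \<oplus> b) \<otimes>\<^bsub>QR\<^esub> s1)"
        using uv(3) a b s1 s2 True sc frac_emb_closed by (simp add: E_mult \<phi>_def[symmetric] phi_add distrib_right)
      then have "q = frac_emb R (a \<oplus> b) \<otimes>\<^bsub>QR\<^esub> s1" using E_inj qc sc a b frac_emb_closed by simp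
      then show ?thesis using True a b sc frac_emb_closed by (intro exI[of _ "\<lambda>_. a \<oplus> b"]) (simp add: TQ.finsum_insert)
    next
      case False
      have "E q = E (frac_emb R a \<otimes>\<^bsub>QR\<^esub> s1 \<oplus>\<^bsub>QR\<^esub> frac_emb R b \<otimes>\<^bsub>QR\<^esub> s2)"
        using uv(3) a b s1 s2 sc frac_emb_closed by (simp add: E_mult E_add \<phi>_def[symmetric])
      then have "q = frac_emb R a \<otimes>\<^bsub>QR\<^esub> s1 \<oplus>\<^bsub>QR\<^esub> frac_emb R b \<otimes>\<^bsub>QR\<^esub> s2" using E_inj qc sc a b frac_emb_closed by simp
      then show ?thesis using False a b sc frac_emb_closed
        by (intro exI[of _ "\<lambda>s. if s = s1 then a else b"]) (simp add: TQ.finsum_insert)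
    qed
  qed
qed

text \<open>The section \<open>s\<close> of the projective module yields the dual basis. At
  \<open>x = m^(k+l)\<close> it has finite support, and its coordinate functional at
  \<open>y\<close> is multiplication by \<open>b y = s x y / x\<close>. The relation
  \<open>x = \<Sum> s x y * y\<close>, divided by \<open>x\<close>, becomes
  \<open>e = \<Sum> b y * y\<close>.\<close>

lemma stable_inv_frac:
  assumes st: "stable_ring R" and nd: "nzd_divides R m" and F: "C.fractional F" shows "C.inv_frac F"
proof -
  have sF: "C.submod F" using F by (simp add: C.fractional_def)
  obtain k l where k: "\<And>x. x \<in> F \<Longrightarrow> \<phi> m ^ k * x \<in> AA" and l: "\<phi> m ^ l * \<phi> \<one> \<in> F"
    using F by (auto simp: C.fractional_def C.bdd_def C.reg_def)
  note F' = C.submodD[OF sF]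
  let ?G = "(\<lambda>x. \<phi> m ^ k * x) ` F"
  have Gs: "C.submod ?G" unfolding C.submod_def
  proof (intro conjI ballI)
    show "?G \<subseteq> QQ" using k by auto
    show "0 \<in> ?G" using F'(2) by (intro image_eqI[of _ _ 0]) auto
    fix x y assume "x \<in> ?G" "y \<in> ?G"
    then obtain s t where "s \<in> F" "t \<in> F" "x = \<phi> m ^ k * s" "y = \<phi> m ^ k * t" by blast
    then show "x + y \<in> ?G" using F'(3) by (intro image_eqI[of _ _ "s + t"]) (auto simp: distrib_left)
  next
    fix a x assume a: "a \<in> AA" "x \<in> ?G"
    then obtain s where s: "s \<in> F" "x = \<phi> m ^ k * s" by blast
    show "a * x \<in> ?G" using F'(4)[OF a(1) s(1)] s(2) by (intro image_eqI[of _ _ "a * s"]) (auto simp: mult_ac)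
  qed
  have GA: "?G \<subseteq> AA" using k by blast
  from submod_ideal[OF Gs GA] obtain I where I: "ideal I R" "?G = \<phi> ` I" by (elim exE conjE) (rule that)
  interpret I: ideal I R by (rule I(1))
  have "\<phi> m ^ k * (\<phi> m ^ l * \<phi> \<one>) \<in> ?G" using l by blast
  then have "\<phi> m ^ (k + l) * \<phi> \<one> \<in> ?G" by (simp add: power_add mult.assoc)
  then have j: "m [^] (k + l) \<in> I" unfolding I(2) using phi_inj I.Icarr by (auto simp: phi_pow[symmetric] image_iff)
  let ?N = "frac_emb R ` I"
  let ?x = "frac_emb R (m [^] (k + l))"
  have "regular_ideal R I" unfolding regular_ideal_def using I(1) j nzd_pow[OF nzd_m] by blast
  then have "projective_in QR (endo_ring R ?N) ?N" using st unfolding stable_ring_def stable_ideal_def by blast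
  then obtain s where s0: "\<forall>x\<in>?N. \<forall>y\<in>?N. s x y \<in> endo_ring R ?N"
    "\<forall>x\<in>?N. finite {y \<in> ?N. s x y \<noteq> \<zero>\<^bsub>QR\<^esub>}"
    "\<forall>w\<in>endo_ring R ?N. \<forall>x\<in>?N. \<forall>y\<in>?N. s (w \<otimes>\<^bsub>QR\<^esub> x) y = w \<otimes>\<^bsub>QR\<^esub> s x y"
    "\<forall>x\<in>?N. x = (\<Oplus>\<^bsub>QR\<^esub>y\<in>{y\<in>?N. s x y \<noteq> \<zero>\<^bsub>QR\<^esub>}. s x y \<otimes>\<^bsub>QR\<^esub> y)"
    unfolding projective_in_def by (elim exE conjE) (rule that; assumption)
  note s = s0(1)[rule_format] s0(2)[rule_format] s0(3)[rule_format] s0(4)[rule_format]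
  have Nc: "?N \<subseteq> carrier QR" using frac_emb_closed I.Icarr by blast
  have "E ` ?N = \<phi> ` I" unfolding \<phi>_def by (rule image_image)
  then have EN: "E ` ?N = ?G" using I(2) by simp
  have xN: "?x \<in> ?N" using j by blast
  \<comment> \<open>An ideal multiplies itself into itself. This is what allows elements of
    \<open>?N\<close> to be used as scalars in the linearity of \<open>s\<close>.\<close>
  have sub: "?N \<subseteq> endo_ring R ?N"
  proof
    fix w assume "w \<in> ?N"
    then obtain a where a: "a \<in> I" "w = frac_emb R a" by blast
    have "w \<otimes>\<^bsub>QR\<^esub> frac_emb R b \<in> ?N" if "b \<in> I" for b
      using a that I.Icarr I.I_l_closed[of b a] by (auto simp: frac_emb_mult[symmetric])
    then show "w \<in> endo_ring R ?N" unfolding endo_ring_def using a I.Icarr frac_emb_closed by auto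
  qed
  have sc: "s x y \<in> carrier QR" if "x \<in> ?N" "y \<in> ?N" for x y using s(1)[OF that] unfolding endo_ring_def by blast
  have endo: "E w \<in> C.endo ?G" if w: "w \<in> endo_ring R ?N" for w
  proof -
    have wc: "w \<in> carrier QR" "\<And>x. x \<in> ?N \<Longrightarrow> w \<otimes>\<^bsub>QR\<^esub> x \<in> ?N" using w unfolding endo_ring_def by blast+
    have "E w * g \<in> ?G" if g: "g \<in> ?G" for g
    proof -
      obtain y where y: "y \<in> ?N" "g = E y" using g unfolding EN[symmetric] by blast
      then have "E w * g = E (w \<otimes>\<^bsub>QR\<^esub> y)" using wc(1) Nc by (simp add: E_mult subset_iff)
      then show ?thesis using wc(2)[OF y(1)] unfolding EN[symmetric] by blast
    qed
    then show ?thesis unfolding C.endo_def using QQ_full[OF nd wc(1)] by blast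
  qed
  define Y where "Y = {y \<in> ?N. s ?x y \<noteq> \<zero>\<^bsub>QR\<^esub>}"
  have Y: "finite Y" "Y \<subseteq> ?N" "Y \<subseteq> carrier QR" using s(2)[OF xN] Nc unfolding Y_def by auto
  define g where "g = the_inv_into (carrier QR) E"
  have injE: "inj_on E (carrier QR)" using E_inj by (auto intro: inj_onI)
  have gE: "g (E y) = y" if "y \<in> carrier QR" for y unfolding g_def by (rule the_inv_into_f_f[OF injE that])
  define b where "b u = mi ^ (k + l) * E (s ?x (g u))" for u
  have Ex: "E ?x = \<phi> m ^ (k + l) * \<phi> \<one>" using phi_pow[of m "k + l"] unfolding \<phi>_def by simp
  have "C.inv_frac ?G" unfolding C.inv_frac_def
  proof (intro exI[of _ "E ` Y"] exI[of _ b] conjI ballI)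
    show "finite (E ` Y)" using Y(1) by simp
    show "E ` Y \<subseteq> ?G" unfolding EN[symmetric] using Y(2) by (rule image_mono)
    fix u assume "u \<in> E ` Y"
    then obtain y where y: "y \<in> Y" "u = E y" by blast
    have yN: "y \<in> ?N" "y \<in> carrier QR" using y Y by auto
    have bu: "b u = mi ^ (k + l) * E (s ?x y)" unfolding b_def y(2) gE[OF yN(2)] ..
    have sQ: "E (s ?x y) \<in> QQ" using QQ_full[OF nd sc[OF xN yN(1)]] .
    show "b u \<in> QQ" unfolding bu using sQ by simp
    fix x assume "x \<in> ?G"
    then obtain x' where x': "x' \<in> ?N" "x = E x'" unfolding EN[symmetric] by blast
    have xc: "x' \<in> carrier QR" "?x \<in> carrier QR" using x' xN Nc by auto
    \<comment> \<open>Linearity in both factors of the product of \<open>?x\<close> and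
      \<open>x'\<close> gives \<open>?x * s x' y = x' * s ?x y\<close>; divided by
      \<open>?x\<close>, this puts \<open>b u * x\<close> into the endomorphism ring.\<close>
    have "?x \<otimes>\<^bsub>QR\<^esub> s x' y = s (?x \<otimes>\<^bsub>QR\<^esub> x') y" using s(3)[of ?x x' y] sub xN x' yN by auto
    also have "\<dots> = s (x' \<otimes>\<^bsub>QR\<^esub> ?x) y" using xc by (simp add: TQ.m_comm)
    also have "\<dots> = x' \<otimes>\<^bsub>QR\<^esub> s ?x y" using s(3)[of x' ?x y] sub xN x' yN by auto
    finally have "E (?x \<otimes>\<^bsub>QR\<^esub> s x' y) = E (x' \<otimes>\<^bsub>QR\<^esub> s ?x y)" by simp
    then have 1: "E ?x * E (s x' y) = x * E (s ?x y)" using xc sc[OF x'(1) yN(1)] sc[OF xN yN(1)] x'(2) by (simp add: E_mult)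
    have sQ': "E (s x' y) \<in> QQ" using QQ_full[OF nd sc[OF x'(1) yN(1)]] .
    have "b u * x = mi ^ (k + l) * (x * E (s ?x y))" unfolding bu by (simp only: mult_ac)
    also have "\<dots> = mi ^ (k + l) * (\<phi> m ^ (k + l) * E (s x' y))" unfolding 1[symmetric] Ex using sQ' by (simp add: mult.assoc)
    also have "\<dots> = E (s x' y)" by (rule C.minv[OF sQ'])
    finally show "b u * x \<in> C.endo ?G" using endo[OF s(1)[OF x'(1) yN(1)]] by simp
  next
    have Ysc: "s ?x y \<in> carrier QR" "y \<in> carrier QR" if "y \<in> Y" for y
      using that Y(2,3) sc[OF xN, of y] by blast+
    have inj: "inj_on E Y" using injE Y(3) by (rule inj_on_subset)
    have "(\<Sum>u\<in>E ` Y. b u * u) = (\<Sum>y\<in>Y. b (E y) * E y)" by (rule sum.reindex_cong[OF inj]) auto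
    also have "\<dots> = (\<Sum>y\<in>Y. mi ^ (k + l) * (E (s ?x y) * E y))"
      by (rule sum.cong) (use gE Ysc in \<open>auto simp: b_def mult.assoc\<close>)
    also have "\<dots> = mi ^ (k + l) * (\<Sum>y\<in>Y. E (s ?x y \<otimes>\<^bsub>QR\<^esub> y))"
      unfolding sum_distrib_left by (rule sum.cong) (use Ysc in \<open>auto simp: E_mult\<close>)
    also have "(\<Sum>y\<in>Y. E (s ?x y \<otimes>\<^bsub>QR\<^esub> y)) = E (\<Oplus>\<^bsub>QR\<^esub>y\<in>Y. s ?x y \<otimes>\<^bsub>QR\<^esub> y)"
      by (rule E_sum[symmetric]) (use Y(1) Ysc in auto)
    also have "(\<Oplus>\<^bsub>QR\<^esub>y\<in>Y. s ?x y \<otimes>\<^bsub>QR\<^esub> y) = ?x" using s(4)[OF xN] unfolding Y_def by simp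
    also have "mi ^ (k + l) * E ?x = \<phi> \<one>" unfolding Ex by (rule C.minv[OF C.Qe])
    finally show "(\<Sum>u\<in>E ` Y. b u * u) = \<phi> \<one>" .
  qed
  then show ?thesis by (rule C.inv_frac_scale[OF sF])
qed

text \<open>The ideal is \<open>z * endo F\<close> with \<open>z\<close> invertible, because it
  contains a power of \<open>m\<close>. So it is free of rank one, and the section can be supported
  on the single basis element \<open>z\<close>, where it takes the value
  \<open>x / z\<close>.\<close>

lemma endo_principal_stable:
  assumes P: "C.endo_principal" and nd: "nzd_divides R m" shows "stable_ring R"
  unfolding stable_ring_def
proof (intro allI impI)
  fix I assume "regular_ideal R I"
  then obtain r where I: "ideal I R" and r: "r \<in> I" "nzd R r" unfolding regular_ideal_def by blast
  interpret I: ideal I R by (rule I)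
  obtain k :: nat and y where y: "y \<in> carrier R" "m [^] k = r \<otimes> y" using nd r(2) unfolding nzd_divides_def by blast
  have mk: "m [^] k \<in> I" unfolding y(2) using I.I_r_closed r(1) y(1) by blast
  let ?N = "frac_emb R ` I"
  let ?F = "\<phi> ` I"
  have EN: "E ` ?N = ?F" unfolding \<phi>_def by (rule image_image)
  have Nc: "?N \<subseteq> carrier QR" using frac_emb_closed I.Icarr by blast
  have sF: "C.submod ?F" "?F \<subseteq> AA" using ideal_submod[OF I] by auto
  have "C.reg ?F" using reg_phi[OF I.a_subset] mk by blast
  moreover have "\<forall>x\<in>?F. \<phi> m ^ 0 * x \<in> AA" using sF(2) by auto
  ultimately have "C.fractional ?F" unfolding C.fractional_def C.bdd_def using sF(1) by blast
  then obtain z where z: "z \<in> ?F" "?F = (\<lambda>q. z * q) ` C.endo ?F" using P[unfolded C.endo_principal_def, rule_format] by blast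
  obtain zq where zq: "zq \<in> ?N" "z = E zq" using z(1) unfolding EN[symmetric] by blast
  have "\<phi> (m [^] k) \<in> ?F" using mk by blast
  then obtain g where g: "g \<in> C.endo ?F" "\<phi> (m [^] k) = z * g" by (subst (asm) z(2)) (erule imageE)
  have gQ: "g \<in> QQ" using g(1) by (simp add: C.endo_def)
  let ?zi = "mi ^ k * g"
  have zzi: "z * ?zi = \<phi> \<one>"
  proof -
    have "z * ?zi = mi ^ k * (\<phi> m ^ k * \<phi> \<one>)" using g(2) phi_pow[of m k] by (simp add: mult_ac)
    then show ?thesis by (simp only: C.minv[OF C.Qe])
  qed
  have ziQ: "?zi \<in> QQ" using gQ by simp
  obtain w where w: "w \<in> carrier QR" "?zi = E w" using E_QQ[OF ziQ] by blast
  have zc: "zq \<in> carrier QR" using zq Nc by blast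
  have wz: "w \<otimes>\<^bsub>QR\<^esub> zq = \<one>\<^bsub>QR\<^esub>"
  proof -
    have "E (w \<otimes>\<^bsub>QR\<^esub> zq) = E \<one>\<^bsub>QR\<^esub>" using w zc zq(2) zzi by (simp add: E_mult E_one mult.commute)
    then show ?thesis using E_inj w zc by simp
  qed
  have endoI: "q \<in> endo_ring R ?N" if q: "q \<in> carrier QR" "E q \<in> C.endo ?F" for q
  proof -
    have "q \<otimes>\<^bsub>QR\<^esub> x \<in> ?N" if x: "x \<in> ?N" for x
    proof -
      have xc: "x \<in> carrier QR" using x Nc by blast
      have "E q * E x \<in> ?F" using q(2) x EN unfolding C.endo_def by blast
      then have "E (q \<otimes>\<^bsub>QR\<^esub> x) \<in> E ` ?N" using q xc EN by (simp add: E_mult)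
      then obtain n where n: "n \<in> ?N" "E (q \<otimes>\<^bsub>QR\<^esub> x) = E n" by blast
      have "q \<otimes>\<^bsub>QR\<^esub> x = n" using n E_inj[of "q \<otimes>\<^bsub>QR\<^esub> x" n] q xc Nc by auto
      then show ?thesis using n by simp
    qed
    then show ?thesis unfolding endo_ring_def using q by blast
  qed
  have wE: "w \<otimes>\<^bsub>QR\<^esub> x \<in> endo_ring R ?N" if x: "x \<in> ?N" for x
  proof (rule endoI)
    have xc: "x \<in> carrier QR" using x Nc by blast
    show "w \<otimes>\<^bsub>QR\<^esub> x \<in> carrier QR" using w xc by simp
    have "E x \<in> ?F" using x EN by blast
    then obtain h where h: "h \<in> C.endo ?F" "E x = z * h" by (subst (asm) z(2)) (erule imageE)
    have hQ: "h \<in> QQ" using h(1) by (simp add: C.endo_def)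
    have "E (w \<otimes>\<^bsub>QR\<^esub> x) = ?zi * (z * h)" using w xc h by (simp add: E_mult)
    also have "\<dots> = (z * ?zi) * h" by (simp only: mult_ac)
    also have "\<dots> = h" using hQ zzi by simp
    finally show "E (w \<otimes>\<^bsub>QR\<^esub> x) \<in> C.endo ?F" using h(1) by simp
  qed
  let ?s = "\<lambda>x y. if y = zq then w \<otimes>\<^bsub>QR\<^esub> x else \<zero>\<^bsub>QR\<^esub>"
  have z0: "\<zero>\<^bsub>QR\<^esub> \<in> endo_ring R ?N"
  proof (rule endoI)
    have "0 \<in> C.endo ?F" using C.subrD(2)[OF C.subr_endo[OF sF(1)] C.A0] .
    then show "E \<zero>\<^bsub>QR\<^esub> \<in> C.endo ?F" using E_zero by simp
  qed simp
  have ec: "q \<in> carrier QR" if "q \<in> endo_ring R ?N" for q using that unfolding endo_ring_def by blast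
  show "stable_ideal R I" unfolding stable_ideal_def projective_in_def
  proof (intro exI[of _ ?s] conjI ballI)
    fix x y assume xy: "x \<in> ?N" "y \<in> ?N"
    show "?s x y \<in> endo_ring R ?N" using wE[OF xy(1)] z0 by simp
  next
    fix x assume "x \<in> ?N"
    show "finite {y \<in> ?N. ?s x y \<noteq> \<zero>\<^bsub>QR\<^esub>}" by (rule finite_subset[of _ "{zq}"]) auto
  next
    fix x x' y assume "x \<in> ?N" "x' \<in> ?N" "y \<in> ?N"
    then have "x \<in> carrier QR" "x' \<in> carrier QR" using Nc by auto
    then show "?s (x \<oplus>\<^bsub>QR\<^esub> x') y = ?s x y \<oplus>\<^bsub>QR\<^esub> ?s x' y" using w by (simp add: TQ.r_distr)
  next
    fix q x y assume q: "q \<in> endo_ring R ?N" and x: "x \<in> ?N" and "y \<in> ?N"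
    have "x \<in> carrier QR" "q \<in> carrier QR" using x Nc ec[OF q] by auto
    then show "?s (q \<otimes>\<^bsub>QR\<^esub> x) y = q \<otimes>\<^bsub>QR\<^esub> ?s x y" using w by (simp add: TQ.m_ac)
  next
    fix x assume x: "x \<in> ?N"
    have xc: "x \<in> carrier QR" using x Nc by blast
    have wxz: "(w \<otimes>\<^bsub>QR\<^esub> x) \<otimes>\<^bsub>QR\<^esub> zq = x"
    proof -
      have "(w \<otimes>\<^bsub>QR\<^esub> x) \<otimes>\<^bsub>QR\<^esub> zq = x \<otimes>\<^bsub>QR\<^esub> (w \<otimes>\<^bsub>QR\<^esub> zq)" using w(1) xc zc by (simp add: TQ.m_ac)
      then show ?thesis using wz xc by simp
    qed
    show "x = (\<Oplus>\<^bsub>QR\<^esub>y\<in>{y \<in> ?N. ?s x y \<noteq> \<zero>\<^bsub>QR\<^esub>}. ?s x y \<otimes>\<^bsub>QR\<^esub> y)"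
    proof (cases "w \<otimes>\<^bsub>QR\<^esub> x = \<zero>\<^bsub>QR\<^esub>")
      case True
      then have e: "{y \<in> ?N. ?s x y \<noteq> \<zero>\<^bsub>QR\<^esub>} = {}" by auto
      have "x = \<zero>\<^bsub>QR\<^esub>" using wxz True zc by simp
      then show ?thesis unfolding e by simp
    next
      case False
      then have e: "{y \<in> ?N. ?s x y \<noteq> \<zero>\<^bsub>QR\<^esub>} = {zq}" using zq(1) by auto
      show ?thesis unfolding e using wxz w xc zc by (simp add: TQ.finsum_insert)
    qed
  qed
qed

text \<open>From stability boundedness is derived before two-generation, since the argument with
  leading forms uses a common denominator of \<open>T\<close>.\<close>

theorem stable_finite_iff:
  assumes "nzd_divides R m"
  shows "stable_ring R \<and> finite_int_closure R \<longleftrightarrow> two_gen R m \<and> bounded_closure R m"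
proof
  assume h: "stable_ring R \<and> finite_int_closure R"
  have P: "C.endo_principal" by (rule C.inv_frac_endo_principal) (use stable_inv_frac h assms in blast)
  have b: "bounded_closure R m" using nzd_divides_bounded[OF P] h assms by blast
  then obtain c where "\<And>q. q \<in> C.T \<Longrightarrow> \<phi> m ^ c * q \<in> AA" using bounded_iff by blast
  then have "C.two_gen_reg" by (rule C.endo_principal_two_gen_reg[OF P])
  then show "two_gen R m \<and> bounded_closure R m" using b two_gen_iff by blast
next
  assume h: "two_gen R m \<and> bounded_closure R m"
  then have "C.endo_principal" using C.two_gen_reg_endo_principal two_gen_iff by blast
  then show "stable_ring R \<and> finite_int_closure R" using endo_principal_stable[OF _ assms] bounded_finite_closure h assms by blast
qed

end

section \<open>Krull dimension one\<close>

context cring begin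

text \<open>An ideal maximal among those disjoint from the multiplicative set \<open>S\<close>
  exists by Zorn and is prime. Its maximality is kept in the conclusion because for
  \<open>S = {\<one>}\<close> it yields a maximal ideal.\<close>

lemma prime_avoiding:
  assumes I: "ideal I R" and S: "S \<subseteq> carrier R" "\<one> \<in> S" "\<And>s t. s \<in> S \<Longrightarrow> t \<in> S \<Longrightarrow> s \<otimes> t \<in> S" and IS: "I \<inter> S = {}"
  shows "\<exists>P. primeideal P R \<and> I \<subseteq> P \<and> P \<inter> S = {} \<and> (\<forall>J. ideal J R \<longrightarrow> P \<subseteq> J \<longrightarrow> J \<inter> S = {} \<longrightarrow> J = P)"
proof -
  let ?A = "{J. ideal J R \<and> I \<subseteq> J \<and> J \<inter> S = {}}"
  have "\<exists>M\<in>?A. \<forall>X\<in>?A. M \<subseteq> X \<longrightarrow> X = M"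
  proof (rule subset_Zorn_nonempty)
    show "?A \<noteq> {}" using I IS by blast
    fix C assume C: "C \<noteq> {}" "subset.chain ?A C"
    then have CA: "C \<subseteq> ?A" by (auto simp: pred_on.chain_def)
    have "subset.chain {J. ideal J R} C" using C(2) by (auto simp: pred_on.chain_def)
    then have "ideal (\<Union>C) R" using chain_Union_is_ideal[of C] C(1) by simp
    then show "\<Union>C \<in> ?A" using CA C(1) by blast
  qed
  then obtain P where P: "ideal P R" "I \<subseteq> P" "P \<inter> S = {}" and "\<forall>X\<in>?A. P \<subseteq> X \<longrightarrow> X = P" by blast
  then have max: "J = P" if "ideal J R" "P \<subseteq> J" "J \<inter> S = {}" for J using that by blast
  interpret P: ideal P R by (rule P(1))
  have "primeideal P R"
  proof (rule primeidealI[OF P(1) is_cring])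
    show "carrier R \<noteq> P" using S(1,2) P(3) by blast
    fix a b assume ab: "a \<in> carrier R" "b \<in> carrier R" "a \<otimes> b \<in> P"
    have meet: "\<exists>p\<in>P. \<exists>x\<in>carrier R. p \<oplus> x \<otimes> c \<in> S" if c: "c \<in> carrier R" "c \<notin> P" for c
    proof -
      have id: "ideal (P <+>\<^bsub>R\<^esub> PIdl c) R" by (rule add_ideals[OF P(1) cgenideal_ideal[OF c(1)]])
      have "P \<subseteq> P <+>\<^bsub>R\<^esub> PIdl c"
      proof
        fix p assume p: "p \<in> P"
        have "p = p \<oplus> \<zero> \<otimes> c" using p c P.Icarr by simp
        moreover have "\<zero> \<otimes> c \<in> PIdl c" unfolding cgenideal_def by blast
        ultimately show "p \<in> P <+>\<^bsub>R\<^esub> PIdl c" using p unfolding set_add_def' by blast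
      qed
      moreover have "c \<in> P <+>\<^bsub>R\<^esub> PIdl c"
      proof -
        have "c = \<zero> \<oplus> c" using c by simp
        then show ?thesis using P.zero_closed cgenideal_self[OF c(1)] unfolding set_add_def' by blast
      qed
      ultimately have "(P <+>\<^bsub>R\<^esub> PIdl c) \<inter> S \<noteq> {}" using max[OF id] c(2) by blast
      then show ?thesis unfolding set_add_def' cgenideal_def by blast
    qed
    show "a \<in> P \<or> b \<in> P"
    proof (rule ccontr)
      assume n: "\<not> (a \<in> P \<or> b \<in> P)"
      obtain p x where 1: "p \<in> P" "x \<in> carrier R" "p \<oplus> x \<otimes> a \<in> S" using meet ab n by blast
      obtain q y where 2: "q \<in> P" "y \<in> carrier R" "q \<oplus> y \<otimes> b \<in> S" using meet ab n by blast
      have c: "p \<in> carrier R" "q \<in> carrier R" using 1 2 P.Icarr by auto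
      have "(p \<oplus> x \<otimes> a) \<otimes> (q \<oplus> y \<otimes> b) = (q \<oplus> y \<otimes> b) \<otimes> p \<oplus> ((x \<otimes> a) \<otimes> q \<oplus> (x \<otimes> y) \<otimes> (a \<otimes> b))"
        using c 1(2) 2(2) ab(1,2) by (simp add: l_distr r_distr m_ac a_ac)
      also have "\<dots> \<in> P"
        using P.I_l_closed[OF 1(1), of "q \<oplus> y \<otimes> b"] P.I_l_closed[OF 2(1), of "x \<otimes> a"] P.I_l_closed[OF ab(3), of "x \<otimes> y"] c 1(2) 2(2) ab(1,2)
        by (auto intro!: P.a_closed)
      finally show False using S(3)[OF 1(3) 2(3)] P(3) by blast
    qed
  qed
  then show ?thesis using P max by blast
qed

lemma nonunit_cgenideal: assumes "a \<in> carrier R" "a \<notin> Units R" shows "\<one> \<notin> PIdl a"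
proof
  assume "\<one> \<in> PIdl a"
  then obtain x where x: "x \<in> carrier R" "\<one> = x \<otimes> a" unfolding cgenideal_def by blast
  then have "a \<otimes> x = \<one>" using assms(1) by (simp add: m_comm)
  then have "a \<in> Units R" using x assms(1) unfolding Units_def by auto
  then show False using assms(2) by blast
qed

lemma local_nonunit:
  assumes "local_ring R" "maximalideal M R" "a \<in> carrier R" "a \<notin> Units R" shows "a \<in> M"
proof -
  have "PIdl a \<inter> {\<one>} = {}" using nonunit_cgenideal assms by blast
  then obtain P where P: "primeideal P R" "PIdl a \<subseteq> P" "P \<inter> {\<one>} = {}"
      "\<And>J. ideal J R \<Longrightarrow> P \<subseteq> J \<Longrightarrow> J \<inter> {\<one>} = {} \<Longrightarrow> J = P"
    using prime_avoiding[OF cgenideal_ideal[OF assms(3)], of "{\<one>}"] by auto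
  have "maximalideal P R"
  proof (rule maximalidealI)
    show "ideal P R" using P(1) by (simp add: primeideal.axioms(1))
    show "carrier R \<noteq> P" using P(3) by blast
    fix J assume J: "ideal J R" "P \<subseteq> J" "J \<subseteq> carrier R"
    show "J = P \<or> J = carrier R"
      using P(4)[OF J(1,2)] ideal.one_imp_carrier[OF J(1)] by blast
  qed
  then have "P = M" using assms(1,2) unfolding local_ring_def by blast
  then show ?thesis using P(2) cgenideal_self[OF assms(3)] by blast
qed

lemma proper_no_unit: assumes "ideal I R" "I \<noteq> carrier R" "a \<in> I" shows "a \<notin> Units R"
proof
  assume a: "a \<in> Units R"
  interpret ideal I R by (rule assms(1))
  have "inv a \<otimes> a \<in> I" using a assms(3) by (intro I_l_closed) auto
  then have "\<one> \<in> I" using a by simp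
  then show False using one_imp_carrier assms(2) by blast
qed

end

text \<open>By locality \<open>P'\<close> lies in \<open>M\<close>, so \<open>P' \<noteq> M\<close>
  would give a chain of three primes.\<close>

lemma (in cring) krull_one_prime_maximal:
  assumes loc: "local_ring R" and dim: "krull_dim_one R" and M: "maximalideal M R"
    and P: "primeideal P R" "primeideal P' R" "P \<subset> P'"
  shows "P' = M"
proof (rule ccontr)
  assume ne: "P' \<noteq> M"
  interpret P': primeideal P' R by (rule P(2))
  have "P' \<subseteq> M"
  proof
    fix x assume x: "x \<in> P'"
    have "x \<notin> Units R" by (rule proper_no_unit[OF P'.is_ideal P'.I_notcarr[symmetric] x])
    then show "x \<in> M" by (rule local_nonunit[OF loc M P'.Icarr[OF x]])
  qed
  then have "P' \<subset> M" using ne by blast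
  moreover have "primeideal M R" by (rule maximalideal_prime[OF M])
  ultimately show False using dim P unfolding krull_dim_one_def by blast
qed

text \<open>Otherwise some prime \<open>P\<close> contains \<open>m\<close> and avoids the powers of
  \<open>t\<close>. Inside \<open>P\<close> there is a prime without \<open>m\<close>, so
  \<open>P\<close> is not minimal and must be \<open>M\<close>; but \<open>M\<close> contains
  \<open>t\<close>.\<close>

lemma (in cring) krull_one_radical:
  assumes loc: "local_ring R" and dim: "krull_dim_one R" and M: "maximalideal M R" and m: "m \<in> M" "nzd R m"
    and t: "t \<in> M"
  shows "\<exists>k::nat. \<exists>x\<in>carrier R. t [^] k = m \<otimes> x"
proof (rule ccontr)
  assume neg: "\<not> ?thesis"
  interpret M: maximalideal M R by (rule M)
  have tc: "t \<in> carrier R" and mc: "m \<in> carrier R" using t m M.Icarr by auto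
  let ?S = "{t [^] k | k::nat. True}"
  have "PIdl m \<inter> ?S = {}"
  proof (rule ccontr)
    assume "PIdl m \<inter> ?S \<noteq> {}"
    then obtain s where s: "s \<in> PIdl m" "s \<in> ?S" by blast
    obtain k :: nat where k: "s = t [^] k" using s(2) by blast
    obtain y where y: "y \<in> carrier R" "s = y \<otimes> m" using s(1) unfolding cgenideal_def by blast
    then have "t [^] k = m \<otimes> y" using mc k m_comm[OF y(1) mc] by simp
    then show False using neg y(1) by blast
  qed
  moreover have "?S \<subseteq> carrier R" using tc by auto
  moreover have "t [^] (0::nat) \<in> ?S" by blast
  then have "\<one> \<in> ?S" by simp
  moreover have "s \<otimes> s' \<in> ?S" if "s \<in> ?S" "s' \<in> ?S" for s s' using that tc by (auto simp: nat_pow_mult)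
  ultimately obtain P where P: "primeideal P R" "PIdl m \<subseteq> P" "P \<inter> ?S = {}"
    using prime_avoiding[OF cgenideal_ideal[OF mc], of ?S] by blast
  interpret P: primeideal P R by (rule P(1))
  have mP: "m \<in> P" using P(2) cgenideal_self[OF mc] by blast
  have oneP: "\<one> \<notin> P" using P.one_imp_carrier P.I_notcarr by blast
  \<comment> \<open>A prime that avoids this set lies inside \<open>P\<close> and does not contain
    \<open>m\<close>. Zero is not in the set because \<open>m\<close> is a nonzerodivisor.\<close>
  let ?S2 = "{m [^] i \<otimes> s | (i::nat) s. s \<in> carrier R - P}"
  have "{\<zero>} \<inter> ?S2 = {}"
  proof -
    have "m [^] i \<otimes> s \<noteq> \<zero>" if "s \<in> carrier R - P" for i :: nat and s
    proof
      assume "m [^] i \<otimes> s = \<zero>"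
      then have "s = \<zero>" using nzd_pow[OF m(2), of i] that unfolding nzd_def by blast
      then show False using that P.zero_closed by blast
    qed
    then show ?thesis by force
  qed
  moreover have "?S2 \<subseteq> carrier R" using mc by auto
  moreover have "\<one> \<in> ?S2"
  proof -
    have "m [^] (0::nat) \<otimes> \<one> \<in> ?S2" using oneP by blast
    then show ?thesis by simp
  qed
  moreover have "a \<otimes> b \<in> ?S2" if ab: "a \<in> ?S2" "b \<in> ?S2" for a b
  proof -
    obtain i j :: nat and s s' where h: "a = m [^] i \<otimes> s" "b = m [^] j \<otimes> s'" "s \<in> carrier R - P" "s' \<in> carrier R - P" using ab by blast
    have "a \<otimes> b = m [^] (i + j) \<otimes> (s \<otimes> s')" using h mc by (simp add: nat_pow_mult[symmetric] m_ac)
    moreover have "s \<otimes> s' \<in> carrier R - P" using h P.I_prime by blast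
    ultimately show ?thesis by blast
  qed
  ultimately obtain P0 where P0: "primeideal P0 R" "P0 \<inter> ?S2 = {}"
    using prime_avoiding[OF zeroideal, of ?S2] by blast
  interpret P0: primeideal P0 R by (rule P0(1))
  have "P0 \<subseteq> P"
  proof
    fix x assume x: "x \<in> P0"
    show "x \<in> P"
    proof (rule ccontr)
      assume "x \<notin> P"
      then have "m [^] (0::nat) \<otimes> x \<in> ?S2" using x P0.Icarr by blast
      then show False using x P0.Icarr P0(2) by auto
    qed
  qed
  moreover have "m \<notin> P0"
  proof -
    have "m [^] (1::nat) \<otimes> \<one> \<in> ?S2" using oneP by blast
    then have "m \<in> ?S2" using mc by simp
    then show ?thesis using P0(2) by blast
  qed
  ultimately have "P = M" using krull_one_prime_maximal[OF loc dim M P0(1) P(1)] mP by blast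
  moreover have "t [^] (1::nat) \<in> ?S" by blast
  ultimately show False using P(3) t tc by auto
qed

text \<open>Otherwise there is a prime \<open>P\<close> without \<open>a\<close> such that
  \<open>P + aR\<close> contains no power of \<open>m\<close>. A prime above \<open>P + aR\<close>
  avoiding the powers of \<open>m\<close> is strictly larger than \<open>P\<close>, hence equal to
  \<open>M\<close>, which contains \<open>m\<close>.\<close>

lemma (in cring) krull_one_pi_regular:
  assumes loc: "local_ring R" and dim: "krull_dim_one R" and M: "maximalideal M R" and m: "m \<in> M" "nzd R m"
    and a: "a \<in> carrier R"
  shows "\<exists>(j::nat) (n::nat). \<exists>x\<in>carrier R. m [^] j \<otimes> a [^] n = a [^] Suc n \<otimes> x"
proof (rule ccontr)
  assume neg: "\<not> ?thesis"
  interpret M: maximalideal M R by (rule M)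
  have mc: "m \<in> carrier R" using m M.Icarr by auto
  \<comment> \<open>The set contains \<open>a\<close> and all \<open>m^j - a x\<close>. It is
    multiplicative because \<open>(m^j - a x) (m^j' - a x')\<close> is again of the form
    \<open>m^(j+j') - a y\<close>, and it avoids zero because the relation sought is assumed to
    fail.\<close>
  let ?S = "{m [^] i \<otimes> (a [^] n \<otimes> (m [^] j \<ominus> a \<otimes> x)) | (i::nat) (n::nat) (j::nat) x. x \<in> carrier R}"
  have "m [^] i \<otimes> (a [^] n \<otimes> (m [^] j \<ominus> a \<otimes> x)) \<noteq> \<zero>" if x: "x \<in> carrier R" for i n j :: nat and x
  proof
    assume "m [^] i \<otimes> (a [^] n \<otimes> (m [^] j \<ominus> a \<otimes> x)) = \<zero>"
    moreover have "a [^] n \<otimes> (m [^] j \<ominus> a \<otimes> x) \<in> carrier R" using a mc x by simp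
    ultimately have "a [^] n \<otimes> (m [^] j \<ominus> a \<otimes> x) = \<zero>" using nzd_pow[OF m(2), of i] unfolding nzd_def by blast
    moreover have "a [^] n \<otimes> (m [^] j \<ominus> a \<otimes> x) = m [^] j \<otimes> a [^] n \<ominus> a [^] Suc n \<otimes> x"
      using a mc x by (simp add: a_minus_def r_distr r_minus m_ac)
    ultimately have "m [^] j \<otimes> a [^] n = a [^] Suc n \<otimes> x" using a mc x by simp
    then show False using neg x by blast
  qed
  then have "{\<zero>} \<inter> ?S = {}" by force
  moreover have "?S \<subseteq> carrier R" using a mc by auto
  moreover have memS: "a [^] n \<in> ?S" for n :: nat
  proof -
    have "m [^] (0::nat) \<otimes> (a [^] n \<otimes> (m [^] (0::nat) \<ominus> a \<otimes> \<zero>)) \<in> ?S" by blast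
    then show ?thesis using a by (simp add: a_minus_def)
  qed
  moreover have "\<one> \<in> ?S" using memS[of 0] by simp
  moreover have "s \<otimes> s' \<in> ?S" if ss: "s \<in> ?S" "s' \<in> ?S" for s s'
  proof -
    obtain i n j :: nat and x where 1: "s = m [^] i \<otimes> (a [^] n \<otimes> (m [^] j \<ominus> a \<otimes> x))" "x \<in> carrier R" using ss(1) by blast
    obtain i' n' j' :: nat and x' where 2: "s' = m [^] i' \<otimes> (a [^] n' \<otimes> (m [^] j' \<ominus> a \<otimes> x'))" "x' \<in> carrier R" using ss(2) by blast
    let ?y = "x \<otimes> m [^] j' \<oplus> (x' \<otimes> m [^] j \<ominus> a \<otimes> (x \<otimes> x'))"
    have y: "?y \<in> carrier R" using a mc 1 2 by simp
    have gen: "(p \<ominus> a \<otimes> x) \<otimes> (q \<ominus> a \<otimes> x') = p \<otimes> q \<ominus> a \<otimes> (x \<otimes> q \<oplus> (x' \<otimes> p \<ominus> a \<otimes> (x \<otimes> x')))" if "p \<in> carrier R" "q \<in> carrier R" for p q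
      using that a 1(2) 2(2) by algebra
    have "s \<otimes> s' = m [^] (i + i') \<otimes> (a [^] (n + n') \<otimes> ((m [^] j \<ominus> a \<otimes> x) \<otimes> (m [^] j' \<ominus> a \<otimes> x')))"
      unfolding 1(1) 2(1) using a mc 1(2) 2(2) by (simp add: nat_pow_mult[symmetric] m_ac)
    also have "(m [^] j \<ominus> a \<otimes> x) \<otimes> (m [^] j' \<ominus> a \<otimes> x') = m [^] (j + j') \<ominus> a \<otimes> ?y"
      using gen[of "m [^] j" "m [^] j'"] mc by (simp add: nat_pow_mult)
    finally show ?thesis using y by blast
  qed
  ultimately obtain P where P: "primeideal P R" "P \<inter> ?S = {}"
    using prime_avoiding[OF zeroideal, of ?S] by blast
  interpret P: primeideal P R by (rule P(1))
  have "a [^] (1::nat) = a" using a by simp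
  then have "a \<in> ?S" using memS[of 1] by (simp only:)
  then have aP: "a \<notin> P" using P(2) by blast
  let ?T = "{m [^] k | k::nat. True}"
  let ?J = "P <+>\<^bsub>R\<^esub> PIdl a"
  have id: "ideal ?J R" by (rule add_ideals[OF P.is_ideal cgenideal_ideal[OF a]])
  have "?J \<inter> ?T = {}"
  proof (rule ccontr)
    assume "?J \<inter> ?T \<noteq> {}"
    then obtain s where s: "s \<in> ?J" "s \<in> ?T" by blast
    obtain p y where py: "p \<in> P" "y \<in> PIdl a" "s = p \<oplus> y" using s(1) unfolding set_add_def' by blast
    obtain x where x: "x \<in> carrier R" "y = x \<otimes> a" using py(2) unfolding cgenideal_def by blast
    obtain j :: nat where j: "s = m [^] j" using s(2) by blast
    have h: "p \<in> P" "x \<in> carrier R" "m [^] j = p \<oplus> x \<otimes> a" using py x j by auto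
    have pc: "p \<in> carrier R" using h P.Icarr by blast
    have "m [^] j \<ominus> a \<otimes> x = p" unfolding h(3) using pc a h(2) by algebra
    then have "m [^] (0::nat) \<otimes> (a [^] (0::nat) \<otimes> (m [^] j \<ominus> a \<otimes> x)) = p" using pc by simp
    moreover have "m [^] (0::nat) \<otimes> (a [^] (0::nat) \<otimes> (m [^] j \<ominus> a \<otimes> x)) \<in> ?S" using h(2) by blast
    ultimately have "p \<in> ?S" by (simp only:)
    then show False using h(1) P(2) by blast
  qed
  moreover have "?T \<subseteq> carrier R" using mc by auto
  moreover have "m [^] (0::nat) \<in> ?T" by blast
  then have "\<one> \<in> ?T" by simp
  moreover have "s \<otimes> s' \<in> ?T" if "s \<in> ?T" "s' \<in> ?T" for s s' using that mc by (auto simp: nat_pow_mult)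
  ultimately obtain P' where P': "primeideal P' R" "?J \<subseteq> P'" "P' \<inter> ?T = {}"
    using prime_avoiding[OF id, of ?T] by blast
  have "P \<subseteq> P'"
  proof
    fix p assume p: "p \<in> P"
    have "p = p \<oplus> \<zero> \<otimes> a" using p a P.Icarr by simp
    moreover have "\<zero> \<otimes> a \<in> PIdl a" unfolding cgenideal_def by blast
    ultimately have "p \<in> ?J" using p unfolding set_add_def' by blast
    then show "p \<in> P'" using P'(2) by blast
  qed
  moreover have "a \<in> P'"
  proof -
    have "a = \<zero> \<oplus> a" using a by simp
    then have "a \<in> ?J" using P.zero_closed cgenideal_self[OF a] unfolding set_add_def' by blast
    then show ?thesis using P'(2) by blast
  qed
  ultimately have "P' = M" using krull_one_prime_maximal[OF loc dim M P(1) P'(1)] aP by blast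
  moreover have "m [^] (1::nat) \<in> ?T" by blast
  ultimately show False using P'(3) m mc by auto
qed

lemma (in cring) krull_one_param_ring:
  assumes loc: "local_ring R" and dim: "krull_dim_one R" and M: "maximalideal M R" and m: "m \<in> M" "nzd R m"
  shows "param_ring R m"
proof
  interpret M: maximalideal M R by (rule M)
  have nonunitA: "a \<notin> Units R" if "a \<in> M" for a using proper_no_unit[OF M.is_ideal _ that] M.I_notcarr by blast
  show "nzd R m" by (rule m(2))
  show "m \<notin> Units R" by (rule nonunitA[OF m(1)])
  show "a \<in> Units R \<or> \<one> \<ominus> a \<in> Units R" if a: "a \<in> carrier R" for a
  proof (rule ccontr)
    assume "\<not> ?thesis"
    then have "a \<in> M" "\<one> \<ominus> a \<in> M" using local_nonunit[OF loc M] a by auto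
    then have "\<one> \<ominus> a \<oplus> a \<in> M" by (intro M.a_closed)
    moreover have "\<one> \<ominus> a \<oplus> a = \<one>" using a by algebra
    ultimately show False using nonunitA[of \<one>] by simp
  qed
  show "a \<in> Units R \<or> (\<exists>k::nat. \<exists>x\<in>carrier R. a [^] k = m \<otimes> x)" if "a \<in> carrier R" for a
    using local_nonunit[OF loc M that] krull_one_radical[OF loc dim M m] by blast
qed

text \<open>Pi-regularity of the elements \<open>a\<close> in \<open>R[1/m]\<close>, written without
  denominators: \<open>a^n\<close> is a multiple of \<open>a^(n+1)\<close> there.\<close>

definition "pi_regular R m \<longleftrightarrow> (\<forall>a\<in>carrier R. \<exists>(j::nat) (n::nat). \<exists>x\<in>carrier R.
  m [^]\<^bsub>R\<^esub> j \<otimes>\<^bsub>R\<^esub> a [^]\<^bsub>R\<^esub> n = a [^]\<^bsub>R\<^esub> Suc n \<otimes>\<^bsub>R\<^esub> x)"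

text \<open>Cancelling \<open>r^n\<close> in \<open>m^j r^n = r^(n+1) x\<close> leaves
  \<open>m^j = r x\<close>.\<close>

lemma (in cring) pi_regular_nzd_divides:
  assumes "pi_regular R m" "m \<in> carrier R" shows "nzd_divides R m"
  unfolding nzd_divides_def
proof (intro allI impI)
  fix r assume r: "nzd R r"
  have rc: "r \<in> carrier R" using r by simp
  obtain j n :: nat and x where x: "x \<in> carrier R" "m [^] j \<otimes> r [^] n = r [^] Suc n \<otimes> x"
    using assms rc unfolding pi_regular_def by blast
  have "m [^] j = r \<otimes> x"
  proof (rule nzd_cancel[OF nzd_pow[OF r, of n]])
    show "r [^] n \<otimes> m [^] j = r [^] n \<otimes> (r \<otimes> x)" using x rc assms(2) by (simp add: m_ac)
  qed (use x rc assms(2) in auto)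
  then show "\<exists>k::nat. \<exists>y\<in>carrier R. m [^] k = r \<otimes> y" using x by blast
qed

section \<open>Locality and the Bass property\<close>

context param_ring begin

lemma unitA_iff: "a \<in> carrier R \<Longrightarrow> a \<in> Units R \<longleftrightarrow> C.unitA (\<phi> a)"
proof
  assume "a \<in> Units R" "a \<in> carrier R"
  then show "C.unitA (\<phi> a)" unfolding C.unitA_def using unit_phi phi_A by blast
next
  assume a: "a \<in> carrier R" and "C.unitA (\<phi> a)"
  then obtain u where "u \<in> AA" "\<phi> a * u = \<phi> \<one>" unfolding C.unitA_def by blast
  then obtain b where b: "b \<in> carrier R" "\<phi> a * \<phi> b = \<phi> \<one>" using AA_cases by metis
  then have "\<phi> (a \<otimes> b) = \<phi> \<one>" using a by (simp add: phi_mult)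
  then have "a \<otimes> b = \<one>" using phi_inj[of "a \<otimes> b" \<one>] a b by simp
  moreover from this have "b \<otimes> a = \<one>" using a b by (simp add: m_comm)
  ultimately show "a \<in> Units R" using a b unfolding Units_def by blast
qed

lemma nonunitA_iff: "a \<in> carrier R \<Longrightarrow> a \<notin> Units R \<longleftrightarrow> C.nonunitA (\<phi> a)"
  using unitA_iff phi_A unfolding C.nonunitA_def by blast

lemma local_ring: "local_ring R"
  unfolding local_ring_def
proof (intro conjI ex_ex1I)
  let ?M = "carrier R - Units R"
  have id: "ideal ?M R"
  proof (rule idealI[OF ring_axioms])
    show "subgroup ?M (add_monoid R)"
    proof (rule add.subgroupI)
      show "?M \<subseteq> carrier R" by blast
      show "?M \<noteq> {}" using m_nonunit m_closed' by blast
      show "\<ominus> x \<in> ?M" if "x \<in> ?M" for x using that nonunitA_iff[of x] nonunitA_iff[of "\<ominus> x"] C.nonunitA_neg by (auto simp: phi_neg)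
      show "x \<oplus> y \<in> ?M" if "x \<in> ?M" "y \<in> ?M" for x y
        using that nonunitA_iff[of x] nonunitA_iff[of y] nonunitA_iff[of "x \<oplus> y"] C.nonunitA_add by (auto simp: phi_add)
    qed
    fix x y assume xy: "x \<in> ?M" "y \<in> carrier R"
    show "y \<otimes> x \<in> ?M" using xy nonunitA_iff[of x] nonunitA_iff[of "y \<otimes> x"] C.nonunitA_mult' phi_A by (auto simp: phi_mult)
    then show "x \<otimes> y \<in> ?M" using xy by (simp add: m_comm)
  qed
  have nc: "carrier R \<noteq> ?M" using one_closed Units_one_closed by blast
  show "cring R" by (rule is_cring)
  show "\<exists>M. maximalideal M R"
  proof (rule exI, rule maximalidealI[OF id nc])
    fix J assume J: "ideal J R" "?M \<subseteq> J" "J \<subseteq> carrier R"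
    show "J = ?M \<or> J = carrier R"
      using proper_no_unit[OF J(1)] J(2,3) by blast
  qed
  fix M M' assume M: "maximalideal M R" "maximalideal M' R"
  have "N = ?M" if N: "maximalideal N R" for N
  proof -
    interpret N: maximalideal N R by (rule N)
    have "N \<subseteq> ?M" using proper_no_unit[OF N.is_ideal] N.I_notcarr N.Icarr by blast
    then show ?thesis using N.I_maximal[OF id] nc by blast
  qed
  then show "M = M'" using M by blast
qed

text \<open>\<open>all\<close> and \<open>nd\<close> collect what depends on the particular ring:
  both follow from pi-regularity for the separated quotient and from completeness for the
  completion.\<close>

theorem bass_iff:
  assumes sep: "adic_separated R m"
    and all: "two_gen R m \<Longrightarrow> bounded_closure R m \<Longrightarrow> all_two_gen R"
    and nd: "two_gen R m \<Longrightarrow> bounded_closure R m \<Longrightarrow> nzd_divides R m"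
  shows "bass_ring R \<longleftrightarrow> two_gen R m \<and> bounded_closure R m"
proof
  assume b: "bass_ring R"
  then have "all_two_gen R" "finite_int_closure R" unfolding bass_ring_def all_two_gen_def by blast+
  then show "two_gen R m \<and> bounded_closure R m" using all_two_gen_bounded unfolding two_gen_def all_two_gen_def by blast
next
  assume h: "two_gen R m \<and> bounded_closure R m"
  have a: "all_two_gen R" using all h by blast
  have "noetherian_ring R"
  proof (rule noetherian_ringI)
    fix I assume "ideal I R"
    then obtain a b where "a \<in> carrier R" "b \<in> carrier R" "I = Idl {a, b}" using a unfolding all_two_gen_def by blast
    then show "\<exists>A\<subseteq>carrier R. finite A \<and> I = Idl A" by (intro exI[of _ "{a, b}"]) auto
  qed
  then show "bass_ring R" unfolding bass_ring_def
    using local_ring reduced_I[OF sep] bounded_finite_closure nd h a unfolding all_two_gen_def by blast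
qed

end

section \<open>Analytic isomorphisms\<close>

context param_ring begin

lemma unit_one_minus: assumes "r \<in> carrier R" shows "\<one> \<ominus> m \<otimes> r \<in> Units R"
proof -
  have "m \<otimes> r \<notin> Units R" using nonunitA_iff[of "m \<otimes> r"] nonunitA_iff[of m] m_nonunit assms C.nonunitA_mult phi_A by (simp add: phi_mult)
  then show ?thesis using local[OF m_closed[OF m_closed' assms]] by blast
qed

end

text \<open>A homomorphism inducing isomorphisms \<open>R / m^n R \<rightarrow> B / m^n B\<close> for all \<open>n\<close>.\<close>
locale analytic_hom = param_ring R m + B: cring B for R (structure) and m and B (structure) +
  fixes h
  assumes hom: "h \<in> ring_hom R B"
    and nzd_hm: "nzd B (h m)"
    and approx: "b \<in> carrier B \<Longrightarrow> \<exists>a\<in>carrier R. \<exists>y\<in>carrier B. b = h a \<oplus>\<^bsub>B\<^esub> h m [^]\<^bsub>B\<^esub> (n::nat) \<otimes>\<^bsub>B\<^esub> y"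
    and reflect: "a \<in> carrier R \<Longrightarrow> y \<in> carrier B \<Longrightarrow> h a = h m [^]\<^bsub>B\<^esub> (n::nat) \<otimes>\<^bsub>B\<^esub> y \<Longrightarrow> \<exists>x\<in>carrier R. a = m [^] n \<otimes> x"
    and near_one: "y \<in> carrier B \<Longrightarrow> \<one>\<^bsub>B\<^esub> \<oplus>\<^bsub>B\<^esub> h m \<otimes>\<^bsub>B\<^esub> y \<in> Units B"
begin

lemma h_closed[simp]: "a \<in> carrier R \<Longrightarrow> h a \<in> carrier B" using hom by (rule ring_hom_closed)
lemma h_add: "a \<in> carrier R \<Longrightarrow> b \<in> carrier R \<Longrightarrow> h (a \<oplus> b) = h a \<oplus>\<^bsub>B\<^esub> h b" using hom by (rule ring_hom_add)
lemma h_mult: "a \<in> carrier R \<Longrightarrow> b \<in> carrier R \<Longrightarrow> h (a \<otimes> b) = h a \<otimes>\<^bsub>B\<^esub> h b" using hom by (rule ring_hom_mult)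
lemma h_one: "h \<one> = \<one>\<^bsub>B\<^esub>" using hom by (rule ring_hom_one)
lemma h_pow: "a \<in> carrier R \<Longrightarrow> h (a [^] (n::nat)) = h a [^]\<^bsub>B\<^esub> n"
  by (induction n) (auto simp: h_one h_mult)
lemma h_zero: "h \<zero> = \<zero>\<^bsub>B\<^esub>" by (rule ring_hom_zero[OF hom ring_axioms B.ring_axioms])
lemma h_neg: "a \<in> carrier R \<Longrightarrow> h (\<ominus> a) = \<ominus>\<^bsub>B\<^esub> h a"
  using h_add[of "\<ominus> a" a] h_zero by (intro B.minus_equality[symmetric]) (auto simp: l_neg)
lemma h_minus: "a \<in> carrier R \<Longrightarrow> b \<in> carrier R \<Longrightarrow> h (a \<ominus> b) = h a \<ominus>\<^bsub>B\<^esub> h b"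
  by (simp add: a_minus_def h_add h_neg)
lemma hm_closed[simp]: "h m \<in> carrier B" by simp
lemma h_unit: "a \<in> Units R \<Longrightarrow> h a \<in> Units B"
proof -
  assume a: "a \<in> Units R"
  then have c: "a \<in> carrier R" "inv a \<in> carrier R" "a \<otimes> inv a = \<one>" "inv a \<otimes> a = \<one>" by auto
  then have "h a \<otimes>\<^bsub>B\<^esub> h (inv a) = \<one>\<^bsub>B\<^esub>" "h (inv a) \<otimes>\<^bsub>B\<^esub> h a = \<one>\<^bsub>B\<^esub>"
    using h_mult[OF c(1,2)] h_mult[OF c(2,1)] h_one by simp_all
  then show ?thesis using h_closed[OF c(1)] h_closed[OF c(2)] unfolding Units_def[of B] by blast
qed

lemma unit_lift: assumes "a \<in> Units R" "y \<in> carrier B" shows "h a \<oplus>\<^bsub>B\<^esub> h m \<otimes>\<^bsub>B\<^esub> y \<in> Units B"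
proof -
  have ha: "h a \<in> Units B" by (rule h_unit[OF assms(1)])
  let ?i = "inv\<^bsub>B\<^esub> (h a)"
  have ic: "?i \<in> carrier B" "h a \<in> carrier B" "h a \<otimes>\<^bsub>B\<^esub> ?i = \<one>\<^bsub>B\<^esub>" using ha by auto
  have "h a \<otimes>\<^bsub>B\<^esub> (\<one>\<^bsub>B\<^esub> \<oplus>\<^bsub>B\<^esub> h m \<otimes>\<^bsub>B\<^esub> (?i \<otimes>\<^bsub>B\<^esub> y)) = h a \<oplus>\<^bsub>B\<^esub> h m \<otimes>\<^bsub>B\<^esub> ((h a \<otimes>\<^bsub>B\<^esub> ?i) \<otimes>\<^bsub>B\<^esub> y)"
    using ic(1,2) assms(2) by (simp add: B.r_distr B.m_ac)
  also have "\<dots> = h a \<oplus>\<^bsub>B\<^esub> h m \<otimes>\<^bsub>B\<^esub> y" unfolding ic(3) using assms by simp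
  finally have "h a \<oplus>\<^bsub>B\<^esub> h m \<otimes>\<^bsub>B\<^esub> y = h a \<otimes>\<^bsub>B\<^esub> (\<one>\<^bsub>B\<^esub> \<oplus>\<^bsub>B\<^esub> h m \<otimes>\<^bsub>B\<^esub> (?i \<otimes>\<^bsub>B\<^esub> y))" by simp
  moreover have "\<one>\<^bsub>B\<^esub> \<oplus>\<^bsub>B\<^esub> h m \<otimes>\<^bsub>B\<^esub> (?i \<otimes>\<^bsub>B\<^esub> y) \<in> Units B" using ic(1) assms(2) by (intro near_one) auto
  ultimately show ?thesis using ha by simp
qed

text \<open>Modulo \<open>m\<close> every \<open>b\<close> comes from some \<open>a\<close> in
  \<open>R\<close>. A unit \<open>a\<close> makes \<open>b\<close> a unit, since \<open>h m\<close>
  is in the Jacobson radical. For a nonunit \<open>a\<close>, both the unit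
  \<open>\<one> \<ominus> a\<close> and the divisibility of a power of \<open>a\<close> by
  \<open>m\<close> carry over to \<open>b\<close>.\<close>

lemma target_param_ring: "param_ring B (h m)"
proof
  show "nzd B (h m)" by (rule nzd_hm)
  show "h m \<notin> Units B"
  proof
    assume u: "h m \<in> Units B"
    have "h \<one> = h m [^]\<^bsub>B\<^esub> (1::nat) \<otimes>\<^bsub>B\<^esub> inv\<^bsub>B\<^esub> h m" using u by (simp add: h_one)
    then obtain x where x: "x \<in> carrier R" "\<one> = m [^] (1::nat) \<otimes> x" using reflect[of \<one> "inv\<^bsub>B\<^esub> h m" 1] u by auto
    then have "m \<otimes> x = \<one>" "x \<otimes> m = \<one>" by (simp_all add: m_comm)
    then have "m \<in> Units R" using x m_closed' unfolding Units_def by blast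
    then show False using m_nonunit by blast
  qed
  fix b assume b: "b \<in> carrier B"
  obtain a y where ay: "a \<in> carrier R" "y \<in> carrier B" "b = h a \<oplus>\<^bsub>B\<^esub> h m \<otimes>\<^bsub>B\<^esub> y" using approx[OF b, of 1] by auto
  have lu: "a \<in> Units R \<Longrightarrow> b \<in> Units B" using unit_lift ay by blast
  show "b \<in> Units B \<or> \<one>\<^bsub>B\<^esub> \<ominus>\<^bsub>B\<^esub> b \<in> Units B"
  proof (cases "a \<in> Units R")
    case True then show ?thesis using lu by blast
  next
    case False
    then have "\<one> \<ominus> a \<in> Units R" using local ay by blast
    then have "h (\<one> \<ominus> a) \<oplus>\<^bsub>B\<^esub> h m \<otimes>\<^bsub>B\<^esub> (\<ominus>\<^bsub>B\<^esub> y) \<in> Units B" using ay by (intro unit_lift) auto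
    moreover have "h (\<one> \<ominus> a) \<oplus>\<^bsub>B\<^esub> h m \<otimes>\<^bsub>B\<^esub> (\<ominus>\<^bsub>B\<^esub> y) = \<one>\<^bsub>B\<^esub> \<ominus>\<^bsub>B\<^esub> b"
      unfolding h_minus[OF one_closed ay(1)] h_one ay(3) using h_closed[OF ay(1)] ay(2)
      by (simp add: a_minus_def B.r_minus B.minus_add B.a_ac)
    ultimately show ?thesis by simp
  qed
  show "b \<in> Units B \<or> (\<exists>k::nat. \<exists>x\<in>carrier B. b [^]\<^bsub>B\<^esub> k = h m \<otimes>\<^bsub>B\<^esub> x)"
  proof (cases "a \<in> Units R")
    case True then show ?thesis using lu by blast
  next
    case False
    then obtain k :: nat and x where x: "x \<in> carrier R" "a [^] k = m \<otimes> x" using radical ay by blast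
    have "\<exists>w\<in>carrier B. b [^]\<^bsub>B\<^esub> n = h a [^]\<^bsub>B\<^esub> n \<oplus>\<^bsub>B\<^esub> h m \<otimes>\<^bsub>B\<^esub> w" for n :: nat
    proof (induction n)
      case 0 then show ?case by (intro bexI[of _ "\<zero>\<^bsub>B\<^esub>"]) auto
    next
      case (Suc n)
      then obtain w where w: "w \<in> carrier B" "b [^]\<^bsub>B\<^esub> n = h a [^]\<^bsub>B\<^esub> n \<oplus>\<^bsub>B\<^esub> h m \<otimes>\<^bsub>B\<^esub> w" by blast
      have "b [^]\<^bsub>B\<^esub> Suc n = (h a [^]\<^bsub>B\<^esub> n \<oplus>\<^bsub>B\<^esub> h m \<otimes>\<^bsub>B\<^esub> w) \<otimes>\<^bsub>B\<^esub> (h a \<oplus>\<^bsub>B\<^esub> h m \<otimes>\<^bsub>B\<^esub> y)" using w ay by simp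
      also have "\<dots> = h a [^]\<^bsub>B\<^esub> Suc n \<oplus>\<^bsub>B\<^esub> h m \<otimes>\<^bsub>B\<^esub> (h a [^]\<^bsub>B\<^esub> n \<otimes>\<^bsub>B\<^esub> y \<oplus>\<^bsub>B\<^esub> w \<otimes>\<^bsub>B\<^esub> b)"
        using w(1) ay by (simp add: B.l_distr B.r_distr B.m_ac B.a_ac)
      finally show ?case using w ay b by (intro bexI[of _ "h a [^]\<^bsub>B\<^esub> n \<otimes>\<^bsub>B\<^esub> y \<oplus>\<^bsub>B\<^esub> w \<otimes>\<^bsub>B\<^esub> b"]) auto
    qed
    then obtain w where w: "w \<in> carrier B" "b [^]\<^bsub>B\<^esub> k = h a [^]\<^bsub>B\<^esub> k \<oplus>\<^bsub>B\<^esub> h m \<otimes>\<^bsub>B\<^esub> w" by blast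
    have "h a [^]\<^bsub>B\<^esub> k = h m \<otimes>\<^bsub>B\<^esub> h x" using x ay by (simp add: h_pow[symmetric] h_mult)
    then have "b [^]\<^bsub>B\<^esub> k = h m \<otimes>\<^bsub>B\<^esub> (h x \<oplus>\<^bsub>B\<^esub> w)" using w x by (simp add: B.r_distr)
    moreover have "h x \<oplus>\<^bsub>B\<^esub> w \<in> carrier B" using w(1) x(1) by simp
    ultimately show ?thesis by blast
  qed
qed

text \<open>The preimage of \<open>I\<close> contains \<open>m^k\<close>. Its two generators
  generate \<open>I\<close>, since every element of \<open>I\<close> is, up to a multiple of
  \<open>h m^k\<close>, the image of an element of the preimage.\<close>

lemma two_gen_push: assumes "two_gen R m" shows "two_gen B (h m)"
  unfolding two_gen_def
proof (intro allI impI, elim conjE exE)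
  fix I and k :: nat assume I: "ideal I B" and k: "h m [^]\<^bsub>B\<^esub> k \<in> I"
  interpret I: ideal I B by (rule I)
  let ?J = "{r \<in> carrier R. h r \<in> I}"
  have J: "ideal ?J R"
    by (rule ring_hom_ring.ideal_vimage[OF ring_hom_ringI2[OF ring_axioms B.ring_axioms hom] I])
  have mk: "m [^] k \<in> ?J" using k by (simp add: h_pow)
  then obtain a b where ab: "a \<in> carrier R" "b \<in> carrier R" "?J = Idl {a, b}" using assms J unfolding two_gen_def by blast
  interpret PB: param_ring B "h m" by (rule target_param_ring)
  have ha: "h a \<in> carrier B" "h b \<in> carrier B" using ab by auto
  have "a \<in> ?J" "b \<in> ?J" unfolding ab(3) using genideal_self[of "{a, b}"] ab by auto
  then have hI: "h a \<in> I" "h b \<in> I" by auto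
  let ?K = "Idl\<^bsub>B\<^esub> {h a, h b}"
  have K: "ideal ?K B" using ha by (intro B.genideal_ideal) auto
  interpret K: ideal ?K B by (rule K)
  have hJ: "h r \<in> ?K" if r: "r \<in> ?J" for r
  proof -
    obtain u v where uv: "u \<in> carrier R" "v \<in> carrier R" "r = u \<otimes> a \<oplus> v \<otimes> b" using r unfolding ab(3) Idl_two[OF ab(1,2)] by blast
    then have "h r = h u \<otimes>\<^bsub>B\<^esub> h a \<oplus>\<^bsub>B\<^esub> h v \<otimes>\<^bsub>B\<^esub> h b" using ab by (simp add: h_add h_mult)
    then show ?thesis unfolding PB.Idl_two[OF ha] using uv h_closed by blast
  qed
  have "I \<subseteq> ?K"
  proof
    fix y assume y: "y \<in> I"
    obtain r s where rs: "r \<in> carrier R" "s \<in> carrier B" "y = h r \<oplus>\<^bsub>B\<^esub> h m [^]\<^bsub>B\<^esub> k \<otimes>\<^bsub>B\<^esub> s" using approx[OF I.Icarr[OF y], of k] by blast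
    have ks: "h m [^]\<^bsub>B\<^esub> k \<otimes>\<^bsub>B\<^esub> s \<in> I" using I.I_r_closed[OF k rs(2)] .
    have "h r = y \<ominus>\<^bsub>B\<^esub> h m [^]\<^bsub>B\<^esub> k \<otimes>\<^bsub>B\<^esub> s" unfolding rs(3) using rs(1,2) by (simp add: a_minus_def B.a_assoc B.r_neg)
    also have "\<dots> \<in> I" unfolding a_minus_def using y ks by (intro I.a_closed I.a_inv_closed)
    finally have "h r \<in> ?K" using hJ rs(1) by blast
    moreover have "h m [^]\<^bsub>B\<^esub> k \<otimes>\<^bsub>B\<^esub> s \<in> ?K" using K.I_r_closed[OF hJ[OF mk] rs(2)] by (simp add: h_pow)
    ultimately show "y \<in> ?K" unfolding rs(3) by (rule K.a_closed)
  qed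
  moreover have "?K \<subseteq> I" using hI by (intro B.genideal_minimal[OF I]) auto
  ultimately show "\<exists>a\<in>carrier B. \<exists>b\<in>carrier B. I = Idl\<^bsub>B\<^esub> {a, b}" using ha by blast
qed

text \<open>The extension \<open>h(I) + m^k B\<close> has two generators, which up to
  \<open>m^(k+1) B\<close> come from elements \<open>a, b\<close> of \<open>I\<close>. Then
  \<open>I\<close> is contained in \<open>(a, b) + m^(k+1) R\<close>; applied to \<open>m^k\<close>
  itself this puts \<open>m^k (1 - m r)\<close> into \<open>(a, b)\<close>, so \<open>m^k\<close>
  lies in \<open>(a, b)\<close> and the error is absorbed.\<close>

lemma two_gen_pull: assumes "two_gen B (h m)" shows "two_gen R m"
  unfolding two_gen_def
proof (intro allI impI, elim conjE exE)
  fix I and k :: nat assume I: "ideal I R" and k: "m [^] k \<in> I"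
  interpret I: ideal I R by (rule I)
  interpret PB: param_ring B "h m" by (rule target_param_ring)
  let ?M = "h m [^]\<^bsub>B\<^esub> k"
  let ?J = "{h x \<oplus>\<^bsub>B\<^esub> ?M \<otimes>\<^bsub>B\<^esub> y | x y. x \<in> I \<and> y \<in> carrier B}"
  have J0: "ideal ?J B"
  proof (rule idealI[OF B.ring_axioms])
    show "subgroup ?J (add_monoid B)"
    proof (rule B.add.subgroupI)
      show "?J \<subseteq> carrier B" using I.Icarr by auto
      have "h \<zero> \<oplus>\<^bsub>B\<^esub> ?M \<otimes>\<^bsub>B\<^esub> \<zero>\<^bsub>B\<^esub> \<in> ?J" using I.zero_closed by blast
      then show "?J \<noteq> {}" by blast
      fix s assume "s \<in> ?J"
      then obtain x y where s: "x \<in> I" "y \<in> carrier B" "s = h x \<oplus>\<^bsub>B\<^esub> ?M \<otimes>\<^bsub>B\<^esub> y" by blast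
      then have "\<ominus>\<^bsub>B\<^esub> s = h (\<ominus> x) \<oplus>\<^bsub>B\<^esub> ?M \<otimes>\<^bsub>B\<^esub> (\<ominus>\<^bsub>B\<^esub> y)" using I.Icarr by (simp add: h_neg B.minus_add B.r_minus)
      then show "\<ominus>\<^bsub>B\<^esub> s \<in> ?J" using s I.a_inv_closed B.a_inv_closed by blast
      fix t assume "t \<in> ?J"
      then obtain x' y' where t: "x' \<in> I" "y' \<in> carrier B" "t = h x' \<oplus>\<^bsub>B\<^esub> ?M \<otimes>\<^bsub>B\<^esub> y'" by blast
      have "s \<oplus>\<^bsub>B\<^esub> t = h (x \<oplus> x') \<oplus>\<^bsub>B\<^esub> ?M \<otimes>\<^bsub>B\<^esub> (y \<oplus>\<^bsub>B\<^esub> y')" using s t I.Icarr by (simp add: h_add B.r_distr B.a_ac)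
      then show "s \<oplus>\<^bsub>B\<^esub> t \<in> ?J" using I.a_closed[OF s(1) t(1)] s t by blast
    qed
    fix s b assume sb: "s \<in> ?J" "b \<in> carrier B"
    then obtain x y where s: "x \<in> I" "y \<in> carrier B" "s = h x \<oplus>\<^bsub>B\<^esub> ?M \<otimes>\<^bsub>B\<^esub> y" by blast
    obtain r w where r: "r \<in> carrier R" "w \<in> carrier B" "b = h r \<oplus>\<^bsub>B\<^esub> ?M \<otimes>\<^bsub>B\<^esub> w" using approx[OF sb(2), of k] by blast
    have xc: "h x \<in> carrier B" "x \<in> carrier R" using s I.Icarr by auto
    have "b \<otimes>\<^bsub>B\<^esub> s = h r \<otimes>\<^bsub>B\<^esub> h x \<oplus>\<^bsub>B\<^esub> ?M \<otimes>\<^bsub>B\<^esub> (w \<otimes>\<^bsub>B\<^esub> h x \<oplus>\<^bsub>B\<^esub> b \<otimes>\<^bsub>B\<^esub> y)"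
      unfolding s(3) r(3) using xc r(1,2) s(2) by (simp add: B.l_distr B.r_distr B.m_ac B.a_ac)
    then have "b \<otimes>\<^bsub>B\<^esub> s = h (r \<otimes> x) \<oplus>\<^bsub>B\<^esub> ?M \<otimes>\<^bsub>B\<^esub> (w \<otimes>\<^bsub>B\<^esub> h x \<oplus>\<^bsub>B\<^esub> b \<otimes>\<^bsub>B\<^esub> y)" using xc r(1) by (simp add: h_mult)
    moreover have "w \<otimes>\<^bsub>B\<^esub> h x \<oplus>\<^bsub>B\<^esub> b \<otimes>\<^bsub>B\<^esub> y \<in> carrier B" using xc r s sb by simp
    ultimately show bs: "b \<otimes>\<^bsub>B\<^esub> s \<in> ?J" using I.I_l_closed[OF s(1) r(1)] by blast
    have "s \<in> carrier B" using s xc by simp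
    then show "s \<otimes>\<^bsub>B\<^esub> b \<in> ?J" using bs sb by (simp add: B.m_comm)
  qed
  have Jr0: "r \<in> I" if r: "r \<in> carrier R" "h r \<in> ?J" for r
  proof -
    obtain x y where s: "x \<in> I" "y \<in> carrier B" "h r = h x \<oplus>\<^bsub>B\<^esub> ?M \<otimes>\<^bsub>B\<^esub> y" using r(2) by blast
    have xc: "x \<in> carrier R" using s I.Icarr by auto
    have cancel: "(p \<oplus>\<^bsub>B\<^esub> q) \<ominus>\<^bsub>B\<^esub> p = q" if "p \<in> carrier B" "q \<in> carrier B" for p q using that by algebra
    have "h (r \<ominus> x) = ?M \<otimes>\<^bsub>B\<^esub> y" unfolding h_minus[OF r(1) xc] s(3) using xc s(2) by (intro cancel) auto
    then obtain z where z: "z \<in> carrier R" "r \<ominus> x = m [^] k \<otimes> z" using reflect[of "r \<ominus> x" y k] r(1) xc s(2) by auto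
    have "r = x \<oplus> (r \<ominus> x)" using r(1) xc by algebra
    also have "\<dots> \<in> I" unfolding z(2) using s(1) I.I_r_closed[OF k z(1)] by (rule I.a_closed)
    finally show ?thesis .
  qed
  have "h (m [^] k) \<oplus>\<^bsub>B\<^esub> ?M \<otimes>\<^bsub>B\<^esub> \<zero>\<^bsub>B\<^esub> \<in> ?J" using k by blast
  then have MJ0: "?M \<in> ?J" by (simp add: h_pow)
  have hJ0: "h x \<in> ?J" if x: "x \<in> I" for x
  proof -
    have "h x \<oplus>\<^bsub>B\<^esub> ?M \<otimes>\<^bsub>B\<^esub> \<zero>\<^bsub>B\<^esub> \<in> ?J" using x by blast
    then show ?thesis using I.Icarr[OF x] by simp
  qed
  obtain JJ where JJ: "JJ = ?J" by blast
  note J' = J0[folded JJ] and Jr = Jr0[folded JJ] and MJ = MJ0[folded JJ] and hJ = hJ0[folded JJ]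
  obtain a' b' where ab': "a' \<in> carrier B" "b' \<in> carrier B" "JJ = Idl\<^bsub>B\<^esub> {a', b'}" using assms J' MJ unfolding two_gen_def by blast
  interpret J: ideal JJ B by (rule J')
  \<comment> \<open>The order \<open>k + 1\<close> leaves an error with a spare factor
    \<open>m\<close> over \<open>m^k\<close>, which is what makes the later Nakayama step
    possible.\<close>
  have low: "\<exists>a\<in>I. \<exists>y\<in>carrier B. c = h a \<oplus>\<^bsub>B\<^esub> h m [^]\<^bsub>B\<^esub> Suc k \<otimes>\<^bsub>B\<^esub> y" if c: "c \<in> JJ" for c
  proof -
    obtain a y where a: "a \<in> carrier R" "y \<in> carrier B" "c = h a \<oplus>\<^bsub>B\<^esub> h m [^]\<^bsub>B\<^esub> Suc k \<otimes>\<^bsub>B\<^esub> y" using approx[OF J.Icarr[OF c], of "Suc k"] by blast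
    have t: "h m [^]\<^bsub>B\<^esub> Suc k \<otimes>\<^bsub>B\<^esub> y = ?M \<otimes>\<^bsub>B\<^esub> (h m \<otimes>\<^bsub>B\<^esub> y)" using a by (simp add: B.m_assoc)
    have tJ: "?M \<otimes>\<^bsub>B\<^esub> (h m \<otimes>\<^bsub>B\<^esub> y) \<in> JJ" using J.I_r_closed[OF MJ] a(2) by simp
    have "h a = c \<ominus>\<^bsub>B\<^esub> ?M \<otimes>\<^bsub>B\<^esub> (h m \<otimes>\<^bsub>B\<^esub> y)" unfolding a(3) t using a(1,2) by (simp add: a_minus_def B.a_assoc B.r_neg)
    also have "\<dots> \<in> JJ" unfolding a_minus_def using c tJ by (intro J.a_closed J.a_inv_closed)
    finally show ?thesis using Jr a by blast
  qed
  have "a' \<in> JJ" "b' \<in> JJ" unfolding ab'(3) using B.genideal_self[of "{a', b'}"] ab'(1,2) by auto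
  then obtain a b s t where a: "a \<in> I" "s \<in> carrier B" "a' = h a \<oplus>\<^bsub>B\<^esub> h m [^]\<^bsub>B\<^esub> Suc k \<otimes>\<^bsub>B\<^esub> s"
    and b: "b \<in> I" "t \<in> carrier B" "b' = h b \<oplus>\<^bsub>B\<^esub> h m [^]\<^bsub>B\<^esub> Suc k \<otimes>\<^bsub>B\<^esub> t" using low by meson
  have c: "a \<in> carrier R" "b \<in> carrier R" using a b I.Icarr by auto
  let ?K = "Idl {a, b}"
  interpret K: ideal ?K R using c by (intro genideal_ideal) auto
  have main: "\<exists>z\<in>?K. \<exists>r\<in>carrier R. x = z \<oplus> m [^] Suc k \<otimes> r" if x: "x \<in> I" for x
  proof -
    have xc: "x \<in> carrier R" using x I.Icarr by auto
    have "h x \<in> JJ" by (rule hJ[OF x])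
    then obtain u' v' where u': "u' \<in> carrier B" "v' \<in> carrier B" "h x = u' \<otimes>\<^bsub>B\<^esub> a' \<oplus>\<^bsub>B\<^esub> v' \<otimes>\<^bsub>B\<^esub> b'" unfolding ab'(3) PB.Idl_two[OF ab'(1,2)] by blast
    let ?N = "h m [^]\<^bsub>B\<^esub> Suc k"
    obtain u p where u: "u \<in> carrier R" "p \<in> carrier B" "u' = h u \<oplus>\<^bsub>B\<^esub> ?N \<otimes>\<^bsub>B\<^esub> p" using approx[OF u'(1), of "Suc k"] by blast
    obtain v q where v: "v \<in> carrier R" "q \<in> carrier B" "v' = h v \<oplus>\<^bsub>B\<^esub> ?N \<otimes>\<^bsub>B\<^esub> q" using approx[OF u'(2), of "Suc k"] by blast
    let ?z = "u \<otimes> a \<oplus> v \<otimes> b"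
    let ?w = "h u \<otimes>\<^bsub>B\<^esub> s \<oplus>\<^bsub>B\<^esub> p \<otimes>\<^bsub>B\<^esub> a' \<oplus>\<^bsub>B\<^esub> (h v \<otimes>\<^bsub>B\<^esub> t \<oplus>\<^bsub>B\<^esub> q \<otimes>\<^bsub>B\<^esub> b')"
    have N: "?N \<in> carrier B" "h a \<in> carrier B" "h b \<in> carrier B" "h u \<in> carrier B" "h v \<in> carrier B" using c u v by (auto simp del: B.nat_pow_Suc)
    have gen: "(U \<oplus>\<^bsub>B\<^esub> N \<otimes>\<^bsub>B\<^esub> P) \<otimes>\<^bsub>B\<^esub> (X \<oplus>\<^bsub>B\<^esub> N \<otimes>\<^bsub>B\<^esub> S) = U \<otimes>\<^bsub>B\<^esub> X \<oplus>\<^bsub>B\<^esub> N \<otimes>\<^bsub>B\<^esub> (U \<otimes>\<^bsub>B\<^esub> S \<oplus>\<^bsub>B\<^esub> P \<otimes>\<^bsub>B\<^esub> (X \<oplus>\<^bsub>B\<^esub> N \<otimes>\<^bsub>B\<^esub> S))"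
      if "U \<in> carrier B" "N \<in> carrier B" "P \<in> carrier B" "X \<in> carrier B" "S \<in> carrier B" for U N P X S
      using that by (simp add: B.l_distr B.r_distr B.m_ac B.a_ac)
    have 1: "u' \<otimes>\<^bsub>B\<^esub> a' = h u \<otimes>\<^bsub>B\<^esub> h a \<oplus>\<^bsub>B\<^esub> ?N \<otimes>\<^bsub>B\<^esub> (h u \<otimes>\<^bsub>B\<^esub> s \<oplus>\<^bsub>B\<^esub> p \<otimes>\<^bsub>B\<^esub> a')"
      unfolding a(3) u(3) by (rule gen) (use N u a in auto)
    have 2: "v' \<otimes>\<^bsub>B\<^esub> b' = h v \<otimes>\<^bsub>B\<^esub> h b \<oplus>\<^bsub>B\<^esub> ?N \<otimes>\<^bsub>B\<^esub> (h v \<otimes>\<^bsub>B\<^esub> t \<oplus>\<^bsub>B\<^esub> q \<otimes>\<^bsub>B\<^esub> b')"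
      unfolding b(3) v(3) by (rule gen) (use N v b in auto)
    have hz: "h ?z = h u \<otimes>\<^bsub>B\<^esub> h a \<oplus>\<^bsub>B\<^esub> h v \<otimes>\<^bsub>B\<^esub> h b" using c u v by (simp add: h_add h_mult)
    have wc: "?w \<in> carrier B" "?z \<in> carrier R" using N u v a b c ab' by auto
    have gen2: "(X \<oplus>\<^bsub>B\<^esub> N \<otimes>\<^bsub>B\<^esub> P) \<oplus>\<^bsub>B\<^esub> (Y \<oplus>\<^bsub>B\<^esub> N \<otimes>\<^bsub>B\<^esub> Z) \<ominus>\<^bsub>B\<^esub> (X \<oplus>\<^bsub>B\<^esub> Y) = N \<otimes>\<^bsub>B\<^esub> (P \<oplus>\<^bsub>B\<^esub> Z)"
      if "X \<in> carrier B" "N \<in> carrier B" "P \<in> carrier B" "Y \<in> carrier B" "Z \<in> carrier B" for X N P Y Z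
      using that by algebra
    have "h (x \<ominus> ?z) = ?N \<otimes>\<^bsub>B\<^esub> ?w"
      unfolding h_minus[OF xc wc(2)] u'(3) 1 2 hz by (rule gen2) (use N u v a b ab' in auto)
    then obtain r where r: "r \<in> carrier R" "x \<ominus> ?z = m [^] Suc k \<otimes> r" using reflect[of "x \<ominus> ?z" ?w "Suc k"] wc xc by blast
    have "x = ?z \<oplus> (x \<ominus> ?z)" using xc wc(2) by algebra
    moreover have "?z \<in> ?K" unfolding Idl_two[OF c] using u v by blast
    ultimately show ?thesis using r by metis
  qed
  have kK: "m [^] k \<in> ?K"
  proof -
    obtain z r where z: "z \<in> ?K" "r \<in> carrier R" "m [^] k = z \<oplus> m [^] Suc k \<otimes> r" using main[OF k] by blast
    have zc: "z \<in> carrier R" using z K.Icarr by blast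
    have "m [^] k \<otimes> (\<one> \<ominus> m \<otimes> r) = m [^] k \<ominus> m [^] Suc k \<otimes> r" using z(2) by (simp add: a_minus_def r_distr r_minus m_assoc)
    also have "\<dots> = z" by (subst z(3)) (use zc z(2) in \<open>simp add: a_minus_def a_assoc r_neg\<close>)
    finally have 1: "m [^] k \<otimes> (\<one> \<ominus> m \<otimes> r) = z" .
    let ?i = "inv (\<one> \<ominus> m \<otimes> r)"
    have i: "?i \<in> carrier R" "(\<one> \<ominus> m \<otimes> r) \<otimes> ?i = \<one>" using unit_one_minus[OF z(2)] by auto
    have "z \<otimes> ?i = m [^] k \<otimes> ((\<one> \<ominus> m \<otimes> r) \<otimes> ?i)" unfolding 1[symmetric] using i(1) z(2) by (intro m_assoc) auto
    then have "m [^] k = z \<otimes> ?i" using i(2) by simp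
    then show ?thesis using K.I_r_closed[OF z(1) i(1)] by simp
  qed
  have "I \<subseteq> ?K"
  proof
    fix x assume "x \<in> I"
    then obtain z r where z: "z \<in> ?K" "r \<in> carrier R" "x = z \<oplus> m [^] Suc k \<otimes> r" using main by blast
    have "m [^] Suc k \<otimes> r = m [^] k \<otimes> (m \<otimes> r)" using z by (simp add: m_assoc)
    also have "\<dots> \<in> ?K" using K.I_r_closed[OF kK] z(2) by simp
    finally show "x \<in> ?K" unfolding z(3) using z(1) by (intro K.a_closed)
  qed
  moreover have "?K \<subseteq> I" using a b by (intro genideal_minimal[OF I]) auto
  ultimately show "\<exists>a\<in>carrier R. \<exists>b\<in>carrier R. I = Idl {a, b}" using c by blast
qed

lemma divides_push:
  assumes "a \<in> carrier R" shows "(\<exists>y\<in>carrier R. a = m [^] (k::nat) \<otimes> y) \<longleftrightarrow> (\<exists>y\<in>carrier B. h a = h m [^]\<^bsub>B\<^esub> k \<otimes>\<^bsub>B\<^esub> y)"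
proof
  assume "\<exists>y\<in>carrier R. a = m [^] k \<otimes> y"
  then obtain y where "y \<in> carrier R" "a = m [^] k \<otimes> y" by blast
  then show "\<exists>y\<in>carrier B. h a = h m [^]\<^bsub>B\<^esub> k \<otimes>\<^bsub>B\<^esub> y" by (intro bexI[of _ "h y"]) (auto simp: h_mult h_pow)
qed (use reflect assms in blast)

lemma bounded_pull: assumes "bounded_closure B (h m)" shows "bounded_closure R m"
proof -
  obtain c :: nat where c: "\<And>a k. a \<in> carrier B \<Longrightarrow> \<exists>d::nat. \<forall>n::nat. \<exists>y\<in>carrier B. h m [^]\<^bsub>B\<^esub> d \<otimes>\<^bsub>B\<^esub> a [^]\<^bsub>B\<^esub> n = h m [^]\<^bsub>B\<^esub> (k * n) \<otimes>\<^bsub>B\<^esub> y \<Longrightarrow>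
      \<exists>y\<in>carrier B. h m [^]\<^bsub>B\<^esub> c \<otimes>\<^bsub>B\<^esub> a = h m [^]\<^bsub>B\<^esub> (k::nat) \<otimes>\<^bsub>B\<^esub> y" using assms unfolding bounded_closure_def by blast
  show ?thesis unfolding bounded_closure_def
  proof (intro exI[of _ c] ballI allI impI)
    fix a and k :: nat assume a: "a \<in> carrier R" and "\<exists>d::nat. \<forall>n::nat. \<exists>y\<in>carrier R. m [^] d \<otimes> a [^] n = m [^] (k * n) \<otimes> y"
    then obtain d :: nat where d: "\<And>n::nat. \<exists>y\<in>carrier R. m [^] d \<otimes> a [^] n = m [^] (k * n) \<otimes> y" by blast
    have "\<exists>y\<in>carrier B. h m [^]\<^bsub>B\<^esub> d \<otimes>\<^bsub>B\<^esub> h a [^]\<^bsub>B\<^esub> n = h m [^]\<^bsub>B\<^esub> (k * n) \<otimes>\<^bsub>B\<^esub> y" for n :: nat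
      using d[of n] divides_push[of "m [^] d \<otimes> a [^] n" "k * n"] a by (simp add: h_mult h_pow)
    then have "\<exists>y\<in>carrier B. h m [^]\<^bsub>B\<^esub> c \<otimes>\<^bsub>B\<^esub> h a = h m [^]\<^bsub>B\<^esub> k \<otimes>\<^bsub>B\<^esub> y" using c[OF h_closed[OF a], of k] by blast
    then show "\<exists>y\<in>carrier R. m [^] c \<otimes> a = m [^] k \<otimes> y"
      using divides_push[of "m [^] c \<otimes> a" k] a by (simp add: h_mult h_pow)
  qed
qed

text \<open>Choose \<open>a\<close> in \<open>R\<close> congruent to \<open>b\<close> modulo
  \<open>m^k\<close>; then \<open>b / m^k\<close> and \<open>a / m^k\<close> differ by an element of
  the ring. Hence \<open>a / m^k\<close> is almost integral with the same exponent \<open>d\<close>,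
  the bound \<open>c\<close> applies to it, and adding the difference back preserves the
  conclusion.\<close>

lemma bounded_push: assumes "bounded_closure R m" shows "bounded_closure B (h m)"
proof -
  obtain c :: nat where c: "\<And>a k. a \<in> carrier R \<Longrightarrow> \<exists>d::nat. \<forall>n::nat. \<exists>y\<in>carrier R. m [^] d \<otimes> a [^] n = m [^] (k * n) \<otimes> y \<Longrightarrow>
      \<exists>y\<in>carrier R. m [^] c \<otimes> a = m [^] (k::nat) \<otimes> y" using assms unfolding bounded_closure_def by blast
  show ?thesis unfolding bounded_closure_def
  proof (intro exI[of _ c] ballI allI impI)
    fix b and k :: nat assume b: "b \<in> carrier B" and "\<exists>d::nat. \<forall>n::nat. \<exists>y\<in>carrier B. h m [^]\<^bsub>B\<^esub> d \<otimes>\<^bsub>B\<^esub> b [^]\<^bsub>B\<^esub> n = h m [^]\<^bsub>B\<^esub> (k * n) \<otimes>\<^bsub>B\<^esub> y"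
    then obtain d :: nat where d: "\<And>n::nat. \<exists>y\<in>carrier B. h m [^]\<^bsub>B\<^esub> d \<otimes>\<^bsub>B\<^esub> b [^]\<^bsub>B\<^esub> n = h m [^]\<^bsub>B\<^esub> (k * n) \<otimes>\<^bsub>B\<^esub> y" by blast
    obtain a y where ay: "a \<in> carrier R" "y \<in> carrier B" "b = h a \<oplus>\<^bsub>B\<^esub> h m [^]\<^bsub>B\<^esub> k \<otimes>\<^bsub>B\<^esub> y" using approx[OF b, of k] by blast
    have hac: "h a \<in> carrier B" using ay by simp
    have ha: "h a = b \<ominus>\<^bsub>B\<^esub> h m [^]\<^bsub>B\<^esub> k \<otimes>\<^bsub>B\<^esub> y" unfolding ay(3) using ay(2) hac by (simp add: a_minus_def B.a_assoc B.r_neg)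
    \<comment> \<open>The extra factor \<open>b^i\<close> drives the induction on \<open>n\<close>:
      replacing one factor \<open>h a\<close> by \<open>b - m^k y\<close> leads to the exponents
      \<open>(i + 1, n)\<close> and \<open>(i, n)\<close>.\<close>
    have "\<forall>i. \<exists>w\<in>carrier B. h m [^]\<^bsub>B\<^esub> d \<otimes>\<^bsub>B\<^esub> (b [^]\<^bsub>B\<^esub> i \<otimes>\<^bsub>B\<^esub> h a [^]\<^bsub>B\<^esub> n) = h m [^]\<^bsub>B\<^esub> (k * (i + n)) \<otimes>\<^bsub>B\<^esub> w" for n :: nat
    proof (induction n)
      case 0 then show ?case using d b by simp
    next
      case (Suc n)
      show ?case
      proof
        fix i :: nat
        obtain w where w: "w \<in> carrier B" "h m [^]\<^bsub>B\<^esub> d \<otimes>\<^bsub>B\<^esub> (b [^]\<^bsub>B\<^esub> Suc i \<otimes>\<^bsub>B\<^esub> h a [^]\<^bsub>B\<^esub> n) = h m [^]\<^bsub>B\<^esub> (k * (Suc i + n)) \<otimes>\<^bsub>B\<^esub> w" using Suc by blast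
        obtain w' where w': "w' \<in> carrier B" "h m [^]\<^bsub>B\<^esub> d \<otimes>\<^bsub>B\<^esub> (b [^]\<^bsub>B\<^esub> i \<otimes>\<^bsub>B\<^esub> h a [^]\<^bsub>B\<^esub> n) = h m [^]\<^bsub>B\<^esub> (k * (i + n)) \<otimes>\<^bsub>B\<^esub> w'" using Suc by blast
        let ?A = "h m [^]\<^bsub>B\<^esub> d" and ?b = "b [^]\<^bsub>B\<^esub> i" and ?h = "h a [^]\<^bsub>B\<^esub> n" and ?M = "h m [^]\<^bsub>B\<^esub> k"
        have gen: "A \<otimes>\<^bsub>B\<^esub> (p \<otimes>\<^bsub>B\<^esub> (q \<otimes>\<^bsub>B\<^esub> (b \<ominus>\<^bsub>B\<^esub> M \<otimes>\<^bsub>B\<^esub> y))) = A \<otimes>\<^bsub>B\<^esub> ((p \<otimes>\<^bsub>B\<^esub> b) \<otimes>\<^bsub>B\<^esub> q) \<ominus>\<^bsub>B\<^esub> (A \<otimes>\<^bsub>B\<^esub> (p \<otimes>\<^bsub>B\<^esub> q)) \<otimes>\<^bsub>B\<^esub> (M \<otimes>\<^bsub>B\<^esub> y)"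
          if "A \<in> carrier B" "p \<in> carrier B" "q \<in> carrier B" "M \<in> carrier B" for A p q M
          using that b ay(2) by algebra
        have "?A \<otimes>\<^bsub>B\<^esub> (?b \<otimes>\<^bsub>B\<^esub> h a [^]\<^bsub>B\<^esub> Suc n) = ?A \<otimes>\<^bsub>B\<^esub> (?b \<otimes>\<^bsub>B\<^esub> (?h \<otimes>\<^bsub>B\<^esub> (b \<ominus>\<^bsub>B\<^esub> ?M \<otimes>\<^bsub>B\<^esub> y)))" using ha by simp
        also have "\<dots> = ?A \<otimes>\<^bsub>B\<^esub> ((?b \<otimes>\<^bsub>B\<^esub> b) \<otimes>\<^bsub>B\<^esub> ?h) \<ominus>\<^bsub>B\<^esub> (?A \<otimes>\<^bsub>B\<^esub> (?b \<otimes>\<^bsub>B\<^esub> ?h)) \<otimes>\<^bsub>B\<^esub> (?M \<otimes>\<^bsub>B\<^esub> y)"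
          by (rule gen) (use b hac in auto)
        also have "?A \<otimes>\<^bsub>B\<^esub> ((?b \<otimes>\<^bsub>B\<^esub> b) \<otimes>\<^bsub>B\<^esub> ?h) = h m [^]\<^bsub>B\<^esub> (k * (i + Suc n)) \<otimes>\<^bsub>B\<^esub> w" using w by simp
        also have "(?A \<otimes>\<^bsub>B\<^esub> (?b \<otimes>\<^bsub>B\<^esub> ?h)) \<otimes>\<^bsub>B\<^esub> (?M \<otimes>\<^bsub>B\<^esub> y) = h m [^]\<^bsub>B\<^esub> (k * (i + Suc n)) \<otimes>\<^bsub>B\<^esub> (w' \<otimes>\<^bsub>B\<^esub> y)"
        proof -
          have "k * (i + Suc n) = k * (i + n) + k" by simp
          then have "h m [^]\<^bsub>B\<^esub> (k * (i + Suc n)) = h m [^]\<^bsub>B\<^esub> (k * (i + n)) \<otimes>\<^bsub>B\<^esub> ?M" by (simp only: B.nat_pow_mult[OF hm_closed])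
          then show ?thesis unfolding w'(2) using w'(1) ay(2) by (simp add: B.m_ac)
        qed
        finally have "?A \<otimes>\<^bsub>B\<^esub> (?b \<otimes>\<^bsub>B\<^esub> h a [^]\<^bsub>B\<^esub> Suc n) = h m [^]\<^bsub>B\<^esub> (k * (i + Suc n)) \<otimes>\<^bsub>B\<^esub> (w \<ominus>\<^bsub>B\<^esub> w' \<otimes>\<^bsub>B\<^esub> y)"
          using w(1) w'(1) ay(2) by (simp add: a_minus_def B.r_distr B.r_minus)
        then show "\<exists>w\<in>carrier B. ?A \<otimes>\<^bsub>B\<^esub> (?b \<otimes>\<^bsub>B\<^esub> h a [^]\<^bsub>B\<^esub> Suc n) = h m [^]\<^bsub>B\<^esub> (k * (i + Suc n)) \<otimes>\<^bsub>B\<^esub> w"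
          using w(1) w'(1) ay(2) by (intro bexI[of _ "w \<ominus>\<^bsub>B\<^esub> w' \<otimes>\<^bsub>B\<^esub> y"]) auto
      qed
    qed
    then have "\<exists>w\<in>carrier B. h m [^]\<^bsub>B\<^esub> d \<otimes>\<^bsub>B\<^esub> (b [^]\<^bsub>B\<^esub> (0::nat) \<otimes>\<^bsub>B\<^esub> h a [^]\<^bsub>B\<^esub> n) = h m [^]\<^bsub>B\<^esub> (k * (0 + n)) \<otimes>\<^bsub>B\<^esub> w" for n :: nat by blast
    then have "\<exists>w\<in>carrier B. h (m [^] d \<otimes> a [^] n) = h m [^]\<^bsub>B\<^esub> (k * n) \<otimes>\<^bsub>B\<^esub> w" for n :: nat using ay(1) hac by (simp add: h_mult h_pow)
    then have "\<exists>x\<in>carrier R. m [^] d \<otimes> a [^] n = m [^] (k * n) \<otimes> x" for n :: nat using divides_push[of "m [^] d \<otimes> a [^] n" "k * n"] ay(1) by simp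
    then have "\<exists>x\<in>carrier R. m [^] c \<otimes> a = m [^] k \<otimes> x" using c[OF ay(1), of k] by blast
    then have "\<exists>x\<in>carrier B. h (m [^] c \<otimes> a) = h m [^]\<^bsub>B\<^esub> k \<otimes>\<^bsub>B\<^esub> x" using divides_push[of "m [^] c \<otimes> a" k] ay(1) by simp
    then obtain x where x: "x \<in> carrier B" "h m [^]\<^bsub>B\<^esub> c \<otimes>\<^bsub>B\<^esub> h a = h m [^]\<^bsub>B\<^esub> k \<otimes>\<^bsub>B\<^esub> x" using ay(1) by (auto simp: h_mult h_pow)
    have "h m [^]\<^bsub>B\<^esub> c \<otimes>\<^bsub>B\<^esub> b = h m [^]\<^bsub>B\<^esub> c \<otimes>\<^bsub>B\<^esub> h a \<oplus>\<^bsub>B\<^esub> h m [^]\<^bsub>B\<^esub> k \<otimes>\<^bsub>B\<^esub> (h m [^]\<^bsub>B\<^esub> c \<otimes>\<^bsub>B\<^esub> y)"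
      unfolding ay(3) using hac ay(2) by (simp add: B.r_distr B.m_ac)
    also have "\<dots> = h m [^]\<^bsub>B\<^esub> k \<otimes>\<^bsub>B\<^esub> (x \<oplus>\<^bsub>B\<^esub> h m [^]\<^bsub>B\<^esub> c \<otimes>\<^bsub>B\<^esub> y)" unfolding x(2) using x(1) ay(2) by (simp add: B.r_distr)
    finally show "\<exists>y\<in>carrier B. h m [^]\<^bsub>B\<^esub> c \<otimes>\<^bsub>B\<^esub> b = h m [^]\<^bsub>B\<^esub> k \<otimes>\<^bsub>B\<^esub> y"
      using x(1) ay(2) by (intro bexI[of _ "x \<oplus>\<^bsub>B\<^esub> h m [^]\<^bsub>B\<^esub> c \<otimes>\<^bsub>B\<^esub> y"]) auto
  qed
qed

theorem transfer: "two_gen R m \<and> bounded_closure R m \<longleftrightarrow> two_gen B (h m) \<and> bounded_closure B (h m)"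
  using two_gen_push two_gen_pull bounded_push bounded_pull by blast

end

section \<open>The separated quotient and the completion\<close>

context param_ring begin

lemma mpow_closed[simp]: "m [^] (n::nat) \<in> carrier R" by simp

lemma PIdl_pow: "PIdl (m [^] (n::nat)) = {m [^] n \<otimes> y | y. y \<in> carrier R}"
proof -
  have "{x \<otimes> m [^] n | x. x \<in> carrier R} = {m [^] n \<otimes> y | y. y \<in> carrier R}"
    by (rule Collect_cong) (metis m_comm mpow_closed)
  then show ?thesis unfolding cgenideal_def .
qed

lemma PIdl_pow_ideal: "ideal (PIdl (m [^] (n::nat))) R"
  by (rule cgenideal_ideal) simp

lemma quot_carrier: "ideal I R \<Longrightarrow> carrier (R Quot I) = {I +> a | a. a \<in> carrier R}"
  unfolding FactRing_def A_RCOSETS_def' by auto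

lemma core_ideal: "ideal (\<Inter>i\<in>{0<..}. PIdl (m [^] (i::nat))) R"
  by (rule i_Intersect) (use PIdl_pow_ideal in auto)

lemma core_iff: "x \<in> (\<Inter>i\<in>{0<..}. PIdl (m [^] (i::nat))) \<longleftrightarrow> x \<in> carrier R \<and> (\<forall>k::nat. \<exists>y\<in>carrier R. x = m [^] k \<otimes> y)"
proof
  assume x: "x \<in> (\<Inter>i\<in>{0<..}. PIdl (m [^] (i::nat)))"
  have k: "\<exists>y\<in>carrier R. x = m [^] k \<otimes> y" if "k > 0" for k :: nat using x that unfolding PIdl_pow by blast
  obtain y where "y \<in> carrier R" "x = m [^] (1::nat) \<otimes> y" using k[of 1] by auto
  then have xc: "x \<in> carrier R" by simp
  have "\<exists>y\<in>carrier R. x = m [^] k \<otimes> y" for k :: nat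
  proof (cases "k = 0")
    case True then show ?thesis using xc by (intro bexI[of _ x]) auto
  qed (use k in auto)
  then show "x \<in> carrier R \<and> (\<forall>k::nat. \<exists>y\<in>carrier R. x = m [^] k \<otimes> y)" using xc by blast
next
  assume "x \<in> carrier R \<and> (\<forall>k::nat. \<exists>y\<in>carrier R. x = m [^] k \<otimes> y)"
  then show "x \<in> (\<Inter>i\<in>{0<..}. PIdl (m [^] (i::nat)))" unfolding PIdl_pow by blast
qed

lemma cancel_pow: assumes "x \<in> carrier R" "y \<in> carrier R" "m [^] (n::nat) \<otimes> x = m [^] n \<otimes> y" shows "x = y"
  by (rule nzd_cancel[OF nzd_pow[OF nzd_m]]) (use assms in auto)

context
  fixes J assumes J_def: "J = (\<Inter>i\<in>{0<..}. PIdl (m [^] (i::nat)))"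
begin

interpretation J: ideal J R unfolding J_def by (rule core_ideal)

lemma J_iff: "x \<in> J \<longleftrightarrow> x \<in> carrier R \<and> (\<forall>k::nat. \<exists>y\<in>carrier R. x = m [^] k \<otimes> y)"
  unfolding J_def by (rule core_iff)

lemma coset_eq: "a \<in> carrier R \<Longrightarrow> b \<in> carrier R \<Longrightarrow> J +> a = J +> b \<longleftrightarrow> a \<ominus> b \<in> J"
  using quotient_eq_iff_same_a_r_cos[OF J.is_ideal] by blast

lemma coset_divides:
  assumes "a \<in> carrier R" "b \<in> carrier R" "J +> a = J +> (m [^] (n::nat) \<otimes> b)" shows "\<exists>x\<in>carrier R. a = m [^] n \<otimes> x"
proof -
  have "a \<ominus> m [^] n \<otimes> b \<in> J" using coset_eq[of a "m [^] n \<otimes> b"] assms by simp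
  then obtain y where y: "y \<in> carrier R" "a \<ominus> m [^] n \<otimes> b = m [^] n \<otimes> y" unfolding J_iff by blast
  have cancel: "p = (p \<ominus> w) \<oplus> w" if "p \<in> carrier R" "w \<in> carrier R" for p w using that by algebra
  have "a = (a \<ominus> m [^] n \<otimes> b) \<oplus> m [^] n \<otimes> b" by (intro cancel) (use assms in auto)
  then have "a = m [^] n \<otimes> (y \<oplus> b)" unfolding y(2) using y(1) assms by (simp add: r_distr)
  then show ?thesis using y(1) assms by blast
qed

interpretation B: cring "R Quot J" by (rule J.quotient_is_cring[OF is_cring])

lemma quot_pow: "a \<in> carrier R \<Longrightarrow> (J +> a) [^]\<^bsub>R Quot J\<^esub> (n::nat) = J +> (a [^] n)"
proof (induction n)
  case 0 then show ?case using ring_hom_one[OF J.rcos_ring_hom] by simp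
next
  case (Suc n) then show ?case using ring_hom_mult[OF J.rcos_ring_hom, of "a [^] n" a] by simp
qed

lemma quot_mult: "a \<in> carrier R \<Longrightarrow> b \<in> carrier R \<Longrightarrow> (J +> a) \<otimes>\<^bsub>R Quot J\<^esub> (J +> b) = J +> (a \<otimes> b)"
  using ring_hom_mult[OF J.rcos_ring_hom, of a b] by simp

lemma quot_rep: "b \<in> carrier (R Quot J) \<Longrightarrow> \<exists>a\<in>carrier R. b = J +> a"
  unfolding quot_carrier[OF J.is_ideal] by blast

lemma quot_zero: "\<zero>\<^bsub>R Quot J\<^esub> = J +> \<zero>"
  using ring_hom_zero[OF J.rcos_ring_hom ring_axioms B.ring_axioms] by simp

lemma quot_analytic: "analytic_hom R m (R Quot J) ((+>) J)"
proof unfold_locales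
  show "(+>) J \<in> ring_hom R (R Quot J)" by (rule J.rcos_ring_hom)
  have mc: "J +> m \<in> carrier (R Quot J)" unfolding quot_carrier[OF J.is_ideal] by auto
  show "nzd (R Quot J) (J +> m)" unfolding nzd_def
  proof (intro conjI mc ballI impI)
    fix b assume "b \<in> carrier (R Quot J)" and z: "(J +> m) \<otimes>\<^bsub>R Quot J\<^esub> b = \<zero>\<^bsub>R Quot J\<^esub>"
    then obtain a where a: "a \<in> carrier R" "b = J +> a" using quot_rep by blast
    have "J +> (m \<otimes> a) = J +> \<zero>" using z a quot_mult[of m a] quot_zero by simp
    then have "m \<otimes> a \<ominus> \<zero> \<in> J" using coset_eq[of "m \<otimes> a" \<zero>] a by simp
    then have mJ: "m \<otimes> a \<in> J" using a by (simp add: a_minus_def)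
    have "\<exists>y\<in>carrier R. a = m [^] k \<otimes> y" for k :: nat
    proof -
      \<comment> \<open>The exponent is taken one higher to make up for the factor \<open>m\<close>
        about to be cancelled.\<close>
      obtain y where y: "y \<in> carrier R" "m \<otimes> a = m [^] Suc k \<otimes> y" using mJ unfolding J_iff by blast
      have "m [^] (1::nat) \<otimes> a = m [^] (1::nat) \<otimes> (m [^] k \<otimes> y)" using y a by (simp add: m_ac)
      then have "a = m [^] k \<otimes> y" by (rule cancel_pow[rotated 2]) (use a y in auto)
      then show ?thesis using y by blast
    qed
    then have "a \<ominus> \<zero> \<in> J" using a J_iff[of a] by (simp add: a_minus_def)
    then show "b = \<zero>\<^bsub>R Quot J\<^esub>" using coset_eq[of a \<zero>] a quot_zero by simp
  qed
  fix n :: nat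
  show "\<exists>a\<in>carrier R. \<exists>y\<in>carrier (R Quot J). b = (J +> a) \<oplus>\<^bsub>R Quot J\<^esub> (J +> m) [^]\<^bsub>R Quot J\<^esub> n \<otimes>\<^bsub>R Quot J\<^esub> y"
    if b: "b \<in> carrier (R Quot J)" for b
  proof -
    obtain a where a: "a \<in> carrier R" "b = J +> a" using quot_rep b by blast
    have "b = b \<oplus>\<^bsub>R Quot J\<^esub> (J +> m) [^]\<^bsub>R Quot J\<^esub> n \<otimes>\<^bsub>R Quot J\<^esub> \<zero>\<^bsub>R Quot J\<^esub>" using b mc by simp
    then show ?thesis using a B.zero_closed by blast
  qed
  show "\<exists>x\<in>carrier R. a = m [^] n \<otimes> x"
    if a: "a \<in> carrier R" "y \<in> carrier (R Quot J)" "J +> a = (J +> m) [^]\<^bsub>R Quot J\<^esub> n \<otimes>\<^bsub>R Quot J\<^esub> y" for a y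
  proof -
    obtain b where b: "b \<in> carrier R" "y = J +> b" using quot_rep a by blast
    then have "J +> a = J +> (m [^] n \<otimes> b)" using a(3) quot_pow[of m n] quot_mult[of "m [^] n" b] by simp
    then show ?thesis by (rule coset_divides[OF a(1) b(1)])
  qed
  show "\<one>\<^bsub>R Quot J\<^esub> \<oplus>\<^bsub>R Quot J\<^esub> (J +> m) \<otimes>\<^bsub>R Quot J\<^esub> y \<in> Units (R Quot J)" if yc: "y \<in> carrier (R Quot J)" for y
  proof -
    obtain b where b: "b \<in> carrier R" "y = J +> b" using quot_rep yc by blast
    let ?u = "\<one> \<ominus> m \<otimes> (\<ominus> b)"
    have u: "?u \<in> Units R" using unit_one_minus[of "\<ominus> b"] b by simp
    have ub: "?u = \<one> \<oplus> m \<otimes> b" using b by (simp add: a_minus_def r_minus)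
    have "\<one>\<^bsub>R Quot J\<^esub> \<oplus>\<^bsub>R Quot J\<^esub> (J +> m) \<otimes>\<^bsub>R Quot J\<^esub> y = J +> ?u"
      unfolding ub using b quot_mult[of m b] ring_hom_one[OF J.rcos_ring_hom] ring_hom_add[OF J.rcos_ring_hom, of \<one> "m \<otimes> b"] by simp
    moreover have "J +> ?u \<in> Units (R Quot J)"
    proof -
      have uc: "?u \<in> carrier R" "inv ?u \<in> carrier R" "?u \<otimes> inv ?u = \<one>" "inv ?u \<otimes> ?u = \<one>" using u by (auto simp del: Units_inv_closed intro: Units_inv_closed)
      have "(J +> ?u) \<otimes>\<^bsub>R Quot J\<^esub> (J +> inv ?u) = \<one>\<^bsub>R Quot J\<^esub>" "(J +> inv ?u) \<otimes>\<^bsub>R Quot J\<^esub> (J +> ?u) = \<one>\<^bsub>R Quot J\<^esub>"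
        using quot_mult[OF uc(1,2)] quot_mult[OF uc(2,1)] uc(3,4) ring_hom_one[OF J.rcos_ring_hom] by simp_all
      then show ?thesis using ring_hom_closed[OF J.rcos_ring_hom uc(1)] ring_hom_closed[OF J.rcos_ring_hom uc(2)] unfolding Units_def by blast
    qed
    ultimately show ?thesis by simp
  qed
qed

lemma quot_separated: "adic_separated (R Quot J) (J +> m)"
  unfolding adic_separated_def
proof (intro ballI impI)
  fix x assume x: "x \<in> carrier (R Quot J)" "\<forall>k::nat. \<exists>y\<in>carrier (R Quot J). x = (J +> m) [^]\<^bsub>R Quot J\<^esub> k \<otimes>\<^bsub>R Quot J\<^esub> y"
  obtain a where a: "a \<in> carrier R" "x = J +> a" using quot_rep x by blast
  have "\<exists>y\<in>carrier R. a = m [^] k \<otimes> y" for k :: nat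
  proof -
    obtain y where y: "y \<in> carrier (R Quot J)" "x = (J +> m) [^]\<^bsub>R Quot J\<^esub> k \<otimes>\<^bsub>R Quot J\<^esub> y" using x(2) by blast
    obtain b where b: "b \<in> carrier R" "y = J +> b" using quot_rep y by blast
    then have "J +> a = J +> (m [^] k \<otimes> b)" using y(2) a(2) quot_pow[of m k] quot_mult[of "m [^] k" b] by simp
    then show ?thesis by (rule coset_divides[OF a(1) b(1)])
  qed
  then have "a \<ominus> \<zero> \<in> J" using a J_iff[of a] by (simp add: a_minus_def)
  then show "x = \<zero>\<^bsub>R Quot J\<^esub>" using coset_eq[of a \<zero>] a quot_zero by simp
qed

lemma quot_pi_regular: assumes "pi_regular R m" shows "pi_regular (R Quot J) (J +> m)"
  unfolding pi_regular_def
proof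
  fix b assume "b \<in> carrier (R Quot J)"
  then obtain a where a: "a \<in> carrier R" "b = J +> a" using quot_rep by blast
  obtain j n :: nat and x where x: "x \<in> carrier R" "m [^] j \<otimes> a [^] n = a [^] Suc n \<otimes> x" using assms a unfolding pi_regular_def by blast
  have "(J +> m) [^]\<^bsub>R Quot J\<^esub> j \<otimes>\<^bsub>R Quot J\<^esub> b [^]\<^bsub>R Quot J\<^esub> n = J +> (m [^] j \<otimes> a [^] n)"
    using a quot_pow[of m j] quot_pow[of a n] quot_mult[of "m [^] j" "a [^] n"] by simp
  also have "\<dots> = b [^]\<^bsub>R Quot J\<^esub> Suc n \<otimes>\<^bsub>R Quot J\<^esub> (J +> x)"
    unfolding x(2) a(2) quot_pow[OF a(1)] using a(1) x(1) by (subst quot_mult) auto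
  finally show "\<exists>(j::nat) (n::nat). \<exists>x\<in>carrier (R Quot J). (J +> m) [^]\<^bsub>R Quot J\<^esub> j \<otimes>\<^bsub>R Quot J\<^esub> b [^]\<^bsub>R Quot J\<^esub> n = b [^]\<^bsub>R Quot J\<^esub> Suc n \<otimes>\<^bsub>R Quot J\<^esub> x"
    using ring_hom_closed[OF J.rcos_ring_hom x(1)] by blast
qed

theorem bass_quot_iff: assumes "pi_regular R m" shows "bass_ring (R Quot J) \<longleftrightarrow> two_gen R m \<and> bounded_closure R m"
proof -
  interpret H: analytic_hom R m "R Quot J" "(+>) J" by (rule quot_analytic)
  interpret P: param_ring "R Quot J" "J +> m" by (rule H.target_param_ring)
  have pr: "pi_regular (R Quot J) (J +> m)" by (rule quot_pi_regular[OF assms])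
  have "bass_ring (R Quot J) \<longleftrightarrow> two_gen (R Quot J) (J +> m) \<and> bounded_closure (R Quot J) (J +> m)"
  proof (rule P.bass_iff[OF quot_separated])
    assume h: "two_gen (R Quot J) (J +> m)" "bounded_closure (R Quot J) (J +> m)"
    show "all_two_gen (R Quot J)"
      by (rule P.pi_regular_all_two_gen[OF quot_separated h(2,1)]) (use pr in \<open>auto simp: pi_regular_def\<close>)
    show "nzd_divides (R Quot J) (J +> m)" by (rule B.pi_regular_nzd_divides[OF pr P.m_closed'])
  qed
  then show ?thesis using H.transfer by simp
qed

end

section \<open>The completion as coherent sequences of representatives\<close>

abbreviation "RC \<equiv> adic_completion R m"
abbreviation "RQ n \<equiv> R Quot (PIdl (m [^] (n::nat)))"
definition "q n a = PIdl (m [^] (n::nat)) +> a"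
text \<open>Representatives instead of cosets, so that computations in the completion become
  pointwise computations in \<open>R\<close>, with equality decided by congruence modulo
  \<open>m^n\<close> at each index.\<close>

definition "coherent a \<longleftrightarrow> (\<forall>n::nat. a n \<in> carrier R \<and> (\<exists>y\<in>carrier R. a (Suc n) = a n \<oplus> m [^] n \<otimes> y))"
definition "mk a = (\<lambda>n. q n (a n))"

lemma q_eq: assumes "a \<in> carrier R" "b \<in> carrier R" shows "q n a = q n b \<longleftrightarrow> (\<exists>y\<in>carrier R. a = b \<oplus> m [^] n \<otimes> y)"
proof -
  have "q n a = q n b \<longleftrightarrow> a \<ominus> b \<in> PIdl (m [^] n)" unfolding q_def using quotient_eq_iff_same_a_r_cos[OF PIdl_pow_ideal] assms by blast
  also have "\<dots> \<longleftrightarrow> (\<exists>y\<in>carrier R. a \<ominus> b = m [^] n \<otimes> y)" unfolding PIdl_pow by blast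
  also have "\<dots> \<longleftrightarrow> (\<exists>y\<in>carrier R. a = b \<oplus> m [^] n \<otimes> y)"
  proof (rule bex_cong[OF refl])
    fix y assume y: "y \<in> carrier R"
    have "a = b \<oplus> (a \<ominus> b)" using assms by algebra
    moreover have "(b \<oplus> m [^] n \<otimes> y) \<ominus> b = m [^] n \<otimes> y"
    proof -
      have "(b \<oplus> z) \<ominus> b = z" if "z \<in> carrier R" for z using that assms by algebra
      then show ?thesis using y by simp
    qed
    ultimately show "a \<ominus> b = m [^] n \<otimes> y \<longleftrightarrow> a = b \<oplus> m [^] n \<otimes> y" by metis
  qed
  finally show ?thesis .
qed

lemma q_hom: "q n \<in> ring_hom R (RQ n)"
  using ideal.rcos_ring_hom[OF PIdl_pow_ideal[of n]] unfolding q_def by simp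

lemma q_closed: "a \<in> carrier R \<Longrightarrow> q n a \<in> carrier (RQ n)" using q_hom by (rule ring_hom_closed)

text \<open>Inclusion of cosets, as used in the completion, amounts to compatibility of residue
  classes: the coset modulo \<open>m^n\<close> that contains the smaller coset is the class of any
  element of the latter.\<close>

lemma q_subset: assumes "a \<in> carrier R" "b \<in> carrier R" shows "q (Suc n) a \<subseteq> q n b \<longleftrightarrow> q n a = q n b"
proof -
  have sub: "q (Suc n) a \<subseteq> q n a"
  proof -
    have "m [^] Suc n \<otimes> y = m [^] n \<otimes> (m \<otimes> y)" if "y \<in> carrier R" for y using that by (simp add: m_assoc)
    then have "PIdl (m [^] Suc n) \<subseteq> PIdl (m [^] n)" unfolding PIdl_pow by (smt (verit) Collect_mono m_closed m_closed')
    then show ?thesis unfolding q_def a_r_coset_def' by blast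
  qed
  have "a \<in> q (Suc n) a" unfolding q_def
    using abelian_subgroup.a_rcos_self[OF abelian_subgroupI3[OF ideal.axioms(1)[OF PIdl_pow_ideal] abelian_group_axioms] assms(1)] .
  moreover have "q n a = q n b" if "a \<in> q n b"
    using that a_repr_independence[of a "PIdl (m [^] n)" b] additive_subgroup.a_subgroup[OF ideal.axioms(1)[OF PIdl_pow_ideal]] assms
    unfolding q_def by metis
  ultimately show ?thesis using sub by blast
qed

lemma RC_carrier: "carrier RC = mk ` {a. coherent a}"
proof
  show "mk ` {a. coherent a} \<subseteq> carrier RC"
  proof
    fix f assume "f \<in> mk ` {a. coherent a}"
    then obtain a where a: "coherent a" "f = mk a" by blast
    have ac: "a n \<in> carrier R" for n using a unfolding coherent_def by blast
    have "q (Suc n) (a (Suc n)) \<subseteq> q n (a n)" for n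
      using q_subset[OF ac ac, of n "Suc n" n] q_eq[OF ac ac, of n "Suc n" n] a(1) unfolding coherent_def by blast
    then show "f \<in> carrier RC" unfolding adic_completion_def a(2) mk_def using q_closed[OF ac] by simp
  qed
  show "carrier RC \<subseteq> mk ` {a. coherent a}"
  proof
    fix f assume f: "f \<in> carrier RC"
    then have "f n \<in> carrier (RQ n)" "f (Suc n) \<subseteq> f n" for n unfolding adic_completion_def by auto
    moreover from this have "\<exists>a\<in>carrier R. f n = q n a" for n
      using quot_carrier[OF PIdl_pow_ideal[of n]] unfolding q_def by blast
    ultimately obtain a where a: "\<And>n. a n \<in> carrier R" "\<And>n. f n = q n (a n)" "\<And>n. f (Suc n) \<subseteq> f n" by metis
    have "q n (a (Suc n)) = q n (a n)" for n using q_subset[OF a(1) a(1), of n "Suc n" n] a(2,3) by metis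
    then have "coherent a" unfolding coherent_def using q_eq[OF a(1) a(1)] a(1) by blast
    then show "f \<in> mk ` {a. coherent a}" using a(2) unfolding mk_def by (intro image_eqI[of _ _ a]) auto
  qed
qed

lemma coherentD: "coherent a \<Longrightarrow> a n \<in> carrier R" unfolding coherent_def by blast

lemma coherent_add: assumes "coherent a" "coherent b" shows "coherent (\<lambda>n. a n \<oplus> b n)"
  unfolding coherent_def
proof (intro allI conjI)
  fix n :: nat
  show "a n \<oplus> b n \<in> carrier R" using coherentD assms by simp
  obtain y z where h: "y \<in> carrier R" "z \<in> carrier R" "a (Suc n) = a n \<oplus> m [^] n \<otimes> y" "b (Suc n) = b n \<oplus> m [^] n \<otimes> z"
    using assms unfolding coherent_def by meson
  then have "a (Suc n) \<oplus> b (Suc n) = a n \<oplus> b n \<oplus> m [^] n \<otimes> (y \<oplus> z)" using coherentD assms by (simp add: r_distr a_ac)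
  then show "\<exists>y\<in>carrier R. a (Suc n) \<oplus> b (Suc n) = a n \<oplus> b n \<oplus> m [^] n \<otimes> y" using h by blast
qed

lemma coherent_mult: assumes "coherent a" "coherent b" shows "coherent (\<lambda>n. a n \<otimes> b n)"
  unfolding coherent_def
proof (intro allI conjI)
  fix n :: nat
  have c: "a n \<in> carrier R" "b n \<in> carrier R" "b (Suc n) \<in> carrier R" using coherentD assms by auto
  then show "a n \<otimes> b n \<in> carrier R" by simp
  obtain y z where h: "y \<in> carrier R" "z \<in> carrier R" "a (Suc n) = a n \<oplus> m [^] n \<otimes> y" "b (Suc n) = b n \<oplus> m [^] n \<otimes> z"
    using assms unfolding coherent_def by meson
  have "a (Suc n) \<otimes> b (Suc n) = a n \<otimes> (b n \<oplus> m [^] n \<otimes> z) \<oplus> (m [^] n \<otimes> y) \<otimes> b (Suc n)"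
    unfolding h(3) using h(1,2) c by (simp add: l_distr flip: h(4))
  also have "\<dots> = a n \<otimes> b n \<oplus> m [^] n \<otimes> (a n \<otimes> z \<oplus> y \<otimes> b (Suc n))" using h(1,2) c by (simp add: r_distr m_ac a_ac)
  finally show "\<exists>y\<in>carrier R. a (Suc n) \<otimes> b (Suc n) = a n \<otimes> b n \<oplus> m [^] n \<otimes> y"
    using h(1,2) c by (intro bexI[of _ "a n \<otimes> z \<oplus> y \<otimes> b (Suc n)"]) auto
qed

lemma coherent_neg: assumes "coherent a" shows "coherent (\<lambda>n. \<ominus> a n)"
  unfolding coherent_def
proof (intro allI conjI)
  fix n :: nat
  show "\<ominus> a n \<in> carrier R" using coherentD assms by simp
  obtain y where h: "y \<in> carrier R" "a (Suc n) = a n \<oplus> m [^] n \<otimes> y" using assms unfolding coherent_def by meson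
  then have "\<ominus> a (Suc n) = \<ominus> a n \<oplus> m [^] n \<otimes> (\<ominus> y)" using coherentD assms by (simp add: r_minus minus_add)
  then show "\<exists>y\<in>carrier R. \<ominus> a (Suc n) = \<ominus> a n \<oplus> m [^] n \<otimes> y" using h by blast
qed

lemma coherent_const: "x \<in> carrier R \<Longrightarrow> coherent (\<lambda>_. x)"
  unfolding coherent_def by (auto intro!: bexI[of _ \<zero>])

lemma mk_closed: "coherent a \<Longrightarrow> mk a \<in> carrier RC" unfolding RC_carrier by blast
lemma mk_cases: "f \<in> carrier RC \<Longrightarrow> \<exists>a. coherent a \<and> f = mk a" unfolding RC_carrier by blast

lemma mk_add: "coherent a \<Longrightarrow> coherent b \<Longrightarrow> mk a \<oplus>\<^bsub>RC\<^esub> mk b = mk (\<lambda>n. a n \<oplus> b n)"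
  using ring_hom_add[OF q_hom] coherentD unfolding adic_completion_def mk_def by simp
lemma mk_mult: "coherent a \<Longrightarrow> coherent b \<Longrightarrow> mk a \<otimes>\<^bsub>RC\<^esub> mk b = mk (\<lambda>n. a n \<otimes> b n)"
  using ring_hom_mult[OF q_hom] coherentD unfolding adic_completion_def mk_def by simp
lemma mk_one: "\<one>\<^bsub>RC\<^esub> = mk (\<lambda>_. \<one>)"
  using ring_hom_one[OF q_hom] unfolding adic_completion_def mk_def by simp
lemma mk_zero: "\<zero>\<^bsub>RC\<^esub> = mk (\<lambda>_. \<zero>)"
  using ring_hom_zero[OF q_hom ring_axioms ideal.quotient_is_ring[OF PIdl_pow_ideal]] unfolding adic_completion_def mk_def by simp

lemma mk_eq: "coherent a \<Longrightarrow> coherent b \<Longrightarrow> mk a = mk b \<longleftrightarrow> (\<forall>n. \<exists>y\<in>carrier R. a n = b n \<oplus> m [^] n \<otimes> y)"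
  unfolding mk_def fun_eq_iff using q_eq[OF coherentD coherentD] by blast

lemma RC_cring: "cring RC"
proof (rule cringI)
  show "abelian_group RC"
  proof (rule abelian_groupI)
    fix x y assume "x \<in> carrier RC" "y \<in> carrier RC"
    then obtain a b where a: "coherent a" "x = mk a" and b: "coherent b" "y = mk b" using mk_cases by meson
    show "x \<oplus>\<^bsub>RC\<^esub> y \<in> carrier RC" unfolding a b using a b by (simp add: mk_add mk_closed coherent_add)
    show "x \<oplus>\<^bsub>RC\<^esub> y = y \<oplus>\<^bsub>RC\<^esub> x" unfolding a b using a b by (simp add: mk_add a_comm coherentD)
    fix z assume "z \<in> carrier RC"
    then obtain c where c: "coherent c" "z = mk c" using mk_cases by meson
    show "(x \<oplus>\<^bsub>RC\<^esub> y) \<oplus>\<^bsub>RC\<^esub> z = x \<oplus>\<^bsub>RC\<^esub> (y \<oplus>\<^bsub>RC\<^esub> z)"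
      unfolding a b c using a b c by (simp add: mk_add coherent_add a_assoc coherentD)
  next
    show "\<zero>\<^bsub>RC\<^esub> \<in> carrier RC" by (simp add: mk_zero mk_closed coherent_const)
    fix x assume "x \<in> carrier RC"
    then obtain a where a: "coherent a" "x = mk a" using mk_cases by meson
    show "\<zero>\<^bsub>RC\<^esub> \<oplus>\<^bsub>RC\<^esub> x = x" unfolding a mk_zero using a by (simp add: mk_add coherent_const coherentD)
    have "mk (\<lambda>n. \<ominus> a n) \<oplus>\<^bsub>RC\<^esub> x = \<zero>\<^bsub>RC\<^esub>" unfolding a mk_zero using a by (simp add: mk_add coherent_neg coherentD l_neg)
    then show "\<exists>y\<in>carrier RC. y \<oplus>\<^bsub>RC\<^esub> x = \<zero>\<^bsub>RC\<^esub>" using mk_closed[OF coherent_neg[OF a(1)]] by blast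
  qed
  show "comm_monoid RC"
  proof (rule comm_monoidI)
    fix x y assume "x \<in> carrier RC" "y \<in> carrier RC"
    then obtain a b where a: "coherent a" "x = mk a" and b: "coherent b" "y = mk b" using mk_cases by meson
    show "x \<otimes>\<^bsub>RC\<^esub> y \<in> carrier RC" unfolding a b using a b by (simp add: mk_mult mk_closed coherent_mult)
    show "x \<otimes>\<^bsub>RC\<^esub> y = y \<otimes>\<^bsub>RC\<^esub> x" unfolding a b using a b by (simp add: mk_mult m_comm coherentD)
    fix z assume "z \<in> carrier RC"
    then obtain c where c: "coherent c" "z = mk c" using mk_cases by meson
    show "(x \<otimes>\<^bsub>RC\<^esub> y) \<otimes>\<^bsub>RC\<^esub> z = x \<otimes>\<^bsub>RC\<^esub> (y \<otimes>\<^bsub>RC\<^esub> z)"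
      unfolding a b c using a b c by (simp add: mk_mult coherent_mult m_assoc coherentD)
  next
    show "\<one>\<^bsub>RC\<^esub> \<in> carrier RC" by (simp add: mk_one mk_closed coherent_const)
    fix x assume "x \<in> carrier RC"
    then obtain a where a: "coherent a" "x = mk a" using mk_cases by meson
    show "\<one>\<^bsub>RC\<^esub> \<otimes>\<^bsub>RC\<^esub> x = x" unfolding a mk_one using a by (simp add: mk_mult coherent_const coherentD)
  qed
  fix x y z assume "x \<in> carrier RC" "y \<in> carrier RC" "z \<in> carrier RC"
  then obtain a b c where a: "coherent a" "x = mk a" and b: "coherent b" "y = mk b" and c: "coherent c" "z = mk c" using mk_cases by meson
  show "(x \<oplus>\<^bsub>RC\<^esub> y) \<otimes>\<^bsub>RC\<^esub> z = x \<otimes>\<^bsub>RC\<^esub> z \<oplus>\<^bsub>RC\<^esub> y \<otimes>\<^bsub>RC\<^esub> z"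
    unfolding a b c using a b c by (simp add: mk_add mk_mult coherent_add coherent_mult l_distr coherentD)
qed

interpretation RC: cring RC by (rule RC_cring)

definition "hc a = mk (\<lambda>_. a)"

lemma hc_hom: "hc \<in> ring_hom R RC"
  by (rule ring_hom_memI) (auto simp: hc_def mk_closed coherent_const mk_add mk_mult mk_one)

lemma hc_pow: "hc m [^]\<^bsub>RC\<^esub> (n::nat) = mk (\<lambda>_. m [^] n)"
proof (induction n)
  case 0 then show ?case by (simp add: mk_one)
next
  case (Suc n) then show ?case unfolding hc_def by (simp add: mk_mult coherent_const)
qed

lemma hc_pow_mult: "coherent a \<Longrightarrow> hc m [^]\<^bsub>RC\<^esub> (n::nat) \<otimes>\<^bsub>RC\<^esub> mk a = mk (\<lambda>k. m [^] n \<otimes> a k)"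
  unfolding hc_pow by (simp add: mk_mult coherent_const)

lemma coherent_mpow: "coherent a \<Longrightarrow> coherent (\<lambda>k. m [^] (n::nat) \<otimes> a k)"
  using coherent_mult[OF coherent_const] by simp

lemma coherent_tail: assumes "coherent a" shows "\<exists>y\<in>carrier R. a (n + k) = a n \<oplus> m [^] n \<otimes> y"
proof (induction k)
  case 0 then show ?case using coherentD[OF assms] by (intro bexI[of _ \<zero>]) auto
next
  case (Suc k)
  then obtain y where y: "y \<in> carrier R" "a (n + k) = a n \<oplus> m [^] n \<otimes> y" by blast
  obtain z where z: "z \<in> carrier R" "a (Suc (n + k)) = a (n + k) \<oplus> m [^] (n + k) \<otimes> z" using assms unfolding coherent_def by meson
  have "a (n + Suc k) = a n \<oplus> m [^] n \<otimes> (y \<oplus> m [^] k \<otimes> z)"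
    using y z coherentD[OF assms] by (simp add: nat_pow_mult[symmetric] r_distr m_assoc a_assoc)
  then show ?case using y z by (intro bexI[of _ "y \<oplus> m [^] k \<otimes> z"]) auto
qed

text \<open>The differences \<open>a (n + k) - a n\<close> are divisible by \<open>m^n\<close>, and
  the quotients form a coherent sequence because \<open>m\<close> can be cancelled. The shifted
  sequence represents the same element as \<open>a\<close>.\<close>

lemma mk_approx: assumes a: "coherent a" shows "\<exists>y. coherent y \<and> mk a = hc (a n) \<oplus>\<^bsub>RC\<^esub> hc m [^]\<^bsub>RC\<^esub> n \<otimes>\<^bsub>RC\<^esub> mk y"
proof -
  have "\<forall>k. \<exists>y\<in>carrier R. a (n + k) = a n \<oplus> m [^] n \<otimes> y" using coherent_tail[OF a] by blast
  then obtain y where y: "\<And>k. y k \<in> carrier R" "\<And>k. a (n + k) = a n \<oplus> m [^] n \<otimes> y k" by metis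
  have ac: "a k \<in> carrier R" for k using coherentD a by blast
  have "\<exists>z\<in>carrier R. y (Suc k) = y k \<oplus> m [^] k \<otimes> z" for k
  proof -
    obtain z where z: "z \<in> carrier R" "a (Suc (n + k)) = a (n + k) \<oplus> m [^] (n + k) \<otimes> z" using a unfolding coherent_def by meson
    have "a n \<oplus> m [^] n \<otimes> y (Suc k) = a n \<oplus> m [^] n \<otimes> (y k \<oplus> m [^] k \<otimes> z)"
      using z y(1) y(2)[of k] y(2)[of "Suc k"] ac by (simp add: nat_pow_mult[symmetric] r_distr m_assoc a_assoc)
    then have "m [^] n \<otimes> y (Suc k) = m [^] n \<otimes> (y k \<oplus> m [^] k \<otimes> z)" using ac y(1) z(1) by simp
    then have "y (Suc k) = y k \<oplus> m [^] k \<otimes> z" by (rule cancel_pow[rotated 2]) (use y z in auto)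
    then show ?thesis using z by blast
  qed
  then have cy: "coherent y" unfolding coherent_def using y(1) by blast
  have "hc (a n) \<oplus>\<^bsub>RC\<^esub> hc m [^]\<^bsub>RC\<^esub> n \<otimes>\<^bsub>RC\<^esub> mk y = mk (\<lambda>k. a n \<oplus> m [^] n \<otimes> y k)"
    unfolding hc_pow_mult[OF cy] unfolding hc_def by (rule mk_add[OF coherent_const[OF ac] coherent_mpow[OF cy]])
  also have "\<dots> = mk (\<lambda>k. a (n + k))" using y(2) by simp
  also have "\<dots> = mk a"
  proof (subst mk_eq)
    show "coherent (\<lambda>k. a (n + k))" using coherent_add[OF coherent_const[OF ac] coherent_mpow[OF cy], of n n] y(2) by simp
    show "\<forall>k. \<exists>y\<in>carrier R. a (n + k) = a k \<oplus> m [^] k \<otimes> y" using coherent_tail[OF a] by (metis add.commute)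
  qed (rule a)
  finally show ?thesis using cy by metis
qed

lemma RC_analytic: "analytic_hom R m RC hc"
proof unfold_locales
  show "hc \<in> ring_hom R RC" by (rule hc_hom)
  have cm: "coherent (\<lambda>_. m)" by (simp add: coherent_const)
  show "nzd RC (hc m)" unfolding nzd_def
  proof (intro conjI ballI impI)
    show "hc m \<in> carrier RC" using ring_hom_closed[OF hc_hom] by simp
    fix f assume f: "f \<in> carrier RC" "hc m \<otimes>\<^bsub>RC\<^esub> f = \<zero>\<^bsub>RC\<^esub>"
    obtain b where b: "coherent b" "f = mk b" using mk_cases f by blast
    have bc: "b k \<in> carrier R" for k using coherentD b by blast
    have "mk (\<lambda>k. m \<otimes> b k) = mk (\<lambda>_. \<zero>)" using f(2) unfolding b hc_def mk_zero by (simp add: mk_mult[OF cm b(1)])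
    then have e: "\<exists>y\<in>carrier R. m \<otimes> b k = \<zero> \<oplus> m [^] k \<otimes> y" for k
      using mk_eq[OF coherent_mult[OF cm b(1)] coherent_const[OF zero_closed]] by blast
    have "\<exists>y\<in>carrier R. b k = \<zero> \<oplus> m [^] k \<otimes> y" for k
    proof -
      \<comment> \<open>Cancelling \<open>m\<close> costs one order of precision, so the relation is
        read at index \<open>k + 1\<close> and brought back to index \<open>k\<close> by
        coherence.\<close>
      obtain y where y: "y \<in> carrier R" "m \<otimes> b (Suc k) = m [^] Suc k \<otimes> y" using e[of "Suc k"] by auto
      have "m [^] (1::nat) \<otimes> b (Suc k) = m [^] (1::nat) \<otimes> (m [^] k \<otimes> y)" using y bc by (simp add: m_ac)
      then have 1: "b (Suc k) = m [^] k \<otimes> y" by (rule cancel_pow[rotated 2]) (use bc y in auto)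
      obtain z where z: "z \<in> carrier R" "b (Suc k) = b k \<oplus> m [^] k \<otimes> z" using b unfolding coherent_def by meson
      have cancel: "p = (p \<oplus> w) \<ominus> w" if "p \<in> carrier R" "w \<in> carrier R" for p w using that by algebra
      have "b k = (b k \<oplus> m [^] k \<otimes> z) \<ominus> m [^] k \<otimes> z" using bc z by (intro cancel) auto
      also have "\<dots> = \<zero> \<oplus> m [^] k \<otimes> (y \<ominus> z)" unfolding z(2)[symmetric] 1 using y z by (simp add: a_minus_def r_distr r_minus)
      finally show ?thesis using y z by blast
    qed
    then show "f = \<zero>\<^bsub>RC\<^esub>" unfolding b mk_zero using mk_eq[OF b(1) coherent_const[OF zero_closed]] by blast
  qed
  fix n :: nat
  show "\<exists>a\<in>carrier R. \<exists>y\<in>carrier RC. f = hc a \<oplus>\<^bsub>RC\<^esub> hc m [^]\<^bsub>RC\<^esub> n \<otimes>\<^bsub>RC\<^esub> y" if f: "f \<in> carrier RC" for f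
  proof -
    obtain a where a: "coherent a" "f = mk a" using mk_cases f by blast
    then show ?thesis using mk_approx[OF a(1), of n] mk_closed coherentD by blast
  qed
  show "\<exists>x\<in>carrier R. a = m [^] n \<otimes> x" if a: "a \<in> carrier R" "f \<in> carrier RC" "hc a = hc m [^]\<^bsub>RC\<^esub> n \<otimes>\<^bsub>RC\<^esub> f" for a f
  proof -
    obtain b where b: "coherent b" "f = mk b" using mk_cases a by blast
    have "mk (\<lambda>_. a) = mk (\<lambda>k. m [^] n \<otimes> b k)" using a(3) unfolding b hc_pow_mult[OF b(1)] unfolding hc_def .
    then obtain y where y: "y \<in> carrier R" "a = m [^] n \<otimes> b n \<oplus> m [^] n \<otimes> y"
      using mk_eq[OF coherent_const[OF a(1)] coherent_mpow[OF b(1)]] by blast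
    then have "a = m [^] n \<otimes> (b n \<oplus> y)" using coherentD[OF b(1)] by (simp add: r_distr)
    then show ?thesis using y coherentD[OF b(1), of n] by blast
  qed
  show "\<one>\<^bsub>RC\<^esub> \<oplus>\<^bsub>RC\<^esub> hc m \<otimes>\<^bsub>RC\<^esub> f \<in> Units RC" if f: "f \<in> carrier RC" for f
  proof -
    obtain b where b: "coherent b" "f = mk b" using mk_cases f by blast
    have bc: "b k \<in> carrier R" for k using coherentD b by blast
    define u where "u k = \<one> \<oplus> m \<otimes> b k" for k
    have cu: "coherent u" unfolding u_def by (intro coherent_add coherent_mult coherent_const b one_closed m_closed')
    have uU: "u k \<in> Units R" for k
    proof -
      have "\<one> \<ominus> m \<otimes> (\<ominus> b k) = u k" unfolding u_def using bc by (simp add: a_minus_def r_minus)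
      then show ?thesis using unit_one_minus[of "\<ominus> b k"] bc by simp
    qed
    \<comment> \<open>Each \<open>u k\<close> is already a unit of \<open>R\<close>, so the inverse
      is formed pointwise; it is coherent because \<open>c k - c (k+1)\<close> is a multiple of
      \<open>u (k+1) - u k\<close>.\<close>
    define c where "c k = inv (u k)" for k
    have cc: "c k \<in> carrier R" "u k \<in> carrier R" "u k \<otimes> c k = \<one>" for k using uU unfolding c_def by auto
    have "\<exists>y\<in>carrier R. c (Suc k) = c k \<oplus> m [^] k \<otimes> y" for k
    proof -
      obtain z where z: "z \<in> carrier R" "u (Suc k) = u k \<oplus> m [^] k \<otimes> z" using cu unfolding coherent_def by meson
      have "c k = (u (Suc k) \<otimes> c (Suc k)) \<otimes> c k" using cc by simp
      also have "\<dots> = (u k \<otimes> c k) \<otimes> c (Suc k) \<oplus> m [^] k \<otimes> (z \<otimes> c (Suc k) \<otimes> c k)" unfolding z(2) using cc(1,2) z(1) by (simp add: l_distr r_distr m_ac)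
      also have "\<dots> = c (Suc k) \<oplus> m [^] k \<otimes> (z \<otimes> c (Suc k) \<otimes> c k)" unfolding cc(3) using cc(1) by simp
      finally have 1: "c k = c (Suc k) \<oplus> m [^] k \<otimes> (z \<otimes> c (Suc k) \<otimes> c k)" .
      have zc: "z \<otimes> c (Suc k) \<otimes> c k \<in> carrier R" using z cc(1) by simp
      have cancel: "p = (p \<oplus> w) \<oplus> \<ominus> w" if "p \<in> carrier R" "w \<in> carrier R" for p w using that by algebra
      have "c (Suc k) = (c (Suc k) \<oplus> m [^] k \<otimes> (z \<otimes> c (Suc k) \<otimes> c k)) \<oplus> \<ominus> (m [^] k \<otimes> (z \<otimes> c (Suc k) \<otimes> c k))"
        using zc cc(1) by (intro cancel) auto
      also have "\<dots> = c k \<oplus> m [^] k \<otimes> (\<ominus> (z \<otimes> c (Suc k) \<otimes> c k))" unfolding 1[symmetric] using zc by (simp add: r_minus)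
      finally show ?thesis using zc by blast
    qed
    then have coc: "coherent c" unfolding coherent_def using cc(1) by blast
    have eq: "\<one>\<^bsub>RC\<^esub> \<oplus>\<^bsub>RC\<^esub> hc m \<otimes>\<^bsub>RC\<^esub> f = mk u"
      unfolding mk_one hc_def b mk_mult[OF cm b(1)] u_def
      by (rule mk_add[OF coherent_const[OF one_closed] coherent_mult[OF cm b(1)]])
    have "mk u \<otimes>\<^bsub>RC\<^esub> mk c = \<one>\<^bsub>RC\<^esub>" unfolding mk_mult[OF cu coc] mk_one using cc(3) by simp
    moreover from this have "mk c \<otimes>\<^bsub>RC\<^esub> mk u = \<one>\<^bsub>RC\<^esub>" using RC.m_comm[OF mk_closed[OF coc] mk_closed[OF cu]] by simp
    ultimately show ?thesis unfolding eq Units_def using mk_closed[OF cu] mk_closed[OF coc] by blast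
  qed
qed

lemma RC_separated: "adic_separated RC (hc m)"
  unfolding adic_separated_def
proof (intro ballI impI)
  fix f assume f: "f \<in> carrier RC" "\<forall>k::nat. \<exists>y\<in>carrier RC. f = hc m [^]\<^bsub>RC\<^esub> k \<otimes>\<^bsub>RC\<^esub> y"
  obtain a where a: "coherent a" "f = mk a" using mk_cases f by blast
  have "\<exists>y\<in>carrier R. a k = \<zero> \<oplus> m [^] k \<otimes> y" for k
  proof -
    obtain g where g: "g \<in> carrier RC" "f = hc m [^]\<^bsub>RC\<^esub> k \<otimes>\<^bsub>RC\<^esub> g" using f(2) by blast
    obtain b where b: "coherent b" "g = mk b" using mk_cases g by blast
    have "mk a = mk (\<lambda>j. m [^] k \<otimes> b j)" using g(2) a(2) unfolding b hc_pow_mult[OF b(1)] by simp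
    then obtain y where y: "y \<in> carrier R" "a k = m [^] k \<otimes> b k \<oplus> m [^] k \<otimes> y"
      using mk_eq[OF a(1) coherent_mpow[OF b(1)]] by blast
    then have "a k = \<zero> \<oplus> m [^] k \<otimes> (b k \<oplus> y)" using coherentD[OF b(1)] by (simp add: r_distr)
    then show ?thesis using y coherentD[OF b(1), of k] by blast
  qed
  then show "f = \<zero>\<^bsub>RC\<^esub>" unfolding a mk_zero using mk_eq[OF a(1) coherent_const[OF zero_closed]] by blast
qed

text \<open>The limit of \<open>s n = mk (A n)\<close> is the diagonal sequence
  \<open>A n n\<close>: both \<open>s n\<close> and the limit agree with \<open>hc (A n n)\<close>
  up to a multiple of \<open>hc m\<close> to the power \<open>n\<close>.\<close>

lemma RC_complete: "adic_complete RC (hc m)"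
  unfolding adic_complete_def
proof (intro allI impI)
  fix s assume s: "\<forall>n::nat. s n \<in> carrier RC \<and> (\<exists>y\<in>carrier RC. s (Suc n) = s n \<oplus>\<^bsub>RC\<^esub> hc m [^]\<^bsub>RC\<^esub> n \<otimes>\<^bsub>RC\<^esub> y)"
  then have "\<forall>n. \<exists>a. coherent a \<and> s n = mk a" using mk_cases by blast
  then obtain A where A: "\<And>n. coherent (A n)" "\<And>n. s n = mk (A n)" by metis
  have Ac: "A n k \<in> carrier R" for n k using coherentD A by blast
  have "\<exists>y\<in>carrier R. A (Suc n) (Suc n) = A n n \<oplus> m [^] n \<otimes> y" for n
  proof -
    obtain y where y: "y \<in> carrier RC" "s (Suc n) = s n \<oplus>\<^bsub>RC\<^esub> hc m [^]\<^bsub>RC\<^esub> n \<otimes>\<^bsub>RC\<^esub> y" using s by blast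
    obtain b where b: "coherent b" "y = mk b" using mk_cases y by blast
    have "mk (A (Suc n)) = mk (\<lambda>k. A n k \<oplus> m [^] n \<otimes> b k)"
      using y(2) unfolding A(2) b hc_pow_mult[OF b(1)] mk_add[OF A(1) coherent_mpow[OF b(1)]] .
    then obtain z where z: "z \<in> carrier R" "A (Suc n) n = A n n \<oplus> m [^] n \<otimes> b n \<oplus> m [^] n \<otimes> z"
      using mk_eq[OF A(1) coherent_add[OF A(1) coherent_mpow[OF b(1)]], of "Suc n" n n] by blast
    obtain w where w: "w \<in> carrier R" "A (Suc n) (Suc n) = A (Suc n) n \<oplus> m [^] n \<otimes> w" using A(1)[of "Suc n"] unfolding coherent_def by meson
    have bn: "b n \<in> carrier R" using coherentD b by blast
    have "A (Suc n) (Suc n) = A n n \<oplus> m [^] n \<otimes> (b n \<oplus> z \<oplus> w)" unfolding w(2) z(2) using Ac bn z(1) w(1) by (simp add: r_distr a_assoc)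
    then show ?thesis using bn z(1) w(1) by (intro bexI[of _ "b n \<oplus> z \<oplus> w"]) auto
  qed
  then have ct: "coherent (\<lambda>n. A n n)" unfolding coherent_def using Ac by blast
  have "\<exists>y\<in>carrier RC. mk (\<lambda>n. A n n) = s n \<oplus>\<^bsub>RC\<^esub> hc m [^]\<^bsub>RC\<^esub> n \<otimes>\<^bsub>RC\<^esub> y" for n
  proof -
    obtain y where y: "coherent y" "mk (\<lambda>n. A n n) = hc (A n n) \<oplus>\<^bsub>RC\<^esub> hc m [^]\<^bsub>RC\<^esub> n \<otimes>\<^bsub>RC\<^esub> mk y" using mk_approx[OF ct] by blast
    obtain z where z: "coherent z" "mk (A n) = hc (A n n) \<oplus>\<^bsub>RC\<^esub> hc m [^]\<^bsub>RC\<^esub> n \<otimes>\<^bsub>RC\<^esub> mk z" using mk_approx[OF A(1)] by blast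
    have c: "hc (A n n) \<in> carrier RC" "hc m [^]\<^bsub>RC\<^esub> n \<in> carrier RC" "mk y \<in> carrier RC" "mk z \<in> carrier RC"
      using ring_hom_closed[OF hc_hom] Ac mk_closed y(1) z(1) by auto
    have gen: "p \<oplus>\<^bsub>RC\<^esub> q \<otimes>\<^bsub>RC\<^esub> r = (p \<oplus>\<^bsub>RC\<^esub> q \<otimes>\<^bsub>RC\<^esub> t) \<oplus>\<^bsub>RC\<^esub> q \<otimes>\<^bsub>RC\<^esub> (r \<ominus>\<^bsub>RC\<^esub> t)"
      if "p \<in> carrier RC" "q \<in> carrier RC" "r \<in> carrier RC" "t \<in> carrier RC" for p q r t using that by algebra
    have "mk (\<lambda>n. A n n) = s n \<oplus>\<^bsub>RC\<^esub> hc m [^]\<^bsub>RC\<^esub> n \<otimes>\<^bsub>RC\<^esub> (mk y \<ominus>\<^bsub>RC\<^esub> mk z)"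
      unfolding A(2) y(2) z(2) by (rule gen[OF c])
    then show ?thesis using c by blast
  qed
  then show "\<exists>t\<in>carrier RC. \<forall>n. \<exists>y\<in>carrier RC. t = s n \<oplus>\<^bsub>RC\<^esub> hc m [^]\<^bsub>RC\<^esub> n \<otimes>\<^bsub>RC\<^esub> y" using mk_closed[OF ct] by blast
qed

theorem bass_completion_iff: "bass_ring RC \<longleftrightarrow> two_gen R m \<and> bounded_closure R m"
proof -
  interpret H: analytic_hom R m RC hc by (rule RC_analytic)
  interpret P: param_ring RC "hc m" by (rule H.target_param_ring)
  have "bass_ring RC \<longleftrightarrow> two_gen RC (hc m) \<and> bounded_closure RC (hc m)"
    by (rule P.bass_iff[OF RC_separated])
      (rule P.complete_all_two_gen[OF RC_separated RC_complete] P.complete_nzd_divides[OF RC_separated RC_complete]; assumption)+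
  then show ?thesis using H.transfer by simp
qed

end

theorem theorem4p5:
  fixes R :: "('a,'b) ring_scheme" and M :: "'a set" and m :: 'a
  assumes "local_ring R"
    and "krull_dim_one R"
    and "maximalideal M R"
    and "regular_ideal R M"
    and "m \<in> M" and "nzd R m"
  defines "J \<equiv> (\<Inter>i\<in>{0<..}. PIdl\<^bsub>R\<^esub> (m [^]\<^bsub>R\<^esub> (i::nat)))"
  shows "(stable_ring R \<and> finite_int_closure R \<longleftrightarrow> bass_ring (R Quot J))
       \<and> (bass_ring (R Quot J) \<longleftrightarrow> bass_ring (adic_completion R m))"
proof -
  interpret cring R using assms(1) unfolding local_ring_def by blast
  interpret P: param_ring R m by (rule krull_one_param_ring[OF assms(1,2,3,5,6)])
  \<comment> \<open>Pi-regularity is drawn from the dimension for \<open>R\<close> alone. It settles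
    the nonzerodivisors of \<open>R\<close> and, passed on to \<open>R / J\<close>, the arguments
    there; for the completion completeness takes its place.\<close>
  have pi: "pi_regular R m" unfolding pi_regular_def using krull_one_pi_regular[OF assms(1,2,3,5,6)] by blast
  have "nzd_divides R m" by (rule pi_regular_nzd_divides[OF pi P.m_closed'])
  then show ?thesis
    using P.stable_finite_iff P.bass_quot_iff[OF J_def[THEN meta_eq_to_obj_eq] pi] P.bass_completion_iff by blast
qed

end
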